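(* Let $G$ be a profinite group with $\mathfrak{g}_1\cong(\mathbb{Z}/n)^I$ for some index set $I$, and let $R$ be an arbitrary generating set of $\ker(\inf:H^2(\mathfrak{g}_1,\Lambda)\to H^2(G,\Lambda))$. Then there is a canonical isomorphism $\Omega_R:\mathfrak{g}_2\to\mathfrak{S}_R$ such that: (1) for $\sigma,\tau\in\mathfrak{g}_1$, $\Omega_R([\sigma,\tau])=\mathrm{res}_R(\sigma\otimes\tau-\tau\otimes\sigma,0)$; (2) for $\sigma\in\mathfrak{g}_1$, $\Omega_R(\sigma^\pi)=\mathrm{res}_R(\binom n2\sigma\otimes\sigma,\sigma)$.
   Context: $n\ge1$, $\Lambda=\mathbb{Z}/n$; maps continuous, cohomology continuous with trivial coefficients. $G^{(1)}=G$, $G^{(i+1)}=[G,G^{(i)}](G^{(i)})^n$, $\mathfrak{g}_i=G^{(i)}/G^{(i+1)}$; $[\sigma,\tau]=\tilde\sigma^{-1}\tilde\tau^{-1}\tilde\sigma\tilde\tau$, $\sigma^\pi=\tilde\sigma^n$ in $\mathfrak{g}_2$ for lifts to $G/G^{(3)}$. $\mathfrak{K}=H^1(\mathfrak{g}_1,\Lambda)$, $\mathfrak{g}_1=\mathrm{Hom}(\mathfrak{K},\Lambda)$. $\mathfrak{g}_1\hat\otimes\mathfrak{g}_1$ (completed tensor product over $\Lambda$) identified with $\Lambda$-bilinear forms on $\mathfrak{K}$, $\sigma\otimes\tau:(x,y)\mapsto\sigma(x)\tau(y)$. $\mathfrak{S}=\{(f,g)\in(\mathfrak{g}_1\hat\otimes\mathfrak{g}_1)\times\mathfrak{g}_1: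 f(x,x)=\binom n2 g(x)\ \forall x\in\mathfrak{K}\}$. $(\cdot,\cdot)_{\mathfrak{S}}:\mathfrak{S}\times H^2(\mathfrak{g}_1,\Lambda)\to\Lambda$ is the perfect pairing with $((f,g),x\cup y)_{\mathfrak{S}}=f(x,y)$ and $((f,g),\beta z)_{\mathfrak{S}}=g(z)$, $\beta$ being the Bockstein of $0\to\mathbb{Z}/n\xrightarrow{n}\mathbb{Z}/n^2\to\mathbb{Z}/n\to0$. For a subset $R\subset H^2(\mathfrak{g}_1,\Lambda)$, $\mathrm{res}_R:\mathfrak{S}\to\mathrm{Fun}(R,\Lambda)$ sends $s$ to $r\mapsto(s,r)_{\mathfrak{S}}$, and $\mathfrak{S}_R$ is its image. *)

theory Defs
  imports "HOL-Analysis.Analysis" "HOL-Algebra.Product_Groups"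
begin

section \<open>Profinite groups and topological quotients\<close>

definition topological_group :: "('a, 'm) monoid_scheme \<Rightarrow> 'a topology \<Rightarrow> bool" where
  "topological_group G T \<longleftrightarrow>
     group G \<and> topspace T = carrier G \<and>
     continuous_map (prod_topology T T) T (\<lambda>(x, y). x \<otimes>\<^bsub>G\<^esub> y) \<and>
     continuous_map T T (\<lambda>x. inv\<^bsub>G\<^esub> x)"

definition profinite_group :: "('a, 'm) monoid_scheme \<Rightarrow> 'a topology \<Rightarrow> bool" where
  "profinite_group G T \<longleftrightarrow>
     topological_group G T \<and> compact_space T \<and> Hausdorff_space T \<and>
     (\<forall>x \<in> topspace T. connected_component_of_set T x = {x})"

definition top_iso ::
    "('a, 'm) monoid_scheme \<Rightarrow> 'a topology \<Rightarrow> ('b, 'k) monoid_scheme \<Rightarrow> 'b topology \<Rightarrow> ('a \<Rightarrow> 'b) set" where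
  "top_iso G S H T = {f \<in> iso G H. homeomorphic_map S T f}"

definition quotient_topology ::
    "('a, 'm) monoid_scheme \<Rightarrow> 'a topology \<Rightarrow> 'a set \<Rightarrow> 'a set topology" where
  "quotient_topology G T N =
     topology (\<lambda>U. U \<subseteq> rcosets\<^bsub>G\<^esub> N \<and> openin T {x \<in> carrier G. N #>\<^bsub>G\<^esub> x \<in> U})"

lemma openin_quotient_topology:
  assumes "topspace T = carrier G"
  shows "openin (quotient_topology G T N) U \<longleftrightarrow>
           U \<subseteq> rcosets\<^bsub>G\<^esub> N \<and> openin T {x \<in> carrier G. N #>\<^bsub>G\<^esub> x \<in> U}"
proof -
  let ?P = "\<lambda>U. U \<subseteq> rcosets\<^bsub>G\<^esub> N \<and> openin T {x \<in> carrier G. N #>\<^bsub>G\<^esub> x \<in> U}"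
  have "istopology ?P"
    unfolding istopology_def
  proof (intro conjI allI impI)
    fix U V assume U: "?P U" and V: "?P V"
    have "{x \<in> carrier G. N #>\<^bsub>G\<^esub> x \<in> U \<inter> V} =
          {x \<in> carrier G. N #>\<^bsub>G\<^esub> x \<in> U} \<inter> {x \<in> carrier G. N #>\<^bsub>G\<^esub> x \<in> V}"
      by auto
    then show "openin T {x \<in> carrier G. N #>\<^bsub>G\<^esub> x \<in> U \<inter> V}"
      using U V by (simp add: openin_Int)
    show "U \<inter> V \<subseteq> rcosets\<^bsub>G\<^esub> N" using U by blast
  next
    fix \<U> assume \<U>: "\<forall>U\<in>\<U>. ?P U"
    have "{x \<in> carrier G. N #>\<^bsub>G\<^esub> x \<in> \<Union>\<U>} =
          \<Union>((\<lambda>U. {x \<in> carrier G. N #>\<^bsub>G\<^esub> x \<in> U}) ` \<U>)"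
      by auto
    then show "openin T {x \<in> carrier G. N #>\<^bsub>G\<^esub> x \<in> \<Union>\<U>}"
      using \<U> by auto
    show "\<Union>\<U> \<subseteq> rcosets\<^bsub>G\<^esub> N" using \<U> by blast
  qed
  then show ?thesis
    by (simp add: quotient_topology_def)
qed


section \<open>The central descending series\<close>

text \<open>As usual for profinite groups, \<open>[G, N]\<close> and \<open>N\<^sup>n\<close> denote the \<^emph>\<open>closed\<close> subgroups generated
  by the commutators and by the powers.\<close>

definition closed_generate :: "('a, 'm) monoid_scheme \<Rightarrow> 'a topology \<Rightarrow> 'a set \<Rightarrow> 'a set" where
  "closed_generate G T X = Abstract_Topology.closure_of T (generate G X)"

text \<open>The series is indexed from 1; the value at 0 is irrelevant.\<close>

fun central_series :: "('a, 'm) monoid_scheme \<Rightarrow> 'a topology \<Rightarrow> nat \<Rightarrow> nat \<Rightarrow> 'a set" where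
  "central_series G T n 0 = carrier G"
| "central_series G T n (Suc 0) = carrier G"
| "central_series G T n (Suc (Suc i)) =
     closed_generate G T
       {inv\<^bsub>G\<^esub> x \<otimes>\<^bsub>G\<^esub> inv\<^bsub>G\<^esub> y \<otimes>\<^bsub>G\<^esub> x \<otimes>\<^bsub>G\<^esub> y | x y. x \<in> carrier G \<and> y \<in> central_series G T n (Suc i)}
     <#>\<^bsub>G\<^esub>
     closed_generate G T {y [^]\<^bsub>G\<^esub> n | y. y \<in> central_series G T n (Suc i)}"

definition gr :: "('a, 'm) monoid_scheme \<Rightarrow> 'a topology \<Rightarrow> nat \<Rightarrow> nat \<Rightarrow> 'a set monoid" where
  "gr G T n i = G\<lparr>carrier := central_series G T n i\<rparr> Mod central_series G T n (Suc i)"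

definition gr_topology ::
    "('a, 'm) monoid_scheme \<Rightarrow> 'a topology \<Rightarrow> nat \<Rightarrow> nat \<Rightarrow> 'a set topology" where
  "gr_topology G T n i =
     quotient_topology (G\<lparr>carrier := central_series G T n i\<rparr>)
       (subtopology T (central_series G T n i)) (central_series G T n (Suc i))"

text \<open>An element \<open>\<sigma>\<close> of \<open>gr G T n 1\<close> and an element \<open>s\<close> of \<open>G Mod central_series G T n 3\<close> are both
  cosets, i.e. subsets of \<open>G\<close>, and \<open>s\<close> maps to \<open>\<sigma>\<close> exactly when \<open>s \<subseteq> \<sigma>\<close>.  The carrier of
  \<open>gr G T n 2\<close> is literally a subset of that of \<open>G Mod central_series G T n 3\<close>.\<close>

definition lifts :: "('a, 'm) monoid_scheme \<Rightarrow> 'a topology \<Rightarrow> nat \<Rightarrow> 'a set \<Rightarrow> 'a set set" where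
  "lifts G T n \<sigma> = {s \<in> carrier (G Mod central_series G T n 3). s \<subseteq> \<sigma>}"

definition gr_commutator ::
    "('a, 'm) monoid_scheme \<Rightarrow> 'a topology \<Rightarrow> nat \<Rightarrow> 'a set \<Rightarrow> 'a set \<Rightarrow> 'a set" where
  "gr_commutator G T n \<sigma> \<tau> =
     (let Q = G Mod central_series G T n 3 in
      THE u. \<exists>s \<in> lifts G T n \<sigma>. \<exists>t \<in> lifts G T n \<tau>.
               u = inv\<^bsub>Q\<^esub> s \<otimes>\<^bsub>Q\<^esub> inv\<^bsub>Q\<^esub> t \<otimes>\<^bsub>Q\<^esub> s \<otimes>\<^bsub>Q\<^esub> t)"

definition gr_power ::
    "('a, 'm) monoid_scheme \<Rightarrow> 'a topology \<Rightarrow> nat \<Rightarrow> 'a set \<Rightarrow> 'a set" where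
  "gr_power G T n \<sigma> =
     (let Q = G Mod central_series G T n 3 in
      THE u. \<exists>s \<in> lifts G T n \<sigma>. u = s [^]\<^bsub>Q\<^esub> n)"


section \<open>Continuous cohomology in degrees 1 and 2\<close>

text \<open>Inhomogeneous continuous cochains on a topological group \<open>(\<Gamma>, T)\<close> with values in a discrete
  abelian group \<open>A\<close>, written multiplicatively, on which \<open>\<Gamma>\<close> acts trivially.  Cochains are
  extensional functions, so that the pointwise operations are those of \<open>product_group\<close>.\<close>

definition cochain1 ::
    "('g, 'm) monoid_scheme \<Rightarrow> 'g topology \<Rightarrow> ('a, 'k) monoid_scheme \<Rightarrow> ('g \<Rightarrow> 'a) set" where
  "cochain1 \<Gamma> T A =
     {\<phi> \<in> carrier \<Gamma> \<rightarrow>\<^sub>E carrier A. continuous_map T (discrete_topology (carrier A)) \<phi>}"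

definition cochain2 ::
    "('g, 'm) monoid_scheme \<Rightarrow> 'g topology \<Rightarrow> ('a, 'k) monoid_scheme \<Rightarrow> ('g \<times> 'g \<Rightarrow> 'a) set" where
  "cochain2 \<Gamma> T A =
     {c \<in> carrier \<Gamma> \<times> carrier \<Gamma> \<rightarrow>\<^sub>E carrier A.
        continuous_map (prod_topology T T) (discrete_topology (carrier A)) c}"

definition coboundary ::
    "('g, 'm) monoid_scheme \<Rightarrow> ('a, 'k) monoid_scheme \<Rightarrow> ('g \<Rightarrow> 'a) \<Rightarrow> 'g \<times> 'g \<Rightarrow> 'a" where
  "coboundary \<Gamma> A \<phi> =
     (\<lambda>(\<sigma>, \<tau>) \<in> carrier \<Gamma> \<times> carrier \<Gamma>. \<phi> \<tau> \<otimes>\<^bsub>A\<^esub> inv\<^bsub>A\<^esub> (\<phi> (\<sigma> \<otimes>\<^bsub>\<Gamma>\<^esub> \<tau>)) \<otimes>\<^bsub>A\<^esub> \<phi> \<sigma>)"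

definition cocycles2 ::
    "('g, 'm) monoid_scheme \<Rightarrow> 'g topology \<Rightarrow> ('a, 'k) monoid_scheme \<Rightarrow> ('g \<times> 'g \<Rightarrow> 'a) set" where
  "cocycles2 \<Gamma> T A =
     {c \<in> cochain2 \<Gamma> T A.
        \<forall>\<sigma> \<in> carrier \<Gamma>. \<forall>\<tau> \<in> carrier \<Gamma>. \<forall>\<rho> \<in> carrier \<Gamma>.
          c (\<tau>, \<rho>) \<otimes>\<^bsub>A\<^esub> c (\<sigma>, \<tau> \<otimes>\<^bsub>\<Gamma>\<^esub> \<rho>) = c (\<sigma> \<otimes>\<^bsub>\<Gamma>\<^esub> \<tau>, \<rho>) \<otimes>\<^bsub>A\<^esub> c (\<sigma>, \<tau>)}"

definition coboundaries2 ::
    "('g, 'm) monoid_scheme \<Rightarrow> 'g topology \<Rightarrow> ('a, 'k) monoid_scheme \<Rightarrow> ('g \<times> 'g \<Rightarrow> 'a) set" where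
  "coboundaries2 \<Gamma> T A = coboundary \<Gamma> A ` cochain1 \<Gamma> T A"

definition Z2 ::
    "('g, 'm) monoid_scheme \<Rightarrow> 'g topology \<Rightarrow> ('a, 'k) monoid_scheme \<Rightarrow> ('g \<times> 'g \<Rightarrow> 'a) monoid" where
  "Z2 \<Gamma> T A =
     (product_group (carrier \<Gamma> \<times> carrier \<Gamma>) (\<lambda>_. A))\<lparr>carrier := cocycles2 \<Gamma> T A\<rparr>"

definition H2 ::
    "('g, 'm) monoid_scheme \<Rightarrow> 'g topology \<Rightarrow> ('a, 'k) monoid_scheme \<Rightarrow> ('g \<times> 'g \<Rightarrow> 'a) set monoid" where
  "H2 \<Gamma> T A = Z2 \<Gamma> T A Mod coboundaries2 \<Gamma> T A"

definition H2_class ::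
    "('g, 'm) monoid_scheme \<Rightarrow> 'g topology \<Rightarrow> ('a, 'k) monoid_scheme \<Rightarrow> ('g \<times> 'g \<Rightarrow> 'a) \<Rightarrow>
     ('g \<times> 'g \<Rightarrow> 'a) set" where
  "H2_class \<Gamma> T A c = coboundaries2 \<Gamma> T A #>\<^bsub>Z2 \<Gamma> T A\<^esub> c"

text \<open>The group of continuous homomorphisms; as the action is trivial, this is also \<open>H\<^sup>1\<close>.\<close>

definition cont_Hom ::
    "('g, 'm) monoid_scheme \<Rightarrow> 'g topology \<Rightarrow> ('a, 'k) monoid_scheme \<Rightarrow> ('g \<Rightarrow> 'a) monoid" where
  "cont_Hom \<Gamma> T A =
     (product_group (carrier \<Gamma>) (\<lambda>_. A))\<lparr>carrier := hom \<Gamma> A \<inter> cochain1 \<Gamma> T A\<rparr>"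

abbreviation "H1 \<equiv> cont_Hom"

text \<open>The map on \<open>H\<^sup>2\<close> induced by a continuous homomorphism \<open>p : \<Gamma> \<rightarrow> \<Delta>\<close>.\<close>

definition H2_pullback ::
    "('g, 'm) monoid_scheme \<Rightarrow> 'g topology \<Rightarrow> ('a, 'k) monoid_scheme \<Rightarrow> ('g \<Rightarrow> 'd) \<Rightarrow>
     ('d \<times> 'd \<Rightarrow> 'a) set \<Rightarrow> ('g \<times> 'g \<Rightarrow> 'a) set" where
  "H2_pullback \<Gamma> T A p X =
     the_elem ((\<lambda>c. H2_class \<Gamma> T A (\<lambda>(\<sigma>, \<tau>) \<in> carrier \<Gamma> \<times> carrier \<Gamma>. c (p \<sigma>, p \<tau>))) ` X)"

definition inflation ::
    "('a, 'm) monoid_scheme \<Rightarrow> 'a topology \<Rightarrow> nat \<Rightarrow>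
     ('a set \<times> 'a set \<Rightarrow> int) set \<Rightarrow> ('a \<times> 'a \<Rightarrow> int) set" where
  "inflation G T n =
     H2_pullback G T (integer_mod_group n) (\<lambda>x. central_series G T n 2 #>\<^bsub>G\<^esub> x)"

definition cup ::
    "nat \<Rightarrow> ('g, 'm) monoid_scheme \<Rightarrow> 'g topology \<Rightarrow> ('g \<Rightarrow> int) \<Rightarrow> ('g \<Rightarrow> int) \<Rightarrow>
     ('g \<times> 'g \<Rightarrow> int) set" where
  "cup n \<Gamma> T x y =
     H2_class \<Gamma> T (integer_mod_group n)
       (\<lambda>(\<sigma>, \<tau>) \<in> carrier \<Gamma> \<times> carrier \<Gamma>. (x \<sigma> * y \<tau>) mod int n)"

text \<open>The connecting homomorphism of \<open>0 \<rightarrow> \<int>/n \<rightarrow> \<int>/n\<^sup>2 \<rightarrow> \<int>/n \<rightarrow> 0\<close>: lift \<open>z\<close> to a continuous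
  cochain \<open>w\<close> with values in \<open>\<int>/n\<^sup>2\<close>, and take the class of the cocycle \<open>c\<close> whose image under
  multiplication by \<open>n\<close> is the coboundary of \<open>w\<close>.\<close>

definition bockstein ::
    "nat \<Rightarrow> ('g, 'm) monoid_scheme \<Rightarrow> 'g topology \<Rightarrow> ('g \<Rightarrow> int) \<Rightarrow> ('g \<times> 'g \<Rightarrow> int) set" where
  "bockstein n \<Gamma> T z =
     (THE b. \<exists>w \<in> cochain1 \<Gamma> T (integer_mod_group (n^2)).
             \<exists>c \<in> cocycles2 \<Gamma> T (integer_mod_group n).
        (\<forall>\<sigma> \<in> carrier \<Gamma>. w \<sigma> mod int n = z \<sigma>) \<and>
        (\<forall>\<sigma> \<in> carrier \<Gamma>. \<forall>\<tau> \<in> carrier \<Gamma>.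
           (int n * c (\<sigma>, \<tau>)) mod int (n^2) = coboundary \<Gamma> (integer_mod_group (n^2)) w (\<sigma>, \<tau>)) \<and>
        b = H2_class \<Gamma> T (integer_mod_group n) c)"


section \<open>The group \<open>\<SS>\<close> and its pairing with \<open>H\<^sup>2\<close>\<close>

text \<open>Here \<open>(\<Gamma>, T)\<close> stands for \<open>\<gg>\<^sub>1\<close>, identified with \<open>Hom(H\<^sup>1(\<Gamma>), \<int>/n)\<close> by evaluation: \<open>\<sigma>(x)\<close> is
  \<open>x \<sigma>\<close>.  The completed tensor square of \<open>\<gg>\<^sub>1\<close> is the group of \<open>\<int>/n\<close>-bilinear forms on \<open>H\<^sup>1(\<Gamma>)\<close>;
  over \<open>\<int>/n\<close>, linear is the same as additive.\<close>

definition tensor_square ::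
    "nat \<Rightarrow> ('g, 'm) monoid_scheme \<Rightarrow> 'g topology \<Rightarrow> (('g \<Rightarrow> int) \<times> ('g \<Rightarrow> int) \<Rightarrow> int) monoid" where
  "tensor_square n \<Gamma> T =
     (let A = integer_mod_group n; K = H1 \<Gamma> T A in
      (product_group (carrier K \<times> carrier K) (\<lambda>_. A))
        \<lparr>carrier := {f \<in> carrier K \<times> carrier K \<rightarrow>\<^sub>E carrier A.
           (\<forall>y \<in> carrier K. (\<lambda>x. f (x, y)) \<in> hom K A) \<and>
           (\<forall>x \<in> carrier K. (\<lambda>y. f (x, y)) \<in> hom K A)}\<rparr>)"

definition tensor ::
    "nat \<Rightarrow> ('g, 'm) monoid_scheme \<Rightarrow> 'g topology \<Rightarrow> 'g \<Rightarrow> 'g \<Rightarrow>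
     ('g \<Rightarrow> int) \<times> ('g \<Rightarrow> int) \<Rightarrow> int" where
  "tensor n \<Gamma> T \<sigma> \<tau> =
     (let K = H1 \<Gamma> T (integer_mod_group n) in
      (\<lambda>(x, y) \<in> carrier K \<times> carrier K. (x \<sigma> * y \<tau>) mod int n))"

definition SS ::
    "nat \<Rightarrow> ('g, 'm) monoid_scheme \<Rightarrow> 'g topology \<Rightarrow>
     ((('g \<Rightarrow> int) \<times> ('g \<Rightarrow> int) \<Rightarrow> int) \<times> 'g) monoid" where
  "SS n \<Gamma> T =
     (tensor_square n \<Gamma> T \<times>\<times> \<Gamma>)
       \<lparr>carrier := {(f, g) \<in> carrier (tensor_square n \<Gamma> T) \<times> carrier \<Gamma>.
          \<forall>x \<in> carrier (H1 \<Gamma> T (integer_mod_group n)). f (x, x) = (int (n choose 2) * x g) mod int n}\<rparr>"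

text \<open>The profinite topology: pointwise convergence on bilinear forms.\<close>

definition SS_topology ::
    "nat \<Rightarrow> ('g, 'm) monoid_scheme \<Rightarrow> 'g topology \<Rightarrow>
     ((('g \<Rightarrow> int) \<times> ('g \<Rightarrow> int) \<Rightarrow> int) \<times> 'g) topology" where
  "SS_topology n \<Gamma> T =
     (let A = integer_mod_group n; K = H1 \<Gamma> T A in
      subtopology
        (prod_topology
          (product_topology (\<lambda>_. discrete_topology (carrier A)) (carrier K \<times> carrier K)) T)
        (carrier (SS n \<Gamma> T)))"

text \<open>Both adjoint maps are isomorphisms onto groups of continuous homomorphisms; in particular
  \<open>P\<close> is biadditive.\<close>

definition perfect_pairing ::
    "('a, 'm) monoid_scheme \<Rightarrow> 'a topology \<Rightarrow> ('b, 'k) monoid_scheme \<Rightarrow> 'b topology \<Rightarrow>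
     ('c, 'l) monoid_scheme \<Rightarrow> ('a \<times> 'b \<Rightarrow> 'c) \<Rightarrow> bool" where
  "perfect_pairing A TA B TB C P \<longleftrightarrow>
     (\<lambda>a. \<lambda>b \<in> carrier B. P (a, b)) \<in> iso A (cont_Hom B TB C) \<and>
     (\<lambda>b. \<lambda>a \<in> carrier A. P (a, b)) \<in> iso B (cont_Hom A TA C)"

definition SS_pairing ::
    "nat \<Rightarrow> ('g, 'm) monoid_scheme \<Rightarrow> 'g topology \<Rightarrow>
     ((('g \<Rightarrow> int) \<times> ('g \<Rightarrow> int) \<Rightarrow> int) \<times> 'g) \<times> ('g \<times> 'g \<Rightarrow> int) set \<Rightarrow> int" where
  "SS_pairing n \<Gamma> T =
     (let A = integer_mod_group n; K = carrier (H1 \<Gamma> T A); H = H2 \<Gamma> T A in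
      THE P. P \<in> carrier (SS n \<Gamma> T) \<times> carrier H \<rightarrow>\<^sub>E carrier A \<and>
        perfect_pairing (SS n \<Gamma> T) (SS_topology n \<Gamma> T) H (discrete_topology (carrier H)) A P \<and>
        (\<forall>(f, g) \<in> carrier (SS n \<Gamma> T).
           (\<forall>x \<in> K. \<forall>y \<in> K. P ((f, g), cup n \<Gamma> T x y) = f (x, y)) \<and>
           (\<forall>z \<in> K. P ((f, g), bockstein n \<Gamma> T z) = z g)))"

definition res_R ::
    "nat \<Rightarrow> ('g, 'm) monoid_scheme \<Rightarrow> 'g topology \<Rightarrow> ('g \<times> 'g \<Rightarrow> int) set set \<Rightarrow>
     (('g \<Rightarrow> int) \<times> ('g \<Rightarrow> int) \<Rightarrow> int) \<times> 'g \<Rightarrow> ('g \<times> 'g \<Rightarrow> int) set \<Rightarrow> int" where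
  "res_R n \<Gamma> T R s = (\<lambda>r \<in> R. SS_pairing n \<Gamma> T (s, r))"

definition SS_R ::
    "nat \<Rightarrow> ('g, 'm) monoid_scheme \<Rightarrow> 'g topology \<Rightarrow> ('g \<times> 'g \<Rightarrow> int) set set \<Rightarrow>
     (('g \<times> 'g \<Rightarrow> int) set \<Rightarrow> int) monoid" where
  "SS_R n \<Gamma> T R =
     (product_group R (\<lambda>_. integer_mod_group n))\<lparr>carrier := res_R n \<Gamma> T R ` carrier (SS n \<Gamma> T)\<rparr>"

definition SS_R_topology ::
    "nat \<Rightarrow> ('g, 'm) monoid_scheme \<Rightarrow> 'g topology \<Rightarrow> ('g \<times> 'g \<Rightarrow> int) set set \<Rightarrow>
     (('g \<times> 'g \<Rightarrow> int) set \<Rightarrow> int) topology" where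
  "SS_R_topology n \<Gamma> T R =
     subtopology (product_topology (\<lambda>_. discrete_topology (carrier (integer_mod_group n))) R)
       (carrier (SS_R n \<Gamma> T R))"

end

theory Submission
  imports Defs "HOL-Number_Theory.Cong" "HOL-Algebra.FiniteProduct" "HOL-Algebra.SndIsomorphismGrp"
begin

text \<open>
  If the class of a cocycle \<open>c\<close> on \<open>\<gg>\<^sub>1\<close> dies in \<open>H\<^sup>2(G)\<close>, then \<open>\<phi>(x y) = \<phi>(x) + \<phi>(y) - c(x, y)\<close> for a
  cochain \<open>\<phi>\<close> on \<open>G\<close>, and \<open>u \<mapsto> \<phi>(1) - \<phi>(u)\<close> is a character of \<open>\<gg>\<^sub>2\<close> which only depends on the class
  (an inverse of the transgression). It takes the value \<open>c(\<sigma>, \<tau>) - c(\<tau>, \<sigma>)\<close> at \<open>[\<sigma>, \<tau>]\<close> and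
  \<open>\<Sum>k<n. c(\<sigma>\<^sup>k, \<sigma>)\<close> at \<open>\<sigma>\<^sup>\<pi>\<close>. These are also the values of the pairing of the class with
  \<open>(\<sigma> \<otimes> \<tau> - \<tau> \<otimes> \<sigma>, 0)\<close> and with \<open>((n choose 2) \<sigma> \<otimes> \<sigma>, \<sigma>)\<close>, as one checks on cup products and
  Bockstein classes. Letting the class run through \<open>R\<close> gives \<open>\<Omega>\<close>.

  For \<open>\<gg>\<^sub>1 = (\<int>/n)\<^sup>I\<close> the two expressions determine the class of \<open>c\<close>: if they vanish, the central
  extension defined by \<open>c\<close> is abelian and the standard generators lift to elements of order dividing
  \<open>n\<close>, so that it splits. Hence cup products and Bockstein classes generate \<open>H\<^sup>2\<close>, and the pairing
  exists, is unique and is perfect.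

  The image of \<open>\<Omega>\<close> and \<open>\<SS>\<^sub>R\<close> are closed subgroups of \<open>(\<int>/n)\<^sup>R\<close>, and both are annihilated precisely
  by the finite linear relations between the elements of \<open>R\<close> in \<open>H\<^sup>2\<close>; so they are equal. \<open>\<Omega>\<close> is
  injective because every character of a finite quotient of \<open>\<gg>\<^sub>2\<close> extends to a cochain on \<open>G\<close> whose
  coboundary is inflated from \<open>\<gg>\<^sub>1\<close>.
\<close>

section \<open>Linear functionals modulo n\<close>

text \<open>They are replaced by the injectivity of \<int>/n as a module over itself: for finite F,
  functionals on submodules of (\<int>/n)^F extend, and they separate points from submodules.
  Compactness brings everything infinite down to finite F. The pairing cannot simply be prescribed
  on cup products and Bockstein classes, because these satisfy relations. It is defined instead by a
  formula in the values of the two expressions at the standard generators. The condition f(x, x) =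
  (n choose 2) g(x) mirrors the relation between x \<union> x and the Bockstein of x; its
  polarisation makes f antisymmetric modulo n, and together they give the formula the prescribed
  values. Cocycles are integer-valued functions compared by congruences and are not normalised,
  whence the corrections c(1, 1) and \<phi>(1). Uniqueness of \<Omega> rests on density: commutators
  and n-th powers generate a dense subgroup of G^(2), and \<Omega> is continuous.\<close>

lemma int_subgroup_generator:
  fixes D :: "int set" and n :: int
  assumes "n > 0" "n \<in> D" and sub: "\<And>i j. i \<in> D \<Longrightarrow> j \<in> D \<Longrightarrow> i - j \<in> D"
  obtains k where "k > 0" "k \<in> D" "\<And>j. j \<in> D \<Longrightarrow> k dvd j"
proof -
  define m where "m = (LEAST m::nat. m > 0 \<and> int m \<in> D)"
  have ex: "\<exists>m::nat. m > 0 \<and> int m \<in> D"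
    using assms(1,2) by (intro exI[of _ "nat n"]) auto
  have m: "m > 0" "int m \<in> D"
    using LeastI_ex[OF ex] unfolding m_def by auto
  have least: "m \<le> l" if "l > 0" "int l \<in> D" for l
    unfolding m_def using that by (intro Least_le) auto
  have zero: "0 \<in> D" using sub[OF \<open>n \<in> D\<close> \<open>n \<in> D\<close>] by simp
  have neg: "- i \<in> D" if "i \<in> D" for i using sub[OF zero that] by simp
  have add: "i + j \<in> D" if "i \<in> D" "j \<in> D" for i j using sub[OF that(1) neg[OF that(2)]] by simp
  have natmul: "int l * int m \<in> D" for l
    by (induction l) (auto simp: zero algebra_simps intro: add m)
  have mul: "l * int m \<in> D" for l
    using natmul[of "nat l"] neg[OF natmul[of "nat (- l)"]] by (cases "l \<ge> 0") auto
  have "int m dvd j" if "j \<in> D" for j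
  proof -
    \<comment> \<open>The remainder of a division by m lies again in D and is smaller than m, so it
      is 0 by minimality.\<close>
    have "j mod int m = j - (j div int m) * int m" by (simp add: minus_div_mult_eq_mod)
    then have "j mod int m \<in> D" using sub[OF that mul] by simp
    moreover have "0 \<le> j mod int m" "j mod int m < int m" using m by auto
    ultimately have "j mod int m = 0"
      using least[of "nat (j mod int m)"] by (cases "j mod int m = 0") auto
    then show ?thesis by auto
  qed
  then show thesis using that[of "int m"] m by auto
qed

text \<open>Closure under differences makes the graph a subgroup. As the functional is only known
  through its graph, scalars have to act on both components at once.\<close>

lemma int_multiple_closed:
  fixes M :: "(('x \<Rightarrow> int) \<times> int) set"
  assumes ne: "M \<noteq> {}"
    and sub: "\<And>b v b' v'. (b, v) \<in> M \<Longrightarrow> (b', v') \<in> M \<Longrightarrow> (\<lambda>r. b r - b' r, v - v') \<in> M"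
    and bv: "(b, v) \<in> M"
  shows "(\<lambda>r. k * b r, k * v) \<in> M"
proof -
  have zero: "(\<lambda>r. 0, 0) \<in> M" using sub[OF bv bv] by simp
  have neg: "(\<lambda>r. - b r, - v) \<in> M" if "(b, v) \<in> M" for b v using sub[OF zero that] by simp
  have natmul: "(\<lambda>r. int l * b r, int l * v) \<in> M" for l
  proof (induction l)
    case (Suc l)
    from sub[OF Suc neg[OF bv]] show ?case by (simp add: algebra_simps)
  qed (simp add: zero)
  show ?thesis
    using natmul[of "nat k"] neg[OF natmul[of "nat (- k)"]] by (cases "k \<ge> 0") auto
qed

text \<open>This is the injectivity of \<open>\<int>/n\<close> as a \<open>\<int>/n\<close>-module; a functional is given by its graph \<open>M\<close>,
  so that it may be only defined modulo \<open>n\<close> and on a subgroup.\<close>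

lemma mod_functional_extend:
  fixes M :: "(('x \<Rightarrow> int) \<times> int) set" and n :: int
  assumes "finite F" "n > 0" "M \<noteq> {}"
    and "\<And>b v b' v'. (b, v) \<in> M \<Longrightarrow> (b', v') \<in> M \<Longrightarrow> (\<lambda>r. b r - b' r, v - v') \<in> M"
    and "\<And>b v. (b, v) \<in> M \<Longrightarrow> (\<And>r. r \<in> F \<Longrightarrow> n dvd b r) \<Longrightarrow> n dvd v"
  shows "\<exists>m. \<forall>b v. (b, v) \<in> M \<longrightarrow> n dvd v - (\<Sum>r\<in>F. m r * b r)"
  using assms(1,3-)
proof (induction F arbitrary: M rule: finite_induct)
  case empty
  then show ?case by auto
next
  case (insert r F)
  \<comment> \<open>The values at r, modulo n, of those elements of the graph that vanish modulo n
    on F. As a subgroup of \<int> containing n, it is generated by a divisor d of n.\<close>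
  define D where "D = {b r + n * k | b v k. (b, v) \<in> M \<and> (\<forall>s\<in>F. n dvd b s)}"
  obtain b1 v1 where bv1: "(b1, v1) \<in> M" using insert.prems(1) by auto
  have zero: "(\<lambda>r. 0, 0) \<in> M" using insert.prems(2)[OF bv1 bv1] by simp
  have "n \<in> D" unfolding D_def
    by (rule CollectI, rule exI[of _ "\<lambda>r. 0"], rule exI[of _ 0], rule exI[of _ 1]) (use zero in auto)
  moreover have "i - j \<in> D" if ij: "i \<in> D" "j \<in> D" for i j
  proof -
    from ij obtain b v k b' v' k' where 1: "i = b r + n * k" "(b, v) \<in> M" "\<forall>s\<in>F. n dvd b s"
      "j = b' r + n * k'" "(b', v') \<in> M" "\<forall>s\<in>F. n dvd b' s" unfolding D_def by blast
    have "i - j = (b r - b' r) + n * (k - k')" using 1 by (simp add: algebra_simps)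
    moreover have "(\<lambda>r. b r - b' r, v - v') \<in> M" using insert.prems(2) 1 by blast
    moreover have "\<forall>s\<in>F. n dvd b s - b' s" using 1 by auto
    ultimately show ?thesis unfolding D_def
      by (intro CollectI exI[of _ "\<lambda>r. b r - b' r"] exI[of _ "v - v'"] exI[of _ "k - k'"]) simp
  qed
  ultimately obtain d where d: "d > 0" "d \<in> D" and ddvd: "\<And>j. j \<in> D \<Longrightarrow> d dvd j"
    using int_subgroup_generator[OF \<open>n > 0\<close>] by metis
  have "d dvd n" using ddvd \<open>n \<in> D\<close> by blast
  then obtain e where e: "n = d * e" by auto
  have "e > 0" using e d \<open>n > 0\<close> by (simp add: zero_less_mult_iff)
  from d obtain b0 v0 k0 where bv0: "d = b0 r + n * k0" "(b0, v0) \<in> M" "\<forall>s\<in>F. n dvd b0 s"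
    unfolding D_def by blast
  \<comment> \<open>Scaling by e = n/d makes every coordinate vanish modulo n, so n divides e * v0,
    that is, d divides v0. This is what allows a coefficient m0 at r with d * m0 = v0.\<close>
  have "(\<lambda>s. e * b0 s, e * v0) \<in> M"
    by (rule int_multiple_closed[OF insert.prems(1,2) bv0(2)])
  moreover have "n dvd e * b0 s" if "s \<in> insert r F" for s
  proof (cases "s = r")
    case True
    have "e * b0 r = e * d - e * n * k0" using bv0(1) by (simp add: algebra_simps)
    also have "n dvd \<dots>" using e by (simp add: mult.commute)
    finally show ?thesis using True by simp
  next
    case False
    then show ?thesis using that bv0 by auto
  qed
  ultimately have "n dvd e * v0" using insert.prems(3) by blast
  then have "d dvd v0" using e \<open>e > 0\<close> by (simp add: mult.commute)
  then obtain m0 where m0: "v0 = d * m0" by auto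
  \<comment> \<open>After m0 * b r is removed, the value is controlled by the coordinates in F
    alone: an element vanishing on F has b r = d * k and is compared with k times (b0, v0).\<close>
  define M' where "M' = {(b, v - m0 * b r) | b v. (b, v) \<in> M}"
  have "\<exists>m. \<forall>b v. (b, v) \<in> M' \<longrightarrow> n dvd v - (\<Sum>r\<in>F. m r * b r)"
  proof (rule insert.IH)
    show "M' \<noteq> {}" using bv1 unfolding M'_def by auto
    show "(\<lambda>s. b s - b' s, v - v') \<in> M'" if "(b, v) \<in> M'" "(b', v') \<in> M'" for b v b' v'
    proof -
      from that obtain w w' where "v = w - m0 * b r" "(b, w) \<in> M" "v' = w' - m0 * b' r" "(b', w') \<in> M"
        unfolding M'_def by auto
      then have "(\<lambda>s. b s - b' s, w - w') \<in> M" "v - v' = (w - w') - m0 * (b r - b' r)"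
        using insert.prems(2) by (auto simp: algebra_simps)
      then show ?thesis unfolding M'_def by auto
    qed
    show "n dvd v" if "(b, v) \<in> M'" and F: "\<And>s. s \<in> F \<Longrightarrow> n dvd b s" for b v
    proof -
      from that obtain w where w: "v = w - m0 * b r" "(b, w) \<in> M" unfolding M'_def by auto
      have "b r \<in> D" unfolding D_def
        by (intro CollectI exI[of _ b] exI[of _ w] exI[of _ 0]) (use w F in auto)
      then obtain k where k: "b r = d * k" using ddvd by blast
      have mem: "(\<lambda>s. b s - k * b0 s, w - k * v0) \<in> M"
      proof -
        have "(\<lambda>s. k * b0 s, k * v0) \<in> M"
          by (rule int_multiple_closed[OF insert.prems(1,2) bv0(2)])
        from insert.prems(2)[OF w(2) this] show ?thesis .
      qed
      have "n dvd b s - k * b0 s" if "s \<in> insert r F" for s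
      proof (cases "s = r")
        case True
        have "b r - k * b0 r = n * (k * k0)" using k bv0(1) by (simp add: algebra_simps)
        then show ?thesis using True by simp
      next
        case False
        then show ?thesis using that bv0 F by auto
      qed
      then have "n dvd w - k * v0" using insert.prems(3)[OF mem] by blast
      moreover have "v = w - k * v0" using w k m0 by (simp add: algebra_simps)
      ultimately show ?thesis by simp
    qed
  qed
  then obtain m where m: "\<And>b v. (b, v) \<in> M' \<Longrightarrow> n dvd v - (\<Sum>r\<in>F. m r * b r)" by blast
  show ?case
  proof (intro exI[of _ "m(r := m0)"] allI impI)
    fix b v assume "(b, v) \<in> M"
    then have "n dvd (v - m0 * b r) - (\<Sum>r\<in>F. m r * b r)" by (intro m) (auto simp: M'_def)
    moreover have "(\<Sum>s\<in>F. (m(r := m0)) s * b s) = (\<Sum>s\<in>F. m s * b s)"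
      using insert.hyps by (intro sum.cong) auto
    ultimately show "n dvd v - (\<Sum>s\<in>insert r F. (m(r := m0)) s * b s)"
      using insert.hyps by (simp add: algebra_simps)
  qed
qed

text \<open>Modulo B, the vector v has an order k > 1 dividing n. The functional that kills B and
  sends v to n/k is well defined on B + \<int>v, and injectivity of \<int>/n extends it to all
  coordinates in F.\<close>

lemma mod_functional_separate:
  fixes B :: "('x \<Rightarrow> int) set" and n :: int
  assumes "finite F" "n > 0" and ne: "B \<noteq> {}"
    and sub: "\<And>b b'. b \<in> B \<Longrightarrow> b' \<in> B \<Longrightarrow> (\<lambda>r. b r - b' r) \<in> B"
    and notin: "\<And>b. b \<in> B \<Longrightarrow> \<exists>r\<in>F. \<not> n dvd v r - b r"
  shows "\<exists>m. (\<forall>b\<in>B. n dvd (\<Sum>r\<in>F. m r * b r)) \<and> \<not> n dvd (\<Sum>r\<in>F. m r * v r)"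
proof -
  define D where "D = {j. \<exists>b\<in>B. \<forall>r\<in>F. n dvd j * v r - b r}"
  obtain b1 where b1: "b1 \<in> B" using ne by auto
  have zero: "(\<lambda>r. 0) \<in> B" using sub[OF b1 b1] by simp
  have "n \<in> D" unfolding D_def using zero by force
  moreover have Dsub: "i - j \<in> D" if "i \<in> D" "j \<in> D" for i j
  proof -
    from that obtain b b' where b: "b \<in> B" "\<forall>r\<in>F. n dvd i * v r - b r" "b' \<in> B" "\<forall>r\<in>F. n dvd j * v r - b' r"
      unfolding D_def by blast
    have "n dvd (i - j) * v r - (b r - b' r)" if "r \<in> F" for r
    proof -
      have "(i - j) * v r - (b r - b' r) = (i * v r - b r) - (j * v r - b' r)" by (simp add: algebra_simps)
      then show ?thesis using b that by (metis dvd_diff)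
    qed
    then show ?thesis unfolding D_def
      by (intro CollectI bexI[of _ "\<lambda>r. b r - b' r"]) (use sub[OF b(1,3)] in auto)
  qed
  ultimately obtain k where k: "k > 0" "k \<in> D" and kdvd: "\<And>j. j \<in> D \<Longrightarrow> k dvd j"
    using int_subgroup_generator[OF \<open>n > 0\<close>] by metis
  have "1 \<notin> D" using notin unfolding D_def by auto
  then have "k > 1" using k by (cases "k = 1") auto
  have "k dvd n" using kdvd \<open>n \<in> D\<close> by blast
  then obtain l where l: "n = k * l" by auto
  have "0 < l" using l \<open>n > 0\<close> k by (simp add: zero_less_mult_iff)
  then have "l < n" using l \<open>k > 1\<close> by simp
  \<comment> \<open>The graph of that functional. If b + j v vanishes modulo n on F, then k divides
    j, and so n = k * l divides j * l.\<close>
  define M where "M = {(\<lambda>r. b r + j * v r, j * l) | b j. b \<in> B}"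
  have "\<exists>m. \<forall>b v. (b, v) \<in> M \<longrightarrow> n dvd v - (\<Sum>r\<in>F. m r * b r)"
  proof (rule mod_functional_extend[OF assms(1,2)])
    show "M \<noteq> {}" unfolding M_def using b1 by auto
    show "(\<lambda>r. c r - c' r, w - w') \<in> M" if "(c, w) \<in> M" "(c', w') \<in> M" for c w c' w'
    proof -
      from that obtain b j b' j' where b: "b \<in> B" "c = (\<lambda>r. b r + j * v r)" "w = j * l"
        "b' \<in> B" "c' = (\<lambda>r. b' r + j' * v r)" "w' = j' * l" unfolding M_def by blast
      have "(\<lambda>r. c r - c' r) = (\<lambda>r. (b r - b' r) + (j - j') * v r)" "w - w' = (j - j') * l"
        using b by (auto simp: algebra_simps)
      then show ?thesis unfolding M_def using sub[OF b(1,4)] by auto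
    qed
    show "n dvd w" if "(c, w) \<in> M" "\<And>r. r \<in> F \<Longrightarrow> n dvd c r" for c w
    proof -
      from that(1) obtain b j where b: "b \<in> B" "c = (\<lambda>r. b r + j * v r)" "w = j * l" unfolding M_def by blast
      have "j \<in> D" unfolding D_def
        using that(2) b sub[OF zero b(1)] by (auto intro!: bexI[of _ "\<lambda>r. 0 - b r"] simp: algebra_simps)
      then show ?thesis using kdvd l b by (metis dvd_refl mult_dvd_mono)
    qed
  qed
  then obtain m where m: "\<And>b w. (b, w) \<in> M \<Longrightarrow> n dvd w - (\<Sum>r\<in>F. m r * b r)" by blast
  have "n dvd (\<Sum>r\<in>F. m r * b r)" if "b \<in> B" for b
  proof -
    have "(b, 0) \<in> M" unfolding M_def using that by (auto intro!: exI[of _ b] exI[of _ 0])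
    from m[OF this] show ?thesis by simp
  qed
  moreover have "\<not> n dvd (\<Sum>r\<in>F. m r * v r)"
  proof
    assume *: "n dvd (\<Sum>r\<in>F. m r * v r)"
    have "(v, l) \<in> M" unfolding M_def using zero by (auto intro!: exI[of _ "\<lambda>r. 0"] exI[of _ 1])
    from m[OF this] * have "n dvd l" by (simp add: dvd_diff_left_iff dvd_diff_right_iff)
    then show False using \<open>0 < l\<close> \<open>l < n\<close> zdvd_not_zless by blast
  qed
  ultimately show ?thesis by blast
qed

text \<open>Sums are formed of integer-valued functions, whereas homomorphisms live on classes or
  reduced functions, where additivity is only a congruence. The predicate V is later
  \<open>cocycle\<close> or \<open>additive\<close>.\<close>

lemma mod_additive_linear:
  fixes h :: "('x \<Rightarrow> int) \<Rightarrow> int" and n :: int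
  assumes V: "V (\<lambda>_. 0)" "\<And>f g. V f \<Longrightarrow> V g \<Longrightarrow> V (\<lambda>p. f p + g p)" "\<And>f k. V f \<Longrightarrow> V (\<lambda>p. k * f p)"
    and add: "\<And>f g. V f \<Longrightarrow> V g \<Longrightarrow> [h (\<lambda>p. f p + g p) = h f + h g] (mod n)"
  shows "V f \<Longrightarrow> [h (\<lambda>p. k * f p) = k * h f] (mod n)"
    and "(\<And>i. i \<in> J \<Longrightarrow> V (fs i)) \<Longrightarrow> [h (\<lambda>p. \<Sum>i\<in>J. m i * fs i p) = (\<Sum>i\<in>J. m i * h (fs i))] (mod n)"
proof -
  have zero: "[h (\<lambda>_. 0) = 0] (mod n)"
  proof -
    let ?z = "h (\<lambda>_. 0)"
    have "[?z + 0 = ?z + ?z] (mod n)" using add[OF V(1) V(1)] by simp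
    then show ?thesis by (simp only: cong_add_lcancel cong_sym_eq[of 0])
  qed
  have nat: "[h (\<lambda>p. int l * f p) = int l * h f] (mod n)" if "V f" for f l
  proof (induction l)
    case (Suc l)
    have "[h (\<lambda>p. int l * f p + f p) = int l * h f + h f] (mod n)"
      using cong_trans[OF add[OF V(3)[OF that] that] cong_add[OF Suc cong_refl]] .
    then show ?case by (simp add: algebra_simps)
  qed (simp add: zero)
  have neg: "[h (\<lambda>p. - f p) = - h f] (mod n)" if "V f" for f
  proof -
    have "V (\<lambda>p. - f p)" using V(3)[OF that, of "- 1"] by simp
    from add[OF that this] have "[h (\<lambda>_. 0) = h f + h (\<lambda>p. - f p)] (mod n)" by simp
    with cong_sym[OF zero] have "[0 = h f + h (\<lambda>p. - f p)] (mod n)" by (rule cong_trans)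
    then have "[0 - h f = h f + h (\<lambda>p. - f p) - h f] (mod n)" by (rule cong_diff) simp
    then show ?thesis by (simp add: cong_sym)
  qed
  show scale: "[h (\<lambda>p. k * f p) = k * h f] (mod n)" if "V f" for f k
  proof (cases "k \<ge> 0")
    case True
    then show ?thesis using nat[OF that, of "nat k"] by simp
  next
    case False
    have "[h (\<lambda>p. - (- k * f p)) = - h (\<lambda>p. - k * f p)] (mod n)"
      by (rule neg[OF V(3)[OF that]])
    also have "[- h (\<lambda>p. - k * f p) = - (- k * h f)] (mod n)"
      using nat[OF that, of "nat (- k)"] False by (simp only: cong_minus_minus_iff) simp
    finally show ?thesis by simp
  qed
  show "[h (\<lambda>p. \<Sum>i\<in>J. m i * fs i p) = (\<Sum>i\<in>J. m i * h (fs i))] (mod n)" if "\<And>i. i \<in> J \<Longrightarrow> V (fs i)"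
    using that
  proof (induction J rule: infinite_finite_induct)
    case (insert i J)
    have Vi: "V (\<lambda>p. m i * fs i p)" using V(3) insert.prems by auto
    have VJ: "V (\<lambda>p. \<Sum>i\<in>A. m i * fs i p)" if "finite A" "A \<subseteq> J" for A
      using that
    proof (induction A rule: finite_induct)
      case (insert j A)
      have "V (\<lambda>p. m j * fs j p + (\<Sum>i\<in>A. m i * fs i p))"
        using insert \<open>\<And>j. j \<in> insert i J \<Longrightarrow> V (fs j)\<close> by (intro V) auto
      then show ?case using insert.hyps by simp
    qed (simp add: V(1))
    have "[h (\<lambda>p. m i * fs i p + (\<Sum>i\<in>J. m i * fs i p)) = h (\<lambda>p. m i * fs i p) + h (\<lambda>p. \<Sum>i\<in>J. m i * fs i p)] (mod n)"
      using add[OF Vi VJ] insert.hyps by simp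
    also have "[h (\<lambda>p. m i * fs i p) + h (\<lambda>p. \<Sum>i\<in>J. m i * fs i p) = m i * h (fs i) + (\<Sum>i\<in>J. m i * h (fs i))] (mod n)"
      using insert by (intro cong_add scale) auto
    finally show ?case using insert.hyps by simp
  qed (simp_all add: zero)
qed

section \<open>Locally constant functions\<close>

text \<open>Continuity into a discrete space without naming the target. Integer-valued lifts of
  cochains can then be added and scaled before they are reduced modulo n.\<close>

definition loc_const :: "'a topology \<Rightarrow> ('a \<Rightarrow> 'b) \<Rightarrow> bool" where
  "loc_const T f \<longleftrightarrow> (\<forall>v. openin T {x \<in> topspace T. f x = v})"

lemma loc_const_openin:
  assumes "loc_const T f"
  shows "openin T {x \<in> topspace T. f x \<in> V}"
proof -
  have "{x \<in> topspace T. f x \<in> V} = (\<Union>v\<in>V. {x \<in> topspace T. f x = v})" by auto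
  then show ?thesis using assms by (auto simp: loc_const_def intro!: openin_Union)
qed

lemma loc_const_closedin:
  assumes "loc_const T f"
  shows "closedin T {x \<in> topspace T. f x \<in> V}"
proof -
  have "topspace T - {x \<in> topspace T. f x \<in> V} = {x \<in> topspace T. f x \<in> - V}" by auto
  then show ?thesis using loc_const_openin[OF assms, of "- V"] by (auto simp: closedin_def)
qed

lemma loc_const_iff:
  assumes "f \<in> topspace T \<rightarrow> D"
  shows "continuous_map T (discrete_topology D) f \<longleftrightarrow> loc_const T f"
proof
  assume *: "continuous_map T (discrete_topology D) f"
  show "loc_const T f" unfolding loc_const_def
  proof
    fix v
    show "openin T {x \<in> topspace T. f x = v}"
    proof (cases "v \<in> D")
      case True
      then show ?thesis using openin_continuous_map_preimage[OF *, of "{v}"] by simp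
    next
      case False
      then have "{x \<in> topspace T. f x = v} = {}" using assms by auto
      then show ?thesis by (simp only: openin_empty)
    qed
  qed
next
  assume "loc_const T f"
  then show "continuous_map T (discrete_topology D) f"
    using assms by (auto simp: continuous_map_def intro: loc_const_openin)
qed

lemma loc_const_cong:
  "(\<And>x. x \<in> topspace T \<Longrightarrow> f x = g x) \<Longrightarrow> loc_const T f \<longleftrightarrow> loc_const T g"
proof -
  assume *: "\<And>x. x \<in> topspace T \<Longrightarrow> f x = g x"
  have "{x \<in> topspace T. f x = v} = {x \<in> topspace T. g x = v}" for v using * by auto
  then show ?thesis by (simp add: loc_const_def)
qed

lemma loc_const_const: "loc_const T (\<lambda>x. a)"
proof -
  have "{x \<in> topspace T. a = v} = (if a = v then topspace T else {})" for v by auto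
  then show ?thesis by (simp add: loc_const_def)
qed

lemma loc_const_map2:
  assumes "loc_const T f" "loc_const T g"
  shows "loc_const T (\<lambda>x. h (f x) (g x))"
  unfolding loc_const_def
proof
  fix v
  have "{x \<in> topspace T. h (f x) (g x) = v} =
    (\<Union>(a, b)\<in>{(a, b). h a b = v}. {x \<in> topspace T. f x = a} \<inter> {x \<in> topspace T. g x = b})" by auto
  then show "openin T {x \<in> topspace T. h (f x) (g x) = v}"
    using assms by (auto simp: loc_const_def intro!: openin_Union openin_Int)
qed

lemma loc_const_map:
  "loc_const T f \<Longrightarrow> loc_const T (\<lambda>x. h (f x))"
  using loc_const_map2[of T f f "\<lambda>a b. h a"] by simp

lemma loc_const_sum:
  "(\<And>i. i \<in> J \<Longrightarrow> loc_const T (f i)) \<Longrightarrow> loc_const T (\<lambda>x. \<Sum>i\<in>J. f i x)"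
  by (induction J rule: infinite_finite_induct) (auto intro: loc_const_const loc_const_map2[of _ _ _ "(+)"])

lemma loc_const_compose:
  assumes "continuous_map S T p" "loc_const T f"
  shows "loc_const S (\<lambda>x. f (p x))"
  unfolding loc_const_def
proof
  fix v
  have "{x \<in> topspace S. f (p x) = v} = {x \<in> topspace S. p x \<in> {y \<in> topspace T. f y = v}}"
    using continuous_map_funspace[OF assms(1)] by auto
  then show "openin S {x \<in> topspace S. f (p x) = v}"
    using openin_continuous_map_preimage[OF assms(1), of "{y \<in> topspace T. f y = v}"] assms(2)
    by (simp only: loc_const_def)
qed

lemma loc_const_subtopology: "loc_const T f \<Longrightarrow> loc_const (subtopology T M) f"
  using loc_const_compose[of "subtopology T M" T "\<lambda>x. x" f] by (simp add: continuous_map_from_subtopology)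

text \<open>Projection along a compact factor is a closed map, so the set of g that disagree with g0
  at some x is closed.\<close>

lemma openin_agree_on_compact:
  assumes "compact_space X" "g0 \<in> topspace T"
    and lc: "loc_const (prod_topology T X) (\<lambda>(g, x). F g x)"
  shows "openin T {g \<in> topspace T. \<forall>x\<in>topspace X. F g x = F g0 x}"
proof -
  have "continuous_map (prod_topology T X) (prod_topology T X) (\<lambda>z. (g0, snd z))"
    using assms(2) by (simp add: continuous_map_pairwise o_def continuous_map_snd)
  from loc_const_compose[OF this lc] have "loc_const (prod_topology T X) (\<lambda>z. F g0 (snd z))" by simp
  with lc have "loc_const (prod_topology T X) (\<lambda>z. (case z of (g, x) \<Rightarrow> F g x) \<noteq> F g0 (snd z))"
    by (rule loc_const_map2)
  from loc_const_closedin[OF this, of "{True}"]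
  have "closedin T (fst ` {z \<in> topspace (prod_topology T X). (case z of (g, x) \<Rightarrow> F g x) \<noteq> F g0 (snd z)})"
    using closed_map_fst[OF assms(1), of T] unfolding closed_map_def by simp
  moreover have "fst ` {z \<in> topspace (prod_topology T X). (case z of (g, x) \<Rightarrow> F g x) \<noteq> F g0 (snd z)} =
     topspace T - {g \<in> topspace T. \<forall>x\<in>topspace X. F g x = F g0 x}" by (force simp: image_iff)
  ultimately show ?thesis by (simp add: closedin_def double_diff)
qed

section \<open>Compact groups\<close>

locale top_group = group G for G (structure) and T :: "'a topology" +
  assumes topspace: "topspace T = carrier G"
    and continuous_mult: "continuous_map (prod_topology T T) T (\<lambda>(x, y). x \<otimes> y)"
    and continuous_inv: "continuous_map T T (\<lambda>x. inv x)"
begin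

lemma continuous_map_mult:
  "continuous_map S T f \<Longrightarrow> continuous_map S T g \<Longrightarrow> continuous_map S T (\<lambda>x. f x \<otimes> g x)"
  using continuous_map_compose[OF _ continuous_mult, of S "\<lambda>x. (f x, g x)"]
  by (simp add: continuous_map_pairwise o_def)

lemma continuous_map_inv:
  "continuous_map S T f \<Longrightarrow> continuous_map S T (\<lambda>x. inv (f x))"
  using continuous_map_compose[OF _ continuous_inv, of S f] by (simp add: o_def)

lemma openin_lmult:
  assumes "openin T U" "a \<in> carrier G"
  shows "openin T ((\<lambda>x. a \<otimes> x) ` U)"
proof -
  have U: "U \<subseteq> carrier G" using openin_subset[OF assms(1)] topspace by simp
  have "continuous_map T T (\<lambda>x. inv a \<otimes> x)"
    using assms(2) topspace by (intro continuous_map_mult) (auto simp: continuous_map_id)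
  from openin_continuous_map_preimage[OF this assms(1)]
  have "openin T {x \<in> carrier G. inv a \<otimes> x \<in> U}" using topspace by simp
  also have "{x \<in> carrier G. inv a \<otimes> x \<in> U} = (\<lambda>x. a \<otimes> x) ` U"
  proof (intro subset_antisym subsetI)
    fix x assume "x \<in> {x \<in> carrier G. inv a \<otimes> x \<in> U}"
    then show "x \<in> (\<lambda>x. a \<otimes> x) ` U" using assms(2)
      by (intro image_eqI[of _ _ "inv a \<otimes> x"]) (auto simp flip: m_assoc)
  next
    fix x assume "x \<in> (\<lambda>x. a \<otimes> x) ` U"
    then show "x \<in> {x \<in> carrier G. inv a \<otimes> x \<in> U}" using assms(2) U by (auto simp flip: m_assoc)
  qed
  finally show ?thesis .
qed

lemma openin_rmult:
  assumes "openin T U" "a \<in> carrier G"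
  shows "openin T ((\<lambda>x. x \<otimes> a) ` U)"
proof -
  have U: "U \<subseteq> carrier G" using openin_subset[OF assms(1)] topspace by simp
  have "continuous_map T T (\<lambda>x. x \<otimes> inv a)"
    using assms(2) topspace by (intro continuous_map_mult) (auto simp: continuous_map_id)
  from openin_continuous_map_preimage[OF this assms(1)]
  have "openin T {x \<in> carrier G. x \<otimes> inv a \<in> U}" using topspace by simp
  also have "{x \<in> carrier G. x \<otimes> inv a \<in> U} = (\<lambda>x. x \<otimes> a) ` U"
  proof (intro subset_antisym subsetI)
    fix x assume "x \<in> {x \<in> carrier G. x \<otimes> inv a \<in> U}"
    then show "x \<in> (\<lambda>x. x \<otimes> a) ` U" using assms(2)
      by (intro image_eqI[of _ _ "x \<otimes> inv a"]) (auto simp: m_assoc)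
  next
    fix x assume "x \<in> (\<lambda>x. x \<otimes> a) ` U"
    then show "x \<in> {x \<in> carrier G. x \<otimes> inv a \<in> U}" using assms(2) U by (auto simp: m_assoc subset_iff)
  qed
  finally show ?thesis .
qed

lemma openin_set_mult:
  assumes "openin T U" "A \<subseteq> carrier G"
  shows "openin T (A <#> U)"
proof -
  have "A <#> U = (\<Union>a\<in>A. (\<lambda>x. a \<otimes> x) ` U)" by (auto simp: set_mult_def)
  then show ?thesis using assms openin_lmult by (auto intro!: openin_Union)
qed

lemma closure_subgroup:
  assumes "subgroup H G"
  shows "subgroup (T closure_of H) G"
proof -
  interpret H: subgroup H G by fact
  show ?thesis
  proof (rule subgroupI)
    show "T closure_of H \<subseteq> carrier G" using closure_of_subset_topspace[of T H] topspace by simp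
    show "T closure_of H \<noteq> {}" using closure_of_subset[of H T] H.subset topspace H.one_closed by blast
    show "inv a \<in> T closure_of H" if "a \<in> T closure_of H" for a
    proof -
      have "(\<lambda>x. inv x) ` (T closure_of H) \<subseteq> T closure_of ((\<lambda>x. inv x) ` H)"
        using continuous_map_image_closure_subset[OF continuous_inv] .
      moreover have "(\<lambda>x. inv x) ` H \<subseteq> H" by auto
      ultimately show ?thesis using that closure_of_mono by blast
    qed
    show "a \<otimes> b \<in> T closure_of H" if "a \<in> T closure_of H" "b \<in> T closure_of H" for a b
    proof -
      have "(\<lambda>(x, y). x \<otimes> y) ` (prod_topology T T closure_of (H \<times> H)) \<subseteq> T closure_of ((\<lambda>(x, y). x \<otimes> y) ` (H \<times> H))"
        using continuous_map_image_closure_subset[OF continuous_mult] .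
      moreover have "(\<lambda>(x, y). x \<otimes> y) ` (H \<times> H) \<subseteq> H" by auto
      ultimately have "(\<lambda>(x, y). x \<otimes> y) ` (prod_topology T T closure_of (H \<times> H)) \<subseteq> T closure_of H"
        using closure_of_mono by blast
      moreover have "(a, b) \<in> prod_topology T T closure_of (H \<times> H)"
        using that by (simp add: closure_of_Times)
      ultimately show ?thesis by (auto simp: image_subset_iff)
    qed
  qed
qed

lemma closure_normal:
  assumes "H \<lhd> G"
  shows "T closure_of H \<lhd> G"
proof (rule normal_invI)
  interpret H: normal H G by fact
  show "subgroup (T closure_of H) G" by (rule closure_subgroup) (rule H.subgroup_axioms)
  fix g h assume g: "g \<in> carrier G" and h: "h \<in> T closure_of H"
  have "continuous_map T T (\<lambda>x. g \<otimes> x \<otimes> inv g)"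
    using g topspace by (intro continuous_map_mult) (auto simp: continuous_map_id)
  from continuous_map_image_closure_subset[OF this, of H]
  have "g \<otimes> h \<otimes> inv g \<in> T closure_of ((\<lambda>x. g \<otimes> x \<otimes> inv g) ` H)" using h by auto
  moreover have "(\<lambda>x. g \<otimes> x \<otimes> inv g) ` H \<subseteq> H" using g H.inv_op_closed2 by auto
  ultimately show "g \<otimes> h \<otimes> inv g \<in> T closure_of H" using closure_of_mono by blast
qed

lemma compactin_set_mult:
  assumes "compactin T A" "compactin T B"
  shows "compactin T (A <#> B)"
proof -
  have "compactin T ((\<lambda>(x, y). x \<otimes> y) ` (A \<times> B))"
    by (rule image_compactin[OF _ continuous_mult]) (use assms in \<open>simp add: compactin_Times\<close>)
  moreover have "(\<lambda>(x, y). x \<otimes> y) ` (A \<times> B) = A <#> B" by (auto simp: set_mult_def)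
  ultimately show ?thesis by simp
qed

text \<open>The largest normal subgroup all of whose cosets are either contained in or disjoint from the
  clopen set \<open>W\<close> is open by the tube lemma.\<close>

lemma open_normal_subgroup_in_clopen:
  assumes comp: "compact_space T" and W: "openin T W" "closedin T W" "\<one> \<in> W"
  shows "\<exists>U. U \<lhd> G \<and> openin T U \<and> U \<subseteq> W"
proof -
  \<comment> \<open>Comparing all two-sided translates at once makes the resulting subgroup
    invariant under conjugation.\<close>
  define F where "F = (\<lambda>g (x, y). x \<otimes> g \<otimes> y \<in> W)"
  have lcW: "loc_const T (\<lambda>x. x \<in> W)"
  proof -
    have "{x \<in> topspace T. (x \<in> W) = v} = (if v then W else topspace T - W)" for v
      using openin_subset[OF W(1)] by auto
    then show ?thesis using W by (auto simp: loc_const_def closedin_def)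
  qed
  have cont: "continuous_map (prod_topology T (prod_topology T T)) T (\<lambda>z. fst (snd z) \<otimes> fst z \<otimes> snd (snd z))"
    by (intro continuous_map_mult continuous_map_fst_of continuous_map_snd_of continuous_map_fst
        continuous_map_snd continuous_map_compose[OF continuous_map_snd, unfolded o_def])
  have "loc_const (prod_topology T (prod_topology T T)) (\<lambda>(g, x). F g x)"
    using loc_const_compose[OF cont lcW] by (simp add: F_def case_prod_unfold)
  then have op: "openin T {g \<in> topspace T. \<forall>x\<in>topspace (prod_topology T T). F g x = F \<one> x}"
    using comp topspace by (intro openin_agree_on_compact) (auto simp: compact_space_prod_topology)
  define U where "U = {g \<in> carrier G. \<forall>x\<in>carrier G. \<forall>y\<in>carrier G. x \<otimes> g \<otimes> y \<in> W \<longleftrightarrow> x \<otimes> y \<in> W}"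
  have "U = {g \<in> topspace T. \<forall>x\<in>topspace (prod_topology T T). F g x = F \<one> x}"
    unfolding U_def F_def using topspace by auto
  with op have opU: "openin T U" by simp
  have "U \<lhd> G"
  proof (rule normal_invI)
    show "subgroup U G"
    proof (rule subgroupI)
      show "U \<subseteq> carrier G" "U \<noteq> {}" unfolding U_def by (auto intro: exI[of _ \<one>])
      show "inv a \<in> U" if "a \<in> U" for a
      proof -
        have "x \<otimes> inv a \<otimes> y \<in> W \<longleftrightarrow> x \<otimes> y \<in> W" if xy: "x \<in> carrier G" "y \<in> carrier G" for x y
        proof -
          have a: "a \<in> carrier G" using \<open>a \<in> U\<close> by (auto simp: U_def)
          have "x \<otimes> a \<otimes> (inv a \<otimes> y) \<in> W \<longleftrightarrow> x \<otimes> (inv a \<otimes> y) \<in> W"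
            using \<open>a \<in> U\<close> xy unfolding U_def by auto
          moreover have "x \<otimes> a \<otimes> (inv a \<otimes> y) = x \<otimes> y" using xy a by (simp add: m_assoc[symmetric]) (simp add: m_assoc)
          ultimately show ?thesis using xy a by (simp add: m_assoc)
        qed
        then show ?thesis using that by (auto simp: U_def)
      qed
      show "a \<otimes> b \<in> U" if "a \<in> U" "b \<in> U" for a b
      proof -
        have ab: "a \<in> carrier G" "b \<in> carrier G" using that by (auto simp: U_def)
        have "x \<otimes> (a \<otimes> b) \<otimes> y \<in> W \<longleftrightarrow> x \<otimes> y \<in> W" if xy: "x \<in> carrier G" "y \<in> carrier G" for x y
        proof -
          have "x \<otimes> a \<otimes> (b \<otimes> y) \<in> W \<longleftrightarrow> x \<otimes> (b \<otimes> y) \<in> W"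
            using \<open>a \<in> U\<close> xy ab unfolding U_def by auto
          moreover have "x \<otimes> b \<otimes> y \<in> W \<longleftrightarrow> x \<otimes> y \<in> W" using \<open>b \<in> U\<close> xy ab unfolding U_def by auto
          ultimately show ?thesis using xy ab by (simp add: m_assoc)
        qed
        then show ?thesis using ab by (auto simp: U_def)
      qed
    qed
    fix h g assume h: "h \<in> carrier G" and g: "g \<in> U"
    then have gc: "g \<in> carrier G" by (auto simp: U_def)
    have "x \<otimes> (h \<otimes> g \<otimes> inv h) \<otimes> y \<in> W \<longleftrightarrow> x \<otimes> y \<in> W" if xy: "x \<in> carrier G" "y \<in> carrier G" for x y
    proof -
      have "(x \<otimes> h) \<otimes> g \<otimes> (inv h \<otimes> y) \<in> W \<longleftrightarrow> (x \<otimes> h) \<otimes> (inv h \<otimes> y) \<in> W"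
        using g xy h unfolding U_def by auto
      moreover have "(x \<otimes> h) \<otimes> (inv h \<otimes> y) = x \<otimes> y" using xy h by (simp add: m_assoc[symmetric]) (simp add: m_assoc)
      ultimately show ?thesis using xy h gc by (simp add: m_assoc)
    qed
    then show "h \<otimes> g \<otimes> inv h \<in> U" using h gc by (auto simp: U_def)
  qed
  moreover have "U \<subseteq> W"
  proof
    fix g assume "g \<in> U"
    then have "\<one> \<otimes> g \<otimes> \<one> \<in> W \<longleftrightarrow> \<one> \<otimes> \<one> \<in> W" "g \<in> carrier G" unfolding U_def by blast+
    then show "g \<in> W" using W(3) by simp
  qed
  ultimately show ?thesis using opU by blast
qed

end

lemma top_group_iff: "top_group G T \<longleftrightarrow> topological_group G T"
  by (auto simp: top_group_def top_group_axioms_def topological_group_def)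

text \<open>In a compact Hausdorff space components and quasi-components coincide, so a point that
  is its own component can be separated by a clopen set from the compact complement of V.\<close>

lemma clopen_neighbourhood:
  assumes "compact_space T" "Hausdorff_space T" "openin T V" "x \<in> V"
    and comp: "connected_component_of_set T x = {x}"
  shows "\<exists>W. openin T W \<and> closedin T W \<and> x \<in> W \<and> W \<subseteq> V"
proof -
  have x: "x \<in> topspace T" using assms openin_subset by blast
  have "{x} \<in> connected_components_of T" using comp x
    by (metis connected_component_in_connected_components_of)
  then have "{x} \<in> quasi_components_of T"
    using assms x by (subst compact_quasi_eq_connected_components_of)
      (auto simp: compact_imp_locally_compact_space)
  moreover have "compactin T (topspace T - V)"
    using assms by (intro closedin_compact_space) auto
  ultimately have "separated_between T {x} (topspace T - V)"
    using assms by (subst separated_between_quasi_component_compact) auto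
  then obtain W where "closedin T W" "openin T W" "{x} \<subseteq> W" "topspace T - V \<subseteq> topspace T - W"
    unfolding separated_between by blast
  moreover from this have "W \<subseteq> V" using openin_subset[of T W] by blast
  ultimately show ?thesis by auto
qed

lemma profinite_open_normal_subgroup:
  assumes "profinite_group G T" "openin T V" "\<one>\<^bsub>G\<^esub> \<in> V"
  shows "\<exists>U. U \<lhd> G \<and> openin T U \<and> U \<subseteq> V"
proof -
  interpret top_group G T using assms(1) by (simp add: top_group_iff profinite_group_def)
  obtain W where "openin T W" "closedin T W" "\<one>\<^bsub>G\<^esub> \<in> W" "W \<subseteq> V"
    using clopen_neighbourhood[of T V "\<one>\<^bsub>G\<^esub>"] assms topspace unfolding profinite_group_def by auto
  then show ?thesis using open_normal_subgroup_in_clopen[of W] assms(1)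
    unfolding profinite_group_def by (meson order.trans)
qed

section \<open>Closed subgroups of powers of \<open>\<int>/n\<close>\<close>

lemma open_nbhd_discrete_product:
  assumes "openin (product_topology (\<lambda>_. discrete_topology D) R) S" "v \<in> S"
  shows "\<exists>F. finite F \<and> F \<subseteq> R \<and> (\<forall>a \<in> R \<rightarrow>\<^sub>E D. (\<forall>r\<in>F. a r = v r) \<longrightarrow> a \<in> S)"
proof -
  obtain U where U: "finite {i \<in> R. U i \<noteq> D}" "v \<in> Pi\<^sub>E R U" "Pi\<^sub>E R U \<subseteq> S"
    using assms unfolding openin_product_topology_alt by (metis topspace_discrete_topology)
  have "a \<in> S" if "a \<in> R \<rightarrow>\<^sub>E D" "\<forall>r\<in>{i \<in> R. U i \<noteq> D}. a r = v r" for a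
  proof (rule subsetD[OF U(3)], rule PiE_I)
    fix r assume "r \<in> R"
    then show "a r \<in> U r" using that PiE_mem[OF U(2)] PiE_mem[OF that(1)] by (cases "U r = D") auto
  next
    fix r assume "r \<notin> R"
    then show "a r = undefined" using that(1) by (auto simp: PiE_iff extensional_def)
  qed
  then show ?thesis using U(1) by (intro exI[of _ "{i \<in> R. U i \<noteq> D}"]) auto
qed

text \<open>Duality for closed subgroups of a power of \<int>/n: a point outside a closed set is
  distinguished from it on finitely many coordinates, and on these a functional separates it from
  the subgroup.\<close>

lemma mem_closed_subgroup_by_annihilator:
  fixes A :: "('r \<Rightarrow> int) set" and n :: nat
  assumes "n > 0"
    and cl: "closedin (product_topology (\<lambda>_. discrete_topology {0..<int n}) R) A"
    and ne: "A \<noteq> {}" and sub: "\<And>a b. a \<in> A \<Longrightarrow> b \<in> A \<Longrightarrow> (\<lambda>r\<in>R. (a r - b r) mod int n) \<in> A"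
    and v: "v \<in> R \<rightarrow>\<^sub>E {0..<int n}"
    and ann: "\<And>F m. finite F \<Longrightarrow> F \<subseteq> R \<Longrightarrow> (\<And>a. a \<in> A \<Longrightarrow> int n dvd (\<Sum>r\<in>F. m r * a r)) \<Longrightarrow>
                int n dvd (\<Sum>r\<in>F. m r * v r)"
  shows "v \<in> A"
proof (rule ccontr)
  let ?P = "product_topology (\<lambda>_. discrete_topology {0..<int n}) R"
  assume "v \<notin> A"
  then have "openin ?P (topspace ?P - A)" "v \<in> topspace ?P - A"
    using openin_diff[OF openin_topspace cl] v by auto
  then obtain F where F: "finite F" "F \<subseteq> R"
    and Fv: "\<forall>a \<in> R \<rightarrow>\<^sub>E {0..<int n}. (\<forall>r\<in>F. a r = v r) \<longrightarrow> a \<in> topspace ?P - A"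
    using open_nbhd_discrete_product[of "{0..<int n}" R "topspace ?P - A" v] by auto
  have AR: "A \<subseteq> R \<rightarrow>\<^sub>E {0..<int n}" using closedin_subset[OF cl] by simp
  have F': "\<exists>r\<in>F. a r \<noteq> v r" if "a \<in> A" for a using Fv AR that by blast
  \<comment> \<open>Looking only at F and admitting arbitrary integer representatives turns A into a
    set closed under plain differences.\<close>
  define B where "B = {b. \<exists>a\<in>A. \<forall>r\<in>F. [b r = a r] (mod int n)}"
  have "\<exists>m. (\<forall>b\<in>B. int n dvd (\<Sum>r\<in>F. m r * b r)) \<and> \<not> int n dvd (\<Sum>r\<in>F. m r * v r)"
  proof (rule mod_functional_separate)
    have "A \<subseteq> B" unfolding B_def using cong_refl by blast
    then show "B \<noteq> {}" using ne by blast
    show "(\<lambda>r. b r - b' r) \<in> B" if "b \<in> B" "b' \<in> B" for b b'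
    proof -
      from that obtain a a' where a: "a \<in> A" "\<forall>r\<in>F. [b r = a r] (mod int n)" "a' \<in> A" "\<forall>r\<in>F. [b' r = a' r] (mod int n)"
        unfolding B_def by blast
      have "\<forall>r\<in>F. [b r - b' r = (\<lambda>r\<in>R. (a r - a' r) mod int n) r] (mod int n)"
      proof
        fix r assume "r \<in> F"
        then have "[b r - b' r = a r - a' r] (mod int n)" "r \<in> R" using a F by (auto intro: cong_diff)
        then show "[b r - b' r = (\<lambda>r\<in>R. (a r - a' r) mod int n) r] (mod int n)"
          by (simp add: cong_def)
      qed
      then show ?thesis unfolding B_def using sub[OF a(1,3)] by blast
    qed
    show "\<exists>r\<in>F. \<not> int n dvd v r - b r" if "b \<in> B" for b
    proof -
      from that obtain a where a: "a \<in> A" "\<forall>r\<in>F. [b r = a r] (mod int n)" unfolding B_def by blast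
      obtain r where r: "r \<in> F" "a r \<noteq> v r" using F'[OF a(1)] by blast
      have "a r \<in> {0..<int n}" "v r \<in> {0..<int n}"
        using a(1) closedin_subset[OF cl] v r F(2) by (auto simp: PiE_iff subset_iff)
      then have "\<not> [v r = a r] (mod int n)" using r by (simp add: cong_def)
      moreover have "[a r = b r] (mod int n)" using a r by (simp add: cong_sym)
      ultimately have "\<not> [v r = b r] (mod int n)" using cong_trans cong_sym by blast
      then show ?thesis using r by (auto simp: cong_iff_dvd_diff)
    qed
  qed (use F assms in auto)
  then obtain m where m: "\<And>b. b \<in> B \<Longrightarrow> int n dvd (\<Sum>r\<in>F. m r * b r)" "\<not> int n dvd (\<Sum>r\<in>F. m r * v r)"
    by blast
  have "A \<subseteq> B" unfolding B_def using cong_refl by blast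
  then show False using ann[OF F(1,2), of m] m by blast
qed

text \<open>Since \<phi> vanishes modulo n wherever the coordinates \<open>ev\<close> do, it is a
  functional of them, and injectivity extends it from their image to all integer vectors. The
  operation d stands for division in a group that may be written multiplicatively.\<close>

lemma character_from_coordinates:
  fixes ev :: "'s \<Rightarrow> 'r \<Rightarrow> int" and \<phi> :: "'s \<Rightarrow> int" and n :: int
  assumes "n > 0" "finite F" "A \<noteq> {}" and d: "\<And>a b. a \<in> A \<Longrightarrow> b \<in> A \<Longrightarrow> d a b \<in> A"
    and ev: "\<And>a b r. a \<in> A \<Longrightarrow> b \<in> A \<Longrightarrow> r \<in> F \<Longrightarrow> [ev (d a b) r = ev a r - ev b r] (mod n)"
    and hom: "\<And>a b. a \<in> A \<Longrightarrow> b \<in> A \<Longrightarrow> [\<phi> (d a b) = \<phi> a - \<phi> b] (mod n)"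
    and ker: "\<And>a. a \<in> A \<Longrightarrow> (\<And>r. r \<in> F \<Longrightarrow> [ev a r = 0] (mod n)) \<Longrightarrow> [\<phi> a = 0] (mod n)"
  shows "\<exists>m. \<forall>a\<in>A. [\<phi> a = (\<Sum>r\<in>F. m r * ev a r)] (mod n)"
proof -
  define M where "M = {(b, w). \<exists>a\<in>A. (\<forall>r\<in>F. [b r = ev a r] (mod n)) \<and> [w = \<phi> a] (mod n)}"
  have mem: "(ev a, \<phi> a) \<in> M" if "a \<in> A" for a
    unfolding M_def using that by (auto intro!: bexI[of _ a] cong_refl)
  have "\<exists>m. \<forall>b v. (b, v) \<in> M \<longrightarrow> n dvd v - (\<Sum>r\<in>F. m r * b r)"
  proof (rule mod_functional_extend)
    show "M \<noteq> {}" using mem assms(3) by auto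
    show "(\<lambda>r. b r - b' r, w - w') \<in> M" if "(b, w) \<in> M" "(b', w') \<in> M" for b w b' w'
    proof -
      from that obtain a a' where a: "a \<in> A" "\<forall>r\<in>F. [b r = ev a r] (mod n)" "[w = \<phi> a] (mod n)"
         "a' \<in> A" "\<forall>r\<in>F. [b' r = ev a' r] (mod n)" "[w' = \<phi> a'] (mod n)"
        unfolding M_def by auto
      have "[w - w' = \<phi> (d a a')] (mod n)"
        using cong_trans[OF cong_diff[OF a(3,6)] cong_sym[OF hom[OF a(1,4)]]] .
      moreover have "\<forall>r\<in>F. [b r - b' r = ev (d a a') r] (mod n)"
        using cong_trans[OF cong_diff[OF bspec[OF a(2)] bspec[OF a(5)]] cong_sym[OF ev[OF a(1,4)]]] by auto
      ultimately show ?thesis unfolding M_def using d[OF a(1,4)] by auto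
    qed
    show "n dvd w" if bw: "(b, w) \<in> M" and F0: "\<And>r. r \<in> F \<Longrightarrow> n dvd b r" for b w
    proof -
      from bw obtain a where a: "a \<in> A" "\<forall>r\<in>F. [b r = ev a r] (mod n)" "[w = \<phi> a] (mod n)"
        unfolding M_def by auto
      have "[ev a r = 0] (mod n)" if "r \<in> F" for r
      proof -
        have "[b r = 0] (mod n)" using F0[OF that] by (simp add: cong_0_iff)
        with cong_sym[OF bspec[OF a(2) that]] show ?thesis by (rule cong_trans)
      qed
      from cong_trans[OF a(3) ker[OF a(1) this]] show ?thesis by (simp add: cong_0_iff)
    qed
  qed (use assms in auto)
  then obtain m where m: "\<And>b w. (b, w) \<in> M \<Longrightarrow> n dvd w - (\<Sum>r\<in>F. m r * b r)" by blast
  show ?thesis using m[OF mem] by (auto simp: cong_iff_dvd_diff)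
qed

section \<open>Second cohomology with coefficients in \<open>\<int>/n\<close>\<close>

locale top_group_mod = top_group G T for G (structure) and T :: "'a topology" +
  fixes n :: nat
  assumes n_pos: "n > 0"
begin

abbreviation "\<Lambda> \<equiv> integer_mod_group n"
abbreviation "N \<equiv> int n"

lemma N_pos: "N > 0" using n_pos by simp

lemma carrier_L: "carrier \<Lambda> = {0..<N}"
  using n_pos by (simp add: carrier_integer_mod_group)

lemma mod_in_L [simp]: "a mod N \<in> carrier \<Lambda>"
  using N_pos by (simp add: carrier_L)

lemma L_mod [simp]: "a \<in> carrier \<Lambda> \<Longrightarrow> a mod N = a"
  by (simp add: carrier_L)

lemma L_cong_eq: "a \<in> carrier \<Lambda> \<Longrightarrow> b \<in> carrier \<Lambda> \<Longrightarrow> [a = b] (mod N) \<Longrightarrow> a = b"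
  by (simp add: carrier_L cong_def)

text \<open>Cochains are represented by integer-valued functions, read modulo \<open>n\<close>.\<close>

definition red :: "('a \<times> 'a \<Rightarrow> int) \<Rightarrow> 'a \<times> 'a \<Rightarrow> int" where
  "red c = (\<lambda>p \<in> carrier G \<times> carrier G. c p mod N)"

definition cocycle :: "('a \<times> 'a \<Rightarrow> int) \<Rightarrow> bool" where
  "cocycle c \<longleftrightarrow> loc_const (prod_topology T T) c \<and>
     (\<forall>\<sigma>\<in>carrier G. \<forall>\<tau>\<in>carrier G. \<forall>\<rho>\<in>carrier G.
        [c (\<tau>, \<rho>) + c (\<sigma>, \<tau> \<otimes> \<rho>) = c (\<sigma> \<otimes> \<tau>, \<rho>) + c (\<sigma>, \<tau>)] (mod N))"

definition cobound :: "('a \<Rightarrow> int) \<Rightarrow> 'a \<times> 'a \<Rightarrow> int" where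
  "cobound \<phi> = (\<lambda>(\<sigma>, \<tau>). \<phi> \<tau> - \<phi> (\<sigma> \<otimes> \<tau>) + \<phi> \<sigma>)"

definition cls :: "('a \<times> 'a \<Rightarrow> int) \<Rightarrow> ('a \<times> 'a \<Rightarrow> int) set" where
  "cls c = H2_class G T \<Lambda> (red c)"

lemma cocycleD:
  "cocycle c \<Longrightarrow> \<sigma> \<in> carrier G \<Longrightarrow> \<tau> \<in> carrier G \<Longrightarrow> \<rho> \<in> carrier G \<Longrightarrow>
    [c (\<tau>, \<rho>) + c (\<sigma>, \<tau> \<otimes> \<rho>) = c (\<sigma> \<otimes> \<tau>, \<rho>) + c (\<sigma>, \<tau>)] (mod N)"
  by (simp add: cocycle_def)

lemma red_eq_iff: "red c = red c' \<longleftrightarrow> (\<forall>\<sigma>\<in>carrier G. \<forall>\<tau>\<in>carrier G. [c (\<sigma>, \<tau>) = c' (\<sigma>, \<tau>)] (mod N))"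
  by (auto simp: red_def cong_def fun_eq_iff restrict_def)

lemma loc_const_red: "loc_const (prod_topology T T) c \<Longrightarrow> loc_const (prod_topology T T) (red c)"
  using loc_const_map[of "prod_topology T T" c "\<lambda>a. a mod N"]
  by (subst loc_const_cong[of _ _ "\<lambda>p. c p mod N"]) (auto simp: red_def topspace)

lemma red_cocycle:
  assumes "cocycle c"
  shows "red c \<in> cocycles2 G T \<Lambda>"
proof -
  have 1: "red c \<in> carrier G \<times> carrier G \<rightarrow>\<^sub>E carrier \<Lambda>" by (auto simp: red_def)
  moreover have "continuous_map (prod_topology T T) (discrete_topology (carrier \<Lambda>)) (red c)"
    using 1 topspace assms loc_const_red by (subst loc_const_iff) (auto simp: cocycle_def PiE_def)
  moreover have "(c (\<tau>, \<rho>) mod N + c (\<sigma>, \<tau> \<otimes> \<rho>) mod N) mod N = (c (\<sigma> \<otimes> \<tau>, \<rho>) mod N + c (\<sigma>, \<tau>) mod N) mod N"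
    if "\<sigma> \<in> carrier G" "\<tau> \<in> carrier G" "\<rho> \<in> carrier G" for \<sigma> \<tau> \<rho>
    using cocycleD[OF assms that] by (simp add: cong_def mod_add_eq)
  ultimately show ?thesis by (simp add: cocycles2_def cochain2_def red_def)
qed

lemma cocycles2_cocycle:
  assumes "c \<in> cocycles2 G T \<Lambda>"
  shows "cocycle c" "red c = c"
proof -
  have c: "c \<in> carrier G \<times> carrier G \<rightarrow>\<^sub>E carrier \<Lambda>"
    "continuous_map (prod_topology T T) (discrete_topology (carrier \<Lambda>)) c"
    using assms by (auto simp: cocycles2_def cochain2_def)
  have "loc_const (prod_topology T T) c"
    using c topspace by (subst (asm) loc_const_iff) (auto simp: PiE_def)
  then show "cocycle c" using assms by (auto simp: cocycle_def cocycles2_def cong_def)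
  show "red c = c"
    using c(1) by (auto simp: red_def fun_eq_iff restrict_def PiE_iff extensional_def)
qed

lemma loc_const_cobound:
  assumes "loc_const T \<phi>"
  shows "loc_const (prod_topology T T) (cobound \<phi>)"
proof -
  have "loc_const (prod_topology T T) (\<lambda>p. \<phi> (snd p))" "loc_const (prod_topology T T) (\<lambda>p. \<phi> (fst p))"
    by (intro loc_const_compose[OF _ assms] continuous_map_fst continuous_map_snd)+
  moreover have "loc_const (prod_topology T T) (\<lambda>p. \<phi> (fst p \<otimes> snd p))"
    using loc_const_compose[OF continuous_mult assms] by (simp add: case_prod_unfold)
  ultimately show ?thesis
    unfolding cobound_def case_prod_unfold
    by (intro loc_const_map2[where h = "(+)"] loc_const_map2[where h = "(-)"])
qed

lemma cocycle_cobound: "loc_const T \<phi> \<Longrightarrow> cocycle (cobound \<phi>)"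
  using loc_const_cobound by (auto simp: cocycle_def cobound_def m_assoc cong_def algebra_simps)

lemma cocycle_add: "cocycle c \<Longrightarrow> cocycle c' \<Longrightarrow> cocycle (\<lambda>p. c p + c' p)"
  unfolding cocycle_def
proof (intro conjI ballI)
  fix \<sigma> \<tau> \<rho> assume *: "loc_const (prod_topology T T) c \<and>
     (\<forall>\<sigma>\<in>carrier G. \<forall>\<tau>\<in>carrier G. \<forall>\<rho>\<in>carrier G.
        [c (\<tau>, \<rho>) + c (\<sigma>, \<tau> \<otimes> \<rho>) = c (\<sigma> \<otimes> \<tau>, \<rho>) + c (\<sigma>, \<tau>)] (mod N))"
    "loc_const (prod_topology T T) c' \<and>
     (\<forall>\<sigma>\<in>carrier G. \<forall>\<tau>\<in>carrier G. \<forall>\<rho>\<in>carrier G.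
        [c' (\<tau>, \<rho>) + c' (\<sigma>, \<tau> \<otimes> \<rho>) = c' (\<sigma> \<otimes> \<tau>, \<rho>) + c' (\<sigma>, \<tau>)] (mod N))"
    "\<sigma> \<in> carrier G" "\<tau> \<in> carrier G" "\<rho> \<in> carrier G"
  then have "[c (\<tau>, \<rho>) + c (\<sigma>, \<tau> \<otimes> \<rho>) = c (\<sigma> \<otimes> \<tau>, \<rho>) + c (\<sigma>, \<tau>)] (mod N)"
    "[c' (\<tau>, \<rho>) + c' (\<sigma>, \<tau> \<otimes> \<rho>) = c' (\<sigma> \<otimes> \<tau>, \<rho>) + c' (\<sigma>, \<tau>)] (mod N)" by blast+
  from cong_add[OF this]
  show "[c (\<tau>, \<rho>) + c' (\<tau>, \<rho>) + (c (\<sigma>, \<tau> \<otimes> \<rho>) + c' (\<sigma>, \<tau> \<otimes> \<rho>)) =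
      c (\<sigma> \<otimes> \<tau>, \<rho>) + c' (\<sigma> \<otimes> \<tau>, \<rho>) + (c (\<sigma>, \<tau>) + c' (\<sigma>, \<tau>))] (mod N)" by (simp add: algebra_simps)
qed (auto intro: loc_const_map2[where h = "(+)"])

lemma cocycle_scale:
  assumes "cocycle c"
  shows "cocycle (\<lambda>p. k * c p)"
  unfolding cocycle_def
proof (intro conjI ballI)
  show "loc_const (prod_topology T T) (\<lambda>p. k * c p)"
    using assms by (auto simp: cocycle_def intro: loc_const_map[where h = "\<lambda>a. k * a"])
  fix \<sigma> \<tau> \<rho> assume "\<sigma> \<in> carrier G" "\<tau> \<in> carrier G" "\<rho> \<in> carrier G"
  from cong_scalar_left[OF cocycleD[OF assms this], of k]
  show "[k * c (\<tau>, \<rho>) + k * c (\<sigma>, \<tau> \<otimes> \<rho>) = k * c (\<sigma> \<otimes> \<tau>, \<rho>) + k * c (\<sigma>, \<tau>)] (mod N)"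
    by (simp add: algebra_simps)
qed

lemma cocycle_uminus: "cocycle c \<Longrightarrow> cocycle (\<lambda>p. - c p)"
  using cocycle_scale[of c "- 1"] by simp

lemma cocycle_diff: "cocycle c \<Longrightarrow> cocycle c' \<Longrightarrow> cocycle (\<lambda>p. c p - c' p)"
  using cocycle_add[OF _ cocycle_uminus, of c c'] by simp

lemma cocycle_zero: "cocycle (\<lambda>_. 0)"
  by (simp add: cocycle_def loc_const_const)

lemma cocycle_sum: "(\<And>i. i \<in> J \<Longrightarrow> cocycle (c i)) \<Longrightarrow> cocycle (\<lambda>p. \<Sum>i\<in>J. c i p)"
  by (induction J rule: infinite_finite_induct) (auto simp: cocycle_zero cocycle_add)

lemma Z2_simps:
  "carrier (Z2 G T \<Lambda>) = red ` {c. cocycle c}"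
  "red c \<otimes>\<^bsub>Z2 G T \<Lambda>\<^esub> red c' = red (\<lambda>p. c p + c' p)"
  "\<one>\<^bsub>Z2 G T \<Lambda>\<^esub> = red (\<lambda>_. 0)"
proof -
  show "carrier (Z2 G T \<Lambda>) = red ` {c. cocycle c}"
    using red_cocycle cocycles2_cocycle by (fastforce simp: Z2_def image_iff)
  show "red c \<otimes>\<^bsub>Z2 G T \<Lambda>\<^esub> red c' = red (\<lambda>p. c p + c' p)"
    by (auto simp: Z2_def red_def fun_eq_iff restrict_def mod_add_eq)
  show "\<one>\<^bsub>Z2 G T \<Lambda>\<^esub> = red (\<lambda>_. 0)"
    by (auto simp: Z2_def red_def fun_eq_iff restrict_def)
qed

lemma comm_group_Z2: "comm_group (Z2 G T \<Lambda>)"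
proof (rule comm_groupI)
  fix x assume "x \<in> carrier (Z2 G T \<Lambda>)"
  then obtain c where c: "cocycle c" "x = red c" by (auto simp: Z2_simps)
  then have "red (\<lambda>p. - c p) \<otimes>\<^bsub>Z2 G T \<Lambda>\<^esub> x = \<one>\<^bsub>Z2 G T \<Lambda>\<^esub>" by (simp add: Z2_simps)
  then show "\<exists>y\<in>carrier (Z2 G T \<Lambda>). y \<otimes>\<^bsub>Z2 G T \<Lambda>\<^esub> x = \<one>\<^bsub>Z2 G T \<Lambda>\<^esub>"
    using cocycle_uminus[OF c(1)] by (auto simp: Z2_simps)
qed (auto simp: Z2_simps cocycle_zero add_ac intro!: imageI cocycle_add)

text \<open>Coboundary values occur with inner reductions in several shapes, depending on which
  cochain values are already reduced; all collapse to a single outer reduction.\<close>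

lemma mod_sum3:
  fixes u v w M :: int
  shows "(u + (- w) mod M + v) mod M = (u - w + v) mod M"
    "(u mod M - w + v) mod M = (u - w + v) mod M"
    "(u mod M + (- w) mod M + v) mod M = (u - w + v) mod M"
    "(u mod M - w mod M + v) mod M = (u - w + v) mod M"
    "(u - w mod M + v) mod M = (u - w + v) mod M"
proof -
  have "[u + (- w) mod M + v = u + (- w) + v] (mod M)"
    "[u mod M + (- w) + v = u + (- w) + v] (mod M)"
    "[u mod M + (- w) mod M + v = u + (- w) + v] (mod M)"
    "[u mod M - w mod M + v = u - w + v] (mod M)"
    "[u - w mod M + v = u - w + v] (mod M)" by (intro cong_add cong_diff cong_refl; simp)+
  then show "(u + (- w) mod M + v) mod M = (u - w + v) mod M"
    "(u mod M - w + v) mod M = (u - w + v) mod M"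
    "(u mod M + (- w) mod M + v) mod M = (u - w + v) mod M"
    "(u mod M - w mod M + v) mod M = (u - w + v) mod M"
    "(u - w mod M + v) mod M = (u - w + v) mod M" by (simp_all add: cong_def)
qed

lemma coboundaries2_eq: "coboundaries2 G T \<Lambda> = (\<lambda>\<phi>. red (cobound \<phi>)) ` {\<phi>. loc_const T \<phi>}"
proof (intro subset_antisym subsetI)
  fix x assume "x \<in> coboundaries2 G T \<Lambda>"
  then obtain \<phi> where phi: "\<phi> \<in> carrier G \<rightarrow>\<^sub>E carrier \<Lambda>" "continuous_map T (discrete_topology (carrier \<Lambda>)) \<phi>"
    "x = coboundary G \<Lambda> \<phi>"
    by (auto simp: coboundaries2_def cochain1_def)
  have "loc_const T \<phi>" using phi topspace by (subst (asm) loc_const_iff) (auto simp: PiE_def)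
  moreover have "x = red (cobound \<phi>)" unfolding phi(3) coboundary_def red_def cobound_def
    using PiE_mem[OF phi(1)] by (auto simp: fun_eq_iff restrict_def mod_simps mod_sum3)
  ultimately show "x \<in> (\<lambda>\<phi>. red (cobound \<phi>)) ` {\<phi>. loc_const T \<phi>}" by blast
next
  fix x assume "x \<in> (\<lambda>\<phi>. red (cobound \<phi>)) ` {\<phi>. loc_const T \<phi>}"
  then obtain \<phi> where phi: "loc_const T \<phi>" "x = red (cobound \<phi>)" by blast
  let ?p = "\<lambda>x\<in>carrier G. \<phi> x mod N"
  have "loc_const T ?p"
    using loc_const_map[OF phi(1), of "\<lambda>a. a mod N"]
    by (subst loc_const_cong[of _ _ "\<lambda>x. \<phi> x mod N"]) (auto simp: topspace)
  then have "continuous_map T (discrete_topology (carrier \<Lambda>)) ?p"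
    by (subst loc_const_iff) (auto simp: topspace)
  then have "?p \<in> cochain1 G T \<Lambda>" by (auto simp: cochain1_def)
  moreover have "x = coboundary G \<Lambda> ?p" unfolding phi(2) coboundary_def red_def cobound_def
    by (auto simp: fun_eq_iff restrict_def mod_simps mod_sum3)
  ultimately show "x \<in> coboundaries2 G T \<Lambda>" unfolding coboundaries2_def by blast
qed

lemma inv_Z2: "cocycle c \<Longrightarrow> inv\<^bsub>Z2 G T \<Lambda>\<^esub> (red c) = red (\<lambda>p. - c p)"
proof -
  interpret Z: comm_group "Z2 G T \<Lambda>" by (rule comm_group_Z2)
  assume "cocycle c"
  then show ?thesis by (intro Z.inv_equality) (auto simp: Z2_simps cocycle_uminus)
qed

lemma subgroup_coboundaries2: "subgroup (coboundaries2 G T \<Lambda>) (Z2 G T \<Lambda>)"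
proof -
  interpret Z: comm_group "Z2 G T \<Lambda>" by (rule comm_group_Z2)
  show ?thesis
  proof (rule Z.subgroupI)
    show "coboundaries2 G T \<Lambda> \<subseteq> carrier (Z2 G T \<Lambda>)"
      by (auto simp: coboundaries2_eq Z2_simps cocycle_cobound)
    show "coboundaries2 G T \<Lambda> \<noteq> {}" using loc_const_const[of T 0] by (auto simp: coboundaries2_eq)
    show "inv\<^bsub>Z2 G T \<Lambda>\<^esub> a \<in> coboundaries2 G T \<Lambda>" if a: "a \<in> coboundaries2 G T \<Lambda>" for a
    proof -
      obtain \<phi> where phi: "loc_const T \<phi>" "a = red (cobound \<phi>)" using a by (auto simp: coboundaries2_eq)
      then have "inv\<^bsub>Z2 G T \<Lambda>\<^esub> a = red (cobound (\<lambda>x. - \<phi> x))"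
        unfolding phi(2) inv_Z2[OF cocycle_cobound[OF phi(1)]] by (auto simp: red_eq_iff cobound_def)
      moreover have "loc_const T (\<lambda>x. - \<phi> x)" using phi(1) by (rule loc_const_map)
      ultimately show ?thesis by (auto simp: coboundaries2_eq)
    qed
    show "a \<otimes>\<^bsub>Z2 G T \<Lambda>\<^esub> b \<in> coboundaries2 G T \<Lambda>"
      if ab: "a \<in> coboundaries2 G T \<Lambda>" "b \<in> coboundaries2 G T \<Lambda>" for a b
    proof -
      obtain \<phi> where phi: "loc_const T \<phi>" "a = red (cobound \<phi>)" using ab by (auto simp: coboundaries2_eq)
      obtain \<psi> where psi: "loc_const T \<psi>" "b = red (cobound \<psi>)" using ab by (auto simp: coboundaries2_eq)
      have "a \<otimes>\<^bsub>Z2 G T \<Lambda>\<^esub> b = red (cobound (\<lambda>x. \<phi> x + \<psi> x))"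
        by (auto simp: phi psi Z2_simps red_eq_iff cobound_def algebra_simps)
      moreover have "loc_const T (\<lambda>x. \<phi> x + \<psi> x)" using phi(1) psi(1) by (rule loc_const_map2)
      ultimately show ?thesis by (auto simp: coboundaries2_eq)
    qed
  qed
qed

lemma normal_coboundaries2: "coboundaries2 G T \<Lambda> \<lhd> Z2 G T \<Lambda>"
  using comm_group.subgroup_imp_normal[OF comm_group_Z2 subgroup_coboundaries2] .

lemma comm_group_H2: "comm_group (H2 G T \<Lambda>)"
  unfolding H2_def using comm_group.abelian_FactGroup[OF comm_group_Z2 subgroup_coboundaries2] .

lemma carrier_H2: "carrier (H2 G T \<Lambda>) = cls ` {c. cocycle c}"
  unfolding H2_def carrier_FactGroup cls_def H2_class_def by (simp add: Z2_simps image_image)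

lemma cls_in_H2: "cocycle c \<Longrightarrow> cls c \<in> carrier (H2 G T \<Lambda>)"
  by (auto simp: carrier_H2)

lemma H2_cases:
  assumes "X \<in> carrier (H2 G T \<Lambda>)"
  obtains c where "cocycle c" "X = cls c"
  using assms by (auto simp: carrier_H2)

lemma cls_add:
  assumes "cocycle c" "cocycle c'"
  shows "cls c \<otimes>\<^bsub>H2 G T \<Lambda>\<^esub> cls c' = cls (\<lambda>p. c p + c' p)"
  using assms normal.rcos_sum[OF normal_coboundaries2, of "red c" "red c'"]
  unfolding H2_def mult_FactGroup cls_def H2_class_def by (simp add: Z2_simps)

lemma one_H2: "\<one>\<^bsub>H2 G T \<Lambda>\<^esub> = cls (\<lambda>_. 0)"
proof -
  interpret Z: comm_group "Z2 G T \<Lambda>" by (rule comm_group_Z2)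
  interpret B: normal "coboundaries2 G T \<Lambda>" "Z2 G T \<Lambda>" by (rule normal_coboundaries2)
  show ?thesis
    using Z.coset_mult_one[OF B.subset] unfolding H2_def one_FactGroup cls_def H2_class_def Z2_simps by simp
qed

lemma cls_inv:
  assumes "cocycle c"
  shows "inv\<^bsub>H2 G T \<Lambda>\<^esub> (cls c) = cls (\<lambda>p. - c p)"
proof -
  interpret H: comm_group "H2 G T \<Lambda>" by (rule comm_group_H2)
  show ?thesis using assms
    by (intro H.inv_equality) (auto simp: cls_add cls_in_H2 cocycle_uminus one_H2)
qed

lemma cls_eq_iff:
  assumes "cocycle c" "cocycle c'"
  shows "cls c = cls c' \<longleftrightarrow> (\<exists>\<phi>. loc_const T \<phi> \<and>
     (\<forall>\<sigma>\<in>carrier G. \<forall>\<tau>\<in>carrier G. [c (\<sigma>, \<tau>) - c' (\<sigma>, \<tau>) = \<phi> \<tau> - \<phi> (\<sigma> \<otimes> \<tau>) + \<phi> \<sigma>] (mod N)))"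
proof -
  interpret Z: comm_group "Z2 G T \<Lambda>" by (rule comm_group_Z2)
  interpret B: normal "coboundaries2 G T \<Lambda>" "Z2 G T \<Lambda>" by (rule normal_coboundaries2)
  have cc: "red c \<in> carrier (Z2 G T \<Lambda>)" "red c' \<in> carrier (Z2 G T \<Lambda>)" using assms by (auto simp: Z2_simps)
  have "cls c = cls c' \<longleftrightarrow> red c \<in> coboundaries2 G T \<Lambda> #>\<^bsub>Z2 G T \<Lambda>\<^esub> red c'"
    unfolding cls_def H2_class_def
    using Z.repr_independence[OF _ cc(2) B.subgroup_axioms, of "red c"]
      Z.repr_independenceD[OF B.subgroup_axioms cc(1), of "red c'"] by metis
  also have "\<dots> \<longleftrightarrow> red c \<otimes>\<^bsub>Z2 G T \<Lambda>\<^esub> inv\<^bsub>Z2 G T \<Lambda>\<^esub> (red c') \<in> coboundaries2 G T \<Lambda>"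
    using B.rcos_module[OF Z.group_axioms cc(2,1)] .
  also have "\<dots> \<longleftrightarrow> (\<exists>\<phi>. loc_const T \<phi> \<and> red (\<lambda>p. c p - c' p) = red (cobound \<phi>))"
    using assms by (auto simp: inv_Z2 Z2_simps coboundaries2_eq)
  finally show ?thesis by (simp add: red_eq_iff cobound_def)
qed

lemma cls_cong:
  assumes "cocycle c" "cocycle c'"
    and "\<And>\<sigma> \<tau>. \<sigma> \<in> carrier G \<Longrightarrow> \<tau> \<in> carrier G \<Longrightarrow> [c (\<sigma>, \<tau>) = c' (\<sigma>, \<tau>)] (mod N)"
  shows "cls c = cls c'"
proof -
  have "red c = red c'" using assms by (simp add: red_eq_iff)
  then show ?thesis by (simp add: cls_def)
qed

lemma hom_cls:
  assumes "h \<in> hom (H2 G T \<Lambda>) \<Lambda>"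
  shows hom_cls_add: "cocycle c \<Longrightarrow> cocycle c' \<Longrightarrow> [h (cls (\<lambda>p. c p + c' p)) = h (cls c) + h (cls c')] (mod N)"
    and hom_cls_scale: "cocycle c \<Longrightarrow> [h (cls (\<lambda>p. k * c p)) = k * h (cls c)] (mod N)"
    and hom_cls_sum: "(\<And>i. i \<in> J \<Longrightarrow> cocycle (cs i)) \<Longrightarrow>
      [h (cls (\<lambda>p. \<Sum>i\<in>J. m i * cs i p)) = (\<Sum>i\<in>J. m i * h (cls (cs i)))] (mod N)"
proof -
  have add: "[h (cls (\<lambda>p. c p + c' p)) = h (cls c) + h (cls c')] (mod N)"
    if "cocycle c" "cocycle c'" for c c'
    using hom_mult[OF assms cls_in_H2[OF that(1)] cls_in_H2[OF that(2)]] that by (simp add: cls_add cong_def)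
  note lin = mod_additive_linear[where V = cocycle and h = "\<lambda>c. h (cls c)", OF cocycle_zero cocycle_add cocycle_scale add]
  show "cocycle c \<Longrightarrow> cocycle c' \<Longrightarrow> [h (cls (\<lambda>p. c p + c' p)) = h (cls c) + h (cls c')] (mod N)"
    by (rule add)
  show "cocycle c \<Longrightarrow> [h (cls (\<lambda>p. k * c p)) = k * h (cls c)] (mod N)" by (rule lin)
  show "(\<And>i. i \<in> J \<Longrightarrow> cocycle (cs i)) \<Longrightarrow>
      [h (cls (\<lambda>p. \<Sum>i\<in>J. m i * cs i p)) = (\<Sum>i\<in>J. m i * h (cls (cs i)))] (mod N)" by (rule lin)
qed

lemma H1_iff:
  "z \<in> carrier (H1 G T \<Lambda>) \<longleftrightarrow> z \<in> carrier G \<rightarrow>\<^sub>E carrier \<Lambda> \<and> loc_const T z \<and>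
     (\<forall>\<sigma>\<in>carrier G. \<forall>\<tau>\<in>carrier G. z (\<sigma> \<otimes> \<tau>) = (z \<sigma> + z \<tau>) mod N)"
proof (cases "z \<in> carrier G \<rightarrow>\<^sub>E carrier \<Lambda>")
  case True
  then show ?thesis
    using loc_const_iff[of z T "carrier \<Lambda>"] by (auto simp: cont_Hom_def cochain1_def hom_def topspace)
next
  case False
  then show ?thesis by (auto simp: cont_Hom_def cochain1_def)
qed

lemma H1D:
  assumes "z \<in> carrier (H1 G T \<Lambda>)"
  shows H1_in: "\<sigma> \<in> carrier G \<Longrightarrow> z \<sigma> \<in> carrier \<Lambda>"
    and H1_ext: "z \<in> extensional (carrier G)"
    and H1_lc: "loc_const T z"
    and H1_mult: "\<sigma> \<in> carrier G \<Longrightarrow> \<tau> \<in> carrier G \<Longrightarrow> z (\<sigma> \<otimes> \<tau>) = (z \<sigma> + z \<tau>) mod N"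
    and H1_cong: "\<sigma> \<in> carrier G \<Longrightarrow> \<tau> \<in> carrier G \<Longrightarrow> [z (\<sigma> \<otimes> \<tau>) = z \<sigma> + z \<tau>] (mod N)"
    and H1_one: "z \<one> = 0"
proof -
  show "z \<sigma> \<in> carrier \<Lambda>" if "\<sigma> \<in> carrier G" for \<sigma>
    using assms that by (auto simp: H1_iff)
  note in_L = this
  show "z \<in> extensional (carrier G)" "loc_const T z" using assms by (auto simp: H1_iff PiE_def)
  show m: "z (\<sigma> \<otimes> \<tau>) = (z \<sigma> + z \<tau>) mod N" if "\<sigma> \<in> carrier G" "\<tau> \<in> carrier G" for \<sigma> \<tau>
    using assms that by (auto simp: H1_iff)
  then show "[z (\<sigma> \<otimes> \<tau>) = z \<sigma> + z \<tau>] (mod N)" if "\<sigma> \<in> carrier G" "\<tau> \<in> carrier G" for \<sigma> \<tau>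
    using that by (simp add: cong_def)
  have "[z \<one> + 0 = z \<one> + z \<one>] (mod N)" using m[of \<one> \<one>] in_L[of \<one>] by (simp add: cong_def)
  then have "[0 = z \<one>] (mod N)" by (simp only: cong_add_lcancel)
  moreover have "0 \<in> carrier \<Lambda>" "z \<one> \<in> carrier \<Lambda>" using in_L by auto
  ultimately show "z \<one> = 0" using L_cong_eq by metis
qed

lemma H1_pow:
  assumes "z \<in> carrier (H1 G T \<Lambda>)" "\<sigma> \<in> carrier G"
  shows "[z (\<sigma> [^] (k::nat)) = int k * z \<sigma>] (mod N)"
proof (induction k)
  case (Suc k)
  have "[z (\<sigma> [^] k \<otimes> \<sigma>) = z (\<sigma> [^] k) + z \<sigma>] (mod N)" using assms by (intro H1_cong) auto
  also have "[z (\<sigma> [^] k) + z \<sigma> = int k * z \<sigma> + z \<sigma>] (mod N)" using Suc by (intro cong_add) auto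
  finally show ?case by (simp add: algebra_simps)
qed (use assms in \<open>simp add: H1_one\<close>)

lemma H1_inv:
  assumes "z \<in> carrier (H1 G T \<Lambda>)" "\<sigma> \<in> carrier G"
  shows "[z (inv \<sigma>) = - z \<sigma>] (mod N)"
proof -
  have "[0 = z (inv \<sigma>) + z \<sigma>] (mod N)"
    using H1_cong[OF assms(1), of "inv \<sigma>" \<sigma>] assms by (simp add: H1_one)
  then have "[0 - z \<sigma> = z (inv \<sigma>) + z \<sigma> - z \<sigma>] (mod N)" by (rule cong_diff) simp
  then show ?thesis by (simp add: cong_sym)
qed

subsection \<open>Cup products and the Bockstein map\<close>

definition cup_cocycle :: "('a \<Rightarrow> int) \<Rightarrow> ('a \<Rightarrow> int) \<Rightarrow> 'a \<times> 'a \<Rightarrow> int" where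
  "cup_cocycle x y = (\<lambda>(\<sigma>, \<tau>). x \<sigma> * y \<tau>)"

lemma cup_eq: "cup n G T x y = cls (cup_cocycle x y)"
proof -
  have "(\<lambda>(\<sigma>, \<tau>)\<in>carrier G \<times> carrier G. (x \<sigma> * y \<tau>) mod N) = red (cup_cocycle x y)"
    by (auto simp: red_def cup_cocycle_def fun_eq_iff restrict_def)
  then show ?thesis by (simp add: cup_def cls_def)
qed

lemma cocycle_cup:
  assumes x: "x \<in> carrier (H1 G T \<Lambda>)" and y: "y \<in> carrier (H1 G T \<Lambda>)"
  shows "cocycle (cup_cocycle x y)"
  unfolding cocycle_def
proof (intro conjI ballI)
  have "loc_const (prod_topology T T) (\<lambda>p. x (fst p))" "loc_const (prod_topology T T) (\<lambda>p. y (snd p))"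
    by (intro loc_const_compose[OF _ H1_lc[OF x]] loc_const_compose[OF _ H1_lc[OF y]] continuous_map_fst continuous_map_snd)+
  then show "loc_const (prod_topology T T) (cup_cocycle x y)"
    unfolding cup_cocycle_def case_prod_unfold by (rule loc_const_map2)
  fix \<sigma> \<tau> \<rho> assume g: "\<sigma> \<in> carrier G" "\<tau> \<in> carrier G" "\<rho> \<in> carrier G"
  have "[x \<tau> * y \<rho> + x \<sigma> * y (\<tau> \<otimes> \<rho>) = x \<tau> * y \<rho> + x \<sigma> * (y \<tau> + y \<rho>)] (mod N)"
    using g by (intro cong_add cong_mult cong_refl H1_cong[OF y])
  also have "x \<tau> * y \<rho> + x \<sigma> * (y \<tau> + y \<rho>) = (x \<sigma> + x \<tau>) * y \<rho> + x \<sigma> * y \<tau>" by (simp add: algebra_simps)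
  also have "[\<dots> = x (\<sigma> \<otimes> \<tau>) * y \<rho> + x \<sigma> * y \<tau>] (mod N)"
    using g by (intro cong_add cong_mult cong_refl cong_sym[OF H1_cong[OF x]])
  finally show "[cup_cocycle x y (\<tau>, \<rho>) + cup_cocycle x y (\<sigma>, \<tau> \<otimes> \<rho>) = cup_cocycle x y (\<sigma> \<otimes> \<tau>, \<rho>) + cup_cocycle x y (\<sigma>, \<tau>)] (mod N)"
    by (simp add: cup_cocycle_def)
qed

text \<open>\<open>c\<close> represents the Bockstein of \<open>z\<close>, computed from the lift \<open>w\<close> of \<open>z\<close>.\<close>

definition bock :: "('a \<Rightarrow> int) \<Rightarrow> ('a \<Rightarrow> int) \<Rightarrow> ('a \<times> 'a \<Rightarrow> int) \<Rightarrow> bool" where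
  "bock z w c \<longleftrightarrow> loc_const T w \<and> cocycle c \<and> (\<forall>\<sigma>\<in>carrier G. [w \<sigma> = z \<sigma>] (mod N)) \<and>
     (\<forall>\<sigma>\<in>carrier G. \<forall>\<tau>\<in>carrier G. [N * c (\<sigma>, \<tau>) = w \<tau> - w (\<sigma> \<otimes> \<tau>) + w \<sigma>] (mod N^2))"

lemma cong_cancel_N: "[N * a = N * b] (mod N^2) \<longleftrightarrow> [a = b] (mod N)"
proof -
  have "[N * a = N * b] (mod N^2) \<longleftrightarrow> N * N dvd N * (a - b)"
    by (simp add: cong_iff_dvd_diff power2_eq_square right_diff_distrib)
  also have "\<dots> \<longleftrightarrow> [a = b] (mod N)" using N_pos by (simp add: cong_iff_dvd_diff)
  finally show ?thesis .
qed

text \<open>Lifting a character z by its own residues 0, ..., n - 1 makes the Bockstein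
  representative the carry cocycle of addition modulo n, pulled back along z. The division by n is
  exact.\<close>

definition bock_cocycle :: "('a \<Rightarrow> int) \<Rightarrow> 'a \<times> 'a \<Rightarrow> int" where
  "bock_cocycle z = (\<lambda>(\<sigma>, \<tau>). (z \<tau> - z (\<sigma> \<otimes> \<tau>) + z \<sigma>) div N)"

lemma bock_exists:
  assumes z: "z \<in> carrier (H1 G T \<Lambda>)"
  shows "bock z z (bock_cocycle z)"
proof -
  let ?c = "bock_cocycle z"
  have eq: "N * ?c (\<sigma>, \<tau>) = z \<tau> - z (\<sigma> \<otimes> \<tau>) + z \<sigma>" if "\<sigma> \<in> carrier G" "\<tau> \<in> carrier G" for \<sigma> \<tau>
  proof -
    have "N dvd z \<tau> - z (\<sigma> \<otimes> \<tau>) + z \<sigma>"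
      using H1_cong[OF z that] by (simp add: cong_iff_dvd_diff dvd_diff_commute algebra_simps)
    then show ?thesis by (simp add: bock_cocycle_def)
  qed
  have "cocycle ?c" unfolding cocycle_def
  proof (intro conjI ballI)
    show "loc_const (prod_topology T T) ?c"
      using loc_const_map[OF loc_const_cobound[OF H1_lc[OF z]], of "\<lambda>a. a div N"]
      by (simp add: bock_cocycle_def cobound_def case_prod_unfold)
    fix \<sigma> \<tau> \<rho> assume g: "\<sigma> \<in> carrier G" "\<tau> \<in> carrier G" "\<rho> \<in> carrier G"
    have "N * (?c (\<tau>, \<rho>) + ?c (\<sigma>, \<tau> \<otimes> \<rho>)) = N * (?c (\<sigma> \<otimes> \<tau>, \<rho>) + ?c (\<sigma>, \<tau>))"
      using g by (simp add: distrib_left eq m_assoc)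
    then show "[?c (\<tau>, \<rho>) + ?c (\<sigma>, \<tau> \<otimes> \<rho>) = ?c (\<sigma> \<otimes> \<tau>, \<rho>) + ?c (\<sigma>, \<tau>)] (mod N)"
      using N_pos by simp
  qed
  then show ?thesis using H1_lc[OF z] by (simp add: bock_def eq)
qed

text \<open>Two lifts of z differ by a multiple of n, and the quotient by n is a cochain whose
  coboundary is the difference of the cocycles. This is why the description in
  \<open>bockstein\<close> denotes a single class.\<close>

lemma bock_unique:
  assumes "bock z w c" "bock z w' c'"
  shows "cls c = cls c'"
proof -
  have c: "cocycle c" "cocycle c'" and lc: "loc_const T w" "loc_const T w'" using assms by (auto simp: bock_def)
  have eq: "N * ((w \<sigma> - w' \<sigma>) div N) = w \<sigma> - w' \<sigma>" if "\<sigma> \<in> carrier G" for \<sigma>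
  proof -
    have "[w \<sigma> = w' \<sigma>] (mod N)" using assms that unfolding bock_def by (meson cong_sym cong_trans)
    then show ?thesis by (simp add: cong_iff_dvd_diff)
  qed
  have "loc_const T (\<lambda>\<sigma>. (w \<sigma> - w' \<sigma>) div N)" using lc by (rule loc_const_map2)
  moreover have "[c (\<sigma>, \<tau>) - c' (\<sigma>, \<tau>) =
     (w \<tau> - w' \<tau>) div N - (w (\<sigma> \<otimes> \<tau>) - w' (\<sigma> \<otimes> \<tau>)) div N + (w \<sigma> - w' \<sigma>) div N] (mod N)"
    if g: "\<sigma> \<in> carrier G" "\<tau> \<in> carrier G" for \<sigma> \<tau>
  proof -
    have "[N * c (\<sigma>, \<tau>) - N * c' (\<sigma>, \<tau>) = (w \<tau> - w (\<sigma> \<otimes> \<tau>) + w \<sigma>) - (w' \<tau> - w' (\<sigma> \<otimes> \<tau>) + w' \<sigma>)] (mod N^2)"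
      using assms g unfolding bock_def by (intro cong_diff) auto
    also have "(w \<tau> - w (\<sigma> \<otimes> \<tau>) + w \<sigma>) - (w' \<tau> - w' (\<sigma> \<otimes> \<tau>) + w' \<sigma>) =
      N * ((w \<tau> - w' \<tau>) div N - (w (\<sigma> \<otimes> \<tau>) - w' (\<sigma> \<otimes> \<tau>)) div N + (w \<sigma> - w' \<sigma>) div N)"
      using g by (simp add: distrib_left right_diff_distrib eq)
    finally show ?thesis by (simp only: right_diff_distrib[symmetric] cong_cancel_N)
  qed
  ultimately show ?thesis using c by (subst cls_eq_iff) auto
qed

lemma bockstein_eq:
  assumes z: "z \<in> carrier (H1 G T \<Lambda>)" and b: "bock z w c"
  shows "bockstein n G T z = cls c"
  unfolding bockstein_def
proof (rule the_equality)
  have nn: "int (n^2) = N^2" by simp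
  have car: "carrier (integer_mod_group (n^2)) = {0..<N^2}"
    using n_pos by (simp add: carrier_integer_mod_group)
  let ?w = "\<lambda>\<sigma>\<in>carrier G. w \<sigma> mod N^2"
  have c: "cocycle c" and lc: "loc_const T w" using b by (auto simp: bock_def)
  have w1: "?w \<in> cochain1 G T (integer_mod_group (n^2))"
  proof -
    have "?w \<in> carrier G \<rightarrow>\<^sub>E carrier (integer_mod_group (n^2))" using n_pos by (auto simp: car)
    moreover have "loc_const T ?w"
      using loc_const_map[OF lc, of "\<lambda>a. a mod N^2"]
      by (subst loc_const_cong[of _ _ "\<lambda>x. w x mod N^2"]) (auto simp: topspace)
    ultimately show ?thesis
      using loc_const_iff[of ?w T "carrier (integer_mod_group (n^2))"] by (auto simp: cochain1_def topspace PiE_def)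
  qed
  have w2: "\<forall>\<sigma>\<in>carrier G. ?w \<sigma> mod N = z \<sigma>"
  proof
    fix \<sigma> assume s: "\<sigma> \<in> carrier G"
    have "w \<sigma> mod N^2 mod N = w \<sigma> mod N" by (simp add: power2_eq_square mod_mod_cancel)
    also have "\<dots> = z \<sigma> mod N" using b s by (simp add: bock_def cong_def)
    finally show "?w \<sigma> mod N = z \<sigma>" using s H1_in[OF z s] by simp
  qed
  have cob: "coboundary G (integer_mod_group (n^2)) v (\<sigma>, \<tau>) = (v \<tau> - v (\<sigma> \<otimes> \<tau>) + v \<sigma>) mod N^2"
    if "v \<in> carrier G \<rightarrow>\<^sub>E {0..<N^2}" "\<sigma> \<in> carrier G" "\<tau> \<in> carrier G" for v \<sigma> \<tau>
  proof -
    have "v (\<sigma> \<otimes> \<tau>) \<in> carrier (integer_mod_group (n^2))" using that car PiE_mem[OF that(1)] by simp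
    then show ?thesis using that by (simp add: coboundary_def mod_simps mod_sum3)
  qed
  have w3: "(N * red c (\<sigma>, \<tau>)) mod int (n^2) = coboundary G (integer_mod_group (n^2)) ?w (\<sigma>, \<tau>)"
    if g: "\<sigma> \<in> carrier G" "\<tau> \<in> carrier G" for \<sigma> \<tau>
  proof -
    have "?w \<in> carrier G \<rightarrow>\<^sub>E {0..<N^2}" using n_pos by auto
    then have "coboundary G (integer_mod_group (n^2)) ?w (\<sigma>, \<tau>) = (?w \<tau> - ?w (\<sigma> \<otimes> \<tau>) + ?w \<sigma>) mod N^2"
      by (rule cob[OF _ g])
    also have "\<dots> = (w \<tau> - w (\<sigma> \<otimes> \<tau>) + w \<sigma>) mod N^2" using g by (simp add: mod_simps mod_sum3)
    also have "\<dots> = (N * c (\<sigma>, \<tau>)) mod N^2" using b g by (simp add: bock_def cong_def)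
    also have "\<dots> = (N * red c (\<sigma>, \<tau>)) mod N^2"
    proof -
      have "[N * c (\<sigma>, \<tau>) = N * red c (\<sigma>, \<tau>)] (mod N^2)"
        unfolding cong_cancel_N using g by (simp add: red_def cong_def)
      then show ?thesis by (simp add: cong_def)
    qed
    finally show ?thesis by simp
  qed
  show "\<exists>w\<in>cochain1 G T (integer_mod_group (n\<^sup>2)). \<exists>c'\<in>cocycles2 G T \<Lambda>.
        (\<forall>\<sigma>\<in>carrier G. w \<sigma> mod N = z \<sigma>) \<and>
        (\<forall>\<sigma>\<in>carrier G. \<forall>\<tau>\<in>carrier G. N * c' (\<sigma>, \<tau>) mod int (n\<^sup>2) = coboundary G (integer_mod_group (n\<^sup>2)) w (\<sigma>, \<tau>)) \<and>
        cls c = H2_class G T \<Lambda> c'"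
    using w1 red_cocycle[OF c] w2 w3 cls_def by blast
  fix X assume "\<exists>w\<in>cochain1 G T (integer_mod_group (n\<^sup>2)). \<exists>c'\<in>cocycles2 G T \<Lambda>.
        (\<forall>\<sigma>\<in>carrier G. w \<sigma> mod N = z \<sigma>) \<and>
        (\<forall>\<sigma>\<in>carrier G. \<forall>\<tau>\<in>carrier G. N * c' (\<sigma>, \<tau>) mod int (n\<^sup>2) = coboundary G (integer_mod_group (n\<^sup>2)) w (\<sigma>, \<tau>)) \<and>
        X = H2_class G T \<Lambda> c'"
  then obtain v c' where v: "v \<in> cochain1 G T (integer_mod_group (n\<^sup>2))" and c': "c' \<in> cocycles2 G T \<Lambda>"
    and vz: "\<forall>\<sigma>\<in>carrier G. v \<sigma> mod N = z \<sigma>"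
    and vc: "\<forall>\<sigma>\<in>carrier G. \<forall>\<tau>\<in>carrier G. N * c' (\<sigma>, \<tau>) mod int (n\<^sup>2) = coboundary G (integer_mod_group (n\<^sup>2)) v (\<sigma>, \<tau>)"
    and X: "X = H2_class G T \<Lambda> c'" by blast
  have vP: "v \<in> carrier G \<rightarrow>\<^sub>E {0..<N^2}" using v by (auto simp: cochain1_def car)
  have "loc_const T v"
    using v loc_const_iff[of v T "carrier (integer_mod_group (n^2))"] by (auto simp: cochain1_def topspace PiE_def)
  moreover have "[N * c' (\<sigma>, \<tau>) = v \<tau> - v (\<sigma> \<otimes> \<tau>) + v \<sigma>] (mod N^2)"
    if g: "\<sigma> \<in> carrier G" "\<tau> \<in> carrier G" for \<sigma> \<tau>
    using vc g cob[OF vP g] by (simp add: cong_def)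
  moreover have "[v \<sigma> = z \<sigma>] (mod N)" if "\<sigma> \<in> carrier G" for \<sigma>
    using vz that H1_in[OF z that] by (simp add: cong_def)
  ultimately have "bock z v c'" using cocycles2_cocycle(1)[OF c'] by (simp add: bock_def)
  from bock_unique[OF this b] show "X = cls c"
    unfolding X cls_def cocycles2_cocycle(2)[OF c'] .
qed

lemma bockstein_cls:
  "z \<in> carrier (H1 G T \<Lambda>) \<Longrightarrow> bockstein n G T z = cls (bock_cocycle z)"
  "z \<in> carrier (H1 G T \<Lambda>) \<Longrightarrow> cocycle (bock_cocycle z)"
  using bockstein_eq[OF _ bock_exists] bock_exists unfolding bock_def by blast+

end

section \<open>Second cohomology of \<open>(\<int>/n)\<^sup>I\<close>\<close>

context top_group_mod
begin

text \<open>In the central extension defined by c, this element of \<int>/n is the commutator of any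
  lifts of commuting elements \<sigma> and \<tau>.\<close>

definition com :: "('a \<times> 'a \<Rightarrow> int) \<Rightarrow> 'a \<Rightarrow> 'a \<Rightarrow> int" where
  "com c \<sigma> \<tau> = c (\<sigma>, \<tau>) - c (\<tau>, \<sigma>)"

text \<open>For \<sigma> of order dividing n, this is the n-th power of a lift of \<sigma> to the
  central extension, measured from the identity. The choice of the lift does not matter, as n kills
  \<int>/n.\<close>

definition pw :: "('a \<times> 'a \<Rightarrow> int) \<Rightarrow> 'a \<Rightarrow> int" where
  "pw c \<sigma> = (\<Sum>k<n. c (\<sigma> [^] k, \<sigma>))"

lemma cocycle_one_left:
  assumes "cocycle c" "\<sigma> \<in> carrier G"
  shows "[c (\<one>, \<sigma>) = c (\<one>, \<one>)] (mod N)"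
proof -
  have "[c (\<one>, \<sigma>) + c (\<one>, \<sigma>) = c (\<one>, \<sigma>) + c (\<one>, \<one>)] (mod N)"
    using cocycleD[OF assms(1), of \<one> \<one> \<sigma>] assms(2) by simp
  then show ?thesis by (simp only: cong_add_lcancel)
qed

lemma cocycle_one_right:
  assumes "cocycle c" "\<sigma> \<in> carrier G"
  shows "[c (\<sigma>, \<one>) = c (\<one>, \<one>)] (mod N)"
proof -
  have "[c (\<one>, \<one>) + c (\<sigma>, \<one>) = c (\<sigma>, \<one>) + c (\<sigma>, \<one>)] (mod N)"
    using cocycleD[OF assms(1), of \<sigma> \<one> \<one>] assms(2) by simp
  then show ?thesis by (simp only: cong_add_rcancel cong_sym_eq[of "c (\<sigma>, \<one>)"])
qed

text \<open>Reduces a congruence to an integer identity with explicit coefficients. Where fewer than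
  three congruences enter, the list is padded by a reflexive one with coefficient 0.\<close>

lemma cong_linear_combination:
  fixes a b :: int
  assumes "[a1 = b1] (mod N)" "[a2 = b2] (mod N)" "[a3 = b3] (mod N)"
    and "a - b = k1 * (a1 - b1) + k2 * (a2 - b2) + k3 * (a3 - b3)"
  shows "[a = b] (mod N)"
  using assms by (simp add: cong_iff_dvd_diff)

text \<open>Commutators in a central extension of an abelian group are multiplicative in each
  argument. In terms of c this is the sum of the cocycle identities at (\<sigma>, \<tau>, \<rho>)
  and (\<tau>, \<rho>, \<sigma>) minus the one at (\<tau>, \<sigma>, \<rho>).\<close>

lemma com_mult:
  assumes comm: "comm_group G" and c: "cocycle c"
    and g: "\<sigma> \<in> carrier G" "\<tau> \<in> carrier G" "\<rho> \<in> carrier G"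
  shows "[com c \<sigma> (\<tau> \<otimes> \<rho>) = com c \<sigma> \<tau> + com c \<sigma> \<rho>] (mod N)"
proof -
  interpret comm_group G by fact
  have 1: "\<rho> \<otimes> \<sigma> = \<sigma> \<otimes> \<rho>" "\<tau> \<otimes> \<sigma> = \<sigma> \<otimes> \<tau>" using g by (simp_all add: m_comm)
  show ?thesis
    by (rule cong_linear_combination[OF cocycleD[OF c g] cocycleD[OF c g(2,3,1)] cocycleD[OF c g(2,1,3)],
          of _ _ 1 1 "- 1"]) (simp add: com_def 1)
qed

lemma com_swap: "com c \<tau> \<sigma> = - com c \<sigma> \<tau>"
  by (simp add: com_def)

lemma com_add: "com (\<lambda>p. c p + c' p) \<sigma> \<tau> = com c \<sigma> \<tau> + com c' \<sigma> \<tau>"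
  and pw_add: "pw (\<lambda>p. c p + c' p) \<sigma> = pw c \<sigma> + pw c' \<sigma>"
  and com_diff: "com (\<lambda>p. c p - c' p) \<sigma> \<tau> = com c \<sigma> \<tau> - com c' \<sigma> \<tau>"
  and pw_diff: "pw (\<lambda>p. c p - c' p) \<sigma> = pw c \<sigma> - pw c' \<sigma>"
  and com_sum: "com (\<lambda>p. \<Sum>i\<in>J. m i * cs i p) \<sigma> \<tau> = (\<Sum>i\<in>J. m i * com (cs i) \<sigma> \<tau>)"
  and pw_sum: "pw (\<lambda>p. \<Sum>i\<in>J. m i * cs i p) \<sigma> = (\<Sum>i\<in>J. m i * pw (cs i) \<sigma>)"
proof -
  show "pw (\<lambda>p. \<Sum>i\<in>J. m i * cs i p) \<sigma> = (\<Sum>i\<in>J. m i * pw (cs i) \<sigma>)"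
    unfolding pw_def by (subst sum.swap) (simp add: sum_distrib_left)
qed (simp_all add: com_def pw_def sum.distrib sum_subtractf right_diff_distrib)

text \<open>A coboundary on a commutative group is symmetric, so \<open>com\<close> does not see it.
  In \<open>pw\<close> it telescopes to n \<phi>(\<sigma>) + \<phi>(1) - \<phi>(\<sigma>^n), which
  vanishes modulo n because \<sigma>^n = 1.\<close>

lemma com_pw_class:
  assumes comm: "comm_group G" and exp: "\<And>\<sigma>. \<sigma> \<in> carrier G \<Longrightarrow> \<sigma> [^] n = \<one>"
    and c: "cocycle c" "cocycle c'" "cls c = cls c'"
  shows "\<sigma> \<in> carrier G \<Longrightarrow> \<tau> \<in> carrier G \<Longrightarrow> [com c \<sigma> \<tau> = com c' \<sigma> \<tau>] (mod N)"
    and "\<sigma> \<in> carrier G \<Longrightarrow> [pw c \<sigma> = pw c' \<sigma>] (mod N)"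
proof -
  interpret comm_group G by fact
  obtain \<phi> where phi: "\<And>\<sigma> \<tau>. \<sigma> \<in> carrier G \<Longrightarrow> \<tau> \<in> carrier G \<Longrightarrow>
      [c (\<sigma>, \<tau>) - c' (\<sigma>, \<tau>) = \<phi> \<tau> - \<phi> (\<sigma> \<otimes> \<tau>) + \<phi> \<sigma>] (mod N)"
    using c by (auto simp: cls_eq_iff)
  show "[com c \<sigma> \<tau> = com c' \<sigma> \<tau>] (mod N)" if "\<sigma> \<in> carrier G" "\<tau> \<in> carrier G"
    using cong_linear_combination[OF phi[OF that] phi[OF that(2,1)] cong_refl[of 0], of _ _ 1 "- 1" 0] that
    by (simp add: com_def m_comm)
  assume s: "\<sigma> \<in> carrier G"
  have "[(\<Sum>k<n. c (\<sigma> [^] k, \<sigma>) - c' (\<sigma> [^] k, \<sigma>)) = (\<Sum>k<n. \<phi> \<sigma> + (\<phi> (\<sigma> [^] k) - \<phi> (\<sigma> [^] (Suc k))))] (mod N)"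
  proof (rule cong_sum)
    fix k
    show "[c (\<sigma> [^] k, \<sigma>) - c' (\<sigma> [^] k, \<sigma>) = \<phi> \<sigma> + (\<phi> (\<sigma> [^] k) - \<phi> (\<sigma> [^] (Suc k)))] (mod N)"
      using phi[of "\<sigma> [^] k" \<sigma>] s by (simp add: algebra_simps)
  qed
  also have "(\<Sum>k<n. \<phi> \<sigma> + (\<phi> (\<sigma> [^] k) - \<phi> (\<sigma> [^] (Suc k)))) = N * \<phi> \<sigma> + (\<phi> (\<sigma> [^] (0::nat)) - \<phi> (\<sigma> [^] n))"
    by (subst sum.distrib, subst sum_lessThan_telescope') simp
  also have "\<phi> (\<sigma> [^] (0::nat)) - \<phi> (\<sigma> [^] n) = 0" using exp[OF s] by simp
  finally have "[pw c \<sigma> - pw c' \<sigma> = 0] (mod N)" by (simp add: pw_def sum_subtractf cong_def)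
  then show "[pw c \<sigma> = pw c' \<sigma>] (mod N)" by (simp add: cong_diff_iff_cong_0)
qed

lemma sum_lessThan_choose_two: "(\<Sum>k<m. int k) = int (m choose 2)"
  by (induction m) (simp_all add: numeral_2_eq_2)

lemma com_cup: "com (cup_cocycle x y) \<sigma> \<tau> = x \<sigma> * y \<tau> - x \<tau> * y \<sigma>"
  by (simp add: com_def cup_cocycle_def)

text \<open>As x(\<sigma>^k) = k x(\<sigma>), the sum produces 0 + 1 + ... + (n - 1) = n choose 2.
  This is the origin of the binomial coefficient in \<SS> and in the formula for powers.\<close>

lemma pw_cup:
  assumes "x \<in> carrier (H1 G T \<Lambda>)" "\<sigma> \<in> carrier G"
  shows "[pw (cup_cocycle x y) \<sigma> = int (n choose 2) * (x \<sigma> * y \<sigma>)] (mod N)"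
proof -
  have "[(\<Sum>k<n. x (\<sigma> [^] k) * y \<sigma>) = (\<Sum>k<n. (int k * x \<sigma>) * y \<sigma>)] (mod N)"
    by (intro cong_sum cong_mult cong_refl H1_pow[OF assms])
  also have "(\<Sum>k<n. (int k * x \<sigma>) * y \<sigma>) = (\<Sum>k<n. int k) * (x \<sigma> * y \<sigma>)"
    by (simp add: sum_distrib_right mult.assoc)
  finally show ?thesis by (simp add: pw_def cup_cocycle_def sum_lessThan_choose_two)
qed

text \<open>The coboundary of the lift w is symmetric because the group is commutative; the factor n
  is then cancelled modulo n^2.\<close>

lemma com_bock:
  assumes comm: "comm_group G" and b: "bock z w c" and g: "\<sigma> \<in> carrier G" "\<tau> \<in> carrier G"
  shows "[com c \<sigma> \<tau> = 0] (mod N)"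
proof -
  interpret comm_group G by fact
  have "[N * c (\<sigma>, \<tau>) - N * c (\<tau>, \<sigma>) = (w \<tau> - w (\<sigma> \<otimes> \<tau>) + w \<sigma>) - (w \<sigma> - w (\<tau> \<otimes> \<sigma>) + w \<tau>)] (mod N^2)"
    using b g unfolding bock_def by (intro cong_diff) auto
  also have "(w \<tau> - w (\<sigma> \<otimes> \<tau>) + w \<sigma>) - (w \<sigma> - w (\<tau> \<otimes> \<sigma>) + w \<tau>) = N * 0" using g by (simp add: m_comm)
  finally show ?thesis by (simp only: right_diff_distrib[symmetric] cong_cancel_N com_def)
qed

text \<open>The sum of coboundary values of w along the powers of \<sigma> telescopes to n
  w(\<sigma>) modulo n^2, and division by n leaves w(\<sigma>), which reduces to
  z(\<sigma>).\<close>

lemma pw_bock: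
  assumes exp: "\<And>\<sigma>. \<sigma> \<in> carrier G \<Longrightarrow> \<sigma> [^] n = \<one>"
    and b: "bock z w c" and g: "\<sigma> \<in> carrier G"
  shows "[pw c \<sigma> = z \<sigma>] (mod N)"
proof -
  have "[(\<Sum>k<n. N * c (\<sigma> [^] k, \<sigma>)) = (\<Sum>k<n. w \<sigma> + (w (\<sigma> [^] k) - w (\<sigma> [^] (Suc k))))] (mod N^2)"
  proof (rule cong_sum)
    fix k :: nat
    have "[N * c (\<sigma> [^] k, \<sigma>) = w \<sigma> - w (\<sigma> [^] k \<otimes> \<sigma>) + w (\<sigma> [^] k)] (mod N^2)"
      using b g nat_pow_closed[OF g, of k] unfolding bock_def by blast
    then show "[N * c (\<sigma> [^] k, \<sigma>) = w \<sigma> + (w (\<sigma> [^] k) - w (\<sigma> [^] (Suc k)))] (mod N^2)"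
      by (simp add: algebra_simps)
  qed
  also have "(\<Sum>k<n. w \<sigma> + (w (\<sigma> [^] k) - w (\<sigma> [^] (Suc k)))) = N * w \<sigma> + (w (\<sigma> [^] (0::nat)) - w (\<sigma> [^] n))"
    by (subst sum.distrib, subst sum_lessThan_telescope') simp
  also have "w (\<sigma> [^] (0::nat)) - w (\<sigma> [^] n) = 0" using exp[OF g] by simp
  finally have "[N * pw c \<sigma> = N * w \<sigma>] (mod N^2)" by (simp add: pw_def sum_distrib_left)
  then have "[pw c \<sigma> = w \<sigma>] (mod N)" by (simp add: cong_cancel_N)
  also have "[w \<sigma> = z \<sigma>] (mod N)" using b g by (simp add: bock_def)
  finally show ?thesis .
qed

end

section \<open>Coordinates on a power of \<int>/n\<close>

locale mod_power = top_group_mod G T n for G (structure) and T :: "'a topology" and n +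
  fixes I :: "'i set" and \<theta> :: "'a \<Rightarrow> 'i \<Rightarrow> int"
  assumes theta: "\<theta> \<in> top_iso G T (product_group I (\<lambda>_. integer_mod_group n))
     (product_topology (\<lambda>_. discrete_topology (carrier (integer_mod_group n))) I)"
begin

abbreviation "P \<equiv> product_topology (\<lambda>_. discrete_topology (carrier \<Lambda>)) I"
abbreviation "K \<equiv> carrier (H1 G T \<Lambda>)"

lemma theta_iso:
  "bij_betw \<theta> (carrier G) (I \<rightarrow>\<^sub>E carrier \<Lambda>)"
  "\<sigma> \<in> carrier G \<Longrightarrow> \<tau> \<in> carrier G \<Longrightarrow> \<theta> (\<sigma> \<otimes> \<tau>) = (\<lambda>i\<in>I. (\<theta> \<sigma> i + \<theta> \<tau> i) mod N)"
  "homeomorphic_map T P \<theta>"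
  using theta by (auto simp: top_iso_def iso_def hom_def)

lemma theta_in: "\<sigma> \<in> carrier G \<Longrightarrow> i \<in> I \<Longrightarrow> \<theta> \<sigma> i \<in> carrier \<Lambda>"
  using bij_betwE[OF theta_iso(1)] by auto

definition coord :: "'i \<Rightarrow> 'a \<Rightarrow> int" where
  "coord i = (\<lambda>\<sigma>\<in>carrier G. \<theta> \<sigma> i)"

lemma coord_surj:
  assumes "\<And>i. i \<in> I \<Longrightarrow> v i \<in> carrier \<Lambda>"
  shows "\<exists>\<sigma>\<in>carrier G. \<forall>i\<in>I. coord i \<sigma> = v i"
proof -
  have "restrict v I \<in> \<theta> ` carrier G" using theta_iso(1) assms by (auto simp: bij_betw_def)
  then obtain \<sigma> where s: "\<sigma> \<in> carrier G" "restrict v I = \<theta> \<sigma>" by auto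
  have "coord i \<sigma> = v i" if "i \<in> I" for i using s(1) that fun_cong[OF s(2), of i] by (simp add: coord_def)
  then show ?thesis using s(1) by blast
qed

lemma coord_eqI:
  assumes "\<sigma> \<in> carrier G" "\<tau> \<in> carrier G" "\<And>i. i \<in> I \<Longrightarrow> coord i \<sigma> = coord i \<tau>"
  shows "\<sigma> = \<tau>"
proof -
  have "\<theta> \<sigma> = \<theta> \<tau>"
  proof (rule PiE_ext)
    show "\<theta> \<sigma> \<in> I \<rightarrow>\<^sub>E carrier \<Lambda>" "\<theta> \<tau> \<in> I \<rightarrow>\<^sub>E carrier \<Lambda>" using bij_betwE[OF theta_iso(1)] assms by auto
    show "\<theta> \<sigma> i = \<theta> \<tau> i" if "i \<in> I" for i using assms that by (simp add: coord_def)
  qed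
  then show ?thesis using assms theta_iso(1) by (auto simp: bij_betw_def inj_on_def)
qed

lemma coord_H1:
  assumes "i \<in> I"
  shows "coord i \<in> K"
  unfolding H1_iff
proof (intro conjI ballI)
  show "coord i \<in> carrier G \<rightarrow>\<^sub>E carrier \<Lambda>" using theta_in assms by (auto simp: coord_def)
  have "continuous_map P (discrete_topology (carrier \<Lambda>)) (\<lambda>v. v i)"
    using continuous_map_product_projection[OF assms] by metis
  then have "continuous_map T (discrete_topology (carrier \<Lambda>)) (\<lambda>\<sigma>. \<theta> \<sigma> i)"
    using continuous_map_compose[OF homeomorphic_imp_continuous_map[OF theta_iso(3)]] by (simp add: o_def)
  then have "loc_const T (\<lambda>\<sigma>. \<theta> \<sigma> i)" by (subst (asm) loc_const_iff) (auto simp: topspace theta_in assms)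
  then show "loc_const T (coord i)"
    by (subst loc_const_cong[of _ _ "\<lambda>\<sigma>. \<theta> \<sigma> i"]) (auto simp: topspace coord_def)
  fix \<sigma> \<tau> assume "\<sigma> \<in> carrier G" "\<tau> \<in> carrier G"
  then show "coord i (\<sigma> \<otimes> \<tau>) = (coord i \<sigma> + coord i \<tau>) mod N" using assms by (simp add: coord_def theta_iso)
qed

lemma comm_group_G: "comm_group G"
proof (rule group_comm_groupI)
  fix x y assume "x \<in> carrier G" "y \<in> carrier G"
  then show "x \<otimes> y = y \<otimes> x"
    by (intro coord_eqI) (auto simp: H1_mult[OF coord_H1] add.commute)
qed

sublocale comm_group G by (rule comm_group_G)

lemma exponent: "\<sigma> \<in> carrier G \<Longrightarrow> \<sigma> [^] n = \<one>"
proof (rule coord_eqI)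
  fix i assume s: "\<sigma> \<in> carrier G" "i \<in> I"
  note K = coord_H1[OF s(2)]
  have "[coord i (\<sigma> [^] n) = N * coord i \<sigma>] (mod N)" by (rule H1_pow[OF K s(1)])
  also have "[N * coord i \<sigma> = 0] (mod N)" by (simp add: cong_def)
  finally show "coord i (\<sigma> [^] n) = coord i \<one>"
    using H1_in[OF K] s by (intro L_cong_eq) (auto simp: H1_one[OF K] carrier_L n_pos)
qed auto

lemma compact_space_T: "compact_space T"
proof -
  have "compact_space P" by (simp add: compact_space_product_topology compact_space_discrete_topology carrier_L)
  then show ?thesis using homeomorphic_map_imp_homeomorphic_space[OF theta_iso(3)] homeomorphic_compact_space by blast
qed

lemma open_contains_coord_kernel:
  assumes "openin T U" "\<one> \<in> U"
  shows "\<exists>F. finite F \<and> F \<subseteq> I \<and> {\<sigma> \<in> carrier G. \<forall>i\<in>F. coord i \<sigma> = 0} \<subseteq> U"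
proof -
  have U: "U \<subseteq> carrier G" using openin_subset[OF assms(1)] topspace by simp
  have "openin P (\<theta> ` U)"
    using homeomorphic_imp_open_map[OF theta_iso(3)] assms(1) by (simp add: open_map_def)
  then obtain F where F: "finite F" "F \<subseteq> I"
    and *: "\<forall>a\<in>I \<rightarrow>\<^sub>E carrier \<Lambda>. (\<forall>r\<in>F. a r = \<theta> \<one> r) \<longrightarrow> a \<in> \<theta> ` U"
    using open_nbhd_discrete_product[of "carrier \<Lambda>" I "\<theta> ` U" "\<theta> \<one>"] assms(2) by auto
  have "\<sigma> \<in> U" if s: "\<sigma> \<in> carrier G" "\<forall>i\<in>F. coord i \<sigma> = 0" for \<sigma>
  proof -
    have "\<theta> \<sigma> r = \<theta> \<one> r" if "r \<in> F" for r
      using that F s H1_one[OF coord_H1, of r] by (auto simp: coord_def subset_iff)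
    then have "\<theta> \<sigma> \<in> \<theta> ` U" using * bij_betwE[OF theta_iso(1)] s(1) by blast
    then show "\<sigma> \<in> U" using theta_iso(1) U s(1) by (auto simp: bij_betw_def inj_on_def)
  qed
  then show ?thesis using F by blast
qed

text \<open>A standard generator. The entry is 1 mod n rather than 1, since for n = 1 the only
  residue is 0; for i outside I all coordinates vanish.\<close>

definition unit :: "'i \<Rightarrow> 'a" where
  "unit i = (SOME \<sigma>. \<sigma> \<in> carrier G \<and> (\<forall>j\<in>I. coord j \<sigma> = (if j = i then 1 mod N else 0)))"

lemma unit: "unit i \<in> carrier G" "j \<in> I \<Longrightarrow> coord j (unit i) = (if j = i then 1 mod N else 0)"
proof -
  have "\<exists>\<sigma>\<in>carrier G. \<forall>j\<in>I. coord j \<sigma> = (if j = i then 1 mod N else 0)"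
    by (rule coord_surj) auto
  then have "unit i \<in> carrier G \<and> (\<forall>j\<in>I. coord j (unit i) = (if j = i then 1 mod N else 0))"
    unfolding unit_def Bex_def by (rule someI_ex)
  then show "unit i \<in> carrier G" "j \<in> I \<Longrightarrow> coord j (unit i) = (if j = i then 1 mod N else 0)" by auto
qed

lemma coord_unit: "j \<in> I \<Longrightarrow> [coord j (unit i) = (if j = i then 1 else 0)] (mod N)"
  by (simp add: unit cong_def)

text \<open>Truncation: \<sigma> may have infinitely many nonzero coordinates and is replaced by a
  finite product of generators with the same coordinates in F.\<close>

definition proj :: "'i set \<Rightarrow> 'a \<Rightarrow> 'a" where
  "proj F \<sigma> = finprod G (\<lambda>i. unit i [^] nat (coord i \<sigma>)) F"

lemma proj_closed: "proj F \<sigma> \<in> carrier G"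
  unfolding proj_def using unit(1) by (intro finprod_closed) auto

lemma coord_nonneg: "\<sigma> \<in> carrier G \<Longrightarrow> i \<in> I \<Longrightarrow> coord i \<sigma> \<ge> 0"
  using H1_in[OF coord_H1, of i \<sigma>] by (simp add: carrier_L)

lemma additive_proj:
  assumes f: "\<And>\<sigma> \<tau>. \<sigma> \<in> carrier G \<Longrightarrow> \<tau> \<in> carrier G \<Longrightarrow> [f (\<sigma> \<otimes> \<tau>) = f \<sigma> + (f \<tau> :: int)] (mod N)"
    and s: "\<sigma> \<in> carrier G" and F: "F \<subseteq> I" "finite F"
  shows "[f (proj F \<sigma>) = (\<Sum>i\<in>F. coord i \<sigma> * f (unit i))] (mod N)"
proof -
  have "[f \<one> + f \<one> = f \<one> + 0] (mod N)" using f[of \<one> \<one>] by (simp add: cong_sym)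
  then have one: "[f \<one> = 0] (mod N)" by (simp only: cong_add_lcancel)
  have pow: "[f (a [^] k) = int k * f a] (mod N)" if "a \<in> carrier G" for a and k :: nat
  proof (induction k)
    case (Suc k)
    have "[f (a [^] k \<otimes> a) = f (a [^] k) + f a] (mod N)" using that by (intro f) auto
    also have "[f (a [^] k) + f a = int k * f a + f a] (mod N)" by (intro cong_add Suc cong_refl)
    finally show ?case by (simp add: algebra_simps)
  qed (simp add: one)
  show ?thesis using F(2,1)
  proof (induction F rule: finite_induct)
    case empty
    then show ?case by (simp add: proj_def one)
  next
    case (insert i F)
    have "proj (insert i F) \<sigma> = unit i [^] nat (coord i \<sigma>) \<otimes> proj F \<sigma>"
      unfolding proj_def using insert.hyps unit(1) by (subst finprod_insert) auto
    then have "[f (proj (insert i F) \<sigma>) = f (unit i [^] nat (coord i \<sigma>)) + f (proj F \<sigma>)] (mod N)"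
      using f[of "unit i [^] nat (coord i \<sigma>)" "proj F \<sigma>"] unit(1) proj_closed by simp
    also have "[f (unit i [^] nat (coord i \<sigma>)) + f (proj F \<sigma>) =
        int (nat (coord i \<sigma>)) * f (unit i) + (\<Sum>i\<in>F. coord i \<sigma> * f (unit i))] (mod N)"
      using insert unit(1) by (intro cong_add pow) auto
    finally show ?case using insert s by (simp add: coord_nonneg)
  qed
qed

lemma coord_proj:
  assumes "\<sigma> \<in> carrier G" "F \<subseteq> I" "finite F" "j \<in> F"
  shows "coord j (proj F \<sigma>) = coord j \<sigma>"
proof -
  have j: "j \<in> I" using assms by auto
  have "[coord j (proj F \<sigma>) = (\<Sum>i\<in>F. coord i \<sigma> * coord j (unit i))] (mod N)"
    by (rule additive_proj[OF H1_cong[OF coord_H1[OF j]] assms(1-3)])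
  also have "[(\<Sum>i\<in>F. coord i \<sigma> * coord j (unit i)) = (\<Sum>i\<in>F. coord i \<sigma> * (if j = i then 1 else 0))] (mod N)"
    by (intro cong_sum cong_mult cong_refl coord_unit[OF j])
  also have "(\<Sum>i\<in>F. coord i \<sigma> * (if j = i then 1 else 0)) = coord j \<sigma>" using assms by (simp add: if_distrib[of "\<lambda>x. _ * x"] sum.delta' cong: if_cong)
  finally show ?thesis using assms proj_closed by (intro L_cong_eq H1_in[OF coord_H1[OF j]])
qed

text \<open>Stated for all large finite sets, so that two elements can be expanded over a common one.\<close>

lemma H1_expansion:
  assumes x: "x \<in> K"
  shows "\<exists>F. finite F \<and> F \<subseteq> I \<and> (\<forall>F'. finite F' \<longrightarrow> F \<subseteq> F' \<longrightarrow> F' \<subseteq> I \<longrightarrow>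
     (\<forall>\<sigma>\<in>carrier G. [x \<sigma> = (\<Sum>i\<in>F'. x (unit i) * coord i \<sigma>)] (mod N)))"
proof -
  have "openin T {\<sigma> \<in> carrier G. x \<sigma> = 0}" using H1_lc[OF x] by (simp add: loc_const_def topspace)
  then obtain F where F: "finite F" "F \<subseteq> I" "{\<sigma> \<in> carrier G. \<forall>i\<in>F. coord i \<sigma> = 0} \<subseteq> {\<sigma> \<in> carrier G. x \<sigma> = 0}"
    using open_contains_coord_kernel[of "{\<sigma> \<in> carrier G. x \<sigma> = 0}"] H1_one[OF x] by auto
  have "[x \<sigma> = (\<Sum>i\<in>F'. x (unit i) * coord i \<sigma>)] (mod N)"
    if F': "finite F'" "F \<subseteq> F'" "F' \<subseteq> I" and s: "\<sigma> \<in> carrier G" for F' \<sigma>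
  proof -
    let ?p = "proj F' \<sigma>"
    have p: "?p \<in> carrier G" by (rule proj_closed)
    \<comment> \<open>The quotient of \<sigma> by its truncation lies in the coordinate kernel on
      which x vanishes, so x(\<sigma>) is computed on the truncation by additivity.\<close>
    have "coord i (\<sigma> \<otimes> inv ?p) = 0" if "i \<in> F" for i
    proof -
      have i: "i \<in> I" "i \<in> F'" using that F F' by auto
      note K = coord_H1[OF i(1)]
      have "[coord i (\<sigma> \<otimes> inv ?p) = coord i \<sigma> + coord i (inv ?p)] (mod N)" using s p by (intro H1_cong[OF K]) auto
      also have "[coord i \<sigma> + coord i (inv ?p) = coord i \<sigma> + - coord i ?p] (mod N)"
        using p by (intro cong_add cong_refl H1_inv[OF K])
      also have "coord i \<sigma> + - coord i ?p = 0" using coord_proj[OF s F'(3,1) i(2)] by simp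
      finally show ?thesis using s p H1_in[OF K, of "\<sigma> \<otimes> inv ?p"] by (intro L_cong_eq) (auto simp: carrier_L n_pos)
    qed
    then have "\<sigma> \<otimes> inv ?p \<in> {\<sigma> \<in> carrier G. \<forall>i\<in>F. coord i \<sigma> = 0}" using s p by simp
    then have "x (\<sigma> \<otimes> inv ?p) = 0" using F(3) by blast
    moreover have "\<sigma> = (\<sigma> \<otimes> inv ?p) \<otimes> ?p" using s p by (simp add: m_assoc)
    ultimately have "[x \<sigma> = x ?p] (mod N)" using H1_cong[OF x, of "\<sigma> \<otimes> inv ?p" ?p] s p by simp
    also have "[x ?p = (\<Sum>i\<in>F'. coord i \<sigma> * x (unit i))] (mod N)"
      by (rule additive_proj[OF H1_cong[OF x] s F'(3,1)])
    finally show ?thesis by (simp add: mult.commute)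
  qed
  then show ?thesis using F by blast
qed

text \<open>For a set F of indices: c factors through the quotient (\<int>/n)^F in both
  arguments.\<close>

definition depends :: "'i set \<Rightarrow> ('a \<times> 'a \<Rightarrow> int) \<Rightarrow> bool" where
  "depends F c \<longleftrightarrow> (\<forall>\<sigma>\<in>carrier G. \<forall>\<sigma>'\<in>carrier G. \<forall>\<tau>\<in>carrier G. \<forall>\<tau>'\<in>carrier G.
     (\<forall>i\<in>F. coord i \<sigma> = coord i \<sigma>' \<and> coord i \<tau> = coord i \<tau>') \<longrightarrow> c (\<sigma>, \<tau>) = c (\<sigma>', \<tau>'))"

text \<open>The elements g such that translating either argument by g leaves c unchanged everywhere
  form an open set, by compactness of the square; it contains the kernel of finitely many
  coordinates. Elements with equal coordinates there differ by such a g.\<close>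

lemma cocycle_depends:
  assumes c: "cocycle c"
  shows "\<exists>F. finite F \<and> F \<subseteq> I \<and> depends F c"
proof -
  let ?X = "prod_topology T T"
  define F where "F = (\<lambda>g (x, y). (c (x \<otimes> g, y), c (x, y \<otimes> g)))"
  have lc: "loc_const ?X c" using c by (simp add: cocycle_def)
  have 1: "continuous_map (prod_topology T ?X) ?X (\<lambda>z. (fst (snd z) \<otimes> fst z, snd (snd z)))"
    by (intro continuous_map_pairedI continuous_map_mult continuous_map_fst_of continuous_map_snd_of continuous_map_fst
        continuous_map_snd continuous_map_compose[OF continuous_map_snd, unfolded o_def])
  have 2: "continuous_map (prod_topology T ?X) ?X (\<lambda>z. (fst (snd z), snd (snd z) \<otimes> fst z))"
    by (intro continuous_map_pairedI continuous_map_mult continuous_map_fst_of continuous_map_snd_of continuous_map_fst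
        continuous_map_snd continuous_map_compose[OF continuous_map_snd, unfolded o_def])
  have "loc_const (prod_topology T ?X) (\<lambda>(g, x). F g x)"
    using loc_const_map2[OF loc_const_compose[OF 1 lc] loc_const_compose[OF 2 lc], of Pair]
    by (simp add: F_def case_prod_unfold)
  then have "openin T {g \<in> topspace T. \<forall>x\<in>topspace ?X. F g x = F \<one> x}"
    using compact_space_T topspace by (intro openin_agree_on_compact) (auto simp: compact_space_prod_topology)
  then obtain J where J: "finite J" "J \<subseteq> I"
    "{\<sigma> \<in> carrier G. \<forall>i\<in>J. coord i \<sigma> = 0} \<subseteq> {g \<in> topspace T. \<forall>x\<in>topspace ?X. F g x = F \<one> x}"
    using open_contains_coord_kernel[of "{g \<in> topspace T. \<forall>x\<in>topspace ?X. F g x = F \<one> x}"] topspace by auto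
  have inv: "c (x \<otimes> g, y) = c (x, y)" "c (x, y \<otimes> g) = c (x, y)"
    if g: "g \<in> carrier G" "\<forall>i\<in>J. coord i g = 0" and xy: "x \<in> carrier G" "y \<in> carrier G" for g x y
  proof -
    have "F g (x, y) = F \<one> (x, y)" using J(3) g xy topspace by auto
    then show "c (x \<otimes> g, y) = c (x, y)" "c (x, y \<otimes> g) = c (x, y)" using xy by (auto simp: F_def)
  qed
  have diff: "coord i (inv \<sigma> \<otimes> \<sigma>') = 0"
    if "\<sigma> \<in> carrier G" "\<sigma>' \<in> carrier G" "coord i \<sigma> = coord i \<sigma>'" "i \<in> J" for i \<sigma> \<sigma>'
  proof -
    have i: "i \<in> I" using J that by auto
    note K = coord_H1[OF i]
    have "[coord i (inv \<sigma> \<otimes> \<sigma>') = coord i (inv \<sigma>) + coord i \<sigma>'] (mod N)" using that by (intro H1_cong[OF K]) auto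
    also have "[coord i (inv \<sigma>) + coord i \<sigma>' = - coord i \<sigma> + coord i \<sigma>'] (mod N)"
      using that by (intro cong_add cong_refl H1_inv[OF K])
    also have "- coord i \<sigma> + coord i \<sigma>' = 0" using that by simp
    finally show ?thesis using that H1_in[OF K, of "inv \<sigma> \<otimes> \<sigma>'"] by (intro L_cong_eq) (auto simp: carrier_L n_pos)
  qed
  have "depends J c" unfolding depends_def
  proof (intro ballI impI)
    fix \<sigma> \<sigma>' \<tau> \<tau>' assume g: "\<sigma> \<in> carrier G" "\<sigma>' \<in> carrier G" "\<tau> \<in> carrier G" "\<tau>' \<in> carrier G"
      and *: "\<forall>i\<in>J. coord i \<sigma> = coord i \<sigma>' \<and> coord i \<tau> = coord i \<tau>'"
    have "c (\<sigma> \<otimes> (inv \<sigma> \<otimes> \<sigma>'), \<tau>) = c (\<sigma>, \<tau>)" using g * by (intro inv) (auto simp: diff)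
    moreover have "c (\<sigma>', \<tau> \<otimes> (inv \<tau> \<otimes> \<tau>')) = c (\<sigma>', \<tau>)" using g * by (intro inv) (auto simp: diff)
    ultimately show "c (\<sigma>, \<tau>) = c (\<sigma>', \<tau>')" using g by (simp add: m_assoc[symmetric])
  qed
  then show ?thesis using J by blast
qed

end

context mod_power
begin

lemma dependsD:
  assumes "depends F c" "\<sigma> \<in> carrier G" "\<sigma>' \<in> carrier G" "\<tau> \<in> carrier G" "\<tau>' \<in> carrier G"
    and "\<And>i. i \<in> F \<Longrightarrow> coord i \<sigma> = coord i \<sigma>'" "\<And>i. i \<in> F \<Longrightarrow> coord i \<tau> = coord i \<tau>'"
  shows "c (\<sigma>, \<tau>) = c (\<sigma>', \<tau>')"
proof -
  have "(\<forall>i\<in>F. coord i \<sigma> = coord i \<sigma>' \<and> coord i \<tau> = coord i \<tau>') \<longrightarrow> c (\<sigma>, \<tau>) = c (\<sigma>', \<tau>')"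
    using assms(1)[unfolded depends_def] assms(2-5) by (elim ballE) auto
  then show ?thesis using assms(6,7) by blast
qed

end

section \<open>Splitting the extension defined by a symmetric cocycle\<close>

locale split_extension = mod_power +
  fixes c :: "'a \<times> 'a \<Rightarrow> int" and F :: "'c set"
  assumes c: "cocycle c" and F: "finite F" "F \<subseteq> I" and dep: "depends F c"
    and sym: "\<And>\<sigma> \<tau>. \<sigma> \<in> carrier G \<Longrightarrow> \<tau> \<in> carrier G \<Longrightarrow> [c (\<sigma>, \<tau>) = c (\<tau>, \<sigma>)] (mod int n)"
    and pw_unit: "\<And>i. i \<in> F \<Longrightarrow> [pw c (unit i) = 0] (mod int n)"
begin

text \<open>The central extension of \<open>G\<close> by \<open>\<int>/n\<close> defined by \<open>c\<close>; it is abelian as \<open>c\<close> is symmetric.\<close>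

definition E :: "('a \<times> int) monoid" where
  "E = \<lparr>carrier = carrier G \<times> carrier \<Lambda>,
        monoid.mult = (\<lambda>(\<sigma>, a) (\<tau>, b). (\<sigma> \<otimes> \<tau>, (a + b + c (\<sigma>, \<tau>)) mod N)),
        one = (\<one>, (- c (\<one>, \<one>)) mod N)\<rparr>"

lemma E_simps:
  "carrier E = carrier G \<times> carrier \<Lambda>"
  "(\<sigma>, a) \<otimes>\<^bsub>E\<^esub> (\<tau>, b) = (\<sigma> \<otimes> \<tau>, (a + b + c (\<sigma>, \<tau>)) mod N)"
  "\<one>\<^bsub>E\<^esub> = (\<one>, (- c (\<one>, \<one>)) mod N)"
  by (simp_all add: E_def)

lemma comm_group_E: "comm_group E"
proof (rule comm_groupI)
  fix x y z assume "x \<in> carrier E" "y \<in> carrier E" "z \<in> carrier E"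
  then obtain \<sigma> a \<tau> b \<rho> d where x: "x = (\<sigma>, a)" "y = (\<tau>, b)" "z = (\<rho>, d)"
    and g: "\<sigma> \<in> carrier G" "\<tau> \<in> carrier G" "\<rho> \<in> carrier G" by (auto simp: E_simps)
  have "[(a + b + c (\<sigma>, \<tau>)) mod N + d + c (\<sigma> \<otimes> \<tau>, \<rho>) = a + b + d + (c (\<sigma> \<otimes> \<tau>, \<rho>) + c (\<sigma>, \<tau>))] (mod N)"
  proof -
    have "[(a + b + c (\<sigma>, \<tau>)) mod N + d + c (\<sigma> \<otimes> \<tau>, \<rho>) = (a + b + c (\<sigma>, \<tau>)) + d + c (\<sigma> \<otimes> \<tau>, \<rho>)] (mod N)"
      by (intro cong_add cong_refl) simp
    then show ?thesis by (simp add: algebra_simps)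
  qed
  also have "[a + b + d + (c (\<sigma> \<otimes> \<tau>, \<rho>) + c (\<sigma>, \<tau>)) = a + b + d + (c (\<tau>, \<rho>) + c (\<sigma>, \<tau> \<otimes> \<rho>))] (mod N)"
    by (intro cong_add cong_refl cong_sym[OF cocycleD[OF c g]])
  also have "[a + b + d + (c (\<tau>, \<rho>) + c (\<sigma>, \<tau> \<otimes> \<rho>)) = a + (b + d + c (\<tau>, \<rho>)) mod N + c (\<sigma>, \<tau> \<otimes> \<rho>)] (mod N)"
  proof -
    have "[a + (b + d + c (\<tau>, \<rho>)) mod N + c (\<sigma>, \<tau> \<otimes> \<rho>) = a + (b + d + c (\<tau>, \<rho>)) + c (\<sigma>, \<tau> \<otimes> \<rho>)] (mod N)"
      by (intro cong_add cong_refl) simp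
    from cong_sym[OF this] show ?thesis by (simp add: algebra_simps)
  qed
  finally show "x \<otimes>\<^bsub>E\<^esub> y \<otimes>\<^bsub>E\<^esub> z = x \<otimes>\<^bsub>E\<^esub> (y \<otimes>\<^bsub>E\<^esub> z)"
    using g by (simp add: x E_simps m_assoc cong_def)
next
  fix x y assume "x \<in> carrier E" "y \<in> carrier E"
  then obtain \<sigma> a \<tau> b where x: "x = (\<sigma>, a)" "y = (\<tau>, b)"
    and g: "\<sigma> \<in> carrier G" "\<tau> \<in> carrier G" by (auto simp: E_simps)
  have "[a + b + c (\<sigma>, \<tau>) = a + b + c (\<tau>, \<sigma>)] (mod N)"
    by (intro cong_add cong_refl sym g)
  then show "x \<otimes>\<^bsub>E\<^esub> y = y \<otimes>\<^bsub>E\<^esub> x" using g by (simp add: x E_simps m_comm cong_def add.commute)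
next
  fix x assume "x \<in> carrier E"
  then obtain \<sigma> a where x: "x = (\<sigma>, a)" and g: "\<sigma> \<in> carrier G" and a: "a \<in> carrier \<Lambda>" by (auto simp: E_simps)
  have "[(- c (\<one>, \<one>)) mod N + a + c (\<one>, \<sigma>) = - c (\<one>, \<one>) + a + c (\<one>, \<one>)] (mod N)"
    by (intro cong_add cong_refl cocycle_one_left[OF c g]) simp
  then show "\<one>\<^bsub>E\<^esub> \<otimes>\<^bsub>E\<^esub> x = x" using g L_mod[OF a] by (simp add: x E_simps cong_def)
  have "[(- a - c (inv \<sigma>, \<sigma>) - c (\<one>, \<one>)) mod N + a + c (inv \<sigma>, \<sigma>) = - a - c (inv \<sigma>, \<sigma>) - c (\<one>, \<one>) + a + c (inv \<sigma>, \<sigma>)] (mod N)"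
    by (intro cong_add cong_refl) simp
  then have "(inv \<sigma>, (- a - c (inv \<sigma>, \<sigma>) - c (\<one>, \<one>)) mod N) \<otimes>\<^bsub>E\<^esub> x = \<one>\<^bsub>E\<^esub>"
    using g by (simp add: x E_simps cong_def)
  then show "\<exists>y\<in>carrier E. y \<otimes>\<^bsub>E\<^esub> x = \<one>\<^bsub>E\<^esub>"
    using g by (intro bexI[of _ "(inv \<sigma>, (- a - c (inv \<sigma>, \<sigma>) - c (\<one>, \<one>)) mod N)"]) (auto simp: E_simps)
qed (auto simp: E_simps)

sublocale E: comm_group E by (rule comm_group_E)

definition gen :: "'c \<Rightarrow> 'a \<times> int" where "gen i = (unit i, 0)"

lemma gen_closed: "gen i \<in> carrier E"
  using unit(1) n_pos by (simp add: gen_def E_simps carrier_L)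

text \<open>The summand -c(1, 1) is the second component of the identity of \<open>E\<close>, as c
  is not normalised. It makes the n-th power of a generator trivial exactly when \<open>pw\<close>
  vanishes modulo n.\<close>

lemma pow_E: "\<sigma> \<in> carrier G \<Longrightarrow>
  (\<sigma>, 0) [^]\<^bsub>E\<^esub> k = (\<sigma> [^] k, (- c (\<one>, \<one>) + (\<Sum>j<k. c (\<sigma> [^] j, \<sigma>))) mod N)" for k :: nat
proof (induction k)
  case 0
  then show ?case by (simp add: E_simps)
next
  case (Suc k)
  have "[(- c (\<one>, \<one>) + (\<Sum>j<k. c (\<sigma> [^] j, \<sigma>))) mod N + 0 + c (\<sigma> [^] k, \<sigma>) =
     - c (\<one>, \<one>) + (\<Sum>j<k. c (\<sigma> [^] j, \<sigma>)) + 0 + c (\<sigma> [^] k, \<sigma>)] (mod N)"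
    by (intro cong_add cong_refl) simp
  then show ?case using Suc by (simp add: E_simps cong_def algebra_simps)
qed

lemma gen_exponent: "i \<in> F \<Longrightarrow> gen i [^]\<^bsub>E\<^esub> n = \<one>\<^bsub>E\<^esub>"
proof -
  assume "i \<in> F"
  then have "[- c (\<one>, \<one>) + pw c (unit i) = - c (\<one>, \<one>) + 0] (mod N)" by (intro cong_add cong_refl pw_unit)
  then show ?thesis using unit(1)
    by (simp add: gen_def pow_E exponent E_simps pw_def cong_def)
qed

text \<open>Coordinates are added with a carry, and the carry costs a factor \<open>gen i\<close> to
  the power n, which is trivial.\<close>

lemma gen_pow_mod:
  assumes "i \<in> F" "a \<ge> 0" "b \<ge> 0"
  shows "gen i [^]\<^bsub>E\<^esub> nat ((a + b) mod N) = gen i [^]\<^bsub>E\<^esub> nat a \<otimes>\<^bsub>E\<^esub> gen i [^]\<^bsub>E\<^esub> nat b"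
proof -
  have "nat a + nat b = n * ((nat a + nat b) div n) + (nat a + nat b) mod n" by simp
  then have "gen i [^]\<^bsub>E\<^esub> (nat a + nat b) = gen i [^]\<^bsub>E\<^esub> (n * ((nat a + nat b) div n)) \<otimes>\<^bsub>E\<^esub> gen i [^]\<^bsub>E\<^esub> ((nat a + nat b) mod n)"
    using gen_closed by (simp add: E.nat_pow_mult)
  also have "gen i [^]\<^bsub>E\<^esub> (n * ((nat a + nat b) div n)) = \<one>\<^bsub>E\<^esub>"
    using gen_closed gen_exponent[OF assms(1)] by (simp add: E.nat_pow_pow[symmetric])
  finally have "gen i [^]\<^bsub>E\<^esub> ((nat a + nat b) mod n) = gen i [^]\<^bsub>E\<^esub> nat a \<otimes>\<^bsub>E\<^esub> gen i [^]\<^bsub>E\<^esub> nat b"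
    using gen_closed by (simp add: E.nat_pow_mult)
  moreover have "nat ((a + b) mod N) = (nat a + nat b) mod n"
    using assms by (simp add: nat_mod_distrib nat_add_distrib)
  ultimately show ?thesis by simp
qed

text \<open>Sends each standard generator to a lift of order dividing n and extends
  multiplicatively. With finitely many factors it lifts the truncation
  \<open>proj J \<sigma>\<close> rather than \<sigma>; for J = F this suffices, as c only sees the
  coordinates in F.\<close>

definition sect :: "'c set \<Rightarrow> 'a \<Rightarrow> 'a \<times> int" where
  "sect J \<sigma> = finprod E (\<lambda>i. gen i [^]\<^bsub>E\<^esub> nat (coord i \<sigma>)) J"

lemma sect_mult:
  assumes "\<sigma> \<in> carrier G" "\<tau> \<in> carrier G"
  shows "sect F (\<sigma> \<otimes> \<tau>) = sect F \<sigma> \<otimes>\<^bsub>E\<^esub> sect F \<tau>"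
proof -
  have "sect F (\<sigma> \<otimes> \<tau>) = finprod E (\<lambda>i. gen i [^]\<^bsub>E\<^esub> nat (coord i \<sigma>) \<otimes>\<^bsub>E\<^esub> gen i [^]\<^bsub>E\<^esub> nat (coord i \<tau>)) F"
    unfolding sect_def
  proof (rule E.finprod_cong')
    fix i assume i: "i \<in> F"
    then have iI: "i \<in> I" using F by auto
    have "coord i (\<sigma> \<otimes> \<tau>) = (coord i \<sigma> + coord i \<tau>) mod N" using H1_mult[OF coord_H1[OF iI] assms] .
    then show "gen i [^]\<^bsub>E\<^esub> nat (coord i (\<sigma> \<otimes> \<tau>)) = gen i [^]\<^bsub>E\<^esub> nat (coord i \<sigma>) \<otimes>\<^bsub>E\<^esub> gen i [^]\<^bsub>E\<^esub> nat (coord i \<tau>)"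
      using gen_pow_mod[OF i] coord_nonneg[OF _ iI] assms by simp
  qed (use gen_closed in auto)
  also have "\<dots> = sect F \<sigma> \<otimes>\<^bsub>E\<^esub> sect F \<tau>"
    unfolding sect_def using gen_closed by (intro E.finprod_multf) auto
  finally show ?thesis .
qed

lemma fst_sect: "finite J \<Longrightarrow> fst (sect J \<sigma>) = proj J \<sigma>"
proof (induction J rule: finite_induct)
  case empty
  then show ?case by (simp add: sect_def proj_def E_simps)
next
  case (insert i J)
  have "sect (insert i J) \<sigma> = gen i [^]\<^bsub>E\<^esub> nat (coord i \<sigma>) \<otimes>\<^bsub>E\<^esub> sect J \<sigma>"
    unfolding sect_def using insert.hyps gen_closed by (subst E.finprod_insert) auto
  moreover have "proj (insert i J) \<sigma> = unit i [^] nat (coord i \<sigma>) \<otimes> proj J \<sigma>"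
    unfolding proj_def using insert.hyps unit(1) by (subst finprod_insert) auto
  moreover have "gen i [^]\<^bsub>E\<^esub> nat (coord i \<sigma>) = (unit i [^] nat (coord i \<sigma>), snd (gen i [^]\<^bsub>E\<^esub> nat (coord i \<sigma>)))"
    using unit(1) by (simp add: gen_def pow_E)
  moreover have "sect J \<sigma> = (proj J \<sigma>, snd (sect J \<sigma>))" using insert.IH by (metis prod.collapse)
  ultimately show ?case by (metis E_simps(2) fst_conv)
qed

lemma loc_const_sect: "finite J \<Longrightarrow> J \<subseteq> I \<Longrightarrow> loc_const T (sect J)"
proof (induction J rule: finite_induct)
  case empty
  then show ?case by (simp add: sect_def loc_const_const)
next
  case (insert i J)
  have "sect (insert i J) = (\<lambda>\<sigma>. gen i [^]\<^bsub>E\<^esub> nat (coord i \<sigma>) \<otimes>\<^bsub>E\<^esub> sect J \<sigma>)"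
    unfolding sect_def using insert.hyps gen_closed by (subst E.finprod_insert) auto
  then show ?case
    using loc_const_map2[OF H1_lc[OF coord_H1] insert.IH, of i "\<lambda>a b. gen i [^]\<^bsub>E\<^esub> nat a \<otimes>\<^bsub>E\<^esub> b"] insert.prems by simp
qed

lemma c_proj:
  assumes "\<sigma> \<in> carrier G" "\<tau> \<in> carrier G"
  shows "c (proj F \<sigma>, proj F \<tau>) = c (\<sigma>, \<tau>)"
  by (rule dependsD[OF dep]) (use assms proj_closed coord_proj[OF _ F(2,1)] in simp_all)

text \<open>The second component of a multiplicative section, with sign reversed, is a cochain with
  coboundary c: multiplicativity gives this for c at the truncations, and \<open>c_proj\<close>
  replaces these by the original elements.\<close>

lemma class_trivial: "cls c = \<one>\<^bsub>H2 G T \<Lambda>\<^esub>"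
proof -
  define \<phi> where "\<phi> = (\<lambda>\<sigma>. - snd (sect F \<sigma>))"
  have "loc_const T \<phi>" unfolding \<phi>_def
    using loc_const_map[OF loc_const_sect[OF F], of "\<lambda>x. - snd x"] .
  moreover have "[c (\<sigma>, \<tau>) - 0 = \<phi> \<tau> - \<phi> (\<sigma> \<otimes> \<tau>) + \<phi> \<sigma>] (mod N)"
    if g: "\<sigma> \<in> carrier G" "\<tau> \<in> carrier G" for \<sigma> \<tau>
  proof -
    have s: "sect F \<rho> = (proj F \<rho>, snd (sect F \<rho>))" for \<rho> using fst_sect[OF F(1)] by (metis prod.collapse)
    have "sect F (\<sigma> \<otimes> \<tau>) = (proj F \<sigma>, snd (sect F \<sigma>)) \<otimes>\<^bsub>E\<^esub> (proj F \<tau>, snd (sect F \<tau>))"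
      using sect_mult[OF g] s by simp
    then have "snd (sect F (\<sigma> \<otimes> \<tau>)) = (snd (sect F \<sigma>) + snd (sect F \<tau>) + c (\<sigma>, \<tau>)) mod N"
      by (simp add: E_simps c_proj g)
    then have "[snd (sect F (\<sigma> \<otimes> \<tau>)) = snd (sect F \<sigma>) + snd (sect F \<tau>) + c (\<sigma>, \<tau>)] (mod N)"
      by (simp add: cong_def)
    from cong_linear_combination[OF this cong_refl[of 0] cong_refl[of 0], of _ _ "- 1" 0 0]
    show ?thesis by (simp add: \<phi>_def)
  qed
  ultimately show ?thesis unfolding one_H2 using c cocycle_zero by (subst cls_eq_iff) auto
qed

end

section \<open>Generation of H^2 by cup products and Bockstein classes\<close>

context mod_power
begin

text \<open>\<open>com\<close> is bilinear and only sees coordinates in F, so both arguments can be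
  truncated and expanded in generators, one after the other.\<close>

lemma com_zero:
  assumes c: "cocycle c" and F: "finite F" "F \<subseteq> I" "depends F c"
    and z: "\<And>i j. i \<in> F \<Longrightarrow> j \<in> F \<Longrightarrow> [com c (unit i) (unit j) = 0] (mod N)"
    and g: "\<sigma> \<in> carrier G" "\<tau> \<in> carrier G"
  shows "[com c \<sigma> \<tau> = 0] (mod N)"
proof -
  have com_proj: "com c \<rho> (proj F \<tau>) = com c \<rho> \<tau>" if "\<rho> \<in> carrier G" "\<tau> \<in> carrier G" for \<rho> \<tau>
  proof -
    have "c (\<rho>, proj F \<tau>) = c (\<rho>, \<tau>)" "c (proj F \<tau>, \<rho>) = c (\<tau>, \<rho>)"
      by (rule dependsD[OF F(3)]; use that proj_closed coord_proj[OF that(2) F(2,1)] in simp)+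
    then show ?thesis by (simp add: com_def)
  qed
  have red: "[com c \<rho> \<tau> = 0] (mod N)"
    if r: "\<rho> \<in> carrier G" "\<tau> \<in> carrier G" and *: "\<And>j. j \<in> F \<Longrightarrow> [com c \<rho> (unit j) = 0] (mod N)" for \<rho> \<tau>
  proof -
    have "[com c \<rho> (proj F \<tau>) = (\<Sum>i\<in>F. coord i \<tau> * com c \<rho> (unit i))] (mod N)"
      by (rule additive_proj[OF com_mult[OF comm_group_G c r(1)] r(2) F(2,1)])
    also have "[(\<Sum>i\<in>F. coord i \<tau> * com c \<rho> (unit i)) = (\<Sum>i\<in>F. coord i \<tau> * 0)] (mod N)"
      by (intro cong_sum cong_mult cong_refl *)
    finally show ?thesis using com_proj r by simp
  qed
  have 1: "[com c (unit i) \<rho> = 0] (mod N)" if "i \<in> F" "\<rho> \<in> carrier G" for i \<rho>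
    by (rule red[OF unit(1) that(2) z[OF that(1)]])
  have 2: "[com c \<sigma> (unit j) = 0] (mod N)" if "j \<in> F" for j
    using 1[OF that g(1)] by (subst com_swap) (simp add: cong_0_iff)
  show ?thesis by (rule red[OF g 2])
qed

lemma class_trivial:
  assumes c: "cocycle c" and F: "finite F" "F \<subseteq> I" "depends F c"
    and z: "\<And>i j. i \<in> F \<Longrightarrow> j \<in> F \<Longrightarrow> [com c (unit i) (unit j) = 0] (mod N)"
    and p: "\<And>i. i \<in> F \<Longrightarrow> [pw c (unit i) = 0] (mod N)"
  shows "cls c = \<one>\<^bsub>H2 G T \<Lambda>\<^esub>"
proof -
  interpret split_extension G T n I \<theta> c F
  proof unfold_locales
    show "[c (\<sigma>, \<tau>) = c (\<tau>, \<sigma>)] (mod N)" if "\<sigma> \<in> carrier G" "\<tau> \<in> carrier G" for \<sigma> \<tau>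
      using com_zero[OF c F z that] by (simp add: com_def cong_diff_iff_cong_0)
  qed (use assms in auto)
  show ?thesis by (rule class_trivial)
qed

lemma class_trivial_iff:
  assumes "cocycle c"
    and "\<And>\<sigma> \<tau>. \<sigma> \<in> carrier G \<Longrightarrow> \<tau> \<in> carrier G \<Longrightarrow> [com c \<sigma> \<tau> = 0] (mod N)"
    and "\<And>\<sigma>. \<sigma> \<in> carrier G \<Longrightarrow> [pw c \<sigma> = 0] (mod N)"
  shows "cls c = \<one>\<^bsub>H2 G T \<Lambda>\<^esub>"
  using cocycle_depends[OF assms(1)] class_trivial[OF assms(1)] assms unit(1) by blast

definition pairs :: "'i set \<Rightarrow> ('i \<times> 'i) set" where
  "pairs F = {(i, j). i \<in> F \<and> j \<in> F \<and> i \<noteq> j}"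

lemma finite_pairs: "finite F \<Longrightarrow> finite (pairs F)"
  by (rule finite_subset[of _ "F \<times> F"]) (auto simp: pairs_def)

lemma sum_delta_mod:
  assumes "finite A" "\<And>x. x \<in> A \<Longrightarrow> [f x = (if x = a then v else 0)] (mod N)"
  shows "[(\<Sum>x\<in>A. m x * f x) = (if a \<in> A then m a * v else 0)] (mod N)"
proof -
  have "[(\<Sum>x\<in>A. m x * f x) = (\<Sum>x\<in>A. m x * (if x = a then v else 0))] (mod N)"
    by (intro cong_sum cong_mult cong_refl assms(2))
  also have "(\<Sum>x\<in>A. m x * (if x = a then v else 0)) = (\<Sum>x\<in>A. if x = a then m x * v else 0)"
    by (intro sum.cong) auto
  also have "\<dots> = (if a \<in> A then m a * v else 0)" using assms(1) by (simp add: sum.delta')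
  finally show ?thesis .
qed

text \<open>The right-hand side has the same \<open>com\<close> and \<open>pw\<close> at the
  generators as c. The cup products carry all of \<open>com\<close> and, their indices being
  distinct, nothing of \<open>pw\<close> at a generator; the Bockstein classes carry all of
  \<open>pw\<close> and nothing of \<open>com\<close>.\<close>

lemma class_expansion:
  assumes c: "cocycle c" and F: "finite F" "F \<subseteq> I" "depends F c"
  shows "cls c = cls (\<lambda>p. (\<Sum>q\<in>pairs F. c (unit (fst q), unit (snd q)) * cup_cocycle (coord (fst q)) (coord (snd q)) p) +
     (\<Sum>i\<in>F. pw c (unit i) * bock_cocycle (coord i) p))"
proof -
  let ?a = "\<lambda>p. \<Sum>q\<in>pairs F. c (unit (fst q), unit (snd q)) * cup_cocycle (coord (fst q)) (coord (snd q)) p"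
  let ?b = "\<lambda>p. \<Sum>i\<in>F. pw c (unit i) * bock_cocycle (coord i) p"
  have FI: "i \<in> I" if "i \<in> F" for i using F that by auto
  have a: "cocycle ?a" using FI by (intro cocycle_sum cocycle_scale cocycle_cup coord_H1) (auto simp: pairs_def)
  have b: "cocycle ?b" using FI by (intro cocycle_sum cocycle_scale bockstein_cls(2) coord_H1) auto
  have ab: "cocycle (\<lambda>p. ?a p + ?b p)" using a b by (rule cocycle_add)
  let ?d = "\<lambda>p. c p - (?a p + ?b p)"
  have d: "cocycle ?d" using c ab by (rule cocycle_diff)
  \<comment> \<open>\<open>class_trivial\<close> tests the generators of one finite set, so the
    difference has to depend on the same F as c.\<close>
  have dep: "depends F ?d" unfolding depends_def
  proof (intro ballI impI)
    fix \<sigma> \<sigma>' \<tau> \<tau>' assume g: "\<sigma> \<in> carrier G" "\<sigma>' \<in> carrier G" "\<tau> \<in> carrier G" "\<tau>' \<in> carrier G"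
      and *: "\<forall>i\<in>F. coord i \<sigma> = coord i \<sigma>' \<and> coord i \<tau> = coord i \<tau>'"
    have "c (\<sigma>, \<tau>) = c (\<sigma>', \<tau>')" by (rule dependsD[OF F(3)]) (use g * in simp_all)
    moreover have "?a (\<sigma>, \<tau>) = ?a (\<sigma>', \<tau>')"
      using * by (intro sum.cong) (auto simp: pairs_def cup_cocycle_def)
    moreover have "?b (\<sigma>, \<tau>) = ?b (\<sigma>', \<tau>')"
      using * g by (intro sum.cong) (auto simp: bock_cocycle_def H1_mult[OF coord_H1[OF FI]])
    ultimately show "?d (\<sigma>, \<tau>) = ?d (\<sigma>', \<tau>')" by simp
  qed
  have com_a: "[com ?a (unit k) (unit l) = com c (unit k) (unit l)] (mod N)" if kl: "k \<in> F" "l \<in> F" for k l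
  proof -
    have ab: "[coord (fst q) (unit k) * coord (snd q) (unit l) = (if q = (k, l) then 1 else 0)] (mod N)"
      if "q \<in> pairs F" for q k l
    proof -
      have "fst q \<in> I" "snd q \<in> I" using that FI by (auto simp: pairs_def)
      from cong_mult[OF coord_unit[OF this(1), of k] coord_unit[OF this(2), of l]]
      show ?thesis by (cases q) (auto split: if_splits)
    qed
    let ?S = "\<lambda>k l. \<Sum>q\<in>pairs F. c (unit (fst q), unit (snd q)) * (coord (fst q) (unit k) * coord (snd q) (unit l))"
    have S: "[?S k l = (if (k, l) \<in> pairs F then c (unit k, unit l) else 0)] (mod N)" for k l
      using sum_delta_mod[where m = "\<lambda>q. c (unit (fst q), unit (snd q))", OF finite_pairs[OF F(1)] ab, of k l]
      by (simp only: fst_conv snd_conv mult_1_right)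
    have "com ?a (unit k) (unit l) = ?S k l - ?S l k"
      by (simp add: com_sum com_cup sum_subtractf right_diff_distrib)
    \<comment> \<open>A pair and its reverse both occur in the sum, the reverse with a minus sign;
      for k = l both sides are 0.\<close>
    moreover have "(if (k, l) \<in> pairs F then c (unit k, unit l) else 0) -
        (if (l, k) \<in> pairs F then c (unit l, unit k) else 0) = com c (unit k) (unit l)"
      using kl by (auto simp: pairs_def com_def)
    ultimately show ?thesis using cong_diff[OF S S, of k l l k] by simp
  qed
  have com_b: "[com ?b \<sigma> \<tau> = 0] (mod N)" if g: "\<sigma> \<in> carrier G" "\<tau> \<in> carrier G" for \<sigma> \<tau>
  proof -
    have "[(\<Sum>i\<in>F. pw c (unit i) * com (bock_cocycle (coord i)) \<sigma> \<tau>) = (\<Sum>i\<in>F. pw c (unit i) * 0)] (mod N)"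
      using FI g by (intro cong_sum cong_mult cong_refl com_bock[OF comm_group_G bock_exists] coord_H1) auto
    then show ?thesis by (simp add: com_sum)
  qed
  have pw_a: "[pw ?a (unit k) = 0] (mod N)" if k: "k \<in> F" for k
  proof -
    have "[(\<Sum>q\<in>pairs F. c (unit (fst q), unit (snd q)) * pw (cup_cocycle (coord (fst q)) (coord (snd q))) (unit k)) =
       (\<Sum>q\<in>pairs F. c (unit (fst q), unit (snd q)) * 0)] (mod N)"
    proof (intro cong_sum cong_mult cong_refl)
      fix q assume q: "q \<in> pairs F"
      then have qI: "fst q \<in> I" "snd q \<in> I" "fst q \<noteq> snd q" using FI by (auto simp: pairs_def)
      have "[pw (cup_cocycle (coord (fst q)) (coord (snd q))) (unit k) =
          int (n choose 2) * (coord (fst q) (unit k) * coord (snd q) (unit k))] (mod N)"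
        by (rule pw_cup[OF coord_H1[OF qI(1)] unit(1)])
      \<comment> \<open>The two indices differ, so one of the coordinates of the generator is
        0.\<close>
      also have "coord (fst q) (unit k) * coord (snd q) (unit k) = 0" using qI by (auto simp: unit(2))
      finally show "[pw (cup_cocycle (coord (fst q)) (coord (snd q))) (unit k) = 0] (mod N)" by simp
    qed
    then show ?thesis by (simp add: pw_sum)
  qed
  have pw_b: "[pw ?b (unit k) = pw c (unit k)] (mod N)" if k: "k \<in> F" for k
  proof -
    have "[(\<Sum>i\<in>F. pw c (unit i) * pw (bock_cocycle (coord i)) (unit k)) = (if k \<in> F then pw c (unit k) * 1 else 0)] (mod N)"
    proof (rule sum_delta_mod[OF F(1)])
      fix i assume "i \<in> F"
      then have i: "i \<in> I" using FI by auto
      show "[pw (bock_cocycle (coord i)) (unit k) = (if i = k then 1 else 0)] (mod N)"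
        using cong_trans[OF pw_bock[OF exponent bock_exists[OF coord_H1[OF i]] unit(1)] coord_unit[OF i]] by simp
    qed
    then show ?thesis using k by (simp add: pw_sum)
  qed
  have "cls ?d = \<one>\<^bsub>H2 G T \<Lambda>\<^esub>"
  proof (rule class_trivial[OF d F(1,2) dep])
    fix k l assume kl: "k \<in> F" "l \<in> F"
    have "[com c (unit k) (unit l) - (com ?a (unit k) (unit l) + com ?b (unit k) (unit l)) =
       com c (unit k) (unit l) - (com c (unit k) (unit l) + 0)] (mod N)"
      by (intro cong_diff cong_add cong_refl com_a com_b kl unit(1))
    then show "[com ?d (unit k) (unit l) = 0] (mod N)" by (simp add: com_diff com_add)
  next
    fix k assume k: "k \<in> F"
    have "[pw c (unit k) - (pw ?a (unit k) + pw ?b (unit k)) = pw c (unit k) - (0 + pw c (unit k))] (mod N)"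
      by (intro cong_diff cong_add cong_refl pw_a pw_b k)
    then show "[pw ?d (unit k) = 0] (mod N)" by (simp add: pw_diff pw_add)
  qed
  then have "cls ?d \<otimes>\<^bsub>H2 G T \<Lambda>\<^esub> cls (\<lambda>p. ?a p + ?b p) = cls (\<lambda>p. ?a p + ?b p)"
    using comm_group_H2 cls_in_H2[OF ab] by (simp add: comm_group_def comm_monoid_def monoid.l_one)
  then show ?thesis using cls_add[OF d ab] by simp
qed

text \<open>Cup products and Bockstein classes generate \<open>H\<^sup>2\<close>.\<close>

lemma hom_H2_eqI:
  assumes h: "h \<in> hom (H2 G T \<Lambda>) \<Lambda>" "h' \<in> hom (H2 G T \<Lambda>) \<Lambda>"
    and cup: "\<And>x y. x \<in> K \<Longrightarrow> y \<in> K \<Longrightarrow> [h (cup n G T x y) = h' (cup n G T x y)] (mod N)"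
    and bo: "\<And>z. z \<in> K \<Longrightarrow> [h (bockstein n G T z) = h' (bockstein n G T z)] (mod N)"
    and X: "X \<in> carrier (H2 G T \<Lambda>)"
  shows "h X = h' X"
proof -
  obtain c where c: "cocycle c" "X = cls c" using X by (rule H2_cases)
  obtain F where F: "finite F" "F \<subseteq> I" "depends F c" using cocycle_depends[OF c(1)] by blast
  have FI: "i \<in> I" if "i \<in> F" for i using F that by auto
  let ?ca = "\<lambda>q. cup_cocycle (coord (fst q)) (coord (snd q))"
  let ?ma = "\<lambda>q. c (unit (fst q), unit (snd q))"
  let ?a = "\<lambda>p. \<Sum>q\<in>pairs F. ?ma q * ?ca q p"
  let ?b = "\<lambda>p. \<Sum>i\<in>F. pw c (unit i) * bock_cocycle (coord i) p"
  have ca: "cocycle (?ca q)" if "q \<in> pairs F" for q using FI that by (intro cocycle_cup coord_H1) (auto simp: pairs_def)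
  have cb: "cocycle (bock_cocycle (coord i))" if "i \<in> F" for i using FI that by (intro bockstein_cls(2) coord_H1) auto
  have a: "cocycle ?a" using ca by (intro cocycle_sum cocycle_scale)
  have b: "cocycle ?b" using cb by (intro cocycle_sum cocycle_scale)
  have exp: "[k X = (\<Sum>q\<in>pairs F. ?ma q * k (cls (?ca q))) + (\<Sum>i\<in>F. pw c (unit i) * k (cls (bock_cocycle (coord i))))] (mod N)"
    if k: "k \<in> hom (H2 G T \<Lambda>) \<Lambda>" for k
  proof -
    have "X = cls (\<lambda>p. ?a p + ?b p)" using class_expansion[OF c(1) F] c(2) by simp
    then have "[k X = k (cls ?a) + k (cls ?b)] (mod N)" using hom_cls_add[OF k a b] by simp
    also have "[k (cls ?a) + k (cls ?b) = (\<Sum>q\<in>pairs F. ?ma q * k (cls (?ca q))) + (\<Sum>i\<in>F. pw c (unit i) * k (cls (bock_cocycle (coord i))))] (mod N)"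
      by (intro cong_add hom_cls_sum[OF k] ca cb)
    finally show ?thesis .
  qed
  note exp[OF h(1)]
  also have "[(\<Sum>q\<in>pairs F. ?ma q * h (cls (?ca q))) + (\<Sum>i\<in>F. pw c (unit i) * h (cls (bock_cocycle (coord i)))) =
     (\<Sum>q\<in>pairs F. ?ma q * h' (cls (?ca q))) + (\<Sum>i\<in>F. pw c (unit i) * h' (cls (bock_cocycle (coord i))))] (mod N)"
  proof (intro cong_add cong_sum cong_mult cong_refl)
    fix q assume "q \<in> pairs F"
    then have "fst q \<in> I" "snd q \<in> I" using FI by (auto simp: pairs_def)
    then show "[h (cls (?ca q)) = h' (cls (?ca q))] (mod N)" using cup[OF coord_H1 coord_H1] by (simp add: cup_eq)
  next
    fix i assume "i \<in> F"
    then have "i \<in> I" using FI by auto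
    then show "[h (cls (bock_cocycle (coord i))) = h' (cls (bock_cocycle (coord i)))] (mod N)"
      using bo[OF coord_H1] by (simp add: bockstein_cls coord_H1)
  qed
  also note cong_sym[OF exp[OF h(2)]]
  finally have "[h X = h' X] (mod N)" .
  then show ?thesis using h X by (intro L_cong_eq) (auto simp: hom_def)
qed

end

section \<open>The group \<open>\<SS>\<close> and its pairing with \<open>H\<^sup>2\<close>\<close>

context mod_power
begin

subsection \<open>Linear extension from the coordinates\<close>

text \<open>Integer-valued lifts of characters. Unlike the reduced and extensional elements of
  \<open>K\<close>, they are closed under integer combinations as functions.\<close>

definition additive :: "('a \<Rightarrow> int) \<Rightarrow> bool" where
  "additive f \<longleftrightarrow> loc_const T f \<and> (\<forall>\<sigma>\<in>carrier G. \<forall>\<tau>\<in>carrier G. [f (\<sigma> \<otimes> \<tau>) = f \<sigma> + f \<tau>] (mod N))"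

definition red1 :: "('a \<Rightarrow> int) \<Rightarrow> 'a \<Rightarrow> int" where
  "red1 f = (\<lambda>\<sigma>\<in>carrier G. f \<sigma> mod N)"

lemma red1_K: "additive f \<Longrightarrow> red1 f \<in> K"
  unfolding H1_iff
proof (intro conjI ballI)
  assume f: "additive f"
  show "red1 f \<in> carrier G \<rightarrow>\<^sub>E carrier \<Lambda>" by (auto simp: red1_def)
  have "loc_const T (\<lambda>\<sigma>. f \<sigma> mod N)" using f by (auto simp: additive_def intro: loc_const_map)
  then show "loc_const T (red1 f)"
    by (subst loc_const_cong[of _ _ "\<lambda>\<sigma>. f \<sigma> mod N"]) (auto simp: topspace red1_def)
  fix \<sigma> \<tau> assume "\<sigma> \<in> carrier G" "\<tau> \<in> carrier G"
  then show "red1 f (\<sigma> \<otimes> \<tau>) = (red1 f \<sigma> + red1 f \<tau>) mod N"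
    using f by (simp add: red1_def additive_def cong_def mod_simps)
qed

lemma K_additive: "x \<in> K \<Longrightarrow> additive x"
  by (simp add: additive_def H1_lc H1_cong)

lemma red1_cong: "x \<in> K \<Longrightarrow> (\<And>\<sigma>. \<sigma> \<in> carrier G \<Longrightarrow> [x \<sigma> = f \<sigma>] (mod N)) \<Longrightarrow> x = red1 f"
  using H1_ext[of x] H1_in[of x]
  by (intro extensionalityI[of x "carrier G" "red1 f"]) (auto simp: red1_def cong_def L_mod)

lemma additive_closed:
  "additive (\<lambda>_. 0)"
  "additive f \<Longrightarrow> additive g \<Longrightarrow> additive (\<lambda>\<sigma>. f \<sigma> + g \<sigma>)"
  "additive f \<Longrightarrow> additive (\<lambda>\<sigma>. k * f \<sigma>)"
proof -
  show "additive (\<lambda>_. 0)" by (simp add: additive_def loc_const_const)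
  show "additive (\<lambda>\<sigma>. f \<sigma> + g \<sigma>)" if "additive f" "additive g"
    unfolding additive_def
  proof (intro conjI ballI)
    show "loc_const T (\<lambda>\<sigma>. f \<sigma> + g \<sigma>)" using that by (auto simp: additive_def intro: loc_const_map2)
    fix \<sigma> \<tau> assume "\<sigma> \<in> carrier G" "\<tau> \<in> carrier G"
    then have "[f (\<sigma> \<otimes> \<tau>) + g (\<sigma> \<otimes> \<tau>) = (f \<sigma> + f \<tau>) + (g \<sigma> + g \<tau>)] (mod N)"
      using that by (intro cong_add) (auto simp: additive_def)
    then show "[f (\<sigma> \<otimes> \<tau>) + g (\<sigma> \<otimes> \<tau>) = f \<sigma> + g \<sigma> + (f \<tau> + g \<tau>)] (mod N)" by (simp add: algebra_simps)
  qed
  show "additive (\<lambda>\<sigma>. k * f \<sigma>)" if "additive f"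
    unfolding additive_def
  proof (intro conjI ballI)
    show "loc_const T (\<lambda>\<sigma>. k * f \<sigma>)" using that by (auto simp: additive_def intro: loc_const_map)
    fix \<sigma> \<tau> assume "\<sigma> \<in> carrier G" "\<tau> \<in> carrier G"
    then have "[k * f (\<sigma> \<otimes> \<tau>) = k * (f \<sigma> + f \<tau>)] (mod N)"
      using that by (intro cong_mult cong_refl) (auto simp: additive_def)
    then show "[k * f (\<sigma> \<otimes> \<tau>) = k * f \<sigma> + k * f \<tau>] (mod N)" by (simp add: algebra_simps)
  qed
qed

lemma H1_mult_red1: "red1 f \<otimes>\<^bsub>H1 G T \<Lambda>\<^esub> red1 g = red1 (\<lambda>\<sigma>. f \<sigma> + g \<sigma>)"
  by (auto simp: cont_Hom_def red1_def fun_eq_iff restrict_def mod_simps)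

lemma H1_mult_eq: "x \<otimes>\<^bsub>H1 G T \<Lambda>\<^esub> y = red1 (\<lambda>\<sigma>. x \<sigma> + y \<sigma>)"
  by (auto simp: cont_Hom_def red1_def fun_eq_iff restrict_def)

lemma H1_mult_closed: "x \<in> K \<Longrightarrow> y \<in> K \<Longrightarrow> x \<otimes>\<^bsub>H1 G T \<Lambda>\<^esub> y \<in> K"
  unfolding H1_mult_eq by (intro red1_K additive_closed K_additive)

lemma hom_H1_sum:
  assumes h: "h \<in> hom (H1 G T \<Lambda>) \<Lambda>" and x: "x \<in> K" and F: "\<And>i. i \<in> F \<Longrightarrow> ys i \<in> K"
    and exp: "\<And>\<sigma>. \<sigma> \<in> carrier G \<Longrightarrow> [x \<sigma> = (\<Sum>i\<in>F. m i * ys i \<sigma>)] (mod N)"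
  shows "[h x = (\<Sum>i\<in>F. m i * h (ys i))] (mod N)"
proof -
  have add: "[h (red1 (\<lambda>p. f p + g p)) = h (red1 f) + h (red1 g)] (mod N)" if "additive f" "additive g" for f g
    using hom_mult[OF h red1_K[OF that(1)] red1_K[OF that(2)]] by (simp add: H1_mult_red1 cong_def)
  note lin = mod_additive_linear(2)[where V = additive and h = "\<lambda>f. h (red1 f)", OF additive_closed add]
  have "x = red1 (\<lambda>\<sigma>. \<Sum>i\<in>F. m i * ys i \<sigma>)" by (rule red1_cong[OF x exp])
  moreover have "[h (red1 (\<lambda>\<sigma>. \<Sum>i\<in>F. m i * ys i \<sigma>)) = (\<Sum>i\<in>F. m i * h (red1 (ys i)))] (mod N)"
    by (rule lin) (auto intro: K_additive F)
  moreover have "(\<Sum>i\<in>F. m i * h (red1 (ys i))) = (\<Sum>i\<in>F. m i * h (ys i))"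
    using red1_cong[OF F cong_refl] by (intro sum.cong) simp_all
  ultimately show ?thesis by simp
qed

lemma class_eqI:
  assumes c: "cocycle c" "cocycle c'"
    and com: "\<And>\<sigma> \<tau>. \<sigma> \<in> carrier G \<Longrightarrow> \<tau> \<in> carrier G \<Longrightarrow> [com c \<sigma> \<tau> = com c' \<sigma> \<tau>] (mod N)"
    and pw: "\<And>\<sigma>. \<sigma> \<in> carrier G \<Longrightarrow> [pw c \<sigma> = pw c' \<sigma>] (mod N)"
  shows "cls c = cls c'"
proof -
  let ?d = "\<lambda>p. c p - c' p"
  have d: "cocycle ?d" using c by (rule cocycle_diff)
  have "cls ?d = \<one>\<^bsub>H2 G T \<Lambda>\<^esub>"
    using com pw by (intro class_trivial_iff[OF d]) (auto simp: com_diff pw_diff cong_diff_iff_cong_0)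
  then have "cls ?d \<otimes>\<^bsub>H2 G T \<Lambda>\<^esub> cls c' = cls c'"
    using comm_group_H2 cls_in_H2[OF c(2)] by (simp add: comm_group_def comm_monoid_def monoid.l_one)
  then show ?thesis using cls_add[OF d c(2)] by simp
qed

text \<open>Both classes have trivial \<open>com\<close>, and their \<open>pw\<close> are (n choose
  2) a^2 and (n choose 2) a with a = x(\<sigma>). This relation in H^2 is dual to the condition that
  cuts \<SS> out of the pairs (f, g).\<close>

lemma cls_cup_same:
  assumes x: "x \<in> K"
  shows "cls (cup_cocycle x x) = cls (\<lambda>p. int (n choose 2) * bock_cocycle x p)"
proof (rule class_eqI)
  note b = bock_exists[OF x]
  show "cocycle (cup_cocycle x x)" by (rule cocycle_cup[OF x x])
  show "cocycle (\<lambda>p. int (n choose 2) * bock_cocycle x p)" by (intro cocycle_scale bockstein_cls(2) x)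
  have com_s: "com (\<lambda>p. k * c p) \<sigma> \<tau> = k * com c \<sigma> \<tau>" "pw (\<lambda>p. k * c p) \<sigma> = k * pw c \<sigma>" for k c \<sigma> \<tau>
    by (simp_all add: com_def pw_def right_diff_distrib sum_distrib_left)
  show "[com (cup_cocycle x x) \<sigma> \<tau> = com (\<lambda>p. int (n choose 2) * bock_cocycle x p) \<sigma> \<tau>] (mod N)"
    if "\<sigma> \<in> carrier G" "\<tau> \<in> carrier G" for \<sigma> \<tau>
  proof -
    have "[int (n choose 2) * 0 = int (n choose 2) * com (bock_cocycle x) \<sigma> \<tau>] (mod N)"
      by (intro cong_mult cong_refl cong_sym[OF com_bock[OF comm_group_G b that]])
    then show ?thesis by (simp add: com_cup com_s mult.commute[of "x \<tau>"])
  qed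
  show "[pw (cup_cocycle x x) \<sigma> = pw (\<lambda>p. int (n choose 2) * bock_cocycle x p) \<sigma>] (mod N)"
    if s: "\<sigma> \<in> carrier G" for \<sigma>
  proof -
    have "[pw (cup_cocycle x x) \<sigma> = int (n choose 2) * (x \<sigma> * x \<sigma>)] (mod N)" by (rule pw_cup[OF x s])
    also have "[int (n choose 2) * (x \<sigma> * x \<sigma>) = int (n choose 2) * x \<sigma>] (mod N)"
    proof -
      \<comment> \<open>Twice the binomial coefficient is n (n - 1), and a (a - 1) supplies the
        missing factor 2.\<close>
      have "even (x \<sigma> * (x \<sigma> - 1))" by simp
      then obtain t where t: "x \<sigma> * (x \<sigma> - 1) = 2 * t" by (auto simp: dvd_def)
      have "even (n * (n - 1))" by (cases n) auto
      then have "2 * (n choose 2) = n * (n - 1)" unfolding choose_two by (rule dvd_mult_div_cancel)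
      then have "2 * int (n choose 2) = N * int (n - 1)" by (metis of_nat_mult of_nat_numeral)
      moreover have "int (n choose 2) * (x \<sigma> * x \<sigma>) - int (n choose 2) * x \<sigma> = 2 * int (n choose 2) * t"
        using t by (simp add: algebra_simps)
      ultimately show ?thesis by (simp add: cong_iff_dvd_diff)
    qed
    also have "[int (n choose 2) * x \<sigma> = int (n choose 2) * pw (bock_cocycle x) \<sigma>] (mod N)"
      by (intro cong_mult cong_refl cong_sym[OF pw_bock[OF exponent b s]])
    finally show ?thesis by (simp add: com_s)
  qed
qed

text \<open>Linearity of the Bockstein map holds for classes only, since carries are not additive.
  It is read off from the invariants: \<open>com\<close> vanishes and \<open>pw\<close> returns the
  character itself.\<close>

lemma cls_bock_sum:
  assumes x: "x \<in> K" and F: "\<And>i. i \<in> F \<Longrightarrow> ys i \<in> K"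
    and exp: "\<And>\<sigma>. \<sigma> \<in> carrier G \<Longrightarrow> [x \<sigma> = (\<Sum>i\<in>F. m i * ys i \<sigma>)] (mod N)"
  shows "cls (bock_cocycle x) = cls (\<lambda>p. \<Sum>i\<in>F. m i * bock_cocycle (ys i) p)"
proof (rule class_eqI)
  show "cocycle (bock_cocycle x)" by (rule bockstein_cls(2)[OF x])
  show "cocycle (\<lambda>p. \<Sum>i\<in>F. m i * bock_cocycle (ys i) p)"
    using F by (intro cocycle_sum cocycle_scale bockstein_cls(2))
  show "[com (bock_cocycle x) \<sigma> \<tau> = com (\<lambda>p. \<Sum>i\<in>F. m i * bock_cocycle (ys i) p) \<sigma> \<tau>] (mod N)"
    if g: "\<sigma> \<in> carrier G" "\<tau> \<in> carrier G" for \<sigma> \<tau>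
  proof -
    have "[(\<Sum>i\<in>F. m i * com (bock_cocycle (ys i)) \<sigma> \<tau>) = (\<Sum>i\<in>F. m i * 0)] (mod N)"
      by (intro cong_sum cong_mult cong_refl com_bock[OF comm_group_G bock_exists g] F)
    then show ?thesis
      using cong_trans[OF com_bock[OF comm_group_G bock_exists[OF x] g] cong_sym] by (simp add: com_sum)
  qed
  show "[pw (bock_cocycle x) \<sigma> = pw (\<lambda>p. \<Sum>i\<in>F. m i * bock_cocycle (ys i) p) \<sigma>] (mod N)"
    if s: "\<sigma> \<in> carrier G" for \<sigma>
  proof -
    have "[pw (bock_cocycle x) \<sigma> = x \<sigma>] (mod N)" by (rule pw_bock[OF exponent bock_exists[OF x] s])
    also have "[x \<sigma> = (\<Sum>i\<in>F. m i * ys i \<sigma>)] (mod N)" by (rule exp[OF s])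
    also have "[(\<Sum>i\<in>F. m i * ys i \<sigma>) = (\<Sum>i\<in>F. m i * pw (bock_cocycle (ys i)) \<sigma>)] (mod N)"
      by (intro cong_sum cong_mult cong_refl cong_sym[OF pw_bock[OF exponent bock_exists s]] F)
    finally show ?thesis by (simp add: pw_sum)
  qed
qed

subsection \<open>The group structure\<close>

abbreviation "TT \<equiv> tensor_square n G T"
abbreviation "SSG \<equiv> SS n G T"
abbreviation "KK \<equiv> product_group (K \<times> K) (\<lambda>_. \<Lambda>)"

lemma carrier_TT: "carrier TT = {f \<in> K \<times> K \<rightarrow>\<^sub>E carrier \<Lambda>.
    (\<forall>y\<in>K. (\<lambda>x. f (x, y)) \<in> hom (H1 G T \<Lambda>) \<Lambda>) \<and> (\<forall>x\<in>K. (\<lambda>y. f (x, y)) \<in> hom (H1 G T \<Lambda>) \<Lambda>)}"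
  by (simp add: tensor_square_def Let_def)

lemma TT_eq: "TT = KK\<lparr>carrier := carrier TT\<rparr>"
  by (simp add: tensor_square_def Let_def)

lemma TT_mult: "f \<otimes>\<^bsub>TT\<^esub> f' = (\<lambda>p\<in>K \<times> K. (f p + f' p) mod N)"
  by (simp add: tensor_square_def Let_def)

lemma TT_one: "\<one>\<^bsub>TT\<^esub> = (\<lambda>p\<in>K \<times> K. 0)"
  by (simp add: tensor_square_def Let_def)

lemma hom_cong_iff:
  "h \<in> hom (H1 G T \<Lambda>) \<Lambda> \<longleftrightarrow> h \<in> K \<rightarrow> carrier \<Lambda> \<and>
     (\<forall>x\<in>K. \<forall>y\<in>K. [h (x \<otimes>\<^bsub>H1 G T \<Lambda>\<^esub> y) = h x + h y] (mod N))"
proof -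
  have "h (x \<otimes>\<^bsub>H1 G T \<Lambda>\<^esub> y) = (h x + h y) mod N \<longleftrightarrow> [h (x \<otimes>\<^bsub>H1 G T \<Lambda>\<^esub> y) = h x + h y] (mod N)"
    if "h \<in> K \<rightarrow> carrier \<Lambda>" "x \<in> K" "y \<in> K" for x y
    using that H1_mult_closed[OF that(2,3)] by (simp add: cong_def Pi_iff)
  then show ?thesis by (auto simp: hom_def)
qed

lemma TT_I:
  assumes "f \<in> extensional (K \<times> K)" "\<And>x y. x \<in> K \<Longrightarrow> y \<in> K \<Longrightarrow> f (x, y) \<in> carrier \<Lambda>"
    and "\<And>x x' y. x \<in> K \<Longrightarrow> x' \<in> K \<Longrightarrow> y \<in> K \<Longrightarrow> [f (x \<otimes>\<^bsub>H1 G T \<Lambda>\<^esub> x', y) = f (x, y) + f (x', y)] (mod N)"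
    and "\<And>x y y'. x \<in> K \<Longrightarrow> y \<in> K \<Longrightarrow> y' \<in> K \<Longrightarrow> [f (x, y \<otimes>\<^bsub>H1 G T \<Lambda>\<^esub> y') = f (x, y) + f (x, y')] (mod N)"
  shows "f \<in> carrier TT"
  using assms unfolding carrier_TT hom_cong_iff by (auto simp: PiE_iff)

lemma TT_D:
  assumes "f \<in> carrier TT"
  shows "f \<in> extensional (K \<times> K)" "\<And>x y. x \<in> K \<Longrightarrow> y \<in> K \<Longrightarrow> f (x, y) \<in> carrier \<Lambda>"
    and "\<And>x x' y. x \<in> K \<Longrightarrow> x' \<in> K \<Longrightarrow> y \<in> K \<Longrightarrow> [f (x \<otimes>\<^bsub>H1 G T \<Lambda>\<^esub> x', y) = f (x, y) + f (x', y)] (mod N)"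
    and "\<And>x y y'. x \<in> K \<Longrightarrow> y \<in> K \<Longrightarrow> y' \<in> K \<Longrightarrow> [f (x, y \<otimes>\<^bsub>H1 G T \<Lambda>\<^esub> y') = f (x, y) + f (x, y')] (mod N)"
    and "\<And>y. y \<in> K \<Longrightarrow> (\<lambda>x. f (x, y)) \<in> hom (H1 G T \<Lambda>) \<Lambda>"
    and "\<And>x. x \<in> K \<Longrightarrow> (\<lambda>y. f (x, y)) \<in> hom (H1 G T \<Lambda>) \<Lambda>"
proof -
  have hom: "(\<lambda>x. f (x, y)) \<in> hom (H1 G T \<Lambda>) \<Lambda>" "(\<lambda>x. f (y, x)) \<in> hom (H1 G T \<Lambda>) \<Lambda>" if "y \<in> K" for y
    using assms that by (auto simp: carrier_TT)
  then show "\<And>y. y \<in> K \<Longrightarrow> (\<lambda>x. f (x, y)) \<in> hom (H1 G T \<Lambda>) \<Lambda>" "\<And>x. x \<in> K \<Longrightarrow> (\<lambda>y. f (x, y)) \<in> hom (H1 G T \<Lambda>) \<Lambda>"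
    by auto
  from hom show "\<And>x x' y. x \<in> K \<Longrightarrow> x' \<in> K \<Longrightarrow> y \<in> K \<Longrightarrow> [f (x \<otimes>\<^bsub>H1 G T \<Lambda>\<^esub> x', y) = f (x, y) + f (x', y)] (mod N)"
    "\<And>x y y'. x \<in> K \<Longrightarrow> y \<in> K \<Longrightarrow> y' \<in> K \<Longrightarrow> [f (x, y \<otimes>\<^bsub>H1 G T \<Lambda>\<^esub> y') = f (x, y) + f (x, y')] (mod N)"
    unfolding hom_cong_iff by auto
  show "f \<in> extensional (K \<times> K)" "\<And>x y. x \<in> K \<Longrightarrow> y \<in> K \<Longrightarrow> f (x, y) \<in> carrier \<Lambda>"
    using assms by (auto simp: carrier_TT PiE_iff)
qed

lemma TT_linear:
  fixes k l :: int
  assumes "f \<in> carrier TT" "f' \<in> carrier TT"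
  shows "(\<lambda>p\<in>K \<times> K. (k * f p + l * f' p) mod N) \<in> carrier TT"
proof (rule TT_I)
  fix x x' y assume K: "x \<in> K" "x' \<in> K" "y \<in> K"
  have "[k * f (x \<otimes>\<^bsub>H1 G T \<Lambda>\<^esub> x', y) + l * f' (x \<otimes>\<^bsub>H1 G T \<Lambda>\<^esub> x', y) = k * (f (x, y) + f (x', y)) + l * (f' (x, y) + f' (x', y))] (mod N)"
    by (intro cong_add cong_mult cong_refl TT_D(3)[OF assms(1)] TT_D(3)[OF assms(2)] K)
  also have "k * (f (x, y) + f (x', y)) + l * (f' (x, y) + f' (x', y)) = (k * f (x, y) + l * f' (x, y)) + (k * f (x', y) + l * f' (x', y))"
    by (simp add: algebra_simps)
  finally show "[(\<lambda>p\<in>K \<times> K. (k * f p + l * f' p) mod N) (x \<otimes>\<^bsub>H1 G T \<Lambda>\<^esub> x', y) =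
      (\<lambda>p\<in>K \<times> K. (k * f p + l * f' p) mod N) (x, y) + (\<lambda>p\<in>K \<times> K. (k * f p + l * f' p) mod N) (x', y)] (mod N)"
    using K by (simp add: H1_mult_closed cong_def mod_simps)
next
  fix x y y' assume K: "x \<in> K" "y \<in> K" "y' \<in> K"
  have "[k * f (x, y \<otimes>\<^bsub>H1 G T \<Lambda>\<^esub> y') + l * f' (x, y \<otimes>\<^bsub>H1 G T \<Lambda>\<^esub> y') = k * (f (x, y) + f (x, y')) + l * (f' (x, y) + f' (x, y'))] (mod N)"
    by (intro cong_add cong_mult cong_refl TT_D(4)[OF assms(1)] TT_D(4)[OF assms(2)] K)
  also have "k * (f (x, y) + f (x, y')) + l * (f' (x, y) + f' (x, y')) = (k * f (x, y) + l * f' (x, y)) + (k * f (x, y') + l * f' (x, y'))"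
    by (simp add: algebra_simps)
  finally show "[(\<lambda>p\<in>K \<times> K. (k * f p + l * f' p) mod N) (x, y \<otimes>\<^bsub>H1 G T \<Lambda>\<^esub> y') =
      (\<lambda>p\<in>K \<times> K. (k * f p + l * f' p) mod N) (x, y) + (\<lambda>p\<in>K \<times> K. (k * f p + l * f' p) mod N) (x, y')] (mod N)"
    using K by (simp add: H1_mult_closed cong_def mod_simps)
qed auto

lemma subgroup_TT: "subgroup (carrier TT) KK"
proof -
  interpret KK: group KK by simp
  have TTsub: "carrier TT \<subseteq> carrier KK" by (auto simp: carrier_TT)
  have lin: "(\<lambda>p\<in>K \<times> K. 0) \<in> carrier TT" by (rule TT_I) (auto simp: H1_mult_closed)
  show ?thesis
  proof (rule KK.subgroupI)
    show "carrier TT \<subseteq> carrier KK" by (rule TTsub)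
    show "carrier TT \<noteq> {}" using lin by auto
    show "inv\<^bsub>KK\<^esub> f \<in> carrier TT" if f: "f \<in> carrier TT" for f
    proof -
      have "inv\<^bsub>KK\<^esub> f = (\<lambda>p\<in>K \<times> K. inv\<^bsub>\<Lambda>\<^esub> f p)"
        using f by (intro inv_product_group) (auto simp: carrier_TT)
      also have "\<dots> = (\<lambda>p\<in>K \<times> K. (- 1 * f p + 0 * f p) mod N)"
        using TT_D(2)[OF f] by (intro restrict_ext) auto
      finally show ?thesis using TT_linear[OF f f, of "- 1" 0] by simp
    qed
    show "f \<otimes>\<^bsub>KK\<^esub> f' \<in> carrier TT" if "f \<in> carrier TT" "f' \<in> carrier TT" for f f'
      using TT_linear[OF that, of 1 1] by simp
  qed
qed

lemma group_TT: "group TT"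
  by (subst TT_eq) (rule subgroup.subgroup_is_group[OF subgroup_TT product_group], simp)

lemma TT_inv: "f \<in> carrier TT \<Longrightarrow> inv\<^bsub>TT\<^esub> f = (\<lambda>p\<in>K \<times> K. (- f p) mod N)"
proof -
  assume f: "f \<in> carrier TT"
  interpret KK: group KK by simp
  have "inv\<^bsub>TT\<^esub> f = inv\<^bsub>KK\<^esub> f"
    by (subst TT_eq) (rule KK.m_inv_consistent[OF subgroup_TT f])
  also have "\<dots> = (\<lambda>p\<in>K \<times> K. inv\<^bsub>\<Lambda>\<^esub> f p)"
    using f by (intro inv_product_group) (auto simp: carrier_TT)
  also have "\<dots> = (\<lambda>p\<in>K \<times> K. (- f p) mod N)"
    using TT_D(2)[OF f] by (intro restrict_ext) auto
  finally show ?thesis .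
qed

lemma TT_pow: "f \<in> carrier TT \<Longrightarrow> f [^]\<^bsub>TT\<^esub> k = (\<lambda>p\<in>K \<times> K. (int k * f p) mod N)" for k :: nat
proof (induction k)
  case 0
  interpret TT: group TT by (rule group_TT)
  show ?case by (simp add: TT_one cong: restrict_cong)
next
  case (Suc k)
  interpret TT: group TT by (rule group_TT)
  show ?case using Suc by (auto simp: TT_mult fun_eq_iff restrict_def mod_simps algebra_simps)
qed

lemma SS_simps:
  "carrier SSG = {(f, g). f \<in> carrier TT \<and> g \<in> carrier G \<and> (\<forall>x\<in>K. f (x, x) = (int (n choose 2) * x g) mod N)}"
  "(f, g) \<otimes>\<^bsub>SSG\<^esub> (f', g') = (f \<otimes>\<^bsub>TT\<^esub> f', g \<otimes> g')"
  "\<one>\<^bsub>SSG\<^esub> = (\<one>\<^bsub>TT\<^esub>, \<one>)"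
  by (auto simp: SS_def DirProd_def)

lemma SS_eq: "SSG = (TT \<times>\<times> G)\<lparr>carrier := carrier SSG\<rparr>"
  by (simp add: SS_def)

lemma subgroup_SS: "subgroup (carrier SSG) (TT \<times>\<times> G)"
proof -
  interpret TT: group TT by (rule group_TT)
  interpret D: group "TT \<times>\<times> G" by (rule DirProd_group[OF group_TT is_group])
  show ?thesis
  proof (rule D.subgroupI)
    show "carrier SSG \<subseteq> carrier (TT \<times>\<times> G)" by (auto simp: SS_simps)
    have "(\<one>\<^bsub>TT\<^esub>, \<one>) \<in> carrier SSG" unfolding SS_simps using TT.one_closed
      by (auto simp: TT_one H1_one)
    then show "carrier SSG \<noteq> {}" by blast
    show "inv\<^bsub>TT \<times>\<times> G\<^esub> s \<in> carrier SSG" if s: "s \<in> carrier SSG" for s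
    proof -
      obtain f g where fg: "s = (f, g)" "f \<in> carrier TT" "g \<in> carrier G" "\<And>x. x \<in> K \<Longrightarrow> f (x, x) = (int (n choose 2) * x g) mod N"
        using s by (auto simp: SS_simps)
      have "(inv\<^bsub>TT\<^esub> f) (x, x) = (int (n choose 2) * x (inv g)) mod N" if x: "x \<in> K" for x
      proof -
        have "[int (n choose 2) * x (inv g) = int (n choose 2) * - x g] (mod N)"
          using fg by (intro cong_mult cong_refl H1_inv[OF x])
        then show ?thesis using x fg by (simp add: TT_inv cong_def mod_simps)
      qed
      then show ?thesis using fg by (auto simp: SS_simps inv_DirProd[OF group_TT is_group])
    qed
    show "s \<otimes>\<^bsub>TT \<times>\<times> G\<^esub> s' \<in> carrier SSG" if ss: "s \<in> carrier SSG" "s' \<in> carrier SSG" for s s'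
    proof -
      obtain f g where fg: "s = (f, g)" "f \<in> carrier TT" "g \<in> carrier G" "\<And>x. x \<in> K \<Longrightarrow> f (x, x) = (int (n choose 2) * x g) mod N"
        using ss by (auto simp: SS_simps)
      obtain f' g' where fg': "s' = (f', g')" "f' \<in> carrier TT" "g' \<in> carrier G" "\<And>x. x \<in> K \<Longrightarrow> f' (x, x) = (int (n choose 2) * x g') mod N"
        using ss by (auto simp: SS_simps)
      have "(f \<otimes>\<^bsub>TT\<^esub> f') (x, x) = (int (n choose 2) * x (g \<otimes> g')) mod N" if x: "x \<in> K" for x
      proof -
        have "[int (n choose 2) * x (g \<otimes> g') = int (n choose 2) * (x g + x g')] (mod N)"
          using fg fg' by (intro cong_mult cong_refl H1_cong[OF x])
        then show ?thesis using x fg fg' by (simp add: TT_mult cong_def mod_simps distrib_left)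
      qed
      then show ?thesis using fg fg' TT.m_closed by (auto simp: SS_simps)
    qed
  qed
qed

lemma group_SS: "group SSG"
  by (subst SS_eq) (rule subgroup.subgroup_is_group[OF subgroup_SS DirProd_group[OF group_TT is_group]])

lemma SS_D:
  assumes "(f, g) \<in> carrier SSG"
  shows "f \<in> carrier TT" "g \<in> carrier G" "\<And>x. x \<in> K \<Longrightarrow> [f (x, x) = int (n choose 2) * x g] (mod N)"
  using assms by (auto simp: SS_simps cong_def)

text \<open>Polarisation: f(x + y, x + y) expands bilinearly, while (n choose 2) g(x + y) is
  additive, so the mixed terms cancel. Hence one orientation of each pair of indices determines the
  off-diagonal values of f.\<close>

lemma SS_antisym:
  assumes s: "(f, g) \<in> carrier SSG" and x: "x \<in> K" and y: "y \<in> K"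
  shows "[f (y, x) = - f (x, y)] (mod N)"
proof -
  note D = SS_D[OF s]
  note T = TT_D[OF D(1)]
  let ?xy = "x \<otimes>\<^bsub>H1 G T \<Lambda>\<^esub> y"
  have xy: "?xy \<in> K" by (rule H1_mult_closed[OF x y])
  have "[?xy g = x g + y g] (mod N)" using D(2) by (simp add: H1_mult_eq red1_def cong_def)
  then have 1: "[int (n choose 2) * ?xy g = int (n choose 2) * (x g + y g)] (mod N)"
    by (intro cong_mult cong_refl)
  have "[f (?xy, ?xy) = f (x, ?xy) + f (y, ?xy)] (mod N)" by (rule T(3)[OF x y xy])
  also have "[f (x, ?xy) + f (y, ?xy) = (f (x, x) + f (x, y)) + (f (y, x) + f (y, y))] (mod N)"
    by (intro cong_add T(4) x y)
  also have "[(f (x, x) + f (x, y)) + (f (y, x) + f (y, y)) =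
     (int (n choose 2) * x g + f (x, y)) + (f (y, x) + int (n choose 2) * y g)] (mod N)"
    by (intro cong_add cong_refl D(3) x y)
  finally have "[f (?xy, ?xy) = (int (n choose 2) * x g + f (x, y)) + (f (y, x) + int (n choose 2) * y g)] (mod N)" .
  with cong_sym[OF cong_trans[OF D(3)[OF xy] 1]]
  have "[int (n choose 2) * (x g + y g) = (int (n choose 2) * x g + f (x, y)) + (f (y, x) + int (n choose 2) * y g)] (mod N)"
    by (rule cong_trans)
  from cong_linear_combination[OF this cong_refl[of 0] cong_refl[of 0], of "f (y, x)" "- f (x, y)" "- 1" 0 0]
  show ?thesis by (simp add: algebra_simps)
qed

end

type_synonym 'b form = "(('b \<Rightarrow> int) \<times> ('b \<Rightarrow> int) \<Rightarrow> int) \<times> 'b"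


context top_group_mod
begin

lemma hom_L_cong:
  assumes "h \<in> hom A \<Lambda>" "a \<in> carrier A" "b \<in> carrier A"
  shows "[h (a \<otimes>\<^bsub>A\<^esub> b) = h a + h b] (mod N)"
  using hom_mult[OF assms] by (simp add: cong_def)

lemma hom_L_diff:
  assumes A: "group A" and h: "h \<in> hom A \<Lambda>" and ab: "a \<in> carrier A" "b \<in> carrier A"
  shows "[h (a \<otimes>\<^bsub>A\<^esub> inv\<^bsub>A\<^esub> b) = h a - h b] (mod N)"
proof -
  interpret A: group A by fact
  have "(a \<otimes>\<^bsub>A\<^esub> inv\<^bsub>A\<^esub> b) \<otimes>\<^bsub>A\<^esub> b = a" using ab by (simp add: A.m_assoc)
  then have "[h a = h (a \<otimes>\<^bsub>A\<^esub> inv\<^bsub>A\<^esub> b) + h b] (mod N)"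
    using hom_L_cong[OF h, of "a \<otimes>\<^bsub>A\<^esub> inv\<^bsub>A\<^esub> b" b] ab by simp
  then have "[h a - h b = h (a \<otimes>\<^bsub>A\<^esub> inv\<^bsub>A\<^esub> b) + h b - h b] (mod N)" by (intro cong_diff cong_refl)
  then show ?thesis by (simp add: cong_sym)
qed

lemma hom_L_one:
  assumes A: "group A" and h: "h \<in> hom A \<Lambda>"
  shows "h \<one>\<^bsub>A\<^esub> = 0"
proof -
  interpret A: group A by fact
  have "[h \<one>\<^bsub>A\<^esub> = 0] (mod N)" using hom_L_diff[OF A h A.one_closed A.one_closed] by simp
  then show ?thesis using hom_in_carrier[OF h A.one_closed] by (intro L_cong_eq) auto
qed

lemma carrier_cont_Hom:
  "f \<in> carrier (cont_Hom A TA \<Lambda>) \<longleftrightarrow> f \<in> hom A \<Lambda> \<and> f \<in> extensional (carrier A) \<and>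
     continuous_map TA (discrete_topology (carrier \<Lambda>)) f"
  by (auto simp: cont_Hom_def cochain1_def hom_def PiE_def)

lemma mult_cont_Hom: "f \<otimes>\<^bsub>cont_Hom A TA \<Lambda>\<^esub> g = (\<lambda>a\<in>carrier A. (f a + g a) mod N)"
  by (simp add: cont_Hom_def)

end

context mod_power
begin

subsection \<open>The pairing\<close>

text \<open>An arbitrary orientation of each two-element set of indices: the choice only depends on the
  unordered pair.\<close>

definition precedes :: "'i \<Rightarrow> 'i \<Rightarrow> bool" where
  "precedes i j \<longleftrightarrow> (SOME p. p \<in> {(i, j), (j, i)}) = (i, j)"

lemma precedes: "i \<noteq> j \<Longrightarrow> precedes j i \<longleftrightarrow> \<not> precedes i j"
proof -
  assume ij: "i \<noteq> j"
  let ?p = "SOME p. p \<in> {(i, j), (j, i)}"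
  have "{(j, i), (i, j)} = {(i, j), (j, i)}" by auto
  then have "precedes j i \<longleftrightarrow> ?p = (j, i)" by (simp only: precedes_def)
  moreover have "precedes i j \<longleftrightarrow> ?p = (i, j)" by (simp only: precedes_def)
  moreover have "?p \<in> {(i, j), (j, i)}" by (rule someI[of _ "(i, j)"]) simp
  ultimately show ?thesis using ij by auto
qed

definition opairs :: "'i set \<Rightarrow> ('i \<times> 'i) set" where
  "opairs F = {(i, j). i \<in> F \<and> j \<in> F \<and> i \<noteq> j \<and> precedes i j}"

lemma finite_opairs: "finite F \<Longrightarrow> finite (opairs F)"
  by (rule finite_subset[of _ "F \<times> F"]) (auto simp: opairs_def)

lemma sum_square:
  fixes h :: "'i \<times> 'i \<Rightarrow> int"
  assumes "finite F"
  shows "(\<Sum>q\<in>F \<times> F. h q) = (\<Sum>i\<in>F. h (i, i)) + (\<Sum>q\<in>opairs F. h q + h (prod.swap q))"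
proof -
  have "F \<times> F = (\<lambda>i. (i, i)) ` F \<union> (opairs F \<union> prod.swap ` opairs F)"
  proof (rule Set.set_eqI)
    fix q show "q \<in> F \<times> F \<longleftrightarrow> q \<in> (\<lambda>i. (i, i)) ` F \<union> (opairs F \<union> prod.swap ` opairs F)"
    proof (cases q)
      case (Pair i j)
      have "q \<in> prod.swap ` opairs F \<longleftrightarrow> (j, i) \<in> opairs F" unfolding Pair by force
      moreover have "q \<in> (\<lambda>i. (i, i)) ` F \<longleftrightarrow> i \<in> F \<and> i = j" unfolding Pair by auto
      ultimately show ?thesis using precedes[of i j] unfolding Pair by (auto simp: opairs_def)
    qed
  qed
  moreover have "(\<lambda>i. (i, i)) ` F \<inter> (opairs F \<union> prod.swap ` opairs F) = {}" by (auto simp: opairs_def)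
  moreover have "opairs F \<inter> prod.swap ` opairs F = {}"
  proof (rule equals0I)
    fix q assume "q \<in> opairs F \<inter> prod.swap ` opairs F"
    then obtain i j where "(i, j) \<in> opairs F" "(j, i) \<in> opairs F" by force
    then show False using precedes[of i j] by (simp add: opairs_def)
  qed
  ultimately have "(\<Sum>q\<in>F \<times> F. h q) = (\<Sum>q\<in>(\<lambda>i. (i, i)) ` F. h q) + ((\<Sum>q\<in>opairs F. h q) + (\<Sum>q\<in>prod.swap ` opairs F. h q))"
    using assms finite_opairs[OF assms] by (simp add: sum.union_disjoint)
  also have "(\<Sum>q\<in>(\<lambda>i. (i, i)) ` F. h q) = (\<Sum>i\<in>F. h (i, i))" by (subst sum.reindex) (auto simp: inj_on_def)
  also have "(\<Sum>q\<in>prod.swap ` opairs F. h q) = (\<Sum>q\<in>opairs F. h (prod.swap q))"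
    by (subst sum.reindex) auto
  finally show ?thesis by (simp add: sum.distrib)
qed

text \<open>Unlike \<open>depends\<close>, this is a condition on the class of a cocycle only, as
  \<open>com\<close> and \<open>pw\<close> modulo n depend on the class. It is exactly what makes
  the terms of \<open>eval\<close> outside F vanish.\<close>

definition supports :: "'i set \<Rightarrow> ('a \<times> 'a \<Rightarrow> int) \<Rightarrow> bool" where
  "supports F c \<longleftrightarrow> finite F \<and> F \<subseteq> I \<and> (\<forall>i\<in>I - F. (\<forall>j\<in>I. [com c (unit i) (unit j) = 0] (mod N)) \<and> [pw c (unit i) = 0] (mod N))"

text \<open>Obtained from \<open>class_expansion\<close> by replacing cup products with values of f
  and Bockstein classes with coordinates of g. Antisymmetry of f combines the two orders of a pair,
  so that only \<open>com\<close> enters.\<close>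

definition eval :: "'i set \<Rightarrow> ('a \<times> 'a \<Rightarrow> int) \<Rightarrow> 'a form \<Rightarrow> int" where
  "eval F c s = (\<Sum>q\<in>opairs F. com c (unit (fst q)) (unit (snd q)) * fst s (coord (fst q), coord (snd q))) +
     (\<Sum>i\<in>F. pw c (unit i) * coord i (snd s))"

text \<open>For i outside F the cocycle cannot distinguish \<open>unit i\<close> and its powers from
  1. Thus \<open>com\<close> becomes a difference of two values congruent to c(1, 1), and
  \<open>pw\<close> becomes n c(1, 1).\<close>

lemma supports_depends:
  assumes c: "cocycle c" and F: "finite F" "F \<subseteq> I" "depends F c"
  shows "supports F c"
  unfolding supports_def
proof (intro conjI ballI F)
  fix i assume i: "i \<in> I - F"
  have pow: "coord k (unit i [^] (l::nat)) = coord k \<one>" if "k \<in> F" for k l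
  proof -
    have k: "k \<in> I" "k \<noteq> i" using that i F by auto
    note K = coord_H1[OF k(1)]
    have "[coord k (unit i [^] l) = int l * coord k (unit i)] (mod N)" by (rule H1_pow[OF K unit(1)])
    then have "[coord k (unit i [^] l) = coord k \<one>] (mod N)" using k by (simp add: unit(2) H1_one[OF K])
    then show ?thesis using H1_in[OF K] unit(1) by (intro L_cong_eq) auto
  qed
  have one: "coord k (unit i) = coord k \<one>" if "k \<in> F" for k using pow[OF that, of 1] unit(1) by simp
  show "[com c (unit i) (unit j) = 0] (mod N)" if "j \<in> I" for j
  proof -
    have "c (unit i, unit j) = c (\<one>, unit j)" "c (unit j, unit i) = c (unit j, \<one>)"
      by (rule dependsD[OF F(3)]; simp add: unit(1) one)+
    moreover have "[c (\<one>, unit j) - c (unit j, \<one>) = c (\<one>, \<one>) - c (\<one>, \<one>)] (mod N)"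
      by (intro cong_diff cocycle_one_left cocycle_one_right c unit(1))
    ultimately show ?thesis by (simp add: com_def)
  qed
  have "c (unit i [^] k, unit i) = c (\<one>, \<one>)" for k :: nat
    by (rule dependsD[OF F(3)]) (simp_all add: unit(1) one pow)
  then have "pw c (unit i) = N * c (\<one>, \<one>)" by (simp add: pw_def)
  then show "[pw c (unit i) = 0] (mod N)" by (simp add: cong_0_iff)
qed

lemma supports_exists: "cocycle c \<Longrightarrow> \<exists>F. supports F c"
  using cocycle_depends supports_depends by blast

lemma supports_mono: "supports F c \<Longrightarrow> F \<subseteq> F' \<Longrightarrow> F' \<subseteq> I \<Longrightarrow> finite F' \<Longrightarrow> supports F' c"
  unfolding supports_def by blast

lemma sum_cong_subset:
  fixes h h' :: "'x \<Rightarrow> int"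
  assumes "finite B" "A \<subseteq> B" "\<And>x. x \<in> B - A \<Longrightarrow> [h x = 0] (mod N)"
  shows "[sum h B = sum h A] (mod N)"
proof -
  have "[sum h (B - A) + sum h A = (\<Sum>x\<in>B - A. 0) + sum h A] (mod N)"
    by (intro cong_add cong_sum cong_refl assms(3))
  then show ?thesis using sum.subset_diff[OF assms(2,1), of h] by simp
qed

lemma eval_mono:
  assumes F: "supports F c" and F': "F \<subseteq> F'" "F' \<subseteq> I" "finite F'"
  shows "[eval F' c s = eval F c s] (mod N)"
  unfolding eval_def
proof (intro cong_add sum_cong_subset finite_opairs F')
  show "opairs F \<subseteq> opairs F'" using F' by (auto simp: opairs_def)
  fix q assume q: "q \<in> opairs F' - opairs F"
  have "[com c (unit (fst q)) (unit (snd q)) = 0] (mod N)"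
  proof (cases "fst q \<in> F")
    case False
    then have "fst q \<in> I - F" "snd q \<in> I" using q F' by (auto simp: opairs_def)
    then show ?thesis using F by (simp add: supports_def)
  next
    case True
    then have "snd q \<in> I - F" "fst q \<in> I" using q F' by (auto simp: opairs_def)
    then have "[com c (unit (snd q)) (unit (fst q)) = 0] (mod N)" using F by (simp add: supports_def)
    then show ?thesis by (subst com_swap) (simp add: cong_0_iff)
  qed
  then show "[com c (unit (fst q)) (unit (snd q)) * fst s (coord (fst q), coord (snd q)) = 0] (mod N)"
    by (simp add: cong_0_iff)
next
  fix i assume "i \<in> F' - F"
  then have "[pw c (unit i) = 0] (mod N)" using F F' by (auto simp: supports_def)
  then show "[pw c (unit i) * coord i (snd s) = 0] (mod N)" by (simp add: cong_0_iff)
qed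

lemma eval_class:
  assumes "cocycle c" "cocycle c'" "cls c = cls c'"
  shows "[eval F c s = eval F c' s] (mod N)"
  unfolding eval_def
  by (intro cong_add cong_sum cong_mult cong_refl com_pw_class[OF comm_group_G exponent assms] unit(1))

lemma eval_unique:
  assumes c: "cocycle c" "cocycle c'" "cls c = cls c'" and F: "supports F c" "supports F' c'"
  shows "[eval F c s = eval F' c' s] (mod N)"
proof -
  have U: "F \<union> F' \<subseteq> I" "finite (F \<union> F')" using F by (auto simp: supports_def)
  have "[eval F c s = eval (F \<union> F') c s] (mod N)" by (rule cong_sym[OF eval_mono[OF F(1) _ U]]) simp
  also have "[eval (F \<union> F') c s = eval (F \<union> F') c' s] (mod N)" by (rule eval_class[OF c])
  also have "[eval (F \<union> F') c' s = eval F' c' s] (mod N)" by (rule eval_mono[OF F(2) _ U]) simp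
  finally show ?thesis .
qed

text \<open>Every representative and every supporting set give the same residue by
  \<open>eval_unique\<close>, so the choice operator only replaces a canonical selection.\<close>

definition pairing :: "'a form \<times> ('a \<times> 'a \<Rightarrow> int) set \<Rightarrow> int" where
  "pairing = (\<lambda>(s, X)\<in>carrier SSG \<times> carrier (H2 G T \<Lambda>).
     SOME v. \<exists>c F. cocycle c \<and> X = cls c \<and> supports F c \<and> v = eval F c s mod N)"

lemma pairing_eq:
  assumes s: "s \<in> carrier SSG" and c: "cocycle c" and F: "supports F c"
  shows "pairing (s, cls c) = eval F c s mod N"
proof -
  let ?Q = "\<lambda>v. \<exists>c' F. cocycle c' \<and> cls c = cls c' \<and> supports F c' \<and> v = eval F c' s mod N"
  have "?Q (eval F c s mod N)" using c F by blast
  then have "?Q (SOME v. ?Q v)" by (rule someI)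
  then obtain c' F' where c': "cocycle c'" "cls c = cls c'" "supports F' c'" "(SOME v. ?Q v) = eval F' c' s mod N" by blast
  have "pairing (s, cls c) = (SOME v. ?Q v)" using s cls_in_H2[OF c] by (simp add: pairing_def)
  also have "\<dots> = eval F c s mod N"
    using eval_unique[OF c c'(1,2) F c'(3), of s] c'(4) by (simp add: cong_def)
  finally show ?thesis .
qed

lemma pairing_cong:
  assumes "s \<in> carrier SSG" "cocycle c" "supports F c"
  shows "[pairing (s, cls c) = eval F c s] (mod N)"
  using pairing_eq[OF assms] by (simp add: cong_def)

lemma pairing_in: "s \<in> carrier SSG \<Longrightarrow> X \<in> carrier (H2 G T \<Lambda>) \<Longrightarrow> pairing (s, X) \<in> carrier \<Lambda>"
proof -
  assume s: "s \<in> carrier SSG" and "X \<in> carrier (H2 G T \<Lambda>)"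
  then obtain c where c: "cocycle c" "X = cls c" by (elim H2_cases)
  obtain F where "supports F c" using supports_exists[OF c(1)] by blast
  from pairing_eq[OF s c(1) this] show ?thesis using c(2) by simp
qed

lemma hom_SS_fst: "p \<in> K \<times> K \<Longrightarrow> (\<lambda>s. fst s p) \<in> hom SSG \<Lambda>"
  using TT_D(2) by (auto simp: hom_def SS_simps TT_mult)

lemma hom_SS_snd: "x \<in> K \<Longrightarrow> (\<lambda>s. x (snd s)) \<in> hom SSG \<Lambda>"
  using H1_in H1_mult by (auto simp: hom_def SS_simps)

lemma pairing_hom_left:
  assumes X: "X \<in> carrier (H2 G T \<Lambda>)"
  shows "(\<lambda>s. pairing (s, X)) \<in> hom SSG \<Lambda>"
proof -
  interpret S: group SSG by (rule group_SS)
  obtain c where c: "cocycle c" "X = cls c" using X by (rule H2_cases)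
  obtain F where F: "supports F c" using supports_exists[OF c(1)] by blast
  have FI: "i \<in> I" if "i \<in> F" for i using F that by (auto simp: supports_def)
  have "pairing (s \<otimes>\<^bsub>SSG\<^esub> t, X) = (pairing (s, X) + pairing (t, X)) mod N"
    if st: "s \<in> carrier SSG" "t \<in> carrier SSG" for s t
  proof -
    have "[eval F c (s \<otimes>\<^bsub>SSG\<^esub> t) = (\<Sum>q\<in>opairs F. com c (unit (fst q)) (unit (snd q)) *
        (fst s (coord (fst q), coord (snd q)) + fst t (coord (fst q), coord (snd q)))) +
      (\<Sum>i\<in>F. pw c (unit i) * (coord i (snd s) + coord i (snd t)))] (mod N)"
      unfolding eval_def
      by (intro cong_add cong_sum cong_mult cong_refl hom_L_cong[OF hom_SS_fst] hom_L_cong[OF hom_SS_snd] st)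
        (auto simp: opairs_def FI coord_H1)
    also have "(\<Sum>q\<in>opairs F. com c (unit (fst q)) (unit (snd q)) *
        (fst s (coord (fst q), coord (snd q)) + fst t (coord (fst q), coord (snd q)))) +
      (\<Sum>i\<in>F. pw c (unit i) * (coord i (snd s) + coord i (snd t))) = eval F c s + eval F c t"
      unfolding eval_def distrib_left sum.distrib by simp
    also have "[eval F c s + eval F c t = pairing (s, X) + pairing (t, X)] (mod N)"
      unfolding c(2) by (intro cong_add cong_sym[OF pairing_cong] st c F)
    finally show ?thesis unfolding c(2) using pairing_eq[OF S.m_closed[OF st] c(1) F] by (simp add: cong_def)
  qed
  then show ?thesis using pairing_in X by (auto simp: hom_def)
qed

lemma pairing_hom_right:
  assumes s: "s \<in> carrier SSG"
  shows "(\<lambda>X. pairing (s, X)) \<in> hom (H2 G T \<Lambda>) \<Lambda>"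
proof -
  have "pairing (s, X \<otimes>\<^bsub>H2 G T \<Lambda>\<^esub> Y) = (pairing (s, X) + pairing (s, Y)) mod N"
    if XY: "X \<in> carrier (H2 G T \<Lambda>)" "Y \<in> carrier (H2 G T \<Lambda>)" for X Y
  proof -
    obtain c where c: "cocycle c" "X = cls c" using XY(1) by (rule H2_cases)
    obtain c' where c': "cocycle c'" "Y = cls c'" using XY(2) by (rule H2_cases)
    obtain F F' where F: "supports F c" "supports F' c'" using supports_exists c c' by blast
    \<comment> \<open>Over a common supporting set the two evaluations are sums over the same
      indices and can be added term by term.\<close>
    define J where "J = F \<union> F'"
    have JI: "F \<subseteq> J" "F' \<subseteq> J" "J \<subseteq> I" "finite J" using F by (auto simp: J_def supports_def)
    have J: "supports J c" "supports J c'"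
      by (rule supports_mono[OF F(1) JI(1,3,4)], rule supports_mono[OF F(2) JI(2,3,4)])
    have Jc: "supports J (\<lambda>p. c p + c' p)"
    proof -
      have "[com c (unit i) (unit j) + com c' (unit i) (unit j) = 0 + 0] (mod N)" if "i \<in> I - J" "j \<in> I" for i j
        using J that by (intro cong_add) (auto simp: supports_def)
      moreover have "[pw c (unit i) + pw c' (unit i) = 0 + 0] (mod N)" if "i \<in> I - J" for i
        using J that by (intro cong_add) (auto simp: supports_def)
      ultimately show ?thesis using J by (simp add: supports_def com_add pw_add)
    qed
    have "eval J (\<lambda>p. c p + c' p) s = eval J c s + eval J c' s"
      by (simp add: eval_def com_add pw_add distrib_right sum.distrib)
    moreover have "X \<otimes>\<^bsub>H2 G T \<Lambda>\<^esub> Y = cls (\<lambda>p. c p + c' p)" using c c' by (simp add: cls_add)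
    moreover have "cocycle (\<lambda>p. c p + c' p)" using c(1) c'(1) by (rule cocycle_add)
    ultimately show ?thesis using c c' J Jc s by (simp add: pairing_eq mod_simps)
  qed
  then show ?thesis using pairing_in s by (auto simp: hom_def)
qed

lemma unit_outside:
  assumes x: "x \<in> K" and F: "finite F" "F \<subseteq> I" and exp: "\<And>\<sigma>. \<sigma> \<in> carrier G \<Longrightarrow> [x \<sigma> = (\<Sum>i\<in>F. x (unit i) * coord i \<sigma>)] (mod N)"
    and k: "k \<in> I - F"
  shows "x (unit k) = 0"
proof -
  have "(\<Sum>i\<in>F. x (unit i) * coord i (unit k)) = 0"
    using k F by (intro sum.neutral) (auto simp: unit(2) subset_iff)
  then have "[x (unit k) = 0] (mod N)" using exp[OF unit(1), of k] by simp
  then show ?thesis using H1_in[OF x unit(1)] by (intro L_cong_eq) auto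
qed

text \<open>With x and y expanded in coordinates, antisymmetry unfolds the sum over oriented pairs
  into both orders, and the Bockstein terms become the diagonal. The result is the full double sum
  for f(x, y).\<close>

lemma pairing_cup:
  assumes s: "(f, g) \<in> carrier SSG" and x: "x \<in> K" and y: "y \<in> K"
  shows "pairing ((f, g), cup n G T x y) = f (x, y)"
proof -
  note D = SS_D[OF s]
  note TD = TT_D[OF D(1)]
  obtain Fx where Fx: "finite Fx" "Fx \<subseteq> I" "\<And>F'. finite F' \<Longrightarrow> Fx \<subseteq> F' \<Longrightarrow> F' \<subseteq> I \<Longrightarrow>
     \<forall>\<sigma>\<in>carrier G. [x \<sigma> = (\<Sum>i\<in>F'. x (unit i) * coord i \<sigma>)] (mod N)" using H1_expansion[OF x] by blast
  obtain Fy where Fy: "finite Fy" "Fy \<subseteq> I" "\<And>F'. finite F' \<Longrightarrow> Fy \<subseteq> F' \<Longrightarrow> F' \<subseteq> I \<Longrightarrow>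
     \<forall>\<sigma>\<in>carrier G. [y \<sigma> = (\<Sum>i\<in>F'. y (unit i) * coord i \<sigma>)] (mod N)" using H1_expansion[OF y] by blast
  define F where "F = Fx \<union> Fy"
  have F: "finite F" "F \<subseteq> I" using Fx Fy by (auto simp: F_def)
  have FI: "i \<in> I" if "i \<in> F" for i using F that by auto
  have ex: "[x \<sigma> = (\<Sum>i\<in>F. x (unit i) * coord i \<sigma>)] (mod N)" if "\<sigma> \<in> carrier G" for \<sigma>
    using Fx(3)[OF F(1) _ F(2)] that by (simp add: F_def)
  have ey: "[y \<sigma> = (\<Sum>i\<in>F. y (unit i) * coord i \<sigma>)] (mod N)" if "\<sigma> \<in> carrier G" for \<sigma>
    using Fy(3)[OF F(1) _ F(2)] that by (simp add: F_def)
  let ?c = "cup_cocycle x y"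
  let ?f = "\<lambda>i j. f (coord i, coord j)"
  have c: "cocycle ?c" by (rule cocycle_cup[OF x y])
  have pw: "[pw ?c (unit i) = int (n choose 2) * (x (unit i) * y (unit i))] (mod N)" for i
    by (rule pw_cup[OF x unit(1)])
  have supp: "supports F ?c"
    using F pw unit_outside[OF x F ex] unit_outside[OF y F ey]
    by (auto simp: supports_def com_cup) (metis mult_zero_left mult_zero_right)
  have "[eval F ?c (f, g) =
      (\<Sum>q\<in>opairs F. (x (unit (fst q)) * y (unit (snd q)) - x (unit (snd q)) * y (unit (fst q))) * ?f (fst q) (snd q)) +
      (\<Sum>i\<in>F. (int (n choose 2) * (x (unit i) * y (unit i))) * coord i g)] (mod N)"
    unfolding eval_def com_cup fst_conv snd_conv by (intro cong_add cong_sum cong_mult cong_refl pw)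
  also have "[(\<Sum>q\<in>opairs F. (x (unit (fst q)) * y (unit (snd q)) - x (unit (snd q)) * y (unit (fst q))) * ?f (fst q) (snd q)) +
      (\<Sum>i\<in>F. (int (n choose 2) * (x (unit i) * y (unit i))) * coord i g) =
      (\<Sum>q\<in>opairs F. x (unit (fst q)) * y (unit (snd q)) * ?f (fst q) (snd q) + x (unit (snd q)) * y (unit (fst q)) * ?f (snd q) (fst q)) +
      (\<Sum>i\<in>F. x (unit i) * y (unit i) * ?f i i)] (mod N)"
  proof (intro cong_add cong_sum)
    fix q assume "q \<in> opairs F"
    then have q: "coord (fst q) \<in> K" "coord (snd q) \<in> K" using FI coord_H1 by (auto simp: opairs_def)
    have "[x (unit (fst q)) * y (unit (snd q)) * ?f (fst q) (snd q) + x (unit (snd q)) * y (unit (fst q)) * - ?f (fst q) (snd q)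
       = x (unit (fst q)) * y (unit (snd q)) * ?f (fst q) (snd q) + x (unit (snd q)) * y (unit (fst q)) * ?f (snd q) (fst q)] (mod N)"
      by (intro cong_add cong_mult cong_refl cong_sym[OF SS_antisym[OF s q]])
    then show "[(x (unit (fst q)) * y (unit (snd q)) - x (unit (snd q)) * y (unit (fst q))) * ?f (fst q) (snd q) =
       x (unit (fst q)) * y (unit (snd q)) * ?f (fst q) (snd q) + x (unit (snd q)) * y (unit (fst q)) * ?f (snd q) (fst q)] (mod N)"
      by (simp add: algebra_simps)
  next
    fix i assume "i \<in> F"
    then have i: "coord i \<in> K" using FI coord_H1 by auto
    \<comment> \<open>The defining condition of \<SS> trades the binomial multiple of the coordinate
      of g for the diagonal value of f.\<close>
    have "[x (unit i) * y (unit i) * (int (n choose 2) * coord i g) = x (unit i) * y (unit i) * ?f i i] (mod N)"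
      by (intro cong_mult cong_refl cong_sym[OF D(3)[OF i]])
    then show "[(int (n choose 2) * (x (unit i) * y (unit i))) * coord i g = x (unit i) * y (unit i) * ?f i i] (mod N)"
      by (simp add: algebra_simps)
  qed
  also have "(\<Sum>q\<in>opairs F. x (unit (fst q)) * y (unit (snd q)) * ?f (fst q) (snd q) + x (unit (snd q)) * y (unit (fst q)) * ?f (snd q) (fst q)) +
      (\<Sum>i\<in>F. x (unit i) * y (unit i) * ?f i i) = (\<Sum>q\<in>F \<times> F. x (unit (fst q)) * y (unit (snd q)) * ?f (fst q) (snd q))"
    using sum_square[OF F(1), of "\<lambda>q. x (unit (fst q)) * y (unit (snd q)) * ?f (fst q) (snd q)"] by simp
  also have "\<dots> = (\<Sum>i\<in>F. x (unit i) * (\<Sum>j\<in>F. y (unit j) * ?f i j))"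
    by (simp add: sum.cartesian_product sum_distrib_left mult.assoc case_prod_unfold)
  also have "[\<dots> = (\<Sum>i\<in>F. x (unit i) * f (coord i, y))] (mod N)"
    by (intro cong_sum cong_mult cong_refl cong_sym[OF hom_H1_sum[OF TD(6) y]] coord_H1 FI ey)
  also have "[(\<Sum>i\<in>F. x (unit i) * f (coord i, y)) = f (x, y)] (mod N)"
    by (intro cong_sym[OF hom_H1_sum[OF TD(5)[OF y] x]] coord_H1 FI ex)
  finally have "[eval F ?c (f, g) = f (x, y)] (mod N)" .
  then have "pairing ((f, g), cls ?c) = f (x, y) mod N"
    using pairing_eq[OF s c supp] by (simp add: cong_def)
  then show ?thesis using TD(2)[OF x y] by (simp add: cup_eq)
qed

text \<open>Only the \<open>pw\<close> part of \<open>eval\<close> survives, with coefficients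
  z(unit i), and the expansion of z in coordinates sums it up to z(g).\<close>

lemma pairing_bockstein:
  assumes s: "(f, g) \<in> carrier SSG" and z: "z \<in> K"
  shows "pairing ((f, g), bockstein n G T z) = z g"
proof -
  note D = SS_D[OF s]
  obtain F where F: "finite F" "F \<subseteq> I" and Fz: "\<And>F'. finite F' \<Longrightarrow> F \<subseteq> F' \<Longrightarrow> F' \<subseteq> I \<Longrightarrow>
     \<forall>\<sigma>\<in>carrier G. [z \<sigma> = (\<Sum>i\<in>F'. z (unit i) * coord i \<sigma>)] (mod N)" using H1_expansion[OF z] by blast
  have ez: "[z \<sigma> = (\<Sum>i\<in>F. z (unit i) * coord i \<sigma>)] (mod N)" if "\<sigma> \<in> carrier G" for \<sigma>
    using Fz[OF F(1) _ F(2)] that by simp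
  let ?c = "bock_cocycle z"
  have c: "cocycle ?c" by (rule bockstein_cls(2)[OF z])
  note b = bock_exists[OF z]
  have pw: "[pw ?c (unit i) = z (unit i)] (mod N)" for i by (rule pw_bock[OF exponent b unit(1)])
  have com: "[com ?c (unit i) (unit j) = 0] (mod N)" for i j by (rule com_bock[OF comm_group_G b unit(1) unit(1)])
  have supp: "supports F ?c"
    unfolding supports_def
  proof (intro conjI ballI F com)
    fix i assume "i \<in> I - F"
    from pw[of i] unit_outside[OF z F ez this] show "[pw ?c (unit i) = 0] (mod N)" by simp
  qed
  have "[eval F ?c (f, g) = (\<Sum>q\<in>opairs F. 0 * fst (f, g) (coord (fst q), coord (snd q))) + (\<Sum>i\<in>F. z (unit i) * coord i (snd (f, g)))] (mod N)"
    unfolding eval_def by (intro cong_add cong_sum cong_mult cong_refl pw com)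
  then have "[eval F ?c (f, g) = (\<Sum>i\<in>F. z (unit i) * coord i g)] (mod N)" by simp
  also have "[(\<Sum>i\<in>F. z (unit i) * coord i g) = z g] (mod N)" by (rule cong_sym[OF ez[OF D(2)]])
  finally have "pairing ((f, g), cls ?c) = z g mod N"
    using pairing_eq[OF s c supp] by (simp add: cong_def)
  then show ?thesis using H1_in[OF z D(2)] by (simp add: bockstein_cls(1)[OF z])
qed

end

section \<open>Commutators and powers as functionals on H^2\<close>

context mod_power
begin

text \<open>Turns \<open>com\<close> and \<open>pw\<close> modulo n into functions on H^2, which are
  homomorphisms and can be compared with the pairing on generators.\<close>

definition rep :: "('a \<times> 'a \<Rightarrow> int) set \<Rightarrow> 'a \<times> 'a \<Rightarrow> int" where
  "rep X = (SOME c. cocycle c \<and> X = cls c)"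

lemma rep: "X \<in> carrier (H2 G T \<Lambda>) \<Longrightarrow> cocycle (rep X) \<and> X = cls (rep X)"
proof -
  assume "X \<in> carrier (H2 G T \<Lambda>)"
  then obtain c where "cocycle c" "X = cls c" by (rule H2_cases)
  then show ?thesis unfolding rep_def using someI[of "\<lambda>c. cocycle c \<and> X = cls c" c] by simp
qed

lemma com_pw_rep:
  assumes "cocycle c"
  shows "\<sigma> \<in> carrier G \<Longrightarrow> \<tau> \<in> carrier G \<Longrightarrow> [com (rep (cls c)) \<sigma> \<tau> = com c \<sigma> \<tau>] (mod N)"
    and "\<sigma> \<in> carrier G \<Longrightarrow> [pw (rep (cls c)) \<sigma> = pw c \<sigma>] (mod N)"
  using com_pw_class[OF comm_group_G exponent, of "rep (cls c)" c] rep[OF cls_in_H2[OF assms]] assms by auto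

lemma com_hom:
  assumes g: "\<sigma> \<in> carrier G" "\<tau> \<in> carrier G"
  shows "(\<lambda>X. com (rep X) \<sigma> \<tau> mod N) \<in> hom (H2 G T \<Lambda>) \<Lambda>"
proof -
  have "com (rep (X \<otimes>\<^bsub>H2 G T \<Lambda>\<^esub> Y)) \<sigma> \<tau> mod N = (com (rep X) \<sigma> \<tau> mod N + com (rep Y) \<sigma> \<tau> mod N) mod N"
    if X: "X \<in> carrier (H2 G T \<Lambda>)" and Y: "Y \<in> carrier (H2 G T \<Lambda>)" for X Y
  proof -
    note r = rep[OF X] rep[OF Y]
    have "X \<otimes>\<^bsub>H2 G T \<Lambda>\<^esub> Y = cls (\<lambda>p. rep X p + rep Y p)" using r cls_add by metis
    then show ?thesis
      using com_pw_rep(1)[OF cocycle_add[of "rep X" "rep Y"] g] r by (simp add: com_add cong_def mod_simps)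
  qed
  then show ?thesis by (auto simp: hom_def)
qed

lemma pw_hom:
  assumes g: "\<sigma> \<in> carrier G"
  shows "(\<lambda>X. pw (rep X) \<sigma> mod N) \<in> hom (H2 G T \<Lambda>) \<Lambda>"
proof -
  have "pw (rep (X \<otimes>\<^bsub>H2 G T \<Lambda>\<^esub> Y)) \<sigma> mod N = (pw (rep X) \<sigma> mod N + pw (rep Y) \<sigma> mod N) mod N"
    if X: "X \<in> carrier (H2 G T \<Lambda>)" and Y: "Y \<in> carrier (H2 G T \<Lambda>)" for X Y
  proof -
    note r = rep[OF X] rep[OF Y]
    have "X \<otimes>\<^bsub>H2 G T \<Lambda>\<^esub> Y = cls (\<lambda>p. rep X p + rep Y p)" using r cls_add by metis
    then show ?thesis
      using com_pw_rep(2)[OF cocycle_add[of "rep X" "rep Y"] g] r by (simp add: pw_add cong_def mod_simps)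
  qed
  then show ?thesis by (auto simp: hom_def)
qed

subsection \<open>The elements of \<open>\<SS>\<close> attached to commutators and powers\<close>

lemma tensor_eq: "tensor n G T \<sigma> \<tau> = (\<lambda>p\<in>K \<times> K. (fst p \<sigma> * snd p \<tau>) mod N)"
  by (simp add: tensor_def Let_def case_prod_unfold)

lemma tensor_TT:
  assumes "\<sigma> \<in> carrier G" "\<tau> \<in> carrier G"
  shows "tensor n G T \<sigma> \<tau> \<in> carrier TT"
proof (rule TT_I)
  fix x x' y assume K: "x \<in> K" "x' \<in> K" "y \<in> K"
  have "(x \<otimes>\<^bsub>H1 G T \<Lambda>\<^esub> x') \<sigma> = (x \<sigma> + x' \<sigma>) mod N" using assms by (simp add: H1_mult_eq red1_def)
  then show "[tensor n G T \<sigma> \<tau> (x \<otimes>\<^bsub>H1 G T \<Lambda>\<^esub> x', y) = tensor n G T \<sigma> \<tau> (x, y) + tensor n G T \<sigma> \<tau> (x', y)] (mod N)"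
    using K by (simp add: tensor_eq H1_mult_closed cong_def mod_simps distrib_right)
next
  fix x y y' assume K: "x \<in> K" "y \<in> K" "y' \<in> K"
  have "(y \<otimes>\<^bsub>H1 G T \<Lambda>\<^esub> y') \<tau> = (y \<tau> + y' \<tau>) mod N" using assms by (simp add: H1_mult_eq red1_def)
  then show "[tensor n G T \<sigma> \<tau> (x, y \<otimes>\<^bsub>H1 G T \<Lambda>\<^esub> y') = tensor n G T \<sigma> \<tau> (x, y) + tensor n G T \<sigma> \<tau> (x, y')] (mod N)"
    using K by (simp add: tensor_eq H1_mult_closed cong_def mod_simps distrib_left)
qed (auto simp: tensor_eq)

abbreviation "comm_form \<sigma> \<tau> \<equiv> (tensor n G T \<sigma> \<tau> \<otimes>\<^bsub>TT\<^esub> inv\<^bsub>TT\<^esub> (tensor n G T \<tau> \<sigma>), \<one>)"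
abbreviation "pow_form \<sigma> \<equiv> (tensor n G T \<sigma> \<sigma> [^]\<^bsub>TT\<^esub> (n choose 2), \<sigma>)"

lemma comm_form_apply:
  assumes "\<sigma> \<in> carrier G" "\<tau> \<in> carrier G" "x \<in> K" "y \<in> K"
  shows "fst (comm_form \<sigma> \<tau>) (x, y) = (x \<sigma> * y \<tau> - x \<tau> * y \<sigma>) mod N"
  using assms(3,4) unfolding fst_conv TT_mult TT_inv[OF tensor_TT[OF assms(2,1)]]
  by (simp add: tensor_eq mod_simps)

lemma pow_form_apply:
  assumes "\<sigma> \<in> carrier G" "x \<in> K" "y \<in> K"
  shows "fst (pow_form \<sigma>) (x, y) = (int (n choose 2) * (x \<sigma> * y \<sigma>)) mod N"
  using assms(2,3) unfolding fst_conv TT_pow[OF tensor_TT[OF assms(1,1)]]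
  by (simp add: tensor_eq mod_simps)

lemma comm_form_SS:
  assumes g: "\<sigma> \<in> carrier G" "\<tau> \<in> carrier G"
  shows "comm_form \<sigma> \<tau> \<in> carrier SSG"
proof -
  interpret TT: group TT by (rule group_TT)
  have "fst (comm_form \<sigma> \<tau>) (x, x) = (int (n choose 2) * x \<one>) mod N" if "x \<in> K" for x
    unfolding comm_form_apply[OF g that that] using H1_one[OF that] by simp
  then show ?thesis using tensor_TT g by (simp add: SS_simps)
qed

text \<open>The diagonal condition needs (n choose 2) a^2 = (n choose 2) a modulo n for a =
  x(\<sigma>). It is obtained by evaluating \<open>pw\<close> on the two representatives of the
  class in \<open>cls_cup_same\<close>.\<close>

lemma pow_form_SS:
  assumes g: "\<sigma> \<in> carrier G"
  shows "pow_form \<sigma> \<in> carrier SSG"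
proof -
  interpret TT: group TT by (rule group_TT)
  have "fst (pow_form \<sigma>) (x, x) = (int (n choose 2) * x \<sigma>) mod N" if x: "x \<in> K" for x
  proof -
    have "[pw (cup_cocycle x x) \<sigma> = pw (\<lambda>p. int (n choose 2) * bock_cocycle x p) \<sigma>] (mod N)"
      using com_pw_class(2)[OF comm_group_G exponent cocycle_cup[OF x x] cocycle_scale[OF bockstein_cls(2)[OF x]] cls_cup_same[OF x] g] .
    moreover have "pw (\<lambda>p. int (n choose 2) * bock_cocycle x p) \<sigma> = int (n choose 2) * pw (bock_cocycle x) \<sigma>"
      by (simp add: pw_def sum_distrib_left)
    moreover have "[int (n choose 2) * pw (bock_cocycle x) \<sigma> = int (n choose 2) * x \<sigma>] (mod N)"
      by (intro cong_mult cong_refl pw_bock[OF exponent bock_exists[OF x] g])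
    ultimately have "[int (n choose 2) * (x \<sigma> * x \<sigma>) = int (n choose 2) * x \<sigma>] (mod N)"
      using pw_cup[OF x g, of x] by (metis cong_sym cong_trans)
    then show ?thesis unfolding pow_form_apply[OF g x x] by (simp add: cong_def)
  qed
  then show ?thesis using tensor_TT g by (simp add: SS_simps)
qed

text \<open>Both sides are homomorphisms in the class. On cup products both give x(\<sigma>)
  y(\<tau>) - x(\<tau>) y(\<sigma>); on Bockstein classes both vanish, the second component of the
  form being the identity.\<close>

lemma pairing_comm_form:
  assumes g: "\<sigma> \<in> carrier G" "\<tau> \<in> carrier G" and c: "cocycle c"
  shows "pairing (comm_form \<sigma> \<tau>, cls c) = com c \<sigma> \<tau> mod N"
proof -
  have "pairing (comm_form \<sigma> \<tau>, cls c) = com (rep (cls c)) \<sigma> \<tau> mod N"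
  proof (rule hom_H2_eqI[where h = "\<lambda>X. pairing (comm_form \<sigma> \<tau>, X)" and h' = "\<lambda>X. com (rep X) \<sigma> \<tau> mod N"])
    show "[pairing (comm_form \<sigma> \<tau>, cup n G T x y) = com (rep (cup n G T x y)) \<sigma> \<tau> mod N] (mod N)"
      if K: "x \<in> K" "y \<in> K" for x y
      unfolding pairing_cup[OF comm_form_SS[OF g] K]
      using com_pw_rep(1)[OF cocycle_cup[OF K] g] comm_form_apply[OF g K] by (simp add: cup_eq com_cup cong_def)
    show "[pairing (comm_form \<sigma> \<tau>, bockstein n G T z) = com (rep (bockstein n G T z)) \<sigma> \<tau> mod N] (mod N)"
      if z: "z \<in> K" for z
      using pairing_bockstein[OF comm_form_SS[OF g] z] H1_one[OF z] bockstein_cls(1)[OF z]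
        cong_trans[OF com_pw_rep(1)[OF bockstein_cls(2)[OF z] g] com_bock[OF comm_group_G bock_exists[OF z] g]]
      by (simp add: cong_def)
  qed (use g c in \<open>auto intro: pairing_hom_right comm_form_SS com_hom cls_in_H2\<close>)
  then show ?thesis using com_pw_rep(1)[OF c g] by (simp add: cong_def)
qed

text \<open>Again a comparison on generators: (n choose 2) x(\<sigma>) y(\<sigma>) on cup products
  and z(\<sigma>) on Bockstein classes.\<close>

lemma pairing_pow_form:
  assumes g: "\<sigma> \<in> carrier G" and c: "cocycle c"
  shows "pairing (pow_form \<sigma>, cls c) = pw c \<sigma> mod N"
proof -
  have "pairing (pow_form \<sigma>, cls c) = pw (rep (cls c)) \<sigma> mod N"
  proof (rule hom_H2_eqI[where h = "\<lambda>X. pairing (pow_form \<sigma>, X)" and h' = "\<lambda>X. pw (rep X) \<sigma> mod N"])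
    show "[pairing (pow_form \<sigma>, cup n G T x y) = pw (rep (cup n G T x y)) \<sigma> mod N] (mod N)"
      if K: "x \<in> K" "y \<in> K" for x y
      unfolding pairing_cup[OF pow_form_SS[OF g] K]
      using cong_trans[OF com_pw_rep(2)[OF cocycle_cup[OF K] g] pw_cup[OF K(1) g]] pow_form_apply[OF g K]
      by (simp add: cup_eq cong_def)
    show "[pairing (pow_form \<sigma>, bockstein n G T z) = pw (rep (bockstein n G T z)) \<sigma> mod N] (mod N)"
      if z: "z \<in> K" for z
      using pairing_bockstein[OF pow_form_SS[OF g] z] bockstein_cls(1)[OF z]
        cong_trans[OF com_pw_rep(2)[OF bockstein_cls(2)[OF z] g] pw_bock[OF exponent bock_exists[OF z] g]]
      by (simp add: cong_def)
  qed (use g c in \<open>auto intro: pairing_hom_right pow_form_SS pw_hom cls_in_H2\<close>)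
  then show ?thesis using com_pw_rep(2)[OF c g] by (simp add: cong_def)
qed

text \<open>Pairing with the commutator and power elements of \<SS> already recovers
  \<open>com\<close> and \<open>pw\<close> of a representative, and these detect the class.\<close>

lemma pairing_nondegenerate:
  assumes X: "X \<in> carrier (H2 G T \<Lambda>)" and 0: "\<And>s. s \<in> carrier SSG \<Longrightarrow> pairing (s, X) = 0"
  shows "X = \<one>\<^bsub>H2 G T \<Lambda>\<^esub>"
proof -
  obtain c where c: "cocycle c" "X = cls c" using X by (rule H2_cases)
  have "[com c \<sigma> \<tau> = 0] (mod N)" if "\<sigma> \<in> carrier G" "\<tau> \<in> carrier G" for \<sigma> \<tau>
    using pairing_comm_form[OF that c(1)] 0[OF comm_form_SS[OF that]] c(2) by (simp add: cong_def)
  moreover have "[pw c \<sigma> = 0] (mod N)" if "\<sigma> \<in> carrier G" for \<sigma>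
    using pairing_pow_form[OF that c(1)] 0[OF pow_form_SS[OF that]] c(2) by (simp add: cong_def)
  ultimately show ?thesis unfolding c(2) by (intro class_trivial_iff c)
qed

subsection \<open>Topology of \<open>\<SS>\<close>\<close>

abbreviation "PX \<equiv> prod_topology (product_topology (\<lambda>_. discrete_topology (carrier \<Lambda>)) (K \<times> K)) T"
abbreviation "SST \<equiv> SS_topology n G T"

lemma SST_eq: "SST = subtopology PX (carrier SSG)"
  by (simp add: SS_topology_def Let_def)

lemma SS_subset: "carrier SSG \<subseteq> topspace PX"
  using topspace by (auto simp: SS_simps carrier_TT)

lemma topspace_SST: "topspace SST = carrier SSG"
  unfolding SST_eq topspace_subtopology using SS_subset by blast

lemma loc_const_fst: "p \<in> K \<times> K \<Longrightarrow> loc_const PX (\<lambda>s. fst s p)"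
proof -
  assume p: "p \<in> K \<times> K"
  have "continuous_map PX (discrete_topology (carrier \<Lambda>)) ((\<lambda>v. v p) \<circ> fst)"
    by (rule continuous_map_compose[OF continuous_map_fst continuous_map_product_projection[OF p]])
  then show ?thesis using p by (subst (asm) loc_const_iff) (auto simp: o_def)
qed

lemma loc_const_snd: "x \<in> K \<Longrightarrow> loc_const PX (\<lambda>s. x (snd s))"
  using loc_const_compose[OF continuous_map_snd H1_lc] .

lemma loc_const_SST: "loc_const PX h \<Longrightarrow> loc_const SST h"
  using loc_const_compose[of SST PX "\<lambda>x. x" h] unfolding SST_eq
  by (simp add: continuous_map_from_subtopology)

text \<open>The ambient product is compact, and bilinearity together with the diagonal condition are
  closed conditions, each involving only finitely many entries.\<close>

lemma compact_space_SST: "compact_space SST"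
proof -
  have PX: "compact_space PX"
    using compact_space_T
    by (simp add: compact_space_prod_topology compact_space_product_topology compact_space_discrete_topology carrier_L)
  \<comment> \<open>One triple encodes additivity in the first argument, additivity in the second
    (with y as the first argument), and the diagonal condition at x.\<close>
  define A where "A = (\<lambda>(x, x', y). {s \<in> topspace PX.
     ((fst s (x \<otimes>\<^bsub>H1 G T \<Lambda>\<^esub> x', y), fst s (x, y), fst s (x', y)), (fst s (y, x \<otimes>\<^bsub>H1 G T \<Lambda>\<^esub> x'), fst s (y, x), fst s (y, x')),
      (fst s (x, x), x (snd s))) \<in> {((a, b, c), (d, e, f), (g, h)). [a = b + c] (mod N) \<and> [d = e + f] (mod N) \<and> g = (int (n choose 2) * h) mod N}})"
  have clA: "closedin PX (A k)" if k: "k \<in> K \<times> K \<times> K" for k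
  proof -
    obtain x x' y where k': "k = (x, x', y)" "x \<in> K" "x' \<in> K" "y \<in> K" using k by auto
    show ?thesis unfolding A_def k'(1) prod.case
      by (rule loc_const_closedin) (intro loc_const_map2[where h = Pair] loc_const_fst loc_const_snd; simp add: k' H1_mult_closed)
  qed
  have "closedin PX (\<Inter> (insert (topspace PX) (A ` (K \<times> K \<times> K))))"
  proof (rule closedin_Inter)
    fix S assume "S \<in> insert (topspace PX) (A ` (K \<times> K \<times> K))"
    then show "closedin PX S" using closedin_topspace[of PX] clA by blast
  qed simp
  moreover have "carrier SSG = \<Inter> (insert (topspace PX) (A ` (K \<times> K \<times> K)))"
  proof (intro subset_antisym subsetI)
    fix s assume s: "s \<in> carrier SSG"
    obtain f g where fg: "s = (f, g)" by (cases s)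
    have sP: "s \<in> topspace PX" using s SS_subset by blast
    have "s \<in> A (x, x', y)" if "x \<in> K" "x' \<in> K" "y \<in> K" for x x' y
    proof -
      have f: "f \<in> carrier TT" and fx: "f (x, x) = (int (n choose 2) * x g) mod N"
        using s that(1) by (auto simp: fg SS_simps)
      show ?thesis using TT_D(3)[OF f that] TT_D(4)[OF f that(3,1,2)] fx sP[unfolded fg]
        by (simp add: A_def fg)
    qed
    then show "s \<in> \<Inter> (insert (topspace PX) (A ` (K \<times> K \<times> K)))" using sP by auto
  next
    fix s assume s: "s \<in> \<Inter> (insert (topspace PX) (A ` (K \<times> K \<times> K)))"
    obtain f g where fg: "s = (f, g)" by (cases s)
    have sP: "f \<in> K \<times> K \<rightarrow>\<^sub>E carrier \<Lambda>" "g \<in> carrier G" using s topspace by (auto simp: fg)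
    have A: "s \<in> A (x, x', y)" if "x \<in> K" "x' \<in> K" "y \<in> K" for x x' y
      by (rule InterD[OF s]) (rule insertI2, rule imageI, use that in simp)
    have "f \<in> carrier TT"
    proof (rule TT_I)
      show "[f (x \<otimes>\<^bsub>H1 G T \<Lambda>\<^esub> x', y) = f (x, y) + f (x', y)] (mod N)" if "x \<in> K" "x' \<in> K" "y \<in> K" for x x' y
        using A[OF that] by (simp add: A_def fg)
      show "[f (x, y \<otimes>\<^bsub>H1 G T \<Lambda>\<^esub> y') = f (x, y) + f (x, y')] (mod N)" if "x \<in> K" "y \<in> K" "y' \<in> K" for x y y'
        using A[OF that(2,3,1)] by (simp add: A_def fg)
    qed (use sP in \<open>auto simp: PiE_iff\<close>)
    moreover have "f (x, x) = (int (n choose 2) * x g) mod N" if "x \<in> K" for x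
      using A[OF that that that] by (simp add: A_def fg)
    ultimately show "s \<in> carrier SSG" using sP by (simp add: fg SS_simps)
  qed
  ultimately have "closedin PX (carrier SSG)" by simp
  then show ?thesis unfolding SST_eq using PX closedin_compact_space compact_space_subtopology by blast
qed

lemma pairing_loc_const:
  assumes X: "X \<in> carrier (H2 G T \<Lambda>)"
  shows "loc_const SST (\<lambda>s. pairing (s, X))"
proof -
  obtain c where c: "cocycle c" "X = cls c" using X by (rule H2_cases)
  obtain F where F: "supports F c" using supports_exists[OF c(1)] by blast
  have FI: "i \<in> I" if "i \<in> F" for i using F that by (auto simp: supports_def)
  have "loc_const PX (\<lambda>s. com c (unit (fst q)) (unit (snd q)) * fst s (coord (fst q), coord (snd q)))" if "q \<in> opairs F" for q
    using that FI by (intro loc_const_map[OF loc_const_fst, where h = "\<lambda>a. com c (unit (fst q)) (unit (snd q)) * a"])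
      (auto simp: opairs_def coord_H1)
  moreover have "loc_const PX (\<lambda>s. pw c (unit i) * coord i (snd s))" if "i \<in> F" for i
    using that FI by (intro loc_const_map[OF loc_const_snd, where h = "\<lambda>a. pw c (unit i) * a"] coord_H1)
  ultimately have "loc_const PX (\<lambda>s. eval F c s)" unfolding eval_def
    by (intro loc_const_map2[where h = "(+)"] loc_const_sum)
  then have "loc_const SST (\<lambda>s. eval F c s mod N)" by (intro loc_const_SST loc_const_map[where h = "\<lambda>a. a mod N"])
  then show ?thesis
    by (subst loc_const_cong[of _ _ "\<lambda>s. eval F c s mod N"]) (auto simp: topspace_SST c pairing_eq F)
qed

subsection \<open>Perfectness\<close>

text \<open>The element (f, g) is forced: f is h on cup products, and g has as coordinates the
  values of h on the Bockstein classes of the coordinates. The pair lies in \<SS> because h respects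
  \<open>cls_cup_same\<close>.\<close>

lemma hom_H2_realized:
  assumes h: "h \<in> hom (H2 G T \<Lambda>) \<Lambda>"
  shows "\<exists>s\<in>carrier SSG. \<forall>X\<in>carrier (H2 G T \<Lambda>). pairing (s, X) = h X"
proof -
  define f where "f = (\<lambda>p\<in>K \<times> K. h (cls (cup_cocycle (fst p) (snd p))))"
  have hin: "h (cls c) \<in> carrier \<Lambda>" if "cocycle c" for c
    using hom_in_carrier[OF h cls_in_H2[OF that]] .
  have f: "f \<in> carrier TT"
  proof (rule TT_I)
    fix x x' y assume K: "x \<in> K" "x' \<in> K" "y \<in> K"
    have "cls (cup_cocycle (x \<otimes>\<^bsub>H1 G T \<Lambda>\<^esub> x') y) = cls (\<lambda>p. cup_cocycle x y p + cup_cocycle x' y p)"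
      using K by (intro cls_cong cocycle_cup cocycle_add H1_mult_closed)
        (auto simp: cup_cocycle_def H1_mult_eq red1_def cong_def mod_simps distrib_right)
    then show "[f (x \<otimes>\<^bsub>H1 G T \<Lambda>\<^esub> x', y) = f (x, y) + f (x', y)] (mod N)"
      using hom_cls_add[OF h cocycle_cup[OF K(1,3)] cocycle_cup[OF K(2,3)]] K by (simp add: f_def H1_mult_closed)
  next
    fix x y y' assume K: "x \<in> K" "y \<in> K" "y' \<in> K"
    have "cls (cup_cocycle x (y \<otimes>\<^bsub>H1 G T \<Lambda>\<^esub> y')) = cls (\<lambda>p. cup_cocycle x y p + cup_cocycle x y' p)"
      using K by (intro cls_cong cocycle_cup cocycle_add H1_mult_closed)
        (auto simp: cup_cocycle_def H1_mult_eq red1_def cong_def mod_simps distrib_left)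
    then show "[f (x, y \<otimes>\<^bsub>H1 G T \<Lambda>\<^esub> y') = f (x, y) + f (x, y')] (mod N)"
      using hom_cls_add[OF h cocycle_cup[OF K(1,2)] cocycle_cup[OF K(1,3)]] K by (simp add: f_def H1_mult_closed)
  qed (auto simp: f_def intro!: hin cocycle_cup)
  \<comment> \<open>Every family of residues occurs as coordinates, since the group is the full
    product over I.\<close>
  have "\<exists>g\<in>carrier G. \<forall>i\<in>I. coord i g = h (cls (bock_cocycle (coord i)))"
    by (intro coord_surj hin bockstein_cls(2) coord_H1)
  then obtain g where g: "g \<in> carrier G" "\<And>i. i \<in> I \<Longrightarrow> coord i g = h (cls (bock_cocycle (coord i)))" by blast
  have zg: "[z g = h (cls (bock_cocycle z))] (mod N)" if z: "z \<in> K" for z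
  proof -
    obtain F where F: "finite F" "F \<subseteq> I" and Fz: "\<And>F'. finite F' \<Longrightarrow> F \<subseteq> F' \<Longrightarrow> F' \<subseteq> I \<Longrightarrow>
       \<forall>\<sigma>\<in>carrier G. [z \<sigma> = (\<Sum>i\<in>F'. z (unit i) * coord i \<sigma>)] (mod N)" using H1_expansion[OF z] by blast
    have ez: "[z \<sigma> = (\<Sum>i\<in>F. z (unit i) * coord i \<sigma>)] (mod N)" if "\<sigma> \<in> carrier G" for \<sigma>
      using Fz[OF F(1) _ F(2)] that by simp
    have cK: "coord i \<in> K" if "i \<in> F" for i using F that coord_H1 by auto
    have "[z g = (\<Sum>i\<in>F. z (unit i) * coord i g)] (mod N)" by (rule ez[OF g(1)])
    also have "(\<Sum>i\<in>F. z (unit i) * coord i g) = (\<Sum>i\<in>F. z (unit i) * h (cls (bock_cocycle (coord i))))"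
      using F g(2) by (intro sum.cong) auto
    also have "[(\<Sum>i\<in>F. z (unit i) * h (cls (bock_cocycle (coord i)))) = h (cls (\<lambda>p. \<Sum>i\<in>F. z (unit i) * bock_cocycle (coord i) p))] (mod N)"
      by (rule cong_sym[OF hom_cls_sum[OF h]]) (intro bockstein_cls(2) cK)
    also have "cls (\<lambda>p. \<Sum>i\<in>F. z (unit i) * bock_cocycle (coord i) p) = cls (bock_cocycle z)"
      by (rule cls_bock_sum[OF z cK ez, symmetric])
    finally show ?thesis .
  qed
  have s: "(f, g) \<in> carrier SSG"
  proof -
    have "f (x, x) = (int (n choose 2) * x g) mod N" if x: "x \<in> K" for x
    proof -
      have "f (x, x) = h (cls (\<lambda>p. int (n choose 2) * bock_cocycle x p))"
        using x by (simp add: f_def cls_cup_same)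
      moreover have "[h (cls (\<lambda>p. int (n choose 2) * bock_cocycle x p)) = int (n choose 2) * h (cls (bock_cocycle x))] (mod N)"
        by (rule hom_cls_scale[OF h bockstein_cls(2)[OF x]])
      moreover have "[int (n choose 2) * h (cls (bock_cocycle x)) = int (n choose 2) * x g] (mod N)"
        by (intro cong_mult cong_refl cong_sym[OF zg[OF x]])
      ultimately have "[f (x, x) = int (n choose 2) * x g] (mod N)" using cong_trans by metis
      then show ?thesis using TT_D(2)[OF f x x] by (simp add: cong_def)
    qed
    then show ?thesis using f g by (simp add: SS_simps)
  qed
  show ?thesis
  proof (intro bexI[OF _ s] ballI, rule hom_H2_eqI[where h' = h and h = "\<lambda>X. pairing ((f, g), X)"])
    show "[pairing ((f, g), cup n G T x y) = h (cup n G T x y)] (mod N)" if "x \<in> K" "y \<in> K" for x y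
      unfolding pairing_cup[OF s that] using that by (simp add: f_def cup_eq)
    show "[pairing ((f, g), bockstein n G T z) = h (bockstein n G T z)] (mod N)" if "z \<in> K" for z
      unfolding pairing_bockstein[OF s that] using zg[OF that] by (simp add: bockstein_cls(1)[OF that])
  qed (use h s in \<open>auto intro: pairing_hom_right\<close>)
qed

lemma SS_eqI:
  assumes s: "s \<in> carrier SSG" and t: "t \<in> carrier SSG"
    and eq: "\<And>X. X \<in> carrier (H2 G T \<Lambda>) \<Longrightarrow> pairing (s, X) = pairing (t, X)"
  shows "s = t"
proof -
  obtain f g where fg: "s = (f, g)" by (cases s)
  obtain f' g' where fg': "t = (f', g')" by (cases t)
  note D = SS_D[OF s[unfolded fg]] and D' = SS_D[OF t[unfolded fg']]
  have "f = f'"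
  proof (rule extensionalityI[of _ "K \<times> K"])
    fix p assume "p \<in> K \<times> K"
    then obtain x y where p: "p = (x, y)" "x \<in> K" "y \<in> K" by auto
    have "cup n G T x y \<in> carrier (H2 G T \<Lambda>)" using p by (simp add: cup_eq cls_in_H2 cocycle_cup)
    from eq[OF this] show "f p = f' p"
      using pairing_cup[OF s[unfolded fg] p(2,3)] pairing_cup[OF t[unfolded fg'] p(2,3)] by (simp add: fg fg' p)
  qed (use TT_D(1) D D' in auto)
  moreover have "g = g'"
  proof (rule coord_eqI)
    fix i assume "i \<in> I"
    then have i: "coord i \<in> K" by (rule coord_H1)
    have "bockstein n G T (coord i) \<in> carrier (H2 G T \<Lambda>)" using bockstein_cls[OF i] by (simp add: cls_in_H2)
    from eq[OF this] show "coord i g = coord i g'"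
      using pairing_bockstein[OF s[unfolded fg] i] pairing_bockstein[OF t[unfolded fg'] i] by (simp add: fg fg')
  qed (use D D' in auto)
  ultimately show ?thesis by (simp add: fg fg')
qed

text \<open>Continuity confines h to finitely many entries of f and coordinates of g, so h is an
  integer combination of them. Each is itself the pairing with a cup product or a Bockstein class,
  and the combination of these classes is X.\<close>

lemma character_of_SS:
  assumes h: "h \<in> hom SSG \<Lambda>" and lc: "loc_const SST h"
  shows "\<exists>X\<in>carrier (H2 G T \<Lambda>). \<forall>s\<in>carrier SSG. pairing (s, X) = h s"
proof -
  interpret S: group SSG by (rule group_SS)
  have "openin SST {s \<in> topspace SST. h s = 0}" using lc unfolding loc_const_def by blast
  then have "openin SST {s \<in> carrier SSG. h s = 0}" by (simp only: topspace_SST)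
  then obtain S where S: "openin PX S" "{s \<in> carrier SSG. h s = 0} = S \<inter> carrier SSG"
    unfolding SST_eq openin_subtopology by auto
  have "\<one>\<^bsub>SSG\<^esub> \<in> S \<inter> carrier SSG" unfolding S(2)[symmetric] using hom_L_one[OF group_SS h] by simp
  then have "(\<one>\<^bsub>TT\<^esub>, \<one>) \<in> S" by (simp add: SS_simps)
  then obtain U V where UV: "openin (product_topology (\<lambda>_. discrete_topology (carrier \<Lambda>)) (K \<times> K)) U" "openin T V"
    "\<one>\<^bsub>TT\<^esub> \<in> U" "\<one> \<in> V" "U \<times> V \<subseteq> S"
    using S(1)[unfolded openin_prod_topology_alt, rule_format, of "\<one>\<^bsub>TT\<^esub>" "\<one>"] by auto
  obtain Fp where Fp: "finite Fp" "Fp \<subseteq> K \<times> K"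
    and Fp': "\<forall>a\<in>K \<times> K \<rightarrow>\<^sub>E carrier \<Lambda>. (\<forall>r\<in>Fp. a r = \<one>\<^bsub>TT\<^esub> r) \<longrightarrow> a \<in> U"
    using open_nbhd_discrete_product[OF UV(1,3)] by blast
  obtain Fi where Fi: "finite Fi" "Fi \<subseteq> I" "{\<sigma> \<in> carrier G. \<forall>i\<in>Fi. coord i \<sigma> = 0} \<subseteq> V"
    using open_contains_coord_kernel[OF UV(2,4)] by blast
  \<comment> \<open>\<open>Inl\<close> reads an entry of the bilinear form and \<open>Inr\<close> a
    coordinate of the second component.\<close>
  define ev :: "'a form \<Rightarrow> (('a \<Rightarrow> int) \<times> ('a \<Rightarrow> int)) + 'i \<Rightarrow> int" where "ev = (\<lambda>s r. case r of Inl p \<Rightarrow> fst s p | Inr i \<Rightarrow> coord i (snd s))"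
  have ev_hom: "(\<lambda>s. ev s r) \<in> hom SSG \<Lambda>" if "r \<in> Fp <+> Fi" for r
    using that Fp Fi hom_SS_fst hom_SS_snd coord_H1 by (auto simp: ev_def split: sum.split)
  have "\<exists>m. \<forall>a\<in>carrier SSG. [h a = (\<Sum>r\<in>Fp <+> Fi. m r * ev a r)] (mod N)"
  proof (rule character_from_coordinates[where d = "\<lambda>a b. a \<otimes>\<^bsub>SSG\<^esub> inv\<^bsub>SSG\<^esub> b"])
    fix s assume s: "s \<in> carrier SSG" and 0: "\<And>r. r \<in> Fp <+> Fi \<Longrightarrow> [ev s r = 0] (mod N)"
    have e0: "ev s r = 0" if "r \<in> Fp <+> Fi" for r
      using 0[OF that] hom_in_carrier[OF ev_hom[OF that] s] by (intro L_cong_eq) auto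
    obtain f g where fg: "s = (f, g)" by (cases s)
    have "f \<in> U"
    proof -
      have "f r = \<one>\<^bsub>TT\<^esub> r" if "r \<in> Fp" for r using e0[of "Inl r"] that Fp by (auto simp: ev_def fg TT_one)
      then show ?thesis using Fp' s by (auto simp: fg SS_simps carrier_TT)
    qed
    moreover have "g \<in> V"
    proof -
      have "coord i g = 0" if "i \<in> Fi" for i using e0[of "Inr i"] that by (auto simp: ev_def fg)
      then show ?thesis using Fi(3) s by (auto simp: fg SS_simps)
    qed
    ultimately have "s \<in> S \<inter> carrier SSG" using UV(5) s by (auto simp: fg)
    then have "h s = 0" unfolding S(2)[symmetric] by simp
    then show "[h s = 0] (mod N)" by simp
  next
    show "[ev (a \<otimes>\<^bsub>SSG\<^esub> inv\<^bsub>SSG\<^esub> b) r = ev a r - ev b r] (mod N)"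
      if "a \<in> carrier SSG" "b \<in> carrier SSG" "r \<in> Fp <+> Fi" for a b r
      using hom_L_diff[OF group_SS ev_hom[OF that(3)] that(1,2)] .
    show "[h (a \<otimes>\<^bsub>SSG\<^esub> inv\<^bsub>SSG\<^esub> b) = h a - h b] (mod N)" if "a \<in> carrier SSG" "b \<in> carrier SSG" for a b
      using hom_L_diff[OF group_SS h that] .
    show "carrier SSG \<noteq> {}" using S.one_closed by blast
  qed (use Fp Fi N_pos in auto)
  then obtain m where m: "\<And>a. a \<in> carrier SSG \<Longrightarrow> [h a = (\<Sum>r\<in>Fp <+> Fi. m r * ev a r)] (mod N)" by blast
  define cc where "cc = (\<lambda>r. case r of Inl p \<Rightarrow> cup_cocycle (fst p :: 'a \<Rightarrow> int) (snd p) | Inr i \<Rightarrow> bock_cocycle (coord i))"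
  have cc: "cocycle (cc r)" if "r \<in> Fp <+> Fi" for r
    using that Fp Fi by (auto simp: cc_def split: sum.split intro!: cocycle_cup bockstein_cls(2) coord_H1)
  have cev: "pairing (s, cls (cc r)) = ev s r" if s: "s \<in> carrier SSG" and r: "r \<in> Fp <+> Fi" for s r
  proof -
    obtain f g where fg: "s = (f, g)" by (cases s)
    note s' = s[unfolded fg]
    show ?thesis
    proof (cases r)
      case (Inl p)
      then have "fst p \<in> K" "snd p \<in> K" using r Fp by auto
      then show ?thesis using pairing_cup[OF s', of "fst p" "snd p"] by (simp add: Inl cc_def ev_def fg cup_eq)
    next
      case (Inr i)
      then have i: "coord i \<in> K" using r Fi coord_H1 by auto
      then show ?thesis using pairing_bockstein[OF s' i] by (simp add: Inr cc_def ev_def fg bockstein_cls(1)[OF i])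
    qed
  qed
  let ?c = "\<lambda>p. \<Sum>r\<in>Fp <+> Fi. m r * cc r p"
  have c: "cocycle ?c" using cc by (intro cocycle_sum cocycle_scale)
  have "pairing (s, cls ?c) = h s" if s: "s \<in> carrier SSG" for s
  proof -
    have "[pairing (s, cls ?c) = (\<Sum>r\<in>Fp <+> Fi. m r * pairing (s, cls (cc r)))] (mod N)"
      using hom_cls_sum[OF pairing_hom_right[OF s] cc] .
    also have "(\<Sum>r\<in>Fp <+> Fi. m r * pairing (s, cls (cc r))) = (\<Sum>r\<in>Fp <+> Fi. m r * ev s r)"
      using cev[OF s] by (intro sum.cong) auto
    also have "[(\<Sum>r\<in>Fp <+> Fi. m r * ev s r) = h s] (mod N)" by (rule cong_sym[OF m[OF s]])
    finally show ?thesis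
      using pairing_in[OF s cls_in_H2[OF c]] hom_in_carrier[OF h s] by (intro L_cong_eq)
  qed
  then show ?thesis using cls_in_H2[OF c] by blast
qed

abbreviation "H2T \<equiv> discrete_topology (carrier (H2 G T \<Lambda>))"

text \<open>H^2 is discrete, so all its homomorphisms are continuous and realised by
  \<open>hom_H2_realized\<close>. On the side of \<SS> continuity is a genuine restriction, and
  \<open>character_of_SS\<close> depends on it.\<close>

lemma perfect_pairing_pairing: "perfect_pairing SSG SST (H2 G T \<Lambda>) H2T \<Lambda> pairing"
  unfolding perfect_pairing_def
proof
  interpret S: group SSG by (rule group_SS)
  interpret H: comm_group "H2 G T \<Lambda>" by (rule comm_group_H2)
  let ?l = "\<lambda>s. \<lambda>X\<in>carrier (H2 G T \<Lambda>). pairing (s, X)"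
  let ?r = "\<lambda>X. \<lambda>s\<in>carrier SSG. pairing (s, X)"
  have hom_restrict: "restrict h (carrier A) \<in> hom A \<Lambda>" if "h \<in> hom A \<Lambda>" "group A" for h and A :: "('z, 'y) monoid_scheme"
    using that monoid.m_closed[OF group.is_monoid[OF that(2)]] by (auto simp: hom_def)
  show "?l \<in> iso SSG (cont_Hom (H2 G T \<Lambda>) H2T \<Lambda>)"
    unfolding iso_def
  proof (intro CollectI conjI)
    have in_car: "?l s \<in> carrier (cont_Hom (H2 G T \<Lambda>) H2T \<Lambda>)" if "s \<in> carrier SSG" for s
      using hom_restrict[OF pairing_hom_right[OF that] H.is_group] pairing_in[OF that] by (simp add: carrier_cont_Hom)
    then show "?l \<in> hom SSG (cont_Hom (H2 G T \<Lambda>) H2T \<Lambda>)"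
      using hom_mult[OF pairing_hom_left] by (auto simp: hom_def mult_cont_Hom fun_eq_iff restrict_def)
    show "bij_betw ?l (carrier SSG) (carrier (cont_Hom (H2 G T \<Lambda>) H2T \<Lambda>))"
      unfolding bij_betw_def
    proof (intro conjI subset_antisym subsetI)
      show "inj_on ?l (carrier SSG)"
      proof (rule inj_onI)
        fix s t assume st: "s \<in> carrier SSG" "t \<in> carrier SSG" "?l s = ?l t"
        have "pairing (s, X) = pairing (t, X)" if "X \<in> carrier (H2 G T \<Lambda>)" for X
          using fun_cong[OF st(3), of X] that by simp
        then show "s = t" by (rule SS_eqI[OF st(1,2)])
      qed
      fix h assume h: "h \<in> carrier (cont_Hom (H2 G T \<Lambda>) H2T \<Lambda>)"
      then have "h \<in> hom (H2 G T \<Lambda>) \<Lambda>" by (simp add: carrier_cont_Hom)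
      then obtain s where s: "s \<in> carrier SSG" "\<forall>X\<in>carrier (H2 G T \<Lambda>). pairing (s, X) = h X"
        using hom_H2_realized by blast
      then have "h = ?l s" using h by (intro extensionalityI[of h "carrier (H2 G T \<Lambda>)"]) (auto simp: carrier_cont_Hom)
      then show "h \<in> ?l ` carrier SSG" using s(1) by blast
    qed (use in_car in auto)
  qed
  show "?r \<in> iso (H2 G T \<Lambda>) (cont_Hom SSG SST \<Lambda>)"
    unfolding iso_def
  proof (intro CollectI conjI)
    have lcr: "loc_const SST (?r X) \<longleftrightarrow> loc_const SST (\<lambda>s. pairing (s, X))" for X
      by (rule loc_const_cong) (simp add: topspace_SST)
    have in_car: "?r X \<in> carrier (cont_Hom SSG SST \<Lambda>)" if X: "X \<in> carrier (H2 G T \<Lambda>)" for X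
    proof -
      have "continuous_map SST (discrete_topology (carrier \<Lambda>)) (?r X)"
        by (subst loc_const_iff) (auto simp: topspace_SST lcr pairing_loc_const X pairing_in)
      then show ?thesis using hom_restrict[OF pairing_hom_left[OF X] group_SS] by (simp add: carrier_cont_Hom)
    qed
    then show "?r \<in> hom (H2 G T \<Lambda>) (cont_Hom SSG SST \<Lambda>)"
      using hom_mult[OF pairing_hom_right] by (auto simp: hom_def mult_cont_Hom fun_eq_iff restrict_def)
    show "bij_betw ?r (carrier (H2 G T \<Lambda>)) (carrier (cont_Hom SSG SST \<Lambda>))"
      unfolding bij_betw_def
    proof (intro conjI subset_antisym subsetI)
      show "inj_on ?r (carrier (H2 G T \<Lambda>))"
      proof (rule inj_onI)
        fix X Y assume XY: "X \<in> carrier (H2 G T \<Lambda>)" "Y \<in> carrier (H2 G T \<Lambda>)" "?r X = ?r Y"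
        have "X \<otimes>\<^bsub>H2 G T \<Lambda>\<^esub> inv\<^bsub>H2 G T \<Lambda>\<^esub> Y = \<one>\<^bsub>H2 G T \<Lambda>\<^esub>"
        proof (rule pairing_nondegenerate)
          fix s assume s: "s \<in> carrier SSG"
          have "pairing (s, X) = pairing (s, Y)" using fun_cong[OF XY(3), of s] s by simp
          then have "[pairing (s, X \<otimes>\<^bsub>H2 G T \<Lambda>\<^esub> inv\<^bsub>H2 G T \<Lambda>\<^esub> Y) = 0] (mod N)"
            using hom_L_diff[OF H.is_group pairing_hom_right[OF s] XY(1,2)] by simp
          then show "pairing (s, X \<otimes>\<^bsub>H2 G T \<Lambda>\<^esub> inv\<^bsub>H2 G T \<Lambda>\<^esub> Y) = 0"
            using XY s by (intro L_cong_eq pairing_in) auto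
        qed (use XY in auto)
        then show "X = Y" using XY by (metis H.inv_closed H.inv_inv H.inv_equality H.m_comm)
      qed
      fix h assume h: "h \<in> carrier (cont_Hom SSG SST \<Lambda>)"
      then have hh: "h \<in> hom SSG \<Lambda>" by (simp add: carrier_cont_Hom)
      have "loc_const SST h"
        using h loc_const_iff[of h SST "carrier \<Lambda>"] hom_in_carrier[OF hh] by (auto simp: carrier_cont_Hom topspace_SST)
      then obtain X where X: "X \<in> carrier (H2 G T \<Lambda>)" "\<forall>s\<in>carrier SSG. pairing (s, X) = h s"
        using character_of_SS hh by blast
      then have "h = ?r X" using h by (intro extensionalityI[of h "carrier SSG"]) (auto simp: carrier_cont_Hom)
      then show "h \<in> ?r ` carrier (H2 G T \<Lambda>)" using X(1) by blast
    qed (use in_car in auto)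
  qed
qed

lemma pairing_extensional: "pairing \<in> extensional (carrier SSG \<times> carrier (H2 G T \<Lambda>))"
  by (simp add: pairing_def)

text \<open>For another pairing Q with the prescribed values, each Q((f, g), -) is a homomorphism on
  H^2, hence determined by its values on cup products and Bockstein classes.\<close>

lemma SS_pairing_eq: "SS_pairing n G T = pairing"
  unfolding SS_pairing_def Let_def
proof (rule the_equality)
  show "pairing \<in> carrier SSG \<times> carrier (H2 G T \<Lambda>) \<rightarrow>\<^sub>E carrier \<Lambda> \<and>
     perfect_pairing SSG SST (H2 G T \<Lambda>) H2T \<Lambda> pairing \<and>
     (\<forall>(f, g)\<in>carrier SSG. (\<forall>x\<in>K. \<forall>y\<in>K. pairing ((f, g), cup n G T x y) = f (x, y)) \<and>
        (\<forall>z\<in>K. pairing ((f, g), bockstein n G T z) = z g))"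
    using perfect_pairing_pairing pairing_in pairing_cup pairing_bockstein
    by (auto simp: PiE_iff pairing_extensional)
  fix Q assume Q: "Q \<in> carrier SSG \<times> carrier (H2 G T \<Lambda>) \<rightarrow>\<^sub>E carrier \<Lambda> \<and>
     perfect_pairing SSG SST (H2 G T \<Lambda>) H2T \<Lambda> Q \<and>
     (\<forall>(f, g)\<in>carrier SSG. (\<forall>x\<in>K. \<forall>y\<in>K. Q ((f, g), cup n G T x y) = f (x, y)) \<and>
        (\<forall>z\<in>K. Q ((f, g), bockstein n G T z) = z g))"
  then have ext: "Q \<in> extensional (carrier SSG \<times> carrier (H2 G T \<Lambda>))" by (auto simp: PiE_def)
  show "Q = pairing"
  proof (rule extensionalityI[OF ext])
    show "pairing \<in> extensional (carrier SSG \<times> carrier (H2 G T \<Lambda>))" by (rule pairing_extensional)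
    fix q assume "q \<in> carrier SSG \<times> carrier (H2 G T \<Lambda>)"
    then obtain f g X where q: "q = ((f, g), X)" "(f, g) \<in> carrier SSG" "X \<in> carrier (H2 G T \<Lambda>)" by (metis SigmaE prod.exhaust)
    let ?h = "\<lambda>X\<in>carrier (H2 G T \<Lambda>). Q ((f, g), X)"
    have "(\<lambda>a. \<lambda>b\<in>carrier (H2 G T \<Lambda>). Q (a, b)) \<in> iso SSG (cont_Hom (H2 G T \<Lambda>) H2T \<Lambda>)"
      using Q by (simp add: perfect_pairing_def)
    then have "?h \<in> carrier (cont_Hom (H2 G T \<Lambda>) H2T \<Lambda>)" using q(2) unfolding iso_def hom_def by blast
    then have h: "?h \<in> hom (H2 G T \<Lambda>) \<Lambda>" by (simp add: carrier_cont_Hom)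
    have "?h X = pairing ((f, g), X)"
    proof (rule hom_H2_eqI[OF h pairing_hom_right[OF q(2)] _ _ q(3)])
      fix x y assume K: "x \<in> K" "y \<in> K"
      have "cup n G T x y \<in> carrier (H2 G T \<Lambda>)" using K by (simp add: cup_eq cls_in_H2 cocycle_cup)
      moreover have "Q ((f, g), cup n G T x y) = f (x, y)" using Q q(2) K by blast
      ultimately show "[?h (cup n G T x y) = pairing ((f, g), cup n G T x y)] (mod N)"
        using pairing_cup[OF q(2) K] by simp
    next
      fix z assume z: "z \<in> K"
      have "bockstein n G T z \<in> carrier (H2 G T \<Lambda>)" using bockstein_cls[OF z] by (simp add: cls_in_H2)
      moreover have "Q ((f, g), bockstein n G T z) = z g" using Q q(2) z by blast
      ultimately show "[?h (bockstein n G T z) = pairing ((f, g), bockstein n G T z)] (mod N)"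
        using pairing_bockstein[OF q(2) z] by simp
    qed
    then show "Q q = pairing q" using q by simp
  qed
qed

end

section \<open>The descending series and its quotients\<close>

context group
begin

abbreviation cmt :: "'a \<Rightarrow> 'a \<Rightarrow> 'a" where
  "cmt x y \<equiv> inv x \<otimes> inv y \<otimes> x \<otimes> y"

lemma cancel_left:
  "a \<in> carrier G \<Longrightarrow> b \<in> carrier G \<Longrightarrow> inv a \<otimes> (a \<otimes> b) = b"
  "a \<in> carrier G \<Longrightarrow> b \<in> carrier G \<Longrightarrow> a \<otimes> (inv a \<otimes> b) = b"
  by (simp_all add: m_assoc[symmetric])

lemma mult_cmt: "x \<in> carrier G \<Longrightarrow> y \<in> carrier G \<Longrightarrow> y \<otimes> x \<otimes> cmt x y = x \<otimes> y"
proof -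
  assume "x \<in> carrier G" "y \<in> carrier G"
  then show ?thesis by (simp add: m_assoc cancel_left)
qed

lemma conj_mult:
  "g \<in> carrier G \<Longrightarrow> a \<in> carrier G \<Longrightarrow> b \<in> carrier G \<Longrightarrow>
    g \<otimes> a \<otimes> inv g \<otimes> (g \<otimes> b \<otimes> inv g) = g \<otimes> (a \<otimes> b) \<otimes> inv g"
proof -
  assume "g \<in> carrier G" "a \<in> carrier G" "b \<in> carrier G"
  then show ?thesis by (simp add: m_assoc cancel_left)
qed

lemma conj_inv:
  "g \<in> carrier G \<Longrightarrow> a \<in> carrier G \<Longrightarrow> inv (g \<otimes> a \<otimes> inv g) = g \<otimes> inv a \<otimes> inv g"
  by (simp add: inv_mult_group m_assoc)

lemma conj_cmt:
  assumes "g \<in> carrier G" "x \<in> carrier G" "y \<in> carrier G"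
  shows "g \<otimes> cmt x y \<otimes> inv g = cmt (g \<otimes> x \<otimes> inv g) (g \<otimes> y \<otimes> inv g)"
  using assms by (simp add: conj_inv conj_mult)

lemma conj_pow:
  assumes "g \<in> carrier G" "x \<in> carrier G"
  shows "g \<otimes> x [^] (k::nat) \<otimes> inv g = (g \<otimes> x \<otimes> inv g) [^] k"
proof (induction k)
  case (Suc k)
  have "g \<otimes> x [^] Suc k \<otimes> inv g = (g \<otimes> x [^] k \<otimes> inv g) \<otimes> (g \<otimes> x \<otimes> inv g)"
    using assms by (simp add: conj_mult)
  then show ?case using Suc by simp
qed (use assms in simp)

text \<open>Meant for G/G^(3), where G^(2) is central: the commutator of two lifts does not depend
  on the lifts.\<close>

lemma cmt_central:
  assumes "x \<in> carrier G" "y \<in> carrier G" "d \<in> carrier G" "e \<in> carrier G"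
    and d: "\<And>g. g \<in> carrier G \<Longrightarrow> d \<otimes> g = g \<otimes> d" and e: "\<And>g. g \<in> carrier G \<Longrightarrow> e \<otimes> g = g \<otimes> e"
  shows "cmt (d \<otimes> x) (e \<otimes> y) = cmt x y"
proof -
  have 1: "cmt (d \<otimes> x) z = cmt x z" if z: "z \<in> carrier G" for z
  proof -
    have "cmt (d \<otimes> x) z = inv x \<otimes> (inv d \<otimes> (inv z \<otimes> d)) \<otimes> x \<otimes> z"
      using assms(1-4) z by (simp add: inv_mult_group m_assoc)
    also have "inv z \<otimes> d = d \<otimes> inv z" using d z by simp
    also have "inv d \<otimes> (d \<otimes> inv z) = inv z" using assms(1-4) z by (simp add: cancel_left)
    finally show ?thesis .
  qed
  have "cmt x (e \<otimes> y) = inv x \<otimes> inv y \<otimes> (inv e \<otimes> (x \<otimes> e)) \<otimes> y"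
    using assms(1-4) by (simp add: inv_mult_group m_assoc)
  also have "x \<otimes> e = e \<otimes> x" using e assms by simp
  also have "inv e \<otimes> (e \<otimes> x) = x" using assms(1-4) by (simp add: cancel_left)
  finally show ?thesis using 1[of "e \<otimes> y"] assms(1-4) by simp
qed

end

locale profinite_mod = top_group_mod G T n for G (structure) and T :: "'a topology" and n +
  assumes profinite: "profinite_group G T"
begin

lemma compact_T: "compact_space T" and Hausdorff_T: "Hausdorff_space T"
  using profinite by (auto simp: profinite_group_def)

text \<open>The recursion step as a function of the preceding term, so that G^(2) and G^(3) obtain
  their properties from the same lemmas.\<close>

definition next_term :: "'a set \<Rightarrow> 'a set" where
  "next_term M = closed_generate G T {cmt x y | x y. x \<in> carrier G \<and> y \<in> M} <#>
     closed_generate G T {y [^] n | y. y \<in> M}"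

abbreviation "D \<equiv> central_series G T n 2"
abbreviation "C \<equiv> central_series G T n 3"

lemma D_eq: "D = next_term (carrier G)" and C_eq: "C = next_term D"
  by (simp_all add: next_term_def numeral_2_eq_2 numeral_3_eq_3)

lemma compact_generate: "compactin T (closed_generate G T X)"
  unfolding closed_generate_def using compact_T by (intro closedin_compact_space) auto

text \<open>A product of closed subgroups need not be closed in a topological group; here both
  factors are compact and the group is Hausdorff.\<close>

lemma next_term_closedin: "closedin T (next_term M)"
  unfolding next_term_def using Hausdorff_T
  by (intro compactin_imp_closedin compactin_set_mult compact_generate)

lemma next_term_normal:
  assumes "M \<lhd> G"
  shows "next_term M \<lhd> G"
proof -
  interpret M: normal M G by fact
  have "generate G {cmt x y | x y. x \<in> carrier G \<and> y \<in> M} \<lhd> G"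
  proof (rule normal_generateI)
    show "{cmt x y | x y. x \<in> carrier G \<and> y \<in> M} \<subseteq> carrier G" using M.subset by auto
    fix h g assume h: "h \<in> {cmt x y | x y. x \<in> carrier G \<and> y \<in> M}" and g: "g \<in> carrier G"
    then obtain x y where xy: "h = cmt x y" "x \<in> carrier G" "y \<in> M" by auto
    have "g \<otimes> h \<otimes> inv g = cmt (g \<otimes> x \<otimes> inv g) (g \<otimes> y \<otimes> inv g)"
      unfolding xy(1) using g xy M.subset by (intro conj_cmt) auto
    moreover have "g \<otimes> y \<otimes> inv g \<in> M" using M.inv_op_closed2[OF g xy(3)] .
    ultimately show "g \<otimes> h \<otimes> inv g \<in> {cmt x y | x y. x \<in> carrier G \<and> y \<in> M}" using g xy by blast
  qed
  moreover have "generate G {y [^] n | y. y \<in> M} \<lhd> G"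
  proof (rule normal_generateI)
    show "{y [^] n | y. y \<in> M} \<subseteq> carrier G" using M.subset by auto
    fix h g assume h: "h \<in> {y [^] n | y. y \<in> M}" and g: "g \<in> carrier G"
    then obtain y where y: "h = y [^] n" "y \<in> M" by auto
    have "g \<otimes> h \<otimes> inv g = (g \<otimes> y \<otimes> inv g) [^] n"
      unfolding y(1) using g y M.subset by (intro conj_pow) auto
    moreover have "g \<otimes> y \<otimes> inv g \<in> M" using M.inv_op_closed2[OF g y(2)] .
    ultimately show "g \<otimes> h \<otimes> inv g \<in> {y [^] n | y. y \<in> M}" by blast
  qed
  ultimately show ?thesis unfolding next_term_def closed_generate_def
    by (intro normal_subgroup_set_mult_closed closure_normal)
qed

lemma closed_generate_incl:
  assumes "X \<subseteq> carrier G"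
  shows "X \<subseteq> closed_generate G T X" and "subgroup (closed_generate G T X) G"
proof -
  show "subgroup (closed_generate G T X) G" unfolding closed_generate_def
    by (intro closure_subgroup generate_is_subgroup assms)
  have "generate G X \<subseteq> closed_generate G T X" unfolding closed_generate_def
    using generate_incl[OF assms] topspace by (intro closure_of_subset) auto
  then show "X \<subseteq> closed_generate G T X" using generate.incl[of _ X G] by blast
qed

lemma next_term_mem:
  assumes M: "subgroup M G"
  shows "x \<in> carrier G \<Longrightarrow> y \<in> M \<Longrightarrow> cmt x y \<in> next_term M" and "y \<in> M \<Longrightarrow> y [^] n \<in> next_term M"
proof -
  interpret M: subgroup M G by fact
  let ?A = "{cmt x y | x y. x \<in> carrier G \<and> y \<in> M}" and ?B = "{y [^] n | y. y \<in> M}"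
  have A: "?A \<subseteq> carrier G" and B: "?B \<subseteq> carrier G" using M.subset by auto
  note cA = closed_generate_incl[OF A] and cB = closed_generate_incl[OF B]
  show "cmt x y \<in> next_term M" if "x \<in> carrier G" "y \<in> M"
  proof -
    have "cmt x y \<in> closed_generate G T ?A" using cA(1) that by blast
    moreover have "\<one> \<in> closed_generate G T ?B" using cB(2) by (rule subgroup.one_closed)
    moreover have "cmt x y = cmt x y \<otimes> \<one>" using that M.subset by auto
    ultimately show ?thesis unfolding next_term_def set_mult_def by blast
  qed
  show "y [^] n \<in> next_term M" if "y \<in> M"
  proof -
    have "y [^] n \<in> closed_generate G T ?B" using cB(1) that by blast
    moreover have "\<one> \<in> closed_generate G T ?A" using cA(2) by (rule subgroup.one_closed)
    moreover have "y [^] n = \<one> \<otimes> y [^] n" using that M.subset by auto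
    ultimately show ?thesis unfolding next_term_def set_mult_def by blast
  qed
qed

text \<open>Reduces statements about all of G^(2) or G^(3) to commutators and n-th powers; H is
  typically the kernel of a locally constant character.\<close>

lemma next_term_minimal:
  assumes H: "subgroup H G" "closedin T H"
    and "\<And>x y. x \<in> carrier G \<Longrightarrow> y \<in> M \<Longrightarrow> cmt x y \<in> H" "\<And>y. y \<in> M \<Longrightarrow> y [^] n \<in> H"
  shows "next_term M \<subseteq> H"
proof -
  have gen: "closed_generate G T X \<subseteq> H" if "X \<subseteq> H" for X
    unfolding closed_generate_def using generate_subgroup_incl[OF that H(1)] H(2) by (rule closure_of_minimal)
  have "a \<otimes> b \<in> H" if "a \<in> closed_generate G T {cmt x y | x y. x \<in> carrier G \<and> y \<in> M}"
    "b \<in> closed_generate G T {y [^] n | y. y \<in> M}" for a b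
  proof (rule subgroup.m_closed[OF H(1)])
    show "a \<in> H" using that(1) assms(3) by (intro subsetD[OF gen that(1)]) auto
    show "b \<in> H" using that(2) assms(4) by (intro subsetD[OF gen that(2)]) auto
  qed
  then show ?thesis unfolding next_term_def set_mult_def by auto
qed

lemma normal_D: "D \<lhd> G"
  unfolding D_eq by (rule next_term_normal[OF normal_self])

lemma normal_C: "C \<lhd> G"
  unfolding C_eq by (rule next_term_normal[OF normal_D])

sublocale D: normal D G by (rule normal_D)
sublocale C: normal C G by (rule normal_C)

lemma D_mem: "x \<in> carrier G \<Longrightarrow> y \<in> carrier G \<Longrightarrow> cmt x y \<in> D" "y \<in> carrier G \<Longrightarrow> y [^] n \<in> D"
  unfolding D_eq using next_term_mem[OF subgroup_self] by auto

lemma C_mem: "x \<in> carrier G \<Longrightarrow> y \<in> D \<Longrightarrow> cmt x y \<in> C" "y \<in> D \<Longrightarrow> y [^] n \<in> C"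
  unfolding C_eq using next_term_mem[OF D.subgroup_axioms] by auto

lemma closedin_D: "closedin T D" and closedin_C: "closedin T C"
  unfolding D_eq C_eq by (rule next_term_closedin)+

lemma C_subset_D: "C \<subseteq> D"
  unfolding C_eq
proof (rule next_term_minimal[OF D.subgroup_axioms closedin_D])
  show "cmt x y \<in> D" if "x \<in> carrier G" "y \<in> D" for x y using D_mem(1)[OF that(1)] that(2) D.subset by blast
  show "y [^] n \<in> D" if "y \<in> D" for y using D_mem(2) that D.subset by blast
qed

lemma D_minimal:
  assumes "subgroup H G" "closedin T H"
    and "\<And>x y. x \<in> carrier G \<Longrightarrow> y \<in> carrier G \<Longrightarrow> cmt x y \<in> H" "\<And>y. y \<in> carrier G \<Longrightarrow> y [^] n \<in> H"
  shows "D \<subseteq> H"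
  unfolding D_eq by (rule next_term_minimal[OF assms])

subsection \<open>The graded pieces\<close>

abbreviation "gr1 \<equiv> gr G T n (Suc 0)"
abbreviation "T1 \<equiv> gr_topology G T n (Suc 0)"
abbreviation "gr2 \<equiv> gr G T n 2"
abbreviation "T2 \<equiv> gr_topology G T n 2"
abbreviation "p x \<equiv> D #> x"
abbreviation "q x \<equiv> C #> x"

lemma first_term: "central_series G T n (Suc 0) = carrier G" "G\<lparr>carrier := carrier G\<rparr> = G"
  by simp_all

lemma gr1_eq: "gr1 = G Mod D"
  unfolding gr_def first_term numeral_2_eq_2[symmetric] ..

lemma T1_eq: "T1 = quotient_topology G T D"
proof -
  have "subtopology T (carrier G) = T" using subtopology_topspace[of T] unfolding topspace .
  then show ?thesis unfolding gr_topology_def first_term numeral_2_eq_2[symmetric] by simp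
qed

lemma gr1_simps: "carrier gr1 = p ` carrier G" "\<one>\<^bsub>gr1\<^esub> = D"
  "x \<in> carrier G \<Longrightarrow> y \<in> carrier G \<Longrightarrow> p x \<otimes>\<^bsub>gr1\<^esub> p y = p (x \<otimes> y)"
  unfolding gr1_eq by (simp_all add: carrier_FactGroup D.rcos_sum)

lemma gr1_pow: "x \<in> carrier G \<Longrightarrow> p x [^]\<^bsub>gr1\<^esub> (k::nat) = p (x [^] k)"
  unfolding gr1_eq by (rule D.FactGroup_pow)

lemma p_D: "d \<in> D \<Longrightarrow> p d = D"
  by (rule D.rcos_const) (rule is_group)

lemma openin_T1: "openin T1 U \<longleftrightarrow> U \<subseteq> carrier gr1 \<and> openin T {x \<in> carrier G. p x \<in> U}"
  unfolding T1_eq openin_quotient_topology[OF topspace] gr1_eq by (simp add: FactGroup_def)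

lemma topspace_T1: "topspace T1 = carrier gr1"
proof -
  have "openin T1 (carrier gr1)" unfolding openin_T1 using topspace openin_topspace[of T]
    by (auto simp: gr1_simps cong: conj_cong)
  then show ?thesis using openin_subset[of T1 "carrier gr1"] openin_topspace[of T1] unfolding openin_T1 by blast
qed

lemma continuous_p: "continuous_map T T1 p"
  unfolding continuous_map_def topspace_T1 openin_T1 using topspace by (auto simp: gr1_simps)

lemma open_p: "open_map T T1 p"
  unfolding open_map_def
proof (intro allI impI)
  fix U assume U: "openin T U"
  have Us: "U \<subseteq> carrier G" using openin_subset[OF U] topspace by simp
  have "{x \<in> carrier G. p x \<in> p ` U} = D <#> U"
  proof (intro subset_antisym subsetI)
    fix x assume x: "x \<in> {x \<in> carrier G. p x \<in> p ` U}"
    then obtain u where u: "u \<in> U" "p x = p u" "x \<in> carrier G" by auto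
    then have "x \<in> p u" using rcos_self[OF u(3) D.subgroup_axioms] by simp
    then show "x \<in> D <#> U" using u(1) by (auto simp: r_coset_def set_mult_def)
  next
    fix x assume "x \<in> D <#> U"
    then obtain d u where du: "x = d \<otimes> u" "d \<in> D" "u \<in> U" by (auto simp: set_mult_def)
    have c: "d \<in> carrier G" "u \<in> carrier G" using du D.subset Us by auto
    have "p x = p d <#> p u" unfolding du(1) using D.rcos_sum[OF c] by simp
    also have "\<dots> = p \<one> <#> p u" using p_D[OF du(2)] p_D[OF D.one_closed] by simp
    also have "\<dots> = p u" using D.rcos_sum[of \<one> u] c by simp
    finally show "x \<in> {x \<in> carrier G. p x \<in> p ` U}" using du c by auto
  qed
  then show "openin T1 (p ` U)" unfolding openin_T1 using openin_set_mult[OF U D.subset] Us by (auto simp: gr1_simps)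
qed

lemma quotient_pp: "quotient_map (prod_topology T T) (prod_topology T1 T1) (\<lambda>(x, y). (p x, p y))"
proof (rule continuous_open_imp_quotient_map)
  show "continuous_map (prod_topology T T) (prod_topology T1 T1) (\<lambda>(x, y). (p x, p y))"
    unfolding case_prod_unfold
    by (intro continuous_map_pairedI continuous_map_compose[OF _ continuous_p, unfolded o_def] continuous_map_fst continuous_map_snd)
  show "(\<lambda>(x, y). (p x, p y)) ` topspace (prod_topology T T) = topspace (prod_topology T1 T1)"
  proof -
    have "(\<lambda>(x, y). (p x, p y)) ` (A \<times> A) = (p ` A) \<times> (p ` A)" for A by auto
    then show ?thesis using topspace by (simp add: topspace_T1 gr1_simps(1))
  qed
  show "open_map (prod_topology T T) (prod_topology T1 T1) (\<lambda>(x, y). (p x, p y))"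
    unfolding open_map_def
  proof (intro allI impI)
    fix W assume W: "openin (prod_topology T T) W"
    show "openin (prod_topology T1 T1) ((\<lambda>(x, y). (p x, p y)) ` W)"
      unfolding openin_prod_topology_alt
    proof (intro allI impI)
      fix a b assume "(a, b) \<in> (\<lambda>(x, y). (p x, p y)) ` W"
      then obtain x y where xy: "(x, y) \<in> W" "a = p x" "b = p y" by auto
      then obtain U V where UV: "openin T U" "openin T V" "x \<in> U" "y \<in> V" "U \<times> V \<subseteq> W"
        using W[unfolded openin_prod_topology_alt, rule_format, of x y] by auto
      have "openin T1 (p ` U)" "openin T1 (p ` V)" using open_p UV(1,2) by (auto simp: open_map_def)
      moreover have "p ` U \<times> p ` V \<subseteq> (\<lambda>(x, y). (p x, p y)) ` W" using UV(5) by force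
      ultimately show "\<exists>U V. openin T1 U \<and> openin T1 V \<and> a \<in> U \<and> b \<in> V \<and> U \<times> V \<subseteq> (\<lambda>(x, y). (p x, p y)) ` W"
        using UV xy by blast
    qed
  qed
qed

lemma group_gr1: "group gr1"
  unfolding gr1_eq by (rule D.factorgroup_is_group)

lemma quotient_p: "quotient_map T T1 p"
  by (rule continuous_open_imp_quotient_map[OF continuous_p open_p]) (use topspace in \<open>simp add: topspace_T1 gr1_simps\<close>)

lemma inv_gr1: "x \<in> carrier G \<Longrightarrow> inv\<^bsub>gr1\<^esub> (p x) = p (inv x)"
  unfolding gr1_eq by (subst D.inv_FactGroup) (auto simp: carrier_FactGroup D.rcos_inv)

lemma top_group_gr1: "top_group gr1 T1"
proof -
  interpret g: group gr1 by (rule group_gr1)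
  have "continuous_map (prod_topology T1 T1) T1 (\<lambda>(x, y). x \<otimes>\<^bsub>gr1\<^esub> y)"
  proof (rule continuous_compose_quotient_map[OF quotient_pp])
    have "continuous_map (prod_topology T T) T1 (p \<circ> (\<lambda>(x, y). x \<otimes> y))"
      by (rule continuous_map_compose[OF continuous_mult continuous_p])
    then show "continuous_map (prod_topology T T) T1 ((\<lambda>(x, y). x \<otimes>\<^bsub>gr1\<^esub> y) \<circ> (\<lambda>(x, y). (p x, p y)))"
      by (rule continuous_map_eq) (use topspace in \<open>auto simp: gr1_simps\<close>)
  qed
  moreover have "continuous_map T1 T1 (\<lambda>x. inv\<^bsub>gr1\<^esub> x)"
  proof (rule continuous_compose_quotient_map[OF quotient_p])
    have "continuous_map T T1 (p \<circ> (\<lambda>x. inv x))"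
      by (rule continuous_map_compose[OF continuous_inv continuous_p])
    then show "continuous_map T T1 ((\<lambda>x. inv\<^bsub>gr1\<^esub> x) \<circ> p)"
      by (rule continuous_map_eq) (use topspace in \<open>auto simp: inv_gr1\<close>)
  qed
  ultimately show ?thesis
    by (simp add: top_group_def top_group_axioms_def topspace_T1 group_gr1)
qed

lemma loc_const_quotient:
  assumes q: "quotient_map X Y f" and lc: "loc_const X (\<lambda>x. h (f x))"
  shows "loc_const Y h"
proof -
  have "continuous_map X (discrete_topology UNIV) (h \<circ> f)" using lc by (subst loc_const_iff) (auto simp: o_def)
  from continuous_compose_quotient_map[OF q this] show ?thesis by (subst (asm) loc_const_iff) auto
qed

lemma Suc_2: "Suc 2 = 3"
  by simp

lemma gr2_eq: "gr2 = G\<lparr>carrier := D\<rparr> Mod C"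
  unfolding gr_def Suc_2 ..

lemma gr2_simps: "carrier gr2 = q ` D" "\<one>\<^bsub>gr2\<^esub> = C"
  "x \<in> D \<Longrightarrow> y \<in> D \<Longrightarrow> q x \<otimes>\<^bsub>gr2\<^esub> q y = q (x \<otimes> y)"
proof -
  show "carrier gr2 = q ` D" "\<one>\<^bsub>gr2\<^esub> = C" unfolding gr2_eq by (simp_all add: carrier_FactGroup)
  assume xy: "x \<in> D" "y \<in> D"
  have "q x \<otimes>\<^bsub>gr2\<^esub> q y = q x <#> q y" unfolding gr2_eq by simp
  also have "\<dots> = q (x \<otimes> y)" using C.rcos_sum xy D.subset by blast
  finally show "q x \<otimes>\<^bsub>gr2\<^esub> q y = q (x \<otimes> y)" .
qed

lemma openin_T2: "openin T2 U \<longleftrightarrow> U \<subseteq> carrier gr2 \<and> openin (subtopology T D) {x \<in> D. q x \<in> U}"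
proof -
  have "topspace (subtopology T D) = carrier (G\<lparr>carrier := D\<rparr>)" using topspace D.subset by auto
  from openin_quotient_topology[OF this, of C U]
  show ?thesis unfolding gr_topology_def gr2_eq Suc_2 by (simp add: FactGroup_def)
qed

lemma topspace_subD: "topspace (subtopology T D) = D"
  using topspace D.subset by auto

lemma topspace_T2: "topspace T2 = carrier gr2"
proof -
  have "{x \<in> D. q x \<in> carrier gr2} = topspace (subtopology T D)" unfolding topspace_subD by (auto simp: gr2_simps)
  then have "openin T2 (carrier gr2)" unfolding openin_T2 by (simp only: openin_topspace subset_refl simp_thms)
  then show ?thesis using openin_subset[of T2 "carrier gr2"] openin_topspace[of T2] unfolding openin_T2 by blast
qed

lemma quotient_q: "quotient_map (subtopology T D) T2 q"
  unfolding quotient_map_def topspace_T2 topspace_subD by (simp add: gr2_simps openin_T2)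

lemma q_C: "c \<in> C \<Longrightarrow> q c = C"
  by (rule C.rcos_const) (rule is_group)

lemma q_eq_iff: "x \<in> carrier G \<Longrightarrow> y \<in> carrier G \<Longrightarrow> q x = q y \<longleftrightarrow> x \<otimes> inv y \<in> C"
  using C.rcos_module[OF is_group, of y x] repr_independence[OF _ _ C.subgroup_axioms, of x y]
    rcos_self[OF _ C.subgroup_axioms, of x] by metis

lemma compact_space_T2: "compact_space T2"
proof -
  have "compactin T D" using closedin_D compact_T by (rule closedin_compact_space[rotated])
  then have "compactin (subtopology T D) (topspace (subtopology T D))"
    using compact_space_subtopology compact_space_def by blast
  from image_compactin[OF this quotient_imp_continuous_map[OF quotient_q]]
  show ?thesis by (simp add: compact_space_def topspace_subD topspace_T2 gr2_simps del: topspace_subtopology)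
qed

subsection \<open>Commutators and powers in the second graded piece\<close>

lemma D_central: "d \<in> D \<Longrightarrow> g \<in> carrier G \<Longrightarrow> q (d \<otimes> g) = q (g \<otimes> d)"
proof -
  assume d: "d \<in> D" and g: "g \<in> carrier G"
  have dc: "d \<in> carrier G" using d D.subset by blast
  have w: "cmt g d \<in> C" using C_mem(1)[OF g d] .
  have wc: "cmt g d \<in> carrier G" using dc g by simp
  have "q (g \<otimes> d) = q (d \<otimes> g \<otimes> cmt g d)" using mult_cmt[OF g dc] by simp
  also have "\<dots> = q (d \<otimes> g) <#> q (cmt g d)" using C.rcos_sum[of "d \<otimes> g" "cmt g d"] dc g wc by simp
  also have "\<dots> = q (d \<otimes> g) <#> q \<one>" using q_C[OF w] q_C[OF C.one_closed] by simp
  also have "\<dots> = q (d \<otimes> g)" using C.rcos_sum[of "d \<otimes> g" \<one>] dc g by simp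
  finally show ?thesis by simp
qed

abbreviation "Q \<equiv> G Mod C"

lemma Q_simps: "carrier Q = q ` carrier G" "x \<in> carrier G \<Longrightarrow> y \<in> carrier G \<Longrightarrow> q x \<otimes>\<^bsub>Q\<^esub> q y = q (x \<otimes> y)"
  "x \<in> carrier G \<Longrightarrow> inv\<^bsub>Q\<^esub> (q x) = q (inv x)" "x \<in> carrier G \<Longrightarrow> q x [^]\<^bsub>Q\<^esub> (k::nat) = q (x [^] k)"
  using C.inv_FactGroup by (auto simp: carrier_FactGroup C.rcos_sum C.FactGroup_pow C.rcos_inv)

lemma lifts_eq: 
  assumes x: "x \<in> carrier G"
  shows "lifts G T n (p x) = (\<lambda>d. q (d \<otimes> x)) ` D"
proof (intro subset_antisym subsetI)
  fix s assume "s \<in> lifts G T n (p x)"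
  then obtain y where y: "y \<in> carrier G" "s = q y" "q y \<subseteq> p x" by (auto simp: lifts_def Q_simps)
  then have "y \<in> p x" using rcos_self[OF y(1) C.subgroup_axioms] by blast
  then show "s \<in> (\<lambda>d. q (d \<otimes> x)) ` D" using y(2) by (auto simp: r_coset_def)
next
  fix s assume "s \<in> (\<lambda>d. q (d \<otimes> x)) ` D"
  then obtain d where d: "d \<in> D" "s = q (d \<otimes> x)" by auto
  have dc: "d \<in> carrier G" using d D.subset by blast
  have "q (d \<otimes> x) \<subseteq> p x"
  proof
    fix y assume "y \<in> q (d \<otimes> x)"
    then obtain c where c: "c \<in> C" "y = c \<otimes> (d \<otimes> x)" by (auto simp: r_coset_def)
    have "c \<otimes> d \<in> D" using c d C_subset_D D.m_closed by blast
    moreover have "y = (c \<otimes> d) \<otimes> x" using c dc x C.subset by (simp add: m_assoc subset_iff)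
    ultimately show "y \<in> p x" by (auto simp: r_coset_def)
  qed
  then show "s \<in> lifts G T n (p x)" using d dc x by (auto simp: lifts_def Q_simps)
qed

text \<open>Two lifts of the same element differ by an element of G^(2), central modulo G^(3), which
  drops out of the commutator. Hence the definite description has exactly one value.\<close>

lemma gr_commutator_eq:
  assumes x: "x \<in> carrier G" and y: "y \<in> carrier G"
  shows "gr_commutator G T n (p x) (p y) = q (cmt x y)"
proof -
  interpret Q: group Q by (rule C.factorgroup_is_group)
  have val: "inv\<^bsub>Q\<^esub> s \<otimes>\<^bsub>Q\<^esub> inv\<^bsub>Q\<^esub> t \<otimes>\<^bsub>Q\<^esub> s \<otimes>\<^bsub>Q\<^esub> t = q (cmt x y)"
    if st: "s \<in> lifts G T n (p x)" "t \<in> lifts G T n (p y)" for s t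
  proof -
    obtain d e where d: "d \<in> D" "s = q (d \<otimes> x)" and e: "e \<in> D" "t = q (e \<otimes> y)"
      using st by (auto simp: lifts_eq x y)
    have c: "d \<in> carrier G" "e \<in> carrier G" using d e D.subset by auto
    have "s = q d \<otimes>\<^bsub>Q\<^esub> q x" "t = q e \<otimes>\<^bsub>Q\<^esub> q y" using d e c x y by (simp_all only: Q_simps)
    moreover have "q k \<otimes>\<^bsub>Q\<^esub> g = g \<otimes>\<^bsub>Q\<^esub> q k" if k: "k \<in> D" and g: "g \<in> carrier Q" for k g
    proof -
      obtain g' where g': "g' \<in> carrier G" "g = q g'" using g by (auto simp: Q_simps)
      have "k \<in> carrier G" using k D.subset by blast
      then show ?thesis using D_central[OF k g'(1)] g' by (simp only: Q_simps)
    qed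
    ultimately have "Q.cmt s t = Q.cmt (q x) (q y)"
      using Q.cmt_central[of "q x" "q y" "q d" "q e"] c x y d e by (simp add: Q_simps(1))
    also have "\<dots> = q (cmt x y)" using x y by (simp only: Q_simps inv_closed m_closed)
    finally show ?thesis .
  qed
  have mem: "q x \<in> lifts G T n (p x)" if "x \<in> carrier G" for x
    unfolding lifts_eq[OF that] using that D.one_closed by (intro image_eqI[of _ _ \<one>]) auto
  show ?thesis unfolding gr_commutator_def Let_def
  proof (rule the_equality)
    show "\<exists>s\<in>lifts G T n (p x). \<exists>t\<in>lifts G T n (p y). q (cmt x y) = inv\<^bsub>Q\<^esub> s \<otimes>\<^bsub>Q\<^esub> inv\<^bsub>Q\<^esub> t \<otimes>\<^bsub>Q\<^esub> s \<otimes>\<^bsub>Q\<^esub> t"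
      using mem[OF x] mem[OF y] val by metis
  qed (use val in auto)
qed

text \<open>Replacing the lift x by d x with d in G^(2) multiplies the n-th power by d^n, as d is
  central modulo G^(3), and d^n lies in G^(3).\<close>

lemma gr_power_eq:
  assumes x: "x \<in> carrier G"
  shows "gr_power G T n (p x) = q (x [^] n)"
proof -
  have val: "s [^]\<^bsub>Q\<^esub> n = q (x [^] n)" if st: "s \<in> lifts G T n (p x)" for s
  proof -
    interpret Q: group Q by (rule C.factorgroup_is_group)
    obtain d where d: "d \<in> D" "s = q (d \<otimes> x)" using st by (auto simp: lifts_eq x)
    have c: "d \<in> carrier G" using d D.subset by auto
    have qc: "q d \<in> carrier Q" "q x \<in> carrier Q" using c x by (auto simp: Q_simps(1))
    have "s [^]\<^bsub>Q\<^esub> n = (q d \<otimes>\<^bsub>Q\<^esub> q x) [^]\<^bsub>Q\<^esub> n" using d c x by (simp only: Q_simps)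
    also have "\<dots> = q d [^]\<^bsub>Q\<^esub> n \<otimes>\<^bsub>Q\<^esub> q x [^]\<^bsub>Q\<^esub> n"
      using D_central[OF d(1) x] c x qc by (intro Q.pow_mult_distrib) (simp_all only: Q_simps)
    also have "\<dots> = q (d [^] n) \<otimes>\<^bsub>Q\<^esub> q (x [^] n)" using c x by (simp only: Q_simps)
    also have "q (d [^] n) = q \<one>" using q_C[OF C_mem(2)[OF d(1)]] q_C[OF C.one_closed] by simp
    also have "q \<one> \<otimes>\<^bsub>Q\<^esub> q (x [^] n) = q (x [^] n)" using x by (simp only: Q_simps one_closed nat_pow_closed l_one)
    finally show ?thesis .
  qed
  have mem: "q x \<in> lifts G T n (p x)"
    unfolding lifts_eq[OF x] using x D.one_closed by (intro image_eqI[of _ _ \<one>]) auto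
  show ?thesis unfolding gr_power_def Let_def
  proof (rule the_equality)
    show "\<exists>s\<in>lifts G T n (p x). q (x [^] n) = s [^]\<^bsub>Q\<^esub> n" using mem val by metis
  qed (use val in auto)
qed

end

section \<open>Transgression\<close>

locale profinite_presentation = profinite_mod G T n for G (structure) and T :: "'a topology" and n +
  fixes I :: "'i set" and \<theta> :: "'a set \<Rightarrow> 'i \<Rightarrow> int"
  assumes theta: "\<theta> \<in> top_iso (gr G T n (Suc 0)) (gr_topology G T n (Suc 0)) (product_group I (\<lambda>_. integer_mod_group n))
     (product_topology (\<lambda>_. discrete_topology (carrier (integer_mod_group n))) I)"
begin

sublocale \<Gamma>: mod_power gr1 T1 n I \<theta>
proof -
  interpret g: top_group gr1 T1 by (rule top_group_gr1)
  show "mod_power gr1 T1 n I \<theta>" by unfold_locales (use n_pos theta in auto)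
qed

lemma p_in: "x \<in> carrier G \<Longrightarrow> p x \<in> carrier gr1"
  by (simp add: gr1_simps)

definition infl :: "('a set \<times> 'a set \<Rightarrow> int) \<Rightarrow> 'a \<times> 'a \<Rightarrow> int" where
  "infl c = (\<lambda>(x, y). c (p x, p y))"

lemma cocycle_infl:
  assumes "\<Gamma>.cocycle c"
  shows "cocycle (infl c)"
  unfolding cocycle_def
proof (intro conjI ballI)
  have "loc_const (prod_topology T T) (\<lambda>z. c ((\<lambda>(x, y). (p x, p y)) z))"
    using assms by (intro loc_const_compose[OF quotient_imp_continuous_map[OF quotient_pp]]) (simp add: \<Gamma>.cocycle_def)
  then show "loc_const (prod_topology T T) (infl c)" by (simp add: infl_def case_prod_unfold)
  fix x y z assume g: "x \<in> carrier G" "y \<in> carrier G" "z \<in> carrier G"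
  show "[infl c (y, z) + infl c (x, y \<otimes> z) = infl c (x \<otimes> y, z) + infl c (x, y)] (mod N)"
    using \<Gamma>.cocycleD[OF assms p_in[OF g(1)] p_in[OF g(2)] p_in[OF g(3)]] g by (simp add: infl_def gr1_simps(3))
qed

lemma cls_infl_cong:
  assumes "\<Gamma>.cocycle c" "\<Gamma>.cocycle c'" "\<Gamma>.cls c = \<Gamma>.cls c'"
  shows "cls (infl c) = cls (infl c')"
proof -
  obtain \<psi> where psi: "loc_const T1 \<psi>" "\<And>\<sigma> \<tau>. \<sigma> \<in> carrier gr1 \<Longrightarrow> \<tau> \<in> carrier gr1 \<Longrightarrow>
     [c (\<sigma>, \<tau>) - c' (\<sigma>, \<tau>) = \<psi> \<tau> - \<psi> (\<sigma> \<otimes>\<^bsub>gr1\<^esub> \<tau>) + \<psi> \<sigma>] (mod N)"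
    using assms by (auto simp: \<Gamma>.cls_eq_iff)
  have "[infl c (x, y) - infl c' (x, y) = \<psi> (p y) - \<psi> (p (x \<otimes> y)) + \<psi> (p x)] (mod N)"
    if "x \<in> carrier G" "y \<in> carrier G" for x y
    using psi(2)[OF p_in[OF that(1)] p_in[OF that(2)]] that by (simp add: infl_def gr1_simps(3))
  moreover have "loc_const T (\<lambda>x. \<psi> (p x))" by (rule loc_const_compose[OF continuous_p psi(1)])
  ultimately show ?thesis
    by (subst cls_eq_iff[OF cocycle_infl[OF assms(1)] cocycle_infl[OF assms(2)]]) (intro exI[of _ "\<lambda>x. \<psi> (p x)"], auto)
qed

lemma mem_cls:
  assumes c: "\<Gamma>.cocycle c" and c': "c' \<in> \<Gamma>.cls c"
  shows "\<Gamma>.cocycle c'" "\<Gamma>.cls c' = \<Gamma>.cls c" "\<Gamma>.red c' = c'"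
proof -
  interpret Z: comm_group "Z2 gr1 T1 \<Lambda>" by (rule \<Gamma>.comm_group_Z2)
  interpret B: normal "coboundaries2 gr1 T1 \<Lambda>" "Z2 gr1 T1 \<Lambda>" by (rule \<Gamma>.normal_coboundaries2)
  have rc: "\<Gamma>.red c \<in> carrier (Z2 gr1 T1 \<Lambda>)" using c by (simp add: \<Gamma>.Z2_simps)
  have m: "c' \<in> coboundaries2 gr1 T1 \<Lambda> #>\<^bsub>Z2 gr1 T1 \<Lambda>\<^esub> \<Gamma>.red c" using c' by (simp add: \<Gamma>.cls_def H2_class_def)
  have "c' \<in> carrier (Z2 gr1 T1 \<Lambda>)" using B.elemrcos_carrier[OF Z.is_group rc m] .
  then have cc: "c' \<in> cocycles2 gr1 T1 \<Lambda>" by (simp add: Z2_def)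
  show "\<Gamma>.cocycle c'" "\<Gamma>.red c' = c'" using \<Gamma>.cocycles2_cocycle[OF cc] by auto
  then show "\<Gamma>.cls c' = \<Gamma>.cls c" unfolding \<Gamma>.cls_def H2_class_def
    using Z.repr_independence[OF m rc B.subgroup_axioms] by simp
qed

lemma cls_nonempty: "\<Gamma>.cocycle c \<Longrightarrow> \<Gamma>.red c \<in> \<Gamma>.cls c"
proof -
  interpret Z: comm_group "Z2 gr1 T1 \<Lambda>" by (rule \<Gamma>.comm_group_Z2)
  assume "\<Gamma>.cocycle c"
  then show ?thesis unfolding \<Gamma>.cls_def H2_class_def
    by (intro Z.rcos_self \<Gamma>.subgroup_coboundaries2) (simp add: \<Gamma>.Z2_simps)
qed

text \<open>All members of a coset have the same inflated class, so the image taken in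
  \<open>H2_pullback\<close> is a singleton.\<close>

lemma inflation_cls:
  assumes c: "\<Gamma>.cocycle c"
  shows "inflation G T n (\<Gamma>.cls c) = cls (infl c)"
proof -
  have "H2_class G T \<Lambda> (\<lambda>(\<sigma>, \<tau>)\<in>carrier G \<times> carrier G. c' (p \<sigma>, p \<tau>)) = cls (infl c)"
    if c': "c' \<in> \<Gamma>.cls c" for c'
  proof -
    note m = mem_cls[OF c c']
    have "c' (p \<sigma>, p \<tau>) mod N = c' (p \<sigma>, p \<tau>)" if "\<sigma> \<in> carrier G" "\<tau> \<in> carrier G" for \<sigma> \<tau>
      using fun_cong[OF m(3), of "(p \<sigma>, p \<tau>)"] p_in that by (simp add: \<Gamma>.red_def)
    then have "(\<lambda>(\<sigma>, \<tau>)\<in>carrier G \<times> carrier G. c' (p \<sigma>, p \<tau>)) = red (infl c')"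
      by (auto simp: red_def infl_def fun_eq_iff restrict_def)
    then show ?thesis using cls_infl_cong[OF m(1) c m(2)] by (simp add: cls_def)
  qed
  then have "(\<lambda>c'. H2_class G T \<Lambda> (\<lambda>(\<sigma>, \<tau>)\<in>carrier G \<times> carrier G. c' (p \<sigma>, p \<tau>))) ` \<Gamma>.cls c = {cls (infl c)}"
    using cls_nonempty[OF c] by blast
  then show ?thesis unfolding inflation_def H2_pullback_def by simp
qed

text \<open>If \<open>\<phi>\<close> trivializes the inflation of \<open>c\<close>, then the restriction of \<open>\<delta> \<phi>\<close> to \<open>G\<^sup>(\<^sup>2\<^sup>)\<close> is, up to sign,
  the character whose transgression is the class of \<open>c\<close>.\<close>

definition trivializes :: "('a \<Rightarrow> int) \<Rightarrow> ('a set \<times> 'a set \<Rightarrow> int) \<Rightarrow> bool" where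
  "trivializes \<phi> c \<longleftrightarrow> \<Gamma>.cocycle c \<and> loc_const T \<phi> \<and>
     (\<forall>x\<in>carrier G. \<forall>y\<in>carrier G. [\<phi> (x \<otimes> y) = \<phi> x + \<phi> y - c (p x, p y)] (mod N))"

text \<open>The constant \<phi>(1) makes up for cocycles that are not normalised. With this sign
  commutators go to \<open>com\<close> and n-th powers to \<open>pw\<close>.\<close>

definition \<delta> :: "('a \<Rightarrow> int) \<Rightarrow> 'a \<Rightarrow> int" where
  "\<delta> \<phi> u = \<phi> \<one> - \<phi> u"

lemma trivializesD:
  "trivializes \<phi> c \<Longrightarrow> x \<in> carrier G \<Longrightarrow> y \<in> carrier G \<Longrightarrow> [\<phi> (x \<otimes> y) = \<phi> x + \<phi> y - c (p x, p y)] (mod N)"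
  by (simp add: trivializes_def)

lemma trivializes_cocycle: "trivializes \<phi> c \<Longrightarrow> \<Gamma>.cocycle c"
  by (simp add: trivializes_def)

lemma kernel_inflation:
  assumes c: "\<Gamma>.cocycle c"
  shows "\<Gamma>.cls c \<in> kernel (H2 gr1 T1 \<Lambda>) (H2 G T \<Lambda>) (inflation G T n) \<longleftrightarrow> (\<exists>\<phi>. trivializes \<phi> c)"
proof -
  have eq: "[infl c (x, y) - 0 = \<phi> y - \<phi> (x \<otimes> y) + \<phi> x] (mod N) \<longleftrightarrow> [\<phi> (x \<otimes> y) = \<phi> x + \<phi> y - c (p x, p y)] (mod N)" for \<phi> x y
  proof -
    have "infl c (x, y) - 0 - (\<phi> y - \<phi> (x \<otimes> y) + \<phi> x) = \<phi> (x \<otimes> y) - (\<phi> x + \<phi> y - c (p x, p y))"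
      by (simp add: infl_def)
    then show ?thesis by (simp only: cong_iff_dvd_diff)
  qed
  have "\<Gamma>.cls c \<in> kernel (H2 gr1 T1 \<Lambda>) (H2 G T \<Lambda>) (inflation G T n) \<longleftrightarrow> cls (infl c) = cls (\<lambda>_. 0)"
    using \<Gamma>.cls_in_H2[OF c] by (simp add: kernel_def inflation_cls[OF c] one_H2)
  also have "\<dots> \<longleftrightarrow> (\<exists>\<phi>. trivializes \<phi> c)"
    unfolding cls_eq_iff[OF cocycle_infl[OF c] cocycle_zero] eq trivializes_def using c by simp
  finally show ?thesis .
qed

lemma trivializes_one:
  assumes "trivializes \<phi> c"
  shows "[c (D, D) = \<phi> \<one>] (mod N)"
proof -
  have "[\<phi> \<one> = \<phi> \<one> + \<phi> \<one> - c (D, D)] (mod N)"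
    using trivializesD[OF assms, of \<one> \<one>] p_D[OF D.one_closed] by simp
  from cong_linear_combination[OF this cong_refl[of 0] cong_refl[of 0], of "c (D, D)" "\<phi> \<one>" 1 0 0]
  show ?thesis by simp
qed

text \<open>On G^(2) the projection is trivial, so the cocycle value in the defining equation is c
  at an argument 1, congruent to c(1, 1) and thus to \<phi>(1). Translation by d therefore shifts
  \<phi> by a quantity depending on d alone.\<close>

lemma trivializes_D:
  assumes t: "trivializes \<phi> c" and x: "x \<in> carrier G" and d: "d \<in> D"
  shows "[\<phi> (x \<otimes> d) = \<phi> x - \<delta> \<phi> d] (mod N)" and "[\<phi> (d \<otimes> x) = \<phi> x - \<delta> \<phi> d] (mod N)"
proof -
  have dc: "d \<in> carrier G" using d D.subset by blast
  note c = trivializes_cocycle[OF t]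
  have 1: "[c (p x, D) = \<phi> \<one>] (mod N)"
    using cong_trans[OF \<Gamma>.cocycle_one_right[OF c p_in[OF x]]] trivializes_one[OF t] by (simp add: gr1_simps(2))
  have 2: "[c (D, p x) = \<phi> \<one>] (mod N)"
    using cong_trans[OF \<Gamma>.cocycle_one_left[OF c p_in[OF x]]] trivializes_one[OF t] by (simp add: gr1_simps(2))
  show "[\<phi> (x \<otimes> d) = \<phi> x - \<delta> \<phi> d] (mod N)"
    using cong_linear_combination[OF trivializesD[OF t x dc] 1 cong_refl[of 0], of _ _ 1 "- 1" 0]
    by (simp add: p_D[OF d] \<delta>_def)
  show "[\<phi> (d \<otimes> x) = \<phi> x - \<delta> \<phi> d] (mod N)"
    using cong_linear_combination[OF trivializesD[OF t dc x] 2 cong_refl[of 0], of _ _ 1 "- 1" 0]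
    by (simp add: p_D[OF d] \<delta>_def)
qed

lemma \<delta>_mult:
  assumes t: "trivializes \<phi> c" and "d \<in> D" "e \<in> D"
  shows "[\<delta> \<phi> (d \<otimes> e) = \<delta> \<phi> d + \<delta> \<phi> e] (mod N)"
  using cong_linear_combination[OF trivializes_D(1)[OF t, of d e] cong_refl[of 0] cong_refl[of 0],
      of "\<delta> \<phi> (d \<otimes> e)" "\<delta> \<phi> d + \<delta> \<phi> e" "- 1" 0 0] assms D.subset
  by (simp add: \<delta>_def subset_iff)

text \<open>Since x y = y x [x, y], the shift by the commutator is the difference of \<phi> at y x
  and at x y, in which only the two cocycle values remain.\<close>

lemma \<delta>_commutator:
  assumes t: "trivializes \<phi> c" and x: "x \<in> carrier G" and y: "y \<in> carrier G"
  shows "[\<delta> \<phi> (cmt x y) = \<Gamma>.com c (p x) (p y)] (mod N)"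
proof -
  have "[\<phi> (x \<otimes> y) = \<phi> (y \<otimes> x) - \<delta> \<phi> (cmt x y)] (mod N)"
    using trivializes_D(1)[OF t, of "y \<otimes> x" "cmt x y"] D_mem(1)[OF x y] x y by (simp add: mult_cmt)
  from cong_linear_combination[OF this trivializesD[OF t x y] trivializesD[OF t y x],
      of "\<delta> \<phi> (cmt x y)" "\<Gamma>.com c (p x) (p y)" 1 "- 1" 1]
  show ?thesis by (simp add: \<Gamma>.com_def)
qed

text \<open>Inductively \<phi>(x^k) = \<phi>(1) + k \<phi>(x) minus the first k cocycle values. For
  k = n the linear term vanishes modulo n.\<close>

lemma \<delta>_power:
  assumes t: "trivializes \<phi> c" and x: "x \<in> carrier G"
  shows "[\<delta> \<phi> (x [^] n) = \<Gamma>.pw c (p x)] (mod N)"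
proof -
  have "[\<phi> (x [^] k) = \<phi> \<one> + int k * \<phi> x - (\<Sum>j<k. c (p x [^]\<^bsub>gr1\<^esub> j, p x))] (mod N)" for k :: nat
  proof (induction k)
    case (Suc k)
    have "[\<phi> (x [^] k \<otimes> x) = \<phi> (x [^] k) + \<phi> x - c (p (x [^] k), p x)] (mod N)"
      using x by (intro trivializesD[OF t]) auto
    also have "[\<phi> (x [^] k) + \<phi> x - c (p (x [^] k), p x) =
      \<phi> \<one> + int k * \<phi> x - (\<Sum>j<k. c (p x [^]\<^bsub>gr1\<^esub> j, p x)) + \<phi> x - c (p (x [^] k), p x)] (mod N)"
      by (intro cong_add cong_diff cong_refl Suc)
    finally show ?case by (simp add: gr1_pow[OF x] algebra_simps)
  qed simp
  from cong_linear_combination[OF this[of n] cong_refl[of 0] cong_refl[of 0], of "\<delta> \<phi> (x [^] n) + N * \<phi> x" "\<Gamma>.pw c (p x)" "- 1" 0 0]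
  have "[\<delta> \<phi> (x [^] n) + N * \<phi> x = \<Gamma>.pw c (p x)] (mod N)" by (simp add: \<delta>_def \<Gamma>.pw_def)
  then show ?thesis by (simp add: cong_def)
qed

text \<open>Provides closed subgroups for minimality arguments; in these, vanishing on commutators
  and powers becomes vanishing on a term of the series.\<close>

lemma closed_kernel_subgroup:
  assumes lc: "loc_const (subtopology T M) f" and M: "subgroup M G" "closedin T M"
    and hom: "\<And>x y. x \<in> M \<Longrightarrow> y \<in> M \<Longrightarrow> [f (x \<otimes> y) = f x + f y] (mod N)"
  shows "subgroup {x \<in> M. [f x = 0] (mod N)} G" "closedin T {x \<in> M. [f x = 0] (mod N)}"
proof -
  interpret M: subgroup M G by fact
  have one: "[f \<one> = 0] (mod N)"
  proof -
    have "[f \<one> + 0 = f \<one> + f \<one>] (mod N)" using hom[of \<one> \<one>] by simp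
    then show ?thesis by (simp only: cong_add_lcancel cong_sym_eq[of 0])
  qed
  show "subgroup {x \<in> M. [f x = 0] (mod N)} G"
  proof (rule subgroupI)
    show "{x \<in> M. [f x = 0] (mod N)} \<subseteq> carrier G" using M.subset by auto
    show "{x \<in> M. [f x = 0] (mod N)} \<noteq> {}" using one M.one_closed by blast
    show "inv a \<in> {x \<in> M. [f x = 0] (mod N)}" if "a \<in> {x \<in> M. [f x = 0] (mod N)}" for a
    proof -
      have a: "a \<in> M" "[f a = 0] (mod N)" using that by auto
      have ac: "a \<in> carrier G" using a M.subset by blast
      have "[f (inv a \<otimes> a) = f (inv a) + f a] (mod N)" using a by (intro hom) auto
      then have 1: "[f \<one> = f (inv a) + f a] (mod N)" using ac by simp
      have "[f (inv a) = 0] (mod N)"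
        by (rule cong_linear_combination[OF 1 one a(2), of _ _ "- 1" 1 "- 1"]) simp
      then show ?thesis using a by auto
    qed
    show "a \<otimes> b \<in> {x \<in> M. [f x = 0] (mod N)}"
      if "a \<in> {x \<in> M. [f x = 0] (mod N)}" "b \<in> {x \<in> M. [f x = 0] (mod N)}" for a b
    proof -
      have ab: "a \<in> M" "[f a = 0] (mod N)" "b \<in> M" "[f b = 0] (mod N)" using that by auto
      have "[f (a \<otimes> b) = 0] (mod N)"
        by (rule cong_linear_combination[OF hom[OF ab(1,3)] ab(2,4), of _ _ 1 1 1]) simp
      then show ?thesis using ab by auto
    qed
  qed
  have "{x \<in> M. [f x = 0] (mod N)} = {x \<in> topspace (subtopology T M). f x \<in> {a. [a = 0] (mod N)}}"
    using M.subset topspace by auto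
  then show "closedin T {x \<in> M. [f x = 0] (mod N)}"
    using closedin_trans_full[OF loc_const_closedin[OF lc, of "{a. [a = 0] (mod N)}"] M(2)] by simp
qed

lemma loc_const_\<delta>: "loc_const T \<phi> \<Longrightarrow> loc_const T (\<delta> \<phi>)"
  using loc_const_map[of T \<phi> "\<lambda>a. \<phi> \<one> - a"] by (simp add: \<delta>_def[abs_def])

lemma \<delta>_C:
  assumes t: "trivializes \<phi> c" and u: "u \<in> C"
  shows "[\<delta> \<phi> u = 0] (mod N)"
proof -
  have lc: "loc_const T (\<delta> \<phi>)" using t by (intro loc_const_\<delta>) (simp add: trivializes_def)
  let ?H = "{x \<in> D. [\<delta> \<phi> x = 0] (mod N)}"
  note H = closed_kernel_subgroup[OF loc_const_subtopology[OF lc] D.subgroup_axioms closedin_D \<delta>_mult[OF t]]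
  have "C \<subseteq> ?H"
    unfolding C_eq
  proof (rule next_term_minimal[OF H])
    fix x y assume x: "x \<in> carrier G" and y: "y \<in> D"
    have yc: "y \<in> carrier G" using y D.subset by blast
    have 1: "[\<delta> \<phi> (cmt x y) = \<Gamma>.com c (p x) (p \<one>)] (mod N)"
      using \<delta>_commutator[OF t x yc] p_D[OF y] p_D[OF D.one_closed] by simp
    also have "[\<Gamma>.com c (p x) (p \<one>) = \<delta> \<phi> (cmt x \<one>)] (mod N)" by (rule cong_sym[OF \<delta>_commutator[OF t x one_closed]])
    finally have "[\<delta> \<phi> (cmt x y) = 0] (mod N)" using x by (simp add: \<delta>_def)
    then show "cmt x y \<in> ?H" using D_mem(1)[OF x yc] by simp
  next
    fix y assume y: "y \<in> D"
    have yc: "y \<in> carrier G" using y D.subset by blast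
    have "[\<delta> \<phi> (y [^] n) = \<Gamma>.pw c (p \<one>)] (mod N)"
      using \<delta>_power[OF t yc] p_D[OF y] p_D[OF D.one_closed] by simp
    also have "[\<Gamma>.pw c (p \<one>) = \<delta> \<phi> (\<one> [^] n)] (mod N)" by (rule cong_sym[OF \<delta>_power[OF t one_closed]])
    finally have "[\<delta> \<phi> (y [^] n) = 0] (mod N)" by (simp add: \<delta>_def)
    then show "y [^] n \<in> ?H" using D_mem(2)[OF yc] by simp
  qed
  then show ?thesis using u by blast
qed

lemma trivializes_sum:
  assumes t: "\<And>i. i \<in> J \<Longrightarrow> trivializes (\<phi> i) (c i)" 
  shows "trivializes (\<lambda>x. \<Sum>i\<in>J. m i * \<phi> i x) (\<lambda>q. \<Sum>i\<in>J. m i * c i q)"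
  unfolding trivializes_def
proof (intro conjI ballI)
  show "\<Gamma>.cocycle (\<lambda>q. \<Sum>i\<in>J. m i * c i q)" using t by (intro \<Gamma>.cocycle_sum \<Gamma>.cocycle_scale) (simp add: trivializes_def)
  show "loc_const T (\<lambda>x. \<Sum>i\<in>J. m i * \<phi> i x)" using t
    by (intro loc_const_sum loc_const_map[where h = "\<lambda>a. m _ * a"]) (simp add: trivializes_def)
  fix x y assume "x \<in> carrier G" "y \<in> carrier G"
  then have "[(\<Sum>i\<in>J. m i * \<phi> i (x \<otimes> y)) = (\<Sum>i\<in>J. m i * (\<phi> i x + \<phi> i y - c i (p x, p y)))] (mod N)"
    using t by (intro cong_sum cong_mult cong_refl trivializesD) auto
  then show "[(\<Sum>i\<in>J. m i * \<phi> i (x \<otimes> y)) = (\<Sum>i\<in>J. m i * \<phi> i x) + (\<Sum>i\<in>J. m i * \<phi> i y) - (\<Sum>i\<in>J. m i * c i (p x, p y))] (mod N)"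
    by (simp add: sum.distrib sum_subtractf distrib_left right_diff_distrib)
qed

lemma \<delta>_sum: "\<delta> (\<lambda>x. \<Sum>i\<in>J. m i * \<phi> i x) u = (\<Sum>i\<in>J. m i * \<delta> (\<phi> i) u)"
  by (simp add: \<delta>_def sum_subtractf right_diff_distrib)

lemma trivializes_linear:
  assumes "trivializes \<phi> c" "trivializes \<psi> c'"
  shows "trivializes (\<lambda>x. k * \<phi> x + l * \<psi> x) (\<lambda>q. k * c q + l * c' q)"
  using trivializes_sum[of "{False, True}" "\<lambda>b. if b then \<psi> else \<phi>" "\<lambda>b. if b then c' else c" "\<lambda>b. if b then l else k"] assms
  by simp

text \<open>If c is the coboundary of \<psi>, then \<phi> minus the pullback of \<psi> is a
  character of G modulo n, so it kills commutators and n-th powers and hence G^(2). On G^(2) the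
  pullback of \<psi> is constant and drops out of \<delta>.\<close>

lemma trivial_class_\<delta>:
  assumes t: "trivializes \<phi> c" and c: "\<Gamma>.cls c = \<one>\<^bsub>H2 gr1 T1 \<Lambda>\<^esub>" and u: "u \<in> D"
  shows "[\<delta> \<phi> u = 0] (mod N)"
proof -
  note cc = trivializes_cocycle[OF t]
  obtain \<psi> where psi: "loc_const T1 \<psi>" "\<And>\<sigma> \<tau>. \<sigma> \<in> carrier gr1 \<Longrightarrow> \<tau> \<in> carrier gr1 \<Longrightarrow>
     [c (\<sigma>, \<tau>) - 0 = \<psi> \<tau> - \<psi> (\<sigma> \<otimes>\<^bsub>gr1\<^esub> \<tau>) + \<psi> \<sigma>] (mod N)"
    using c unfolding \<Gamma>.one_H2 \<Gamma>.cls_eq_iff[OF cc \<Gamma>.cocycle_zero] by blast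
  define f where "f = (\<lambda>x. \<phi> x - \<psi> (p x))"
  have lc: "loc_const T f" unfolding f_def
    using t loc_const_compose[OF continuous_p psi(1)] by (intro loc_const_map2[where h = "(-)"]) (auto simp: trivializes_def)
  have fm: "[f (x \<otimes> y) = f x + f y] (mod N)" if g: "x \<in> carrier G" "y \<in> carrier G" for x y
    using cong_linear_combination[OF trivializesD[OF t g] psi(2)[OF p_in[OF g(1)] p_in[OF g(2)]] cong_refl[of 0],
        of "f (x \<otimes> y)" "f x + f y" 1 "- 1" 0] g
    by (simp add: f_def gr1_simps(3))
  note H = closed_kernel_subgroup[OF loc_const_subtopology[OF lc] subgroup_self _ fm]
  have clG: "closedin T (carrier G)" using closedin_topspace[of T] unfolding topspace .
  have one: "[f \<one> = 0] (mod N)"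
    using subgroup.one_closed[OF H(1)[OF clG]] by simp
  have finv: "[f (inv x) = - f x] (mod N)" if "x \<in> carrier G" for x
    using cong_linear_combination[OF fm[of "inv x" x] one cong_refl[of 0], of "f (inv x)" "- f x" "- 1" 1 0] that by simp
  have fpow: "[f (x [^] k) = int k * f x] (mod N)" if x: "x \<in> carrier G" for x and k :: nat
  proof (induction k)
    case (Suc k)
    show ?case
      using cong_linear_combination[OF fm[of "x [^] k" x] Suc cong_refl[of 0], of "f (x [^] Suc k)" "int (Suc k) * f x" 1 1 0] x
      by (simp add: algebra_simps)
  qed (simp add: one)
  have "D \<subseteq> {x \<in> carrier G. [f x = 0] (mod N)}"
  proof (rule D_minimal[OF H[OF clG]])
    fix x y assume g: "x \<in> carrier G" "y \<in> carrier G"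
    have "[f (y \<otimes> x \<otimes> cmt x y) = f (y \<otimes> x) + f (cmt x y)] (mod N)" using g by (intro fm) auto
    then have 1: "[f (x \<otimes> y) = f (y \<otimes> x) + f (cmt x y)] (mod N)" using g by (simp add: mult_cmt)
    have "[f (cmt x y) = 0] (mod N)"
      by (rule cong_linear_combination[OF 1 fm[OF g] fm[OF g(2,1)], of _ _ "- 1" 1 "- 1"]) simp
    then show "cmt x y \<in> {x \<in> carrier G. [f x = 0] (mod N)}" using g by simp
  next
    fix y assume g: "y \<in> carrier G"
    note fpow[OF g, of n]
    also have "[N * f y = 0] (mod N)" by (simp add: cong_0_iff)
    finally have "[f (y [^] n) = 0] (mod N)" .
    then show "y [^] n \<in> {x \<in> carrier G. [f x = 0] (mod N)}" using g by simp
  qed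
  then have "[f u = 0] (mod N)" using u by blast
  from cong_diff[OF one this] show ?thesis by (simp add: \<delta>_def f_def p_D[OF u] p_D[OF D.one_closed])
qed

lemma \<delta>_zero_trivial_class:
  assumes t: "trivializes \<phi> c" and 0: "\<And>u. u \<in> D \<Longrightarrow> [\<delta> \<phi> u = 0] (mod N)"
  shows "\<Gamma>.cls c = \<one>\<^bsub>H2 gr1 T1 \<Lambda>\<^esub>"
proof -
  note cc = trivializes_cocycle[OF t]
  define \<psi> where "\<psi> = (\<lambda>\<sigma>. \<phi> (SOME x. x \<in> \<sigma>) mod N)"
  have psi: "\<psi> (p x) = \<phi> x mod N" if x: "x \<in> carrier G" for x
  proof -
    have "(SOME y. y \<in> p x) \<in> p x" using rcos_self[OF x D.subgroup_axioms] by (rule someI)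
    then obtain d where d: "d \<in> D" "(SOME y. y \<in> p x) = d \<otimes> x" by (auto simp: r_coset_def)
    have "[\<phi> (d \<otimes> x) = \<phi> x - 0] (mod N)"
      using cong_trans[OF trivializes_D(2)[OF t x d(1)] cong_diff[OF cong_refl 0[OF d(1)]]] .
    then show ?thesis by (simp add: \<psi>_def d(2) cong_def)
  qed
  have "loc_const T1 \<psi>"
  proof (rule loc_const_quotient[OF quotient_p])
    have "loc_const T (\<lambda>x. \<phi> x mod N)" using t by (intro loc_const_map[where f = \<phi> and h = "\<lambda>a. a mod N"]) (simp add: trivializes_def)
    then show "loc_const T (\<lambda>x. \<psi> (p x))"
      by (subst loc_const_cong[of _ _ "\<lambda>x. \<phi> x mod N"]) (auto simp: psi topspace)
  qed
  moreover have "[c (\<sigma>, \<tau>) - 0 = \<psi> \<tau> - \<psi> (\<sigma> \<otimes>\<^bsub>gr1\<^esub> \<tau>) + \<psi> \<sigma>] (mod N)"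
    if st: "\<sigma> \<in> carrier gr1" "\<tau> \<in> carrier gr1" for \<sigma> \<tau>
  proof -
    obtain x y where xy: "x \<in> carrier G" "\<sigma> = p x" "y \<in> carrier G" "\<tau> = p y" using st by (auto simp: gr1_simps)
    have "[\<phi> y mod N - \<phi> (x \<otimes> y) mod N + \<phi> x mod N = \<phi> y - \<phi> (x \<otimes> y) + \<phi> x] (mod N)"
      by (intro cong_add cong_diff) simp_all
    moreover have "[c (p x, p y) = \<phi> y - \<phi> (x \<otimes> y) + \<phi> x] (mod N)"
      by (rule cong_linear_combination[OF trivializesD[OF t xy(1,3)] cong_refl[of 0] cong_refl[of 0], of _ _ 1 0 0]) simp
    ultimately show ?thesis using xy by (simp add: gr1_simps(3) psi) (meson cong_sym cong_trans)
  qed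
  ultimately show ?thesis unfolding \<Gamma>.one_H2 by (subst \<Gamma>.cls_eq_iff[OF cc \<Gamma>.cocycle_zero]) blast
qed

end

section \<open>Characters separate points\<close>

text \<open>The group is presented with its own elements as generators: \<open>pr\<close> maps
  integer exponent vectors to products, and \<open>mod_functional_separate\<close> is applied to the
  relations, the kernel of \<open>pr\<close>. Exponent n ensures that vectors divisible by n are
  relations.\<close>

lemma (in comm_group) character_separates:
  fixes n :: nat
  assumes fin: "finite (carrier G)" and n: "n > 0" and exp: "\<And>a. a \<in> carrier G \<Longrightarrow> a [^] n = \<one>"
    and u: "u \<in> carrier G" "u \<noteq> \<one>"
  shows "\<exists>m. (\<forall>a\<in>carrier G. \<forall>b\<in>carrier G. [m (a \<otimes> b) = m a + m b] (mod int n)) \<and> \<not> [m u = 0] (mod int n)"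
proof -
  define pr where "pr = (\<lambda>b :: 'a \<Rightarrow> int. finprod G (\<lambda>a. a [^] b a) (carrier G))"
  have pr_closed: "pr b \<in> carrier G" for b unfolding pr_def by (rule finprod_closed) auto
  have pr_add: "pr (\<lambda>a. b a + b' a) = pr b \<otimes> pr b'" for b b'
  proof -
    have "pr (\<lambda>a. b a + b' a) = finprod G (\<lambda>a. a [^] b a \<otimes> a [^] b' a) (carrier G)"
      unfolding pr_def by (rule finprod_cong') (auto simp: int_pow_mult)
    also have "\<dots> = pr b \<otimes> pr b'" unfolding pr_def by (rule finprod_multf) auto
    finally show ?thesis .
  qed
  have pr_zero: "pr (\<lambda>_. 0) = \<one>" unfolding pr_def by (simp add: int_pow_0)
  have pr_diff: "pr (\<lambda>a. b a - b' a) = pr b \<otimes> inv (pr b')" for b b'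
  proof -
    have "pr (\<lambda>a. b a - b' a) \<otimes> pr b' = pr b" using pr_add[of "\<lambda>a. b a - b' a" b'] by simp
    then show ?thesis using pr_closed by (metis inv_solve_right)
  qed
  have pr_multiple: "pr b = \<one>" if nb: "\<And>a. a \<in> carrier G \<Longrightarrow> int n dvd b a" for b
    unfolding pr_def
  proof (rule finprod_one_eqI)
    fix a assume a: "a \<in> carrier G"
    then obtain k where "b a = int n * k" using nb[OF a] by (auto simp: dvd_def)
    then have "a [^] b a = (a [^] int n) [^] k" using a by (simp add: int_pow_pow)
    then show "a [^] b a = \<one>" using exp[OF a] by (simp add: int_pow_int)
  qed
  define e where "e = (\<lambda>v a :: 'a. if a = v then 1 else 0 :: int)"
  have pr_e: "pr (e v) = v" if v: "v \<in> carrier G" for v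
  proof -
    have "pr (e v) = finprod G (\<lambda>a. if a = v then a else \<one>) (carrier G)"
      unfolding pr_def e_def by (rule finprod_cong') (auto simp: int_pow_0)
    also have "\<dots> = v" using finprod_singleton_swap[OF v fin, of "\<lambda>a. a"] by simp
    finally show ?thesis .
  qed
  have "\<exists>m. (\<forall>b\<in>{b. pr b = \<one>}. int n dvd (\<Sum>r\<in>carrier G. m r * b r)) \<and> \<not> int n dvd (\<Sum>r\<in>carrier G. m r * e u r)"
  proof (rule mod_functional_separate[OF fin])
    show "{b. pr b = \<one>} \<noteq> {}" using pr_zero by blast
    show "(\<lambda>r. b r - b' r) \<in> {b. pr b = \<one>}" if "b \<in> {b. pr b = \<one>}" "b' \<in> {b. pr b = \<one>}" for b b'
      using that by (simp add: pr_diff)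
    show "\<exists>r\<in>carrier G. \<not> int n dvd e u r - b r" if "b \<in> {b. pr b = \<one>}" for b
    proof (rule ccontr)
      assume "\<not> ?thesis"
      then have "pr (\<lambda>r. e u r - b r) = \<one>" by (intro pr_multiple) auto
      then show False using that u by (simp add: pr_diff pr_e)
    qed
  qed (use n in auto)
  then obtain m where m: "\<And>b. pr b = \<one> \<Longrightarrow> int n dvd (\<Sum>r\<in>carrier G. m r * b r)"
    "\<not> int n dvd (\<Sum>r\<in>carrier G. m r * e u r)" by blast
  have sum_e: "(\<Sum>r\<in>carrier G. m r * e v r) = m v" if "v \<in> carrier G" for v
    using that fin by (simp add: e_def if_distrib[of "\<lambda>x. _ * x"] sum.delta cong: if_cong)
  have "[m (a \<otimes> b) = m a + m b] (mod int n)" if ab: "a \<in> carrier G" "b \<in> carrier G" for a b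
  proof -
    \<comment> \<open>The multiplication table belongs to the relations, and this makes the
      coefficients m additive modulo n.\<close>
    have "pr (\<lambda>r. e a r + e b r - e (a \<otimes> b) r) = (a \<otimes> b) \<otimes> inv (a \<otimes> b)"
      using ab by (simp add: pr_diff pr_add pr_e)
    also have "\<dots> = \<one>" using ab by (simp del: inv_mult)
    finally have "int n dvd (\<Sum>r\<in>carrier G. m r * (e a r + e b r - e (a \<otimes> b) r))" by (rule m(1))
    also have "(\<Sum>r\<in>carrier G. m r * (e a r + e b r - e (a \<otimes> b) r)) = m a + m b - m (a \<otimes> b)"
      using ab by (simp add: distrib_left right_diff_distrib sum.distrib sum_subtractf sum_e)
    finally show ?thesis by (simp add: cong_iff_dvd_diff dvd_diff_commute)
  qed
  then show ?thesis using m(2) u(1) by (auto simp: sum_e cong_0_iff)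
qed

context top_group
begin

text \<open>The cosets are a disjoint open cover by nonempty sets, so a finite subcover already
  contains all of them.\<close>

lemma open_subgroup_finite_index:
  assumes "compact_space T" "subgroup U G" "openin T U"
  shows "finite (rcosets U)"
proof -
  interpret U: subgroup U G by fact
  have op: "openin T c" if c: "c \<in> rcosets U" for c
  proof -
    obtain a where a: "a \<in> carrier G" "c = U #> a" using c by (auto simp: RCOSETS_def)
    have "c = (\<lambda>x. x \<otimes> a) ` U" unfolding a(2) by (auto simp: r_coset_def)
    then show ?thesis using openin_rmult[OF assms(3) a(1)] by simp
  qed
  have "\<Union> (rcosets U) = topspace T" using rcosets_part_G[OF assms(2)] topspace by simp
  then obtain \<F> where F: "finite \<F>" "\<F> \<subseteq> rcosets U" "topspace T \<subseteq> \<Union> \<F>"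
    using assms(1) op unfolding compact_space_alt by (metis (no_types, lifting) subset_refl)
  have "rcosets U \<subseteq> \<F>"
  proof
    fix c assume c: "c \<in> rcosets U"
    obtain x where x: "x \<in> c" using U.rcosets_non_empty[OF c] by blast
    then have "x \<in> topspace T" using op[OF c] openin_subset by blast
    then obtain f where f: "f \<in> \<F>" "x \<in> f" using F(3) by blast
    then have "f = c" using rcos_disjoint[OF assms(2)] c x F(2) unfolding pairwise_def disjnt_def by blast
    then show "c \<in> \<F>" using f by simp
  qed
  then show ?thesis using F(1) by (rule finite_subset)
qed

end

section \<open>Extending characters of G^(2) to cochains on G\<close>

context profinite_presentation
begin

text \<open>A character of a finite quotient of \<open>G\<^sup>(\<^sup>2\<^sup>)/G\<^sup>(\<^sup>3\<^sup>)\<close> is extended to \<open>G\<close> along the cosets of an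
  open subgroup; its coboundary is inflated from \<open>\<gg>\<^sub>1\<close>.\<close>

lemma transgression_separates:
  assumes u: "u \<in> D" "u \<notin> C"
  shows "\<exists>\<phi> c. trivializes \<phi> c \<and> \<not> [\<delta> \<phi> u = 0] (mod N)"
proof -
  have uc: "u \<in> carrier G" using u D.subset by blast
  \<comment> \<open>The elements v for which u v^(-1) avoids the closed subgroup \<open>C\<close>
    form an open neighbourhood of 1. An open normal U inside it keeps u out of the product of
    \<open>C\<close> and U.\<close>
  have "continuous_map T T (\<lambda>v. u \<otimes> inv v)"
    using uc topspace by (intro continuous_map_mult continuous_map_inv) (auto simp: continuous_map_id)
  moreover have "openin T (topspace T - C)" using closedin_C by blast
  ultimately have V: "openin T {v \<in> topspace T. u \<otimes> inv v \<in> topspace T - C}" by (rule openin_continuous_map_preimage)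
  have V1: "\<one> \<in> {v \<in> topspace T. u \<otimes> inv v \<in> topspace T - C}" using u uc topspace by simp
  obtain U where U: "U \<lhd> G" "openin T U" "U \<subseteq> {v \<in> topspace T. u \<otimes> inv v \<in> topspace T - C}"
    using profinite_open_normal_subgroup[OF profinite V V1] by blast
  \<comment> \<open>Modulo B the group is finite, the image of \<open>D\<close> is central of
    exponent dividing n, and u has nontrivial image.\<close>
  define B where "B = C <#> U"
  have Bn: "B \<lhd> G" unfolding B_def by (rule normal_subgroup_set_mult_closed[OF normal_C U(1)])
  have Bo: "openin T B" unfolding B_def by (rule openin_set_mult[OF U(2) C.subset])
  interpret U: normal U G by (rule U(1))
  interpret B: normal B G by (rule Bn)
  have set_mult_one: "X \<subseteq> X <#> Y" "X \<subseteq> Y <#> X" if "X \<subseteq> carrier G" "\<one> \<in> Y" for X Y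
  proof -
    have "x \<in> X <#> Y" "x \<in> Y <#> X" if "x \<in> X" for x
    proof -
      have "x = x \<otimes> \<one>" "x = \<one> \<otimes> x" using that \<open>X \<subseteq> carrier G\<close> by auto
      then show "x \<in> X <#> Y" "x \<in> Y <#> X" using that \<open>\<one> \<in> Y\<close> unfolding set_mult_def by blast+
    qed
    then show "X \<subseteq> X <#> Y" "X \<subseteq> Y <#> X" by auto
  qed
  have CB: "C \<subseteq> B" unfolding B_def by (rule set_mult_one[OF C.subset U.one_closed])
  have uB: "u \<notin> B"
  proof
    assume "u \<in> B"
    then obtain c v where cv: "u = c \<otimes> v" "c \<in> C" "v \<in> U" by (auto simp: B_def set_mult_def)
    then have "u \<otimes> inv v = c" using C.subset U.subset by (auto simp: m_assoc)
    then show False using cv U(3) by auto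
  qed
  let ?r = "\<lambda>x. B #> x"
  have r_mult: "?r x <#> ?r y = ?r (x \<otimes> y)" if "x \<in> carrier G" "y \<in> carrier G" for x y
    using B.rcos_sum that by simp
  have r_B: "?r b = B" if "b \<in> B" for b using B.rcos_const[OF is_group that] .
  have r_absorb: "?r (b \<otimes> x) = ?r x" if "b \<in> B" "x \<in> carrier G" for b x
  proof -
    have bc: "b \<in> carrier G" using that B.subset by blast
    have "?r (b \<otimes> x) = ?r b <#> ?r x" using r_mult[OF bc that(2)] by simp
    also have "\<dots> = ?r \<one> <#> ?r x" using r_B[OF that(1)] r_B[OF B.one_closed] by simp
    also have "\<dots> = ?r x" using r_mult[of \<one> x] that by simp
    finally show ?thesis .
  qed
  have r_comm: "?r (d \<otimes> g) = ?r (g \<otimes> d)" if d: "d \<in> D" and g: "g \<in> carrier G" for d g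
  proof -
    have dc: "d \<in> carrier G" using d D.subset by blast
    have w: "cmt g d \<in> B" using C_mem(1)[OF g d] CB by blast
    have "?r (g \<otimes> d) = ?r (d \<otimes> g \<otimes> cmt g d)" using mult_cmt[OF g dc] by simp
    also have "\<dots> = ?r (d \<otimes> g) <#> ?r (cmt g d)" using r_mult[of "d \<otimes> g" "cmt g d"] dc g by simp
    also have "\<dots> = ?r (d \<otimes> g) <#> ?r \<one>" using r_B[OF w] r_B[OF B.one_closed] by simp
    also have "\<dots> = ?r (d \<otimes> g)" using r_mult[of "d \<otimes> g" \<one>] dc g by simp
    finally show ?thesis by simp
  qed
  define A where "A = (G Mod B)\<lparr>carrier := ?r ` D\<rparr>"
  interpret QB: group "G Mod B" by (rule B.factorgroup_is_group)
  have A_simps: "carrier A = ?r ` D" "\<one>\<^bsub>A\<^esub> = B" "a \<otimes>\<^bsub>A\<^esub> b = a <#> b" for a b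
    by (simp_all add: A_def)
  have hom_r: "group_hom G (G Mod B) ?r"
    by (simp add: group_hom_def group_hom_axioms_def is_group QB.is_group B.r_coset_hom_Mod)
  have "subgroup (?r ` D) (G Mod B)" by (rule group_hom.subgroup_img_is_subgroup[OF hom_r D.subgroup_axioms])
  then have "group A" unfolding A_def by (rule subgroup.subgroup_is_group) (rule QB.is_group)
  then interpret A: comm_group A
  proof (rule group.group_comm_groupI)
    fix a b assume "a \<in> carrier A" "b \<in> carrier A"
    then obtain d e where de: "d \<in> D" "a = ?r d" "e \<in> D" "b = ?r e" by (auto simp: A_simps)
    have c: "d \<in> carrier G" "e \<in> carrier G" using de D.subset by auto
    show "a \<otimes>\<^bsub>A\<^esub> b = b \<otimes>\<^bsub>A\<^esub> a"
      unfolding A_simps de r_mult[OF c] r_mult[OF c(2,1)] by (rule r_comm[OF de(1) c(2)])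
  qed
  have "?r ` D \<subseteq> rcosets B" using D.subset by (auto simp: RCOSETS_def)
  then have finA: "finite (carrier A)"
    using open_subgroup_finite_index[OF compact_T B.subgroup_axioms Bo] by (simp add: A_simps finite_subset)
  have powA: "a [^]\<^bsub>A\<^esub> n = \<one>\<^bsub>A\<^esub>" if aA: "a \<in> carrier A" for a
  proof -
    obtain d where d: "d \<in> D" "a = ?r d" using aA by (auto simp: A_simps)
    have dc: "d \<in> carrier G" using d D.subset by blast
    have "a [^]\<^bsub>A\<^esub> (k::nat) = a [^]\<^bsub>G Mod B\<^esub> k" for k by (simp add: A_def nat_pow_def)
    then have "a [^]\<^bsub>A\<^esub> n = ?r (d [^] n)" using B.FactGroup_pow[OF dc] d by simp
    also have "\<dots> = B" using C_mem(2)[OF d(1)] CB by (intro r_B) blast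
    finally show ?thesis by (simp add: A_simps)
  qed
  have "?r u \<noteq> \<one>\<^bsub>A\<^esub>" using rcos_self[OF uc B.subgroup_axioms] uB by (auto simp: A_simps)
  then obtain m where m: "\<And>a b. a \<in> carrier A \<Longrightarrow> b \<in> carrier A \<Longrightarrow> [m (a \<otimes>\<^bsub>A\<^esub> b) = m a + m b] (mod N)"
    and mu: "\<not> [m (?r u) = 0] (mod N)"
    using A.character_separates[OF finA n_pos powA, of "?r u"] u by (auto simp: A_simps)
  \<comment> \<open>M and \<open>D\<close> have the same image modulo B, so the character extends to
    M by pulling it back along the quotient by B.\<close>
  define M where "M = D <#> B"
  have Mn: "M \<lhd> G" unfolding M_def by (rule normal_subgroup_set_mult_closed[OF normal_D Bn])
  interpret M: normal M G by (rule Mn)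
  have DM: "D \<subseteq> M" unfolding M_def by (rule set_mult_one[OF D.subset B.one_closed])
  have BM: "B \<subseteq> M" unfolding M_def by (rule set_mult_one[OF B.subset D.one_closed])
  define ch where "ch = (\<lambda>k. m (?r k))"
  have rM: "\<exists>d\<in>D. ?r k = ?r d" if kM: "k \<in> M" for k
  proof -
    obtain d b where db: "k = d \<otimes> b" "d \<in> D" "b \<in> B" using kM by (auto simp: M_def set_mult_def)
    have c: "d \<in> carrier G" "b \<in> carrier G" using db D.subset B.subset by auto
    have "?r k = ?r (b \<otimes> d)" unfolding db(1) using r_comm[OF db(2) c(2)] .
    then show ?thesis using r_absorb[OF db(3) c(1)] db(2) by auto
  qed
  have ch_mult: "[ch (k \<otimes> l) = ch k + ch l] (mod N)" if "k \<in> M" "l \<in> M" for k l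
  proof -
    have "?r k \<in> carrier A" "?r l \<in> carrier A" using rM that by (auto simp: A_simps)
    moreover have "?r (k \<otimes> l) = ?r k \<otimes>\<^bsub>A\<^esub> ?r l" using r_mult that M.subset by (auto simp: A_simps)
    ultimately show ?thesis using m by (simp add: ch_def)
  qed
  have ch_conj: "ch (g \<otimes> k \<otimes> inv g) = ch k" if k: "k \<in> M" and g: "g \<in> carrier G" for g k
  proof -
    obtain d where d: "d \<in> D" "?r k = ?r d" using rM[OF k] by blast
    have c: "d \<in> carrier G" "k \<in> carrier G" using d D.subset k M.subset by auto
    have "?r (g \<otimes> k \<otimes> inv g) = ?r g <#> ?r k <#> ?r (inv g)" using c g by (simp add: r_mult)
    also have "\<dots> = ?r (g \<otimes> d) <#> ?r (inv g)" using c g d by (simp add: r_mult)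
    also have "\<dots> = ?r (d \<otimes> g) <#> ?r (inv g)" using r_comm[OF d(1) g] by simp
    also have "\<dots> = ?r (d \<otimes> g \<otimes> inv g)" using c g by (simp add: r_mult)
    also have "d \<otimes> g \<otimes> inv g = d" using c g by (simp add: m_assoc)
    finally show ?thesis using d by (simp add: ch_def)
  qed
  have ch_B: "ch (b \<otimes> k) = ch k" if "b \<in> B" "k \<in> carrier G" for b k
    using r_absorb[OF that] by (simp add: ch_def)
  have ch_one: "[ch \<one> = 0] (mod N)"
  proof -
    have "[ch \<one> + 0 = ch \<one> + ch \<one>] (mod N)" using ch_mult[OF M.one_closed M.one_closed] by simp
    then show ?thesis by (simp only: cong_add_lcancel cong_sym_eq[of 0])
  qed
  \<comment> \<open>Depends only on the coset of M. The representatives may be arbitrary, because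
    \<phi> becomes invariant under the open subgroup B and is therefore locally constant.\<close>
  define s where "s = (\<lambda>g. SOME x. x \<in> M #> g)"
  have s: "s g \<in> M #> g" if "g \<in> carrier G" for g
    unfolding s_def using rcos_self[OF that M.subgroup_axioms] by (rule someI)
  have s_carrier: "s g \<in> carrier G" if "g \<in> carrier G" for g
    using M.elemrcos_carrier[OF is_group that s[OF that]] .
  have s_M: "g \<otimes> inv (s g) \<in> M" if g: "g \<in> carrier G" for g
  proof -
    have "s g \<otimes> inv g \<in> M" using M.rcos_module_imp[OF is_group g s[OF g]] .
    then have "inv (s g \<otimes> inv g) \<in> M" by (rule M.m_inv_closed)
    then show ?thesis using g s_carrier[OF g] by (simp add: inv_mult_group)
  qed
  have s_mult: "s (k \<otimes> g) = s g" if k: "k \<in> M" and g: "g \<in> carrier G" for k g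
  proof -
    have kc: "k \<in> carrier G" using k M.subset by blast
    have "M #> (k \<otimes> g) = (M #> k) #> g" using kc g M.subset by (simp add: coset_mult_assoc)
    also have "M #> k = M" using M.rcos_const[OF is_group k] .
    finally show ?thesis by (simp add: s_def)
  qed
  \<comment> \<open>The M-component of g relative to its representative. It transforms by
    \<open>ch\<close> under M on the left by construction, and on the right because
    \<open>ch\<close> is invariant under conjugation by G.\<close>
  define \<phi> where "\<phi> = (\<lambda>g. ch (g \<otimes> inv (s g)))"
  have phi_left: "[\<phi> (k \<otimes> g) = ch k + \<phi> g] (mod N)" if k: "k \<in> M" and g: "g \<in> carrier G" for k g
  proof -
    have kc: "k \<in> carrier G" using k M.subset by blast
    have "\<phi> (k \<otimes> g) = ch (k \<otimes> (g \<otimes> inv (s g)))"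
      unfolding \<phi>_def s_mult[OF k g] using kc g s_carrier[OF g] by (simp add: m_assoc)
    then show ?thesis using ch_mult[OF k s_M[OF g]] by (simp add: \<phi>_def)
  qed
  have phi_right: "[\<phi> (g \<otimes> k) = \<phi> g + ch k] (mod N)" if k: "k \<in> M" and g: "g \<in> carrier G" for k g
  proof -
    have kc: "k \<in> carrier G" using k M.subset by blast
    have "g \<otimes> k = (g \<otimes> k \<otimes> inv g) \<otimes> g" using kc g by (simp add: m_assoc)
    then have "[\<phi> (g \<otimes> k) = ch (g \<otimes> k \<otimes> inv g) + \<phi> g] (mod N)"
      using phi_left[OF M.inv_op_closed2[OF g k] g] by simp
    then show ?thesis using ch_conj[OF k g] by (simp add: add.commute)
  qed
  have phi_B: "\<phi> (g \<otimes> b) = \<phi> g" if b: "b \<in> B" and g: "g \<in> carrier G" for g b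
  proof -
    have bc: "b \<in> carrier G" using b B.subset by blast
    have b': "g \<otimes> b \<otimes> inv g \<in> B" using B.inv_op_closed2[OF g b] .
    have eq: "g \<otimes> b = (g \<otimes> b \<otimes> inv g) \<otimes> g" using bc g by (simp add: m_assoc)
    have "s (g \<otimes> b) = s g" using s_mult[of "g \<otimes> b \<otimes> inv g" g] b' BM g eq by auto
    moreover have "g \<otimes> b \<otimes> inv (s g) = (g \<otimes> b \<otimes> inv g) \<otimes> (g \<otimes> inv (s g))"
      using bc g s_carrier[OF g] by (simp add: m_assoc cancel_left)
    ultimately show ?thesis unfolding \<phi>_def using ch_B[OF b', of "g \<otimes> inv (s g)"] g s_carrier[OF g] by simp
  qed
  have lc_phi: "loc_const T \<phi>" unfolding loc_const_def
  proof
    fix v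
    have "{x \<in> topspace T. \<phi> x = v} = {x \<in> topspace T. \<phi> x = v} <#> B"
    proof (intro subset_antisym subsetI)
      fix x assume x: "x \<in> {x \<in> topspace T. \<phi> x = v}"
      then have "x = x \<otimes> \<one>" using topspace by simp
      then show "x \<in> {x \<in> topspace T. \<phi> x = v} <#> B" using x B.one_closed unfolding set_mult_def by blast
    next
      fix x assume "x \<in> {x \<in> topspace T. \<phi> x = v} <#> B"
      then obtain g b where "x = g \<otimes> b" "g \<in> carrier G" "\<phi> g = v" "b \<in> B" using topspace by (auto simp: set_mult_def)
      then show "x \<in> {x \<in> topspace T. \<phi> x = v}" using phi_B B.subset topspace by auto
    qed
    moreover have "openin T ({x \<in> topspace T. \<phi> x = v} <#> B)"
      by (rule openin_set_mult[OF Bo]) (use topspace in auto)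
    ultimately show "openin T {x \<in> topspace T. \<phi> x = v}" by simp
  qed
  \<comment> \<open>Multiplying either argument by an element of \<open>D\<close> leaves the
    coboundary unchanged modulo n, so it can be read off from arbitrary coset
    representatives.\<close>
  define c where "c = (\<lambda>(\<sigma>, \<tau>). cobound \<phi> (SOME x. x \<in> \<sigma>, SOME y. y \<in> \<tau>) mod N)"
  have c_eq: "c (p x, p y) = cobound \<phi> (x, y) mod N" if x: "x \<in> carrier G" and y: "y \<in> carrier G" for x y
  proof -
    have "(SOME z. z \<in> p x) \<in> p x" using rcos_self[OF x D.subgroup_axioms] by (rule someI)
    then obtain d where d: "d \<in> D" "(SOME z. z \<in> p x) = d \<otimes> x" by (auto simp: r_coset_def)
    have "(SOME z. z \<in> p y) \<in> p y" using rcos_self[OF y D.subgroup_axioms] by (rule someI)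
    then obtain e where e: "e \<in> D" "(SOME z. z \<in> p y) = e \<otimes> y" by (auto simp: r_coset_def)
    have dM: "d \<in> M" and eM: "e \<in> M" using d e DM by auto
    have dc: "d \<in> carrier G" and ec: "e \<in> carrier G" using dM eM M.subset by auto
    have kM: "x \<otimes> e \<otimes> inv x \<in> M" using M.inv_op_closed2[OF x eM] .
    have "(d \<otimes> x) \<otimes> (e \<otimes> y) = (d \<otimes> (x \<otimes> e \<otimes> inv x)) \<otimes> (x \<otimes> y)"
      using dc ec x y by (simp add: m_assoc cancel_left)
    moreover have "[\<phi> ((d \<otimes> (x \<otimes> e \<otimes> inv x)) \<otimes> (x \<otimes> y)) = ch (d \<otimes> (x \<otimes> e \<otimes> inv x)) + \<phi> (x \<otimes> y)] (mod N)"
      using dM kM x y by (intro phi_left) auto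
    moreover have "[ch (d \<otimes> (x \<otimes> e \<otimes> inv x)) + \<phi> (x \<otimes> y) = (ch d + ch e) + \<phi> (x \<otimes> y)] (mod N)"
      using ch_mult[OF dM kM] ch_conj[OF eM x] by (intro cong_add cong_refl) simp
    ultimately have 1: "[\<phi> ((d \<otimes> x) \<otimes> (e \<otimes> y)) = ch d + ch e + \<phi> (x \<otimes> y)] (mod N)"
      using cong_trans by metis
    have "[cobound \<phi> (d \<otimes> x, e \<otimes> y) = cobound \<phi> (x, y)] (mod N)"
      using cong_linear_combination[OF phi_left[OF eM y] 1 phi_left[OF dM x], of "cobound \<phi> (d \<otimes> x, e \<otimes> y)" "cobound \<phi> (x, y)" 1 "- 1" 1]
      by (simp add: cobound_def)
    then show ?thesis by (simp add: c_def d(2) e(2) cong_def)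
  qed
  have cob: "cocycle (cobound \<phi>)" by (rule cocycle_cobound[OF lc_phi])
  have cc: "\<Gamma>.cocycle c" unfolding \<Gamma>.cocycle_def
  proof (intro conjI ballI)
    have "loc_const (prod_topology T T) (\<lambda>z. cobound \<phi> z mod N)"
      using cob by (intro loc_const_map[where h = "\<lambda>a. a mod N"]) (simp add: cocycle_def)
    then have "loc_const (prod_topology T T) (\<lambda>z. c ((\<lambda>(x, y). (p x, p y)) z))"
      by (subst loc_const_cong[of _ _ "\<lambda>z. cobound \<phi> z mod N"]) (auto simp: c_eq topspace)
    then show "loc_const (prod_topology T1 T1) c" by (rule loc_const_quotient[OF quotient_pp])
    fix \<sigma> \<tau> \<rho> assume g: "\<sigma> \<in> carrier gr1" "\<tau> \<in> carrier gr1" "\<rho> \<in> carrier gr1"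
    then obtain x y z where xyz: "x \<in> carrier G" "\<sigma> = p x" "y \<in> carrier G" "\<tau> = p y" "z \<in> carrier G" "\<rho> = p z"
      by (auto simp: gr1_simps)
    show "[c (\<tau>, \<rho>) + c (\<sigma>, \<tau> \<otimes>\<^bsub>gr1\<^esub> \<rho>) = c (\<sigma> \<otimes>\<^bsub>gr1\<^esub> \<tau>, \<rho>) + c (\<sigma>, \<tau>)] (mod N)"
      using cocycleD[OF cob xyz(1,3,5)] xyz by (simp add: gr1_simps(3) c_eq cong_def mod_simps)
  qed
  have "trivializes \<phi> c" unfolding trivializes_def
  proof (intro conjI cc lc_phi ballI)
    fix x y assume xy: "x \<in> carrier G" "y \<in> carrier G"
    have "[c (p x, p y) = cobound \<phi> (x, y)] (mod N)" using c_eq[OF xy] by (simp add: cong_def)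
    from cong_linear_combination[OF this cong_refl[of 0] cong_refl[of 0], of "\<phi> (x \<otimes> y)" "\<phi> x + \<phi> y - c (p x, p y)" 1 0 0]
    show "[\<phi> (x \<otimes> y) = \<phi> x + \<phi> y - c (p x, p y)] (mod N)" by (simp add: cobound_def)
  qed
  moreover have "\<not> [\<delta> \<phi> u = 0] (mod N)"
  proof
    assume "[\<delta> \<phi> u = 0] (mod N)"
    moreover have "[\<phi> (u \<otimes> \<one>) = ch u + \<phi> \<one>] (mod N)" using phi_left[of u \<one>] u DM by auto
    ultimately have "[ch u = 0] (mod N)"
      using cong_linear_combination[of "\<delta> \<phi> u" 0 "\<phi> (u \<otimes> \<one>)" "ch u + \<phi> \<one>" 0 0 "ch u" 0 "- 1" "- 1" 0] uc
      by (simp add: \<delta>_def)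
    then show False using mu by (simp add: ch_def)
  qed
  ultimately show ?thesis by blast
qed

end

section \<open>The isomorphism\<close>

context profinite_presentation
begin

text \<open>Separation by some class in the kernel of inflation is reduced to separation by the
  generators: the classes with a trivialisation whose character vanishes at w form a subgroup.
  Membership in it does not depend on the trivialisation.\<close>

lemma generated_kernel_\<delta>:
  assumes R: "generate (H2 gr1 T1 \<Lambda>) R = kernel (H2 gr1 T1 \<Lambda>) (H2 G T \<Lambda>) (inflation G T n)"
    and w: "w \<in> D" and 0: "\<And>r. r \<in> R \<Longrightarrow> \<exists>\<phi> c. trivializes \<phi> c \<and> r = \<Gamma>.cls c \<and> [\<delta> \<phi> w = 0] (mod N)"
  shows "w \<in> C"
proof (rule ccontr)
  assume "w \<notin> C"
  then obtain \<phi> c where t: "trivializes \<phi> c" "\<not> [\<delta> \<phi> w = 0] (mod N)"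
    using transgression_separates[OF w] by blast
  have lin: "\<delta> (\<lambda>x. k * \<phi> x + l * \<psi> x) w = k * \<delta> \<phi> w + l * \<delta> \<psi> w" for k l \<phi> \<psi>
    by (simp add: \<delta>_def algebra_simps)
  have "\<exists>\<phi> c. trivializes \<phi> c \<and> X = \<Gamma>.cls c \<and> [\<delta> \<phi> w = 0] (mod N)" if "X \<in> generate (H2 gr1 T1 \<Lambda>) R" for X
    using that
  proof (induction rule: generate.induct)
    case one
    have "trivializes (\<lambda>x. 0) (\<lambda>q. 0)" using trivializes_sum[of "{}"] by simp
    then show ?case by (intro exI[of _ "\<lambda>x. 0"] exI[of _ "\<lambda>q. 0"]) (simp add: \<Gamma>.one_H2 \<delta>_def)
  next
    case (incl r)
    then show ?case by (rule 0)
  next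
    case (inv r)
    then obtain \<phi> c where r: "trivializes \<phi> c" "r = \<Gamma>.cls c" "[\<delta> \<phi> w = 0] (mod N)" using 0 by blast
    have "trivializes (\<lambda>x. - 1 * \<phi> x + 0 * \<phi> x) (\<lambda>q. - 1 * c q + 0 * c q)" by (rule trivializes_linear[OF r(1,1)])
    moreover have "[\<delta> (\<lambda>x. - 1 * \<phi> x + 0 * \<phi> x) w = 0] (mod N)" using r(3) unfolding lin by (simp add: cong_0_iff)
    ultimately show ?case unfolding r(2) \<Gamma>.cls_inv[OF trivializes_cocycle[OF r(1)]]
      by (intro exI[of _ "\<lambda>x. - 1 * \<phi> x + 0 * \<phi> x"] exI[of _ "\<lambda>q. - 1 * c q + 0 * c q"]) simp
  next
    case (eng X Y)
    then obtain \<phi> c \<psi> c' where r: "trivializes \<phi> c" "X = \<Gamma>.cls c" "[\<delta> \<phi> w = 0] (mod N)"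
       "trivializes \<psi> c'" "Y = \<Gamma>.cls c'" "[\<delta> \<psi> w = 0] (mod N)" by blast
    have "trivializes (\<lambda>x. 1 * \<phi> x + 1 * \<psi> x) (\<lambda>q. 1 * c q + 1 * c' q)" by (rule trivializes_linear[OF r(1,4)])
    moreover have "[\<delta> (\<lambda>x. 1 * \<phi> x + 1 * \<psi> x) w = 0] (mod N)" using r(3,6) unfolding lin by (simp add: cong_0_iff)
    ultimately show ?case unfolding r(2,5) \<Gamma>.cls_add[OF trivializes_cocycle[OF r(1)] trivializes_cocycle[OF r(4)]]
      by (intro exI[of _ "\<lambda>x. 1 * \<phi> x + 1 * \<psi> x"] exI[of _ "\<lambda>q. 1 * c q + 1 * c' q"]) simp
  qed
  moreover have "\<Gamma>.cls c \<in> generate (H2 gr1 T1 \<Lambda>) R"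
    unfolding R kernel_inflation[OF trivializes_cocycle[OF t(1)]] using t(1) by blast
  ultimately obtain \<psi> c' where p: "trivializes \<psi> c'" "\<Gamma>.cls c = \<Gamma>.cls c'" "[\<delta> \<psi> w = 0] (mod N)" by blast
  note cc = trivializes_cocycle[OF t(1)] trivializes_cocycle[OF p(1)]
  \<comment> \<open>Both cochains trivialise representatives of the same class, so their difference
    belongs to the trivial class and its character vanishes on \<open>D\<close>.\<close>
  have tr: "trivializes (\<lambda>x. 1 * \<phi> x + - 1 * \<psi> x) (\<lambda>q. 1 * c q + - 1 * c' q)" by (rule trivializes_linear[OF t(1) p(1)])
  have "\<Gamma>.cls (\<lambda>q. 1 * c q + - 1 * c' q) = \<Gamma>.cls c \<otimes>\<^bsub>H2 gr1 T1 \<Lambda>\<^esub> inv\<^bsub>H2 gr1 T1 \<Lambda>\<^esub> (\<Gamma>.cls c')"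
    using \<Gamma>.cls_add[OF cc(1) \<Gamma>.cocycle_uminus[OF cc(2)]] \<Gamma>.cls_inv[OF cc(2)] by simp
  also have "\<dots> = \<one>\<^bsub>H2 gr1 T1 \<Lambda>\<^esub>"
    unfolding p(2) using group.r_inv[OF comm_group.axioms(2)[OF \<Gamma>.comm_group_H2] \<Gamma>.cls_in_H2[OF cc(2)]] .
  finally have "[1 * \<delta> \<phi> w + - 1 * \<delta> \<psi> w = 0] (mod N)" using trivial_class_\<delta>[OF tr _ w] unfolding lin by blast
  from cong_linear_combination[OF this p(3) cong_refl[of 0], of "\<delta> \<phi> w" 0 1 1 0]
  have "[\<delta> \<phi> w = 0] (mod N)" by simp
  then show False using t(2) by blast
qed

lemma transgression_isomorphism:
  assumes R: "generate (H2 gr1 T1 \<Lambda>) R = kernel (H2 gr1 T1 \<Lambda>) (H2 G T \<Lambda>) (inflation G T n)"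
  shows "\<exists>!\<Omega>. \<Omega> \<in> extensional (carrier gr2) \<and>
           \<Omega> \<in> top_iso gr2 T2 (SS_R n gr1 T1 R) (SS_R_topology n gr1 T1 R) \<and>
           (\<forall>\<sigma> \<in> carrier gr1. \<forall>\<tau> \<in> carrier gr1.
              \<Omega> (gr_commutator G T n \<sigma> \<tau>) = res_R n gr1 T1 R (\<Gamma>.comm_form \<sigma> \<tau>)) \<and>
           (\<forall>\<sigma> \<in> carrier gr1. \<Omega> (gr_power G T n \<sigma>) = res_R n gr1 T1 R (\<Gamma>.pow_form \<sigma>))"
proof -
  let ?H = "H2 gr1 T1 \<Lambda>"
  let ?res = "res_R n gr1 T1 R"
  let ?SR = "SS_R n gr1 T1 R" and ?SRT = "SS_R_topology n gr1 T1 R"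
  define Pt where "Pt = product_topology (\<lambda>_. discrete_topology (carrier \<Lambda>)) R"
  \<comment> \<open>One trivialised representative is fixed for each r. By
    \<open>trivial_class_\<delta>\<close> applied to a difference, the residues of its character on
    \<open>D\<close> do not depend on the choice.\<close>
  have "\<forall>r\<in>R. \<exists>z. trivializes (fst z) (snd z) \<and> r = \<Gamma>.cls (snd z)"
  proof
    fix r assume "r \<in> R"
    then have r: "r \<in> kernel ?H (H2 G T \<Lambda>) (inflation G T n)" using generate.incl[of r R ?H] R by simp
    then have "r \<in> carrier ?H" by (simp add: kernel_def)
    then obtain c where c: "\<Gamma>.cocycle c" "r = \<Gamma>.cls c" by (rule \<Gamma>.H2_cases)
    then obtain \<phi> where "trivializes \<phi> c" using r kernel_inflation[OF c(1)] by blast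
    then show "\<exists>z. trivializes (fst z) (snd z) \<and> r = \<Gamma>.cls (snd z)" using c by (intro exI[of _ "(\<phi>, c)"]) simp
  qed
  then obtain z where z: "\<forall>r\<in>R. trivializes (fst (z r)) (snd (z r)) \<and> r = \<Gamma>.cls (snd (z r))"
    by (rule bchoice[THEN exE])
  define fr where "fr r = fst (z r)" for r
  define cr where "cr r = snd (z r)" for r
  have tr: "trivializes (fr r) (cr r)" and rc: "r = \<Gamma>.cls (cr r)" if "r \<in> R" for r
    using z that by (auto simp: fr_def cr_def)
  note cc = trivializes_cocycle[OF tr]
  have rH: "r \<in> carrier ?H" if "r \<in> R" for r using rc[OF that] \<Gamma>.cls_in_H2[OF cc[OF that]] by simp
  define \<omega> where "\<omega> u = (\<lambda>r\<in>R. \<delta> (fr r) u mod N)" for u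
  have res: "?res s = (\<lambda>r\<in>R. \<Gamma>.pairing (s, r))" for s by (simp add: res_R_def \<Gamma>.SS_pairing_eq)
  have carSR: "carrier ?SR = ?res ` carrier \<Gamma>.SSG" by (simp add: SS_R_def)
  have SRT: "?SRT = subtopology Pt (carrier ?SR)" by (simp add: SS_R_topology_def Pt_def)
  have topPt: "topspace Pt = R \<rightarrow>\<^sub>E carrier \<Lambda>" by (simp add: Pt_def)
  have res_in: "?res s \<in> R \<rightarrow>\<^sub>E carrier \<Lambda>" if "s \<in> carrier \<Gamma>.SSG" for s
    using \<Gamma>.pairing_in[OF that rH] by (auto simp: res)
  have om_in: "\<omega> u \<in> R \<rightarrow>\<^sub>E carrier \<Lambda>" for u by (auto simp: \<omega>_def)
  have HPt: "Hausdorff_space Pt" by (simp add: Pt_def Hausdorff_space_product_topology)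
  have cont: "continuous_map X Pt f"
    if "\<And>x. x \<in> topspace X \<Longrightarrow> f x \<in> R \<rightarrow>\<^sub>E carrier \<Lambda>" "\<And>r. r \<in> R \<Longrightarrow> loc_const X (\<lambda>x. f x r)" for f :: "'x \<Rightarrow> _" and X
    unfolding Pt_def continuous_map_componentwise
    using that by (auto simp: loc_const_iff PiE_iff)
  have cont_om: "continuous_map T Pt \<omega>"
  proof (rule cont[OF om_in])
    fix r assume r: "r \<in> R"
    have "loc_const T (\<delta> (fr r))" using tr[OF r] by (intro loc_const_\<delta>) (simp add: trivializes_def)
    then show "loc_const T (\<lambda>u. \<omega> u r)" using r by (simp add: \<omega>_def loc_const_map[where h = "\<lambda>a. a mod N"])
  qed
  have cont_res: "continuous_map \<Gamma>.SST Pt ?res"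
  proof (rule cont)
    show "?res s \<in> R \<rightarrow>\<^sub>E carrier \<Lambda>" if "s \<in> topspace \<Gamma>.SST" for s using res_in that by (simp only: \<Gamma>.topspace_SST)
    show "loc_const \<Gamma>.SST (\<lambda>s. ?res s r)" if "r \<in> R" for r
      using \<Gamma>.pairing_loc_const[OF rH[OF that]] that by (simp add: res)
  qed
  \<comment> \<open>Continuous images of compact sets in the Hausdorff power of \<int>/n are closed;
    this makes the annihilator criterion applicable to both subgroups.\<close>
  have "compactin T D" by (rule closedin_compact_space[OF compact_T closedin_D])
  then have "closedin Pt (\<omega> ` D)" by (intro compactin_imp_closedin[OF HPt] image_compactin[OF _ cont_om])
  then have cl1: "closedin (product_topology (\<lambda>_. discrete_topology {0..<int n}) R) (\<omega> ` D)" by (simp add: Pt_def carrier_L)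
  have "compactin \<Gamma>.SST (carrier \<Gamma>.SSG)" using \<Gamma>.compact_space_SST unfolding compact_space_def \<Gamma>.topspace_SST .
  then have "closedin Pt (?res ` carrier \<Gamma>.SSG)" by (intro compactin_imp_closedin[OF HPt] image_compactin[OF _ cont_res])
  then have cl2: "closedin (product_topology (\<lambda>_. discrete_topology {0..<int n}) R) (?res ` carrier \<Gamma>.SSG)"
    by (simp add: Pt_def carrier_L)
  have om_mult: "\<omega> (u \<otimes> v) = (\<lambda>r\<in>R. (\<omega> u r + \<omega> v r) mod N)" if uv: "u \<in> D" "v \<in> D" for u v
    using \<delta>_mult[OF tr uv] by (auto simp: \<omega>_def fun_eq_iff restrict_def cong_def mod_simps)
  have om_diff: "\<omega> (u \<otimes> inv v) = (\<lambda>r\<in>R. (\<omega> u r - \<omega> v r) mod N)" if uv: "u \<in> D" "v \<in> D" for u v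
  proof -
    have c: "u \<in> carrier G" "v \<in> carrier G" using uv D.subset by auto
    have iv: "inv v \<in> D" "u \<otimes> inv v \<in> D" using uv by auto
    have "(u \<otimes> inv v) \<otimes> v = u" using c by (simp add: m_assoc)
    then have "\<omega> u r = (\<omega> (u \<otimes> inv v) r + \<omega> v r) mod N" if "r \<in> R" for r
      using fun_cong[OF om_mult[OF iv(2) uv(2)], of r] that by simp
    then show ?thesis by (auto simp: \<omega>_def fun_eq_iff restrict_def mod_simps)
  qed
  have sum_c: "\<Gamma>.cocycle (\<lambda>q. \<Sum>r\<in>F. m r * cr r q)" if "F \<subseteq> R" for F m
    using that cc by (intro \<Gamma>.cocycle_sum \<Gamma>.cocycle_scale) auto
  \<comment> \<open>A finite integer combination of coordinates is the coordinate belonging to one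
    class, the same combination of elements of R. This holds for \<omega> as well as for the
    pairing, so annihilators on both sides become statements about that class.\<close>
  have ann_om: "N dvd (\<Sum>r\<in>F. m r * \<omega> u r) \<longleftrightarrow> [\<delta> (\<lambda>x. \<Sum>r\<in>F. m r * fr r x) u = 0] (mod N)"
    if F: "F \<subseteq> R" for F m u
  proof -
    have "[(\<Sum>r\<in>F. m r * \<omega> u r) = (\<Sum>r\<in>F. m r * \<delta> (fr r) u)] (mod N)"
      using F by (intro cong_sum cong_mult cong_refl) (auto simp: \<omega>_def cong_def)
    then show ?thesis unfolding \<delta>_sum by (simp add: cong_def mod_eq_0_iff_dvd[symmetric])
  qed
  have ann_res: "N dvd (\<Sum>r\<in>F. m r * ?res s r) \<longleftrightarrow> \<Gamma>.pairing (s, \<Gamma>.cls (\<lambda>q. \<Sum>r\<in>F. m r * cr r q)) = 0"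
    if F: "F \<subseteq> R" and s: "s \<in> carrier \<Gamma>.SSG" for F m s
  proof -
    let ?X = "\<Gamma>.cls (\<lambda>q. \<Sum>r\<in>F. m r * cr r q)"
    have "[\<Gamma>.pairing (s, ?X) = (\<Sum>r\<in>F. m r * \<Gamma>.pairing (s, \<Gamma>.cls (cr r)))] (mod N)"
      using F by (intro \<Gamma>.hom_cls_sum[OF \<Gamma>.pairing_hom_right[OF s]] cc) auto
    also have "(\<Sum>r\<in>F. m r * \<Gamma>.pairing (s, \<Gamma>.cls (cr r))) = (\<Sum>r\<in>F. m r * ?res s r)"
      using F rc by (intro sum.cong) (auto simp: res subset_iff)
    finally have 1: "[\<Gamma>.pairing (s, ?X) = (\<Sum>r\<in>F. m r * ?res s r)] (mod N)" .
    have "\<Gamma>.pairing (s, ?X) mod N = \<Gamma>.pairing (s, ?X)"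
      using \<Gamma>.pairing_in[OF s \<Gamma>.cls_in_H2[OF sum_c[OF F]]] by simp
    then show ?thesis using 1 by (simp add: cong_def mod_eq_0_iff_dvd[symmetric])
  qed
  have image: "\<omega> ` D = carrier ?SR" unfolding carSR
  proof (intro subset_antisym subsetI)
    fix v assume "v \<in> \<omega> ` D"
    then obtain u where u: "u \<in> D" "v = \<omega> u" by blast
    show "v \<in> ?res ` carrier \<Gamma>.SSG"
    proof (rule mem_closed_subgroup_by_annihilator[OF n_pos cl2])
      interpret S: group \<Gamma>.SSG by (rule \<Gamma>.group_SS)
      show "?res ` carrier \<Gamma>.SSG \<noteq> {}" using S.one_closed by blast
      show "v \<in> R \<rightarrow>\<^sub>E {0..<int n}" using om_in u(2) by (simp add: carrier_L)
      show "(\<lambda>r\<in>R. (a r - b r) mod int n) \<in> ?res ` carrier \<Gamma>.SSG"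
        if ab: "a \<in> ?res ` carrier \<Gamma>.SSG" "b \<in> ?res ` carrier \<Gamma>.SSG" for a b
      proof -
        obtain s t where st: "s \<in> carrier \<Gamma>.SSG" "a = ?res s" "t \<in> carrier \<Gamma>.SSG" "b = ?res t" using ab by blast
        let ?d = "s \<otimes>\<^bsub>\<Gamma>.SSG\<^esub> inv\<^bsub>\<Gamma>.SSG\<^esub> t"
        have d: "?d \<in> carrier \<Gamma>.SSG" using st by simp
        have "(\<Gamma>.pairing (s, r) - \<Gamma>.pairing (t, r)) mod N = \<Gamma>.pairing (?d, r)" if r: "r \<in> R" for r
          using \<Gamma>.hom_L_diff[OF \<Gamma>.group_SS \<Gamma>.pairing_hom_left[OF rH[OF r]] st(1,3)] \<Gamma>.L_mod[OF \<Gamma>.pairing_in[OF d rH[OF r]]]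
          by (simp add: cong_def)
        then have "(\<lambda>r\<in>R. (a r - b r) mod int n) = ?res ?d" by (auto simp: st res fun_eq_iff restrict_def)
        then show ?thesis using d by blast
      qed
      fix F m assume F: "finite F" "F \<subseteq> R" and ann: "\<And>a. a \<in> ?res ` carrier \<Gamma>.SSG \<Longrightarrow> int n dvd (\<Sum>r\<in>F. m r * a r)"
      \<comment> \<open>A combination annihilating the whole image of \<SS> is trivial by
        nondegeneracy, and the character of a trivial class vanishes on \<open>D\<close>.\<close>
      have "\<Gamma>.cls (\<lambda>q. \<Sum>r\<in>F. m r * cr r q) = \<one>\<^bsub>?H\<^esub>"
        using ann ann_res[OF F(2)] by (intro \<Gamma>.pairing_nondegenerate \<Gamma>.cls_in_H2 sum_c[OF F(2)]) blast
      then have "[\<delta> (\<lambda>x. \<Sum>r\<in>F. m r * fr r x) u = 0] (mod N)"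
        using F(2) tr by (intro trivial_class_\<delta>[OF trivializes_sum _ u(1)]) auto
      then show "int n dvd (\<Sum>r\<in>F. m r * v r)" unfolding u(2) ann_om[OF F(2)] .
    qed
  next
    fix v assume "v \<in> ?res ` carrier \<Gamma>.SSG"
    then obtain s where s: "s \<in> carrier \<Gamma>.SSG" "v = ?res s" by blast
    show "v \<in> \<omega> ` D"
    proof (rule mem_closed_subgroup_by_annihilator[OF n_pos cl1])
      show "\<omega> ` D \<noteq> {}" using D.one_closed by blast
      show "v \<in> R \<rightarrow>\<^sub>E {0..<int n}" using res_in s by (simp add: carrier_L)
      show "(\<lambda>r\<in>R. (a r - b r) mod int n) \<in> \<omega> ` D" if ab: "a \<in> \<omega> ` D" "b \<in> \<omega> ` D" for a b
      proof -
        obtain x y where xy: "x \<in> D" "a = \<omega> x" "y \<in> D" "b = \<omega> y" using ab by blast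
        then have "x \<otimes> inv y \<in> D" "(\<lambda>r\<in>R. (a r - b r) mod int n) = \<omega> (x \<otimes> inv y)" using om_diff by auto
        then show ?thesis by blast
      qed
      fix F m assume F: "finite F" "F \<subseteq> R" and ann: "\<And>a. a \<in> \<omega> ` D \<Longrightarrow> int n dvd (\<Sum>r\<in>F. m r * a r)"
      \<comment> \<open>In the other direction, a class whose character vanishes on \<open>D\<close>
        is trivial, and a trivial class pairs to 0 with every s.\<close>
      have "\<Gamma>.cls (\<lambda>q. \<Sum>r\<in>F. m r * cr r q) = \<one>\<^bsub>?H\<^esub>"
      proof (rule \<delta>_zero_trivial_class)
        show "trivializes (\<lambda>x. \<Sum>r\<in>F. m r * fr r x) (\<lambda>q. \<Sum>r\<in>F. m r * cr r q)"
          using F(2) tr by (intro trivializes_sum) auto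
        show "[\<delta> (\<lambda>x. \<Sum>r\<in>F. m r * fr r x) u = 0] (mod N)" if "u \<in> D" for u
          using ann[OF imageI[OF that]] unfolding ann_om[OF F(2)] .
      qed
      then have "\<Gamma>.pairing (s, \<Gamma>.cls (\<lambda>q. \<Sum>r\<in>F. m r * cr r q)) = 0"
        using \<Gamma>.hom_L_one[OF comm_group.axioms(2)[OF \<Gamma>.comm_group_H2] \<Gamma>.pairing_hom_right[OF s(1)]] by simp
      then show "int n dvd (\<Sum>r\<in>F. m r * v r)" unfolding s(2) ann_res[OF F(2) s(1)] .
    qed
  qed
  have om_C: "\<omega> (c \<otimes> u) = \<omega> u" if "c \<in> C" "u \<in> D" for c u
  proof -
    have cD: "c \<in> D" using that C_subset_D by blast
    have "\<omega> (c \<otimes> u) r = \<omega> u r" if r: "r \<in> R" for r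
    proof -
      have "[\<delta> (fr r) (c \<otimes> u) = 0 + \<delta> (fr r) u] (mod N)"
        using cong_trans[OF \<delta>_mult[OF tr[OF r] cD \<open>u \<in> D\<close>] cong_add[OF \<delta>_C[OF tr[OF r] \<open>c \<in> C\<close>] cong_refl]] .
      then show ?thesis using r by (simp add: \<omega>_def cong_def)
    qed
    then show ?thesis by (auto simp: \<omega>_def fun_eq_iff restrict_def)
  qed
  \<comment> \<open>Cosets of \<open>C\<close> in \<open>D\<close> are evaluated at a chosen member;
    by \<open>om_C\<close> the value is the same for all members.\<close>
  define \<Omega> where "\<Omega> = (\<lambda>X\<in>carrier gr2. \<omega> (SOME u. u \<in> X))"
  have Om: "\<Omega> (q u) = \<omega> u" if u: "u \<in> D" for u
  proof -
    have uc: "u \<in> carrier G" using u D.subset by blast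
    have "(SOME v. v \<in> q u) \<in> q u" using rcos_self[OF uc C.subgroup_axioms] by (rule someI)
    then obtain c where c: "c \<in> C" "(SOME v. v \<in> q u) = c \<otimes> u" by (auto simp: r_coset_def)
    have "\<Omega> (q u) = \<omega> (SOME v. v \<in> q u)" using u by (simp add: \<Omega>_def gr2_simps)
    then show ?thesis using c om_C[OF c(1) u] by simp
  qed
  have SR_mult: "a \<otimes>\<^bsub>?SR\<^esub> b = (\<lambda>r\<in>R. (a r + b r) mod N)" for a b by (simp add: SS_R_def)
  have Om_hom: "\<Omega> \<in> hom gr2 ?SR"
  proof (rule homI)
    fix X assume "X \<in> carrier gr2"
    then show "\<Omega> X \<in> carrier ?SR" using image Om by (auto simp: gr2_simps)
  next
    fix X Y assume "X \<in> carrier gr2" "Y \<in> carrier gr2"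
    then obtain u v where uv: "u \<in> D" "X = q u" "v \<in> D" "Y = q v" by (auto simp: gr2_simps)
    then show "\<Omega> (X \<otimes>\<^bsub>gr2\<^esub> Y) = \<Omega> X \<otimes>\<^bsub>?SR\<^esub> \<Omega> Y"
      using Om[of "u \<otimes> v"] by (simp add: gr2_simps(3) Om om_mult SR_mult)
  qed
  have Om_inj: "inj_on \<Omega> (carrier gr2)"
  proof (rule inj_onI)
    fix X Y assume XY: "X \<in> carrier gr2" "Y \<in> carrier gr2" "\<Omega> X = \<Omega> Y"
    then obtain u v where uv: "u \<in> D" "X = q u" "v \<in> D" "Y = q v" by (auto simp: gr2_simps)
    have eq: "\<omega> u = \<omega> v" using XY(3) uv Om by simp
    have c: "u \<in> carrier G" "v \<in> carrier G" using uv D.subset by auto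
    have w: "u \<otimes> inv v \<in> D" using uv by simp
    have "u \<otimes> inv v \<in> C"
    \<comment> \<open>At this point R has to generate the whole kernel of inflation, rather than
      merely lie in it.\<close>
    proof (rule generated_kernel_\<delta>[OF R w])
      fix r assume r: "r \<in> R"
      have "\<delta> (fr r) (u \<otimes> inv v) mod N = 0"
        using fun_cong[OF om_diff[OF uv(1,3)], of r] fun_cong[OF eq, of r] r by (simp add: \<omega>_def)
      then show "\<exists>\<phi> c. trivializes \<phi> c \<and> r = \<Gamma>.cls c \<and> [\<delta> \<phi> (u \<otimes> inv v) = 0] (mod N)"
        using tr[OF r] rc[OF r] by (intro exI[of _ "fr r"] exI[of _ "cr r"]) (simp add: cong_def)
    qed
    then show "X = Y" using q_eq_iff[OF c] uv by simp
  qed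
  have Om_image: "\<Omega> ` carrier gr2 = carrier ?SR"
    unfolding image[symmetric] gr2_simps(1) image_image using Om by (intro image_cong) auto
  have topSR: "topspace ?SRT = carrier ?SR"
  proof -
    have "carrier ?SR \<subseteq> R \<rightarrow>\<^sub>E carrier \<Lambda>" unfolding carSR using res_in by blast
    then show ?thesis unfolding SRT topspace_subtopology topPt by blast
  qed
  have "continuous_map (subtopology T D) ?SRT \<omega>"
    unfolding SRT continuous_map_in_subtopology
    using continuous_map_from_subtopology[OF cont_om] image topspace_subD by auto
  then have "continuous_map (subtopology T D) ?SRT (\<Omega> \<circ> q)"
    by (rule continuous_map_eq) (simp add: topspace_subD Om del: topspace_subtopology)
  then have Om_cont: "continuous_map T2 ?SRT \<Omega>" by (rule continuous_compose_quotient_map[OF quotient_q])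
  \<comment> \<open>A continuous bijection from a compact space onto a Hausdorff space has a
    continuous inverse.\<close>
  have "homeomorphic_map T2 ?SRT \<Omega>"
    by (rule continuous_imp_homeomorphic_map[OF Om_cont compact_space_T2])
      (simp_all add: SRT Hausdorff_space_subtopology HPt topspace_T2 Om_image Om_inj topSR[unfolded SRT] del: topspace_subtopology)
  then have Om_iso: "\<Omega> \<in> top_iso gr2 T2 ?SR ?SRT"
    using Om_hom Om_inj Om_image by (simp add: top_iso_def iso_def bij_betw_def)
  have comm: "\<omega> (cmt x y) = ?res (\<Gamma>.comm_form (p x) (p y))" if xy: "x \<in> carrier G" "y \<in> carrier G" for x y
  proof -
    have "\<delta> (fr r) (cmt x y) mod N = \<Gamma>.pairing (\<Gamma>.comm_form (p x) (p y), r)" if r: "r \<in> R" for r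
      using \<delta>_commutator[OF tr[OF r] xy] \<Gamma>.pairing_comm_form[OF p_in[OF xy(1)] p_in[OF xy(2)] cc[OF r]] rc[OF r]
      by (simp add: cong_def)
    then show ?thesis by (auto simp: \<omega>_def res fun_eq_iff restrict_def)
  qed
  have power: "\<omega> (x [^] n) = ?res (\<Gamma>.pow_form (p x))" if x: "x \<in> carrier G" for x
  proof -
    have "\<delta> (fr r) (x [^] n) mod N = \<Gamma>.pairing (\<Gamma>.pow_form (p x), r)" if r: "r \<in> R" for r
      using \<delta>_power[OF tr[OF r] x] \<Gamma>.pairing_pow_form[OF p_in[OF x] cc[OF r]] rc[OF r]
      by (simp add: cong_def)
    then show ?thesis by (auto simp: \<omega>_def res fun_eq_iff restrict_def)
  qed
  show ?thesis
  proof (rule ex1I[of _ \<Omega>], intro conjI ballI)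
    show "\<Omega> \<in> extensional (carrier gr2)" by (simp add: \<Omega>_def)
    show "\<Omega> \<in> top_iso gr2 T2 ?SR ?SRT" by (rule Om_iso)
    show "\<Omega> (gr_commutator G T n \<sigma> \<tau>) = ?res (\<Gamma>.comm_form \<sigma> \<tau>)"
      if "\<sigma> \<in> carrier gr1" "\<tau> \<in> carrier gr1" for \<sigma> \<tau>
    proof -
      obtain x y where xy: "x \<in> carrier G" "\<sigma> = p x" "y \<in> carrier G" "\<tau> = p y" using \<open>\<sigma> \<in> carrier gr1\<close> \<open>\<tau> \<in> carrier gr1\<close> by (auto simp: gr1_simps)
      show ?thesis unfolding xy gr_commutator_eq[OF xy(1,3)] Om[OF D_mem(1)[OF xy(1,3)]] by (rule comm[OF xy(1,3)])
    qed
    show "\<Omega> (gr_power G T n \<sigma>) = ?res (\<Gamma>.pow_form \<sigma>)" if "\<sigma> \<in> carrier gr1" for \<sigma>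
    proof -
      obtain x where x: "x \<in> carrier G" "\<sigma> = p x" using \<open>\<sigma> \<in> carrier gr1\<close> by (auto simp: gr1_simps)
      show ?thesis unfolding x gr_power_eq[OF x(1)] Om[OF D_mem(2)[OF x(1)]] by (rule power[OF x(1)])
    qed
  next
    fix W assume "W \<in> extensional (carrier gr2) \<and> W \<in> top_iso gr2 T2 ?SR ?SRT \<and>
       (\<forall>\<sigma> \<in> carrier gr1. \<forall>\<tau> \<in> carrier gr1. W (gr_commutator G T n \<sigma> \<tau>) = ?res (\<Gamma>.comm_form \<sigma> \<tau>)) \<and>
       (\<forall>\<sigma> \<in> carrier gr1. W (gr_power G T n \<sigma>) = ?res (\<Gamma>.pow_form \<sigma>))"
    then have W: "W \<in> extensional (carrier gr2)" "W \<in> hom gr2 ?SR" "homeomorphic_map T2 ?SRT W"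
      and Wc: "\<And>\<sigma> \<tau>. \<sigma> \<in> carrier gr1 \<Longrightarrow> \<tau> \<in> carrier gr1 \<Longrightarrow> W (gr_commutator G T n \<sigma> \<tau>) = ?res (\<Gamma>.comm_form \<sigma> \<tau>)"
      and Wp: "\<And>\<sigma>. \<sigma> \<in> carrier gr1 \<Longrightarrow> W (gr_power G T n \<sigma>) = ?res (\<Gamma>.pow_form \<sigma>)"
      by (auto simp: top_iso_def iso_def)
    have Wq_in: "W (q u) \<in> R \<rightarrow>\<^sub>E carrier \<Lambda>" if "u \<in> D" for u
    proof -
      have "W (q u) \<in> carrier ?SR" using hom_in_carrier[OF W(2)] that by (simp add: gr2_simps)
      then obtain s where "s \<in> carrier \<Gamma>.SSG" "W (q u) = ?res s" unfolding carSR by blast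
      then show ?thesis using res_in by simp
    qed
    have eq: "W (q u) r = \<omega> u r" if r: "r \<in> R" and u: "u \<in> D" for r u
    proof -
      \<comment> \<open>The difference of the two candidates at r is a locally constant character of
        \<open>D\<close> modulo n, zero at commutators and n-th powers. Its kernel is a closed
        subgroup of G and therefore contains \<open>D\<close>.\<close>
      define f where "f x = W (q x) r - \<omega> x r" for x
      have "continuous_map ?SRT (discrete_topology (carrier \<Lambda>)) (\<lambda>v. v r)"
        unfolding SRT Pt_def by (intro continuous_map_from_subtopology continuous_map_product_projection[OF r])
      from continuous_map_compose[OF continuous_map_compose[OF quotient_imp_continuous_map[OF quotient_q] homeomorphic_imp_continuous_map[OF W(3)]] this]
      have "continuous_map (subtopology T D) (discrete_topology (carrier \<Lambda>)) (\<lambda>x. W (q x) r)" by (simp add: o_def)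
      then have l1: "loc_const (subtopology T D) (\<lambda>x. W (q x) r)"
        by (subst (asm) loc_const_iff) (use Wq_in r topspace_subD in \<open>auto simp: PiE_iff\<close>)
      have "continuous_map (subtopology T D) (discrete_topology (carrier \<Lambda>)) (\<lambda>x. \<omega> x r)"
        using continuous_map_compose[OF continuous_map_from_subtopology[OF cont_om[unfolded Pt_def]] continuous_map_product_projection[OF r]]
        by (simp add: o_def)
      then have l2: "loc_const (subtopology T D) (\<lambda>x. \<omega> x r)"
        by (subst (asm) loc_const_iff) (use om_in r in \<open>auto simp: PiE_iff\<close>)
      have lc: "loc_const (subtopology T D) f" unfolding f_def using l1 l2 by (rule loc_const_map2)
      have hom: "[f (x \<otimes> y) = f x + f y] (mod N)" if xy: "x \<in> D" "y \<in> D" for x y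
      proof -
        have "W (q x \<otimes>\<^bsub>gr2\<^esub> q y) = W (q x) \<otimes>\<^bsub>?SR\<^esub> W (q y)"
          using xy by (intro hom_mult[OF W(2)]) (auto simp: gr2_simps)
        then have "[W (q (x \<otimes> y)) r = W (q x) r + W (q y) r] (mod N)"
          using r xy by (simp add: gr2_simps(3) SR_mult cong_def)
        moreover have "[\<omega> (x \<otimes> y) r = \<omega> x r + \<omega> y r] (mod N)" using om_mult[OF xy] r by (simp add: cong_def)
        ultimately have "[W (q (x \<otimes> y)) r - \<omega> (x \<otimes> y) r = (W (q x) r + W (q y) r) - (\<omega> x r + \<omega> y r)] (mod N)"
          by (rule cong_diff)
        then show ?thesis by (simp add: f_def algebra_simps)
      qed
      have "D \<subseteq> {x \<in> D. [f x = 0] (mod N)}"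
      proof (rule D_minimal[OF closed_kernel_subgroup[OF lc D.subgroup_axioms closedin_D hom]])
        fix x y assume xy: "x \<in> carrier G" "y \<in> carrier G"
        show "cmt x y \<in> {x \<in> D. [f x = 0] (mod N)}"
          using D_mem(1)[OF xy] Wc[OF p_in[OF xy(1)] p_in[OF xy(2)]] gr_commutator_eq[OF xy] comm[OF xy]
          by (simp add: f_def)
      next
        fix y assume y: "y \<in> carrier G"
        show "y [^] n \<in> {x \<in> D. [f x = 0] (mod N)}"
          using D_mem(2)[OF y] Wp[OF p_in[OF y]] gr_power_eq[OF y] power[OF y] by (simp add: f_def)
      qed
      then have "[W (q u) r = \<omega> u r] (mod N)" using u by (auto simp: f_def cong_diff_iff_cong_0)
      then show ?thesis using Wq_in[OF u] om_in[of u] r by (intro L_cong_eq) (auto simp: PiE_iff)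
    qed
    show "W = \<Omega>"
    proof (rule extensionalityI[OF W(1)])
      show "\<Omega> \<in> extensional (carrier gr2)" by (simp add: \<Omega>_def)
      fix X assume "X \<in> carrier gr2"
      then obtain u where u: "u \<in> D" "X = q u" by (auto simp: gr2_simps)
      have "W (q u) = \<omega> u" by (rule PiE_ext[OF Wq_in[OF u(1)] om_in]) (rule eq[OF _ u(1)])
      then show "W X = \<Omega> X" using u Om by simp
    qed
  qed
qed

end

text \<open>Canonicity is rendered by unique existence: the two formulas determine the topological
  isomorphism, and extensionality fixes the arbitrary values outside the carrier.\<close>

theorem theorem2p5:
  fixes G :: "('a, 'm) monoid_scheme" and T :: "'a topology" and n :: nat
    and I :: "'i set" and R :: "('a set \<times> 'a set \<Rightarrow> int) set set"
  defines "\<Lambda> \<equiv> integer_mod_group n"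
  defines "\<gg>\<^sub>1 \<equiv> gr G T n 1" and "T\<^sub>1 \<equiv> gr_topology G T n 1"
  defines "\<gg>\<^sub>2 \<equiv> gr G T n 2" and "T\<^sub>2 \<equiv> gr_topology G T n 2"
  defines "TT \<equiv> tensor_square n \<gg>\<^sub>1 T\<^sub>1"
  assumes "n \<ge> 1"
    and "profinite_group G T"
    and "top_iso \<gg>\<^sub>1 T\<^sub>1 (product_group I (\<lambda>_. \<Lambda>))
           (product_topology (\<lambda>_. discrete_topology (carrier \<Lambda>)) I) \<noteq> {}"
    and "generate (H2 \<gg>\<^sub>1 T\<^sub>1 \<Lambda>) R = kernel (H2 \<gg>\<^sub>1 T\<^sub>1 \<Lambda>) (H2 G T \<Lambda>) (inflation G T n)"
  shows "\<exists>!\<Omega>. \<Omega> \<in> extensional (carrier \<gg>\<^sub>2) \<and>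
           \<Omega> \<in> top_iso \<gg>\<^sub>2 T\<^sub>2 (SS_R n \<gg>\<^sub>1 T\<^sub>1 R) (SS_R_topology n \<gg>\<^sub>1 T\<^sub>1 R) \<and>
           (\<forall>\<sigma> \<in> carrier \<gg>\<^sub>1. \<forall>\<tau> \<in> carrier \<gg>\<^sub>1.
              \<Omega> (gr_commutator G T n \<sigma> \<tau>) =
                res_R n \<gg>\<^sub>1 T\<^sub>1 R
                  (tensor n \<gg>\<^sub>1 T\<^sub>1 \<sigma> \<tau> \<otimes>\<^bsub>TT\<^esub> inv\<^bsub>TT\<^esub> (tensor n \<gg>\<^sub>1 T\<^sub>1 \<tau> \<sigma>), \<one>\<^bsub>\<gg>\<^sub>1\<^esub>)) \<and>
           (\<forall>\<sigma> \<in> carrier \<gg>\<^sub>1.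
              \<Omega> (gr_power G T n \<sigma>) =
                res_R n \<gg>\<^sub>1 T\<^sub>1 R (tensor n \<gg>\<^sub>1 T\<^sub>1 \<sigma> \<sigma> [^]\<^bsub>TT\<^esub> (n choose 2), \<sigma>))"
proof -
  from \<open>top_iso \<gg>\<^sub>1 T\<^sub>1 (product_group I (\<lambda>_. \<Lambda>)) (product_topology (\<lambda>_. discrete_topology (carrier \<Lambda>)) I) \<noteq> {}\<close>
  obtain \<theta> where "\<theta> \<in> top_iso \<gg>\<^sub>1 T\<^sub>1 (product_group I (\<lambda>_. \<Lambda>)) (product_topology (\<lambda>_. discrete_topology (carrier \<Lambda>)) I)"
    by blast
  then interpret profinite_presentation G T n I \<theta>
    using \<open>n \<ge> 1\<close> \<open>profinite_group G T\<close> top_group_iff[of G T]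
    unfolding \<Lambda>_def \<gg>\<^sub>1_def T\<^sub>1_def One_nat_def
    by (intro profinite_presentation.intro profinite_mod.intro top_group_mod.intro top_group_mod_axioms.intro
        profinite_mod_axioms.intro profinite_presentation_axioms.intro) (auto simp: profinite_group_def)
  show ?thesis
    using transgression_isomorphism[of R]
      \<open>generate (H2 \<gg>\<^sub>1 T\<^sub>1 \<Lambda>) R = kernel (H2 \<gg>\<^sub>1 T\<^sub>1 \<Lambda>) (H2 G T \<Lambda>) (inflation G T n)\<close>
    unfolding \<Lambda>_def \<gg>\<^sub>1_def T\<^sub>1_def \<gg>\<^sub>2_def T\<^sub>2_def TT_def One_nat_def by blast
qed

end
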